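(* For almost every $\omega\in\Omega$ and $T$ either a minimal shift $T\omega=\omega+\mathfrak{a}$ on $\Omega=\mathbb{T}^d$ or a skew-shift on $\Omega=\mathbb{T}^2$ given by $T(\omega_1,\omega_2)=(\omega_1+2\mathfrak{a},\omega_1+\omega_2)$, there exists a dense $G_\delta$ set of sampling functions $f$ in $C(\Omega,\mathbb{D})$ for which the corresponding CMV operator $\mathcal{E}_\omega$, with Verblunsky coefficients $\alpha(n)=f(T^n\omega)$, $n\in\mathbb{Z}$, has purely singular continuous spectrum.
   Context: $\mathbb{T}=\mathbb{R}/\mathbb{Z}$, $d\ge 1$, $\mathbb{D}$ is the open unit disk in $\mathbb{C}$, and $C(\Omega,\mathbb{D})$ is the set of continuous functions $\Omega\to\mathbb{D}$ with the topology of the supremum norm. The symbol $\mathfrak{a}$ denotes an element of $\mathbb{T}^d$ in the case of the shift and an element of $\mathbb{T}$ in the case of the skew-shift. "Almost every $\omega$" refers to Lebesgue (Haar) measure on the torus. A shift is minimal if every orbit is dense. Given a sequence $\{\alpha(n)\}_{n\in\mathbb{Z}}$ in $\mathbb{D}$ (Verblunsky coefficients), put $\rho(n)=(1-|\alpha(n)|^2)^{1/2}$. The corresponding (two-sided) CMV operator $\mathcal{E}$ is the unitary operator on $\ell^2(\mathbb{Z})$ whose matrix entries are, for every $m\in\mathbb{Z}$, $$\mathcal{E}_{2m,2m-1}=\overline{\alpha(2m)}\rho(2m-1),\quad \mathcal{E}_{2m,2m}=-\overline{\alpha(2m)}\alpha(2m-1),\quad \mathcal{E}_{2m,2m+1}=\overline{\alpha(2m+1)}\rho(2m),\quad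 \mathcal{E}_{2m,2m+2}=\rho(2m+1)\rho(2m),$$ $$\mathcal{E}_{2m+1,2m-1}=\rho(2m)\rho(2m-1),\quad \mathcal{E}_{2m+1,2m}=-\rho(2m)\alpha(2m-1),\quad \mathcal{E}_{2m+1,2m+1}=-\overline{\alpha(2m+1)}\alpha(2m),\quad \mathcal{E}_{2m+1,2m+2}=-\rho(2m+1)\alpha(2m),$$ and all other entries are zero. For a homeomorphism $T$ of $\Omega$, a sampling function $f\in C(\Omega,\mathbb{D})$ and $\omega\in\Omega$, $\mathcal{E}_\omega$ denotes the CMV operator with $\alpha(n)=f(T^n\omega)$. Purely singular continuous spectrum means that all spectral measures of the operator (measures on the unit circle) have neither a pure point part nor a part absolutely continuous with respect to Lebesgue measure on the circle. *)

theory Defs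
  imports "HOL-Analysis.Analysis"
begin

section \<open>The torus\<close>

quotient_type circle = real / "\<lambda>x y. x - y \<in> \<int>"
  morphisms rep_circle to_circle
proof (rule equivpI)
  show "reflp (\<lambda>x y::real. x - y \<in> \<int>)"
    by (simp add: reflp_def)
  show "symp (\<lambda>x y::real. x - y \<in> \<int>)"
    by (metis (no_types, lifting) Ints_minus minus_diff_eq sympI)
  show "transp (\<lambda>x y::real. x - y \<in> \<int>)"
    by (rule transpI) (metis (no_types, lifting) Ints_add add_diff_cancel_left' diff_add_cancel diff_add_eq)
qed

instantiation circle :: ab_group_add
begin

lift_definition zero_circle :: circle is 0 .

lift_definition plus_circle :: "circle \<Rightarrow> circle \<Rightarrow> circle" is "(+)"
  by (metis Ints_add add_diff_add)

lift_definition uminus_circle :: "circle \<Rightarrow> circle" is uminus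
  by (metis Ints_minus minus_diff_minus)

lift_definition minus_circle :: "circle \<Rightarrow> circle \<Rightarrow> circle" is "(-)"
  by (metis Ints_diff diff_diff_eq2 diff_diff_add add.commute add_diff_eq)

instance
  by standard (transfer, simp add: algebra_simps)+

end

text \<open>The quotient topology of \<open>\<real> / \<int>\<close>.\<close>

instantiation circle :: topological_space
begin

definition open_circle :: "circle set \<Rightarrow> bool"
  where "open_circle U \<longleftrightarrow> open (to_circle -` U)"

instance
  by standard (auto simp: open_circle_def vimage_Union intro!: open_Int open_UN)

end

definition to_torus :: "real ^ 'd \<Rightarrow> circle ^ 'd"
  where "to_torus x = (\<chi> i. to_circle (x $ i))"

text \<open>Normalized Haar measure on \<open>\<real>\<^sup>d / \<int>\<^sup>d\<close>: Lebesgue measure on the fundamental domain \<open>[0,1)\<^sup>d\<close>,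
  transported by the quotient map.\<close>

definition torus_measure :: "(circle ^ 'd) measure"
  where "torus_measure =
    distr (restrict_space lborel {x :: real ^ 'd. \<forall>i. 0 \<le> x $ i \<and> x $ i < 1}) borel to_torus"

lemma continuous_on_to_circle: "continuous_on UNIV to_circle"
  by (simp add: continuous_on_open_vimage open_circle_def)

lemma borel_measurable_to_torus: "(to_torus :: real ^ ('d::finite) \<Rightarrow> _) \<in> borel_measurable borel"
proof (rule borel_measurable_continuous_onI)
  have "continuous_on UNIV (\<lambda>x. to_circle (x $ i))" for i :: "'d::finite"
    by (rule continuous_on_compose2[OF continuous_on_to_circle]) (auto intro!: continuous_intros)
  then show "continuous_on UNIV (to_torus :: real ^ ('d::finite) \<Rightarrow> _)"
    unfolding to_torus_def by (intro continuous_on_vec_lambda)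
qed

section \<open>Dynamics\<close>

text \<open>\<open>T\<^sup>n\<close> for \<open>n \<in> \<int>\<close>; meaningful for bijective \<open>T\<close>.\<close>

definition int_iterate :: "('a \<Rightarrow> 'a) \<Rightarrow> int \<Rightarrow> 'a \<Rightarrow> 'a"
  where "int_iterate T n = (if 0 \<le> n then T ^^ nat n else inv T ^^ nat (- n))"

definition minimal_dynamics :: "('a::topological_space \<Rightarrow> 'a) \<Rightarrow> bool"
  where "minimal_dynamics T \<longleftrightarrow> (\<forall>\<omega>. closure (range (\<lambda>n. int_iterate T n \<omega>)) = UNIV)"

definition shift :: "circle ^ 'd \<Rightarrow> circle ^ 'd \<Rightarrow> circle ^ 'd"
  where "shift a \<omega> = \<omega> + a"

definition skew_shift :: "circle \<Rightarrow> circle ^ 2 \<Rightarrow> circle ^ 2"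
  where "skew_shift a \<omega> = vector [\<omega> $ 1 + (a + a), \<omega> $ 1 + \<omega> $ 2]"

text \<open>\<open>C(\<Omega>, \<bbbD>)\<close> with the topology of the supremum norm, which is the metric of the type of bounded
  continuous functions; boundedness is automatic for values in the unit disk.\<close>

definition sampling_functions :: "('a::topological_space \<Rightarrow>\<^sub>C complex) set"
  where "sampling_functions = {f. \<forall>\<omega>. apply_bcontfun f \<omega> \<in> ball 0 1}"

definition sampling_topology :: "('a::topological_space \<Rightarrow>\<^sub>C complex) topology"
  where "sampling_topology = top_of_set sampling_functions"

section \<open>CMV operators\<close>

definition cmv_rho :: "(int \<Rightarrow> complex) \<Rightarrow> int \<Rightarrow> complex"
  where "cmv_rho \<alpha> n = complex_of_real (sqrt (1 - (cmod (\<alpha> n))\<^sup>2))"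

definition cmv_entry :: "(int \<Rightarrow> complex) \<Rightarrow> int \<Rightarrow> int \<Rightarrow> complex"
  where "cmv_entry \<alpha> j k =
    (let m = j div 2; \<rho> = cmv_rho \<alpha> in
     if even j then
       (if k = 2*m - 1 then cnj (\<alpha> (2*m)) * \<rho> (2*m - 1)
        else if k = 2*m then - cnj (\<alpha> (2*m)) * \<alpha> (2*m - 1)
        else if k = 2*m + 1 then cnj (\<alpha> (2*m + 1)) * \<rho> (2*m)
        else if k = 2*m + 2 then \<rho> (2*m + 1) * \<rho> (2*m)
        else 0)
     else
       (if k = 2*m - 1 then \<rho> (2*m) * \<rho> (2*m - 1)
        else if k = 2*m then - \<rho> (2*m) * \<alpha> (2*m - 1)
        else if k = 2*m + 1 then - cnj (\<alpha> (2*m + 1)) * \<alpha> (2*m)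
        else if k = 2*m + 2 then - \<rho> (2*m + 1) * \<alpha> (2*m)
        else 0))"

text \<open>Rows of the matrix have finite support, so the sum below is always finite.\<close>

definition cmv :: "(int \<Rightarrow> complex) \<Rightarrow> (int \<Rightarrow> complex) \<Rightarrow> (int \<Rightarrow> complex)"
  where "cmv \<alpha> u j = (\<Sum>\<^sub>\<infinity>k. cmv_entry \<alpha> j k * u k)"

section \<open>Spectral measures\<close>

definition l2_int :: "(int \<Rightarrow> complex) set"
  where "l2_int = {u. (\<lambda>n. (cmod (u n))\<^sup>2) summable_on UNIV}"

definition l2_inner :: "(int \<Rightarrow> complex) \<Rightarrow> (int \<Rightarrow> complex) \<Rightarrow> complex"
  where "l2_inner u v = (\<Sum>\<^sub>\<infinity>n. cnj (u n) * v n)"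

definition borel_circle :: "complex measure"
  where "borel_circle = restrict_space borel (sphere 0 1)"

definition arc_length :: "complex measure"
  where "arc_length = distr (restrict_space lborel {0..<2 * pi}) borel_circle cis"

text \<open>\<open>\<mu>\<close> is the spectral measure of the vector \<open>u\<close> with respect to the unitary operator \<open>U\<close>:
  \<open>\<langle>u, U\<^sup>n u\<rangle> = \<integral> z\<^sup>n d\<mu>(z)\<close>. The identities for negative \<open>n\<close> follow by complex conjugation,
  so that \<open>\<mu>\<close> exists and is unique by the spectral theorem.\<close>

definition is_spectral_measure ::
  "((int \<Rightarrow> complex) \<Rightarrow> (int \<Rightarrow> complex)) \<Rightarrow> (int \<Rightarrow> complex) \<Rightarrow> complex measure \<Rightarrow> bool"
  where "is_spectral_measure U u \<mu> \<longleftrightarrow>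
    finite_measure \<mu> \<and> sets \<mu> = sets borel_circle \<and>
    (\<forall>n::nat. l2_inner u ((U ^^ n) u) = (\<integral>z. z ^ n \<partial>\<mu>))"

text \<open>In the Lebesgue decomposition of a finite measure \<open>\<mu>\<close> on the unit circle, the pure point part
  vanishes iff \<open>\<mu>\<close> has no atoms, and the absolutely continuous part vanishes iff \<open>\<mu>\<close> is carried by
  a set of zero arc length.\<close>

definition singular_continuous :: "complex measure \<Rightarrow> bool"
  where "singular_continuous \<mu> \<longleftrightarrow>
    (\<forall>z\<in>sphere 0 1. emeasure \<mu> {z} = 0) \<and>
    (\<exists>N\<in>null_sets arc_length. emeasure \<mu> (space \<mu> - N) = 0)"

definition purely_singular_continuous_spectrum ::
  "((int \<Rightarrow> complex) \<Rightarrow> (int \<Rightarrow> complex)) \<Rightarrow> bool"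
  where "purely_singular_continuous_spectrum U \<longleftrightarrow>
    (\<forall>u\<in>l2_int. \<forall>\<mu>. is_spectral_measure U u \<mu> \<longrightarrow> singular_continuous \<mu>)"

text \<open>The conclusion for a fixed base point \<open>\<omega>\<close>: a dense \<open>G\<^sub>\<delta>\<close> set of sampling functions.\<close>

definition generic_singular_continuous :: "('a::topological_space \<Rightarrow> 'a) \<Rightarrow> 'a \<Rightarrow> bool"
  where "generic_singular_continuous T \<omega> \<longleftrightarrow>
    (\<exists>F. gdelta_in sampling_topology F \<and>
         sampling_topology closure_of F = topspace sampling_topology \<and>
         (\<forall>f\<in>F. purely_singular_continuous_spectrum
                   (cmv (\<lambda>n. apply_bcontfun f (int_iterate T n \<omega>)))))"

end

theory Submission
  imports Defs
begin

text \<open>For a unimodular spectral parameter, the eigenvalue equation of the CMV operator reduces to a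
  scalar, real-linear recursion (the Szego recursion on one half-line glued to its inverse on the other),
  whose Wronskian \<open>Im (cnj x * y)\<close> is conserved. Singular continuity is forced by two families of open
  dense conditions on the sampling function. The first excludes solutions whose \<open>\<ell>\<^sup>2\<close> norm is at most a
  fixed multiple of their value at the origin, uniformly in the spectral parameter. If such solutions
  persisted in an open set of sampling functions, one would choose it with the maximal weighted number
  of eigenvalues; then the eigenvalues move continuously, and since the orbit of \<open>\<omega>\<close> is recurrent, a copy of
  the same eigenvalue appears at a far site, and perturbing the two sites independently makes the
  eigenvalues cross, which creates an additional degeneracy and contradicts maximality. The second
  family requires, off a set of angles of measure less than \<open>2\<^sup>-\<^sup>k\<close>, every solution to be large in \<open>\<ell>\<^sup>1\<close>
  mean on some window; it is dense because inserting growing blocks, and moving one coefficient along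
  a parabola, leaves few angles at which both half-line decaying solutions match. A Cesaro
  approximation of the spectral density at a good angle is an approximate solution, hence small, so the
  spectral measures live on the bad angles and Borel-Cantelli makes them singular. Almost every
  base point is recurrent and aperiodic, and Baire's theorem concludes.\<close>

section \<open>The scalar Szego recursion\<close>

text \<open>Normalised Szego transfer matrices lie in SU(1,1), a conjugate of SL(2,R), and with a
  square root \<open>s\<close> of the spectral parameter they preserve the real plane of vectors
  \<open>(x, cnj x)\<close>. One complex number \<open>x\<close> thus replaces a vector, and
  orthogonality, Bessel's inequality and parallelism are all taken over the reals. Squares of
  weights are counted because merging eigenvalues adds weights and so strictly raises the sum of
  squares; a count bounded by Bessel's inequality can be maximal only if nothing merges. Topological
  recurrence would not suffice: the degeneracy is known only for base points in a certain set, and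
  the orbit has to come back to that set. Poincare recurrence gives this off a null set, and
  separability of the space of sampling functions keeps the union of the exceptional sets null. The
  threshold \<open>2 ^ k * (2 * real M + 1)\<close> is calibrated as follows. At each single site
  the approximate density has an integral over the angle that is bounded independently of the site.
  Its sum over a window of \<open>2 * M + 3\<close> sites, divided by the threshold, is therefore of
  order 2 to the power -k, uniformly in \<open>M\<close>; this matters because \<open>M\<close> is
  not controlled in terms of \<open>k\<close>.\<close>

definition szego :: "complex \<Rightarrow> complex \<Rightarrow> complex \<Rightarrow> complex"
  where "szego a s x = (s * x - cnj a * cnj x) / complex_of_real (sqrt (1 - (cmod a)\<^sup>2))"

primrec fwd :: "(nat \<Rightarrow> complex) \<Rightarrow> complex \<Rightarrow> complex \<Rightarrow> nat \<Rightarrow> complex" where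
  "fwd a s v 0 = v"
| "fwd a s v (Suc n) = szego (a n) s (fwd a s v n)"

text \<open>The step from \<open>n\<close> to \<open>n + 1\<close> uses \<open>a n\<close>. Its
  inverse is the step with parameters \<open>- a n\<close> and \<open>cnj s\<close>, so the left
  half-line is again a forward recursion, whose step number \<open>k\<close> undoes the step that
  uses \<open>a (- k - 1)\<close>.\<close>

definition sol :: "(int \<Rightarrow> complex) \<Rightarrow> complex \<Rightarrow> complex \<Rightarrow> int \<Rightarrow> complex"
  where "sol a s v n = (if 0 \<le> n then fwd (\<lambda>k. a (int k)) s v (nat n)
    else fwd (\<lambda>k. - a (- int k - 1)) (cnj s) v (nat (- n)))"

lemma rho_pos: "cmod a < 1 \<Longrightarrow> 0 < sqrt (1 - (cmod a)\<^sup>2)"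
  by (simp add: power_less_one_iff abs_square_less_1)

lemma unit_mult_cnj: "cmod s = 1 \<Longrightarrow> s * cnj s = 1" "cmod s = 1 \<Longrightarrow> cnj s * s = 1"
  using complex_norm_square[of s] by (simp_all add: mult.commute)

lemma szego_add: "szego a s (x + y) = szego a s x + szego a s y"
  by (simp add: szego_def algebra_simps add_divide_distrib diff_divide_distrib)

lemma szego_scale: "szego a s (complex_of_real c * x) = complex_of_real c * szego a s x"
  by (simp add: szego_def algebra_simps)

lemma szego_0 [simp]: "szego a s 0 = 0"
  by (simp add: szego_def)

lemma szego_inverse:
  assumes "cmod a < 1" "cmod s = 1"
  shows "szego (- a) (cnj s) (szego a s x) = x"
proof -
  define \<rho> where "\<rho> = complex_of_real (sqrt (1 - (cmod a)\<^sup>2))"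
  have r0: "\<rho> \<noteq> 0" using rho_pos[OF assms(1)] by (simp add: \<rho>_def)
  have "1 - (cmod a)\<^sup>2 \<ge> 0" using rho_pos[OF assms(1)] by simp
  then have r2: "\<rho> * \<rho> = 1 - a * cnj a"
    unfolding \<rho>_def complex_norm_square[symmetric] of_real_mult[symmetric]
    by (simp del: of_real_mult)
  have cr: "cnj \<rho> = \<rho>" by (simp add: \<rho>_def)
  have "szego (- a) (cnj s) (szego a s x)
      = (cnj s * ((s * x - cnj a * cnj x) / \<rho>) + cnj a * cnj ((s * x - cnj a * cnj x) / \<rho>)) / \<rho>"
    by (simp add: szego_def \<rho>_def)
  also have "\<dots> = (cnj s * (s * x - cnj a * cnj x) + cnj a * (cnj s * cnj x - a * x)) / (\<rho> * \<rho>)"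
    using r0 by (simp add: cr divide_simps)
  also have "\<dots> = ((cnj s * s) * x - (a * cnj a) * x) / (\<rho> * \<rho>)"
    by (simp add: algebra_simps)
  also have "\<dots> = x"
  proof -
    have "(cnj s * s) * x - (a * cnj a) * x = (\<rho> * \<rho>) * x"
      by (simp only: unit_mult_cnj[OF assms(2)] r2) (simp add: algebra_simps)
    then show ?thesis using r0 by simp
  qed
  finally show ?thesis .
qed

lemma szego_inverse':
  assumes "cmod a < 1" "cmod s = 1"
  shows "szego a s (szego (- a) (cnj s) x) = x"
  using szego_inverse[of "- a" "cnj s" x] assms by simp

text \<open>\<open>Im (cnj x * y)\<close> is the area form of the plane, and a step, as a
  real-linear map, has determinant
  \<open>(1 - (cmod a)\<^sup>2) / (1 - (cmod a)\<^sup>2) = 1\<close>.\<close>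

lemma szego_wronskian:
  assumes "cmod a < 1" "cmod s = 1"
  shows "Im (cnj (szego a s x) * szego a s y) = Im (cnj x * y)"
proof -
  define \<rho> where "\<rho> = sqrt (1 - (cmod a)\<^sup>2)"
  have r0: "\<rho> > 0" using rho_pos[OF assms(1)] by (simp add: \<rho>_def)
  have r2: "\<rho> * \<rho> = 1 - (cmod a)\<^sup>2" using r0 unfolding \<rho>_def by simp
  have "cnj (szego a s x) * szego a s y
     = ((cnj s * cnj x - a * x) * (s * y - cnj a * cnj y)) / complex_of_real (\<rho> * \<rho>)"
    unfolding szego_def \<rho>_def[symmetric] by simp
  then have "Im (cnj (szego a s x) * szego a s y)
     = Im ((cnj s * cnj x - a * x) * (s * y - cnj a * cnj y)) / (\<rho> * \<rho>)"
    by (metis Im_divide_of_real)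
  also have "(cnj s * cnj x - a * x) * (s * y - cnj a * cnj y)
     = (cnj s * s) * (cnj x * y) + (a * cnj a) * (x * cnj y) - (a * x * s * y + cnj (a * x * s * y))"
    by (simp add: algebra_simps)
  also have "Im \<dots> = Im (cnj x * y) + (cmod a)\<^sup>2 * Im (x * cnj y) - Im (a * x * s * y + cnj (a * x * s * y))"
    unfolding unit_mult_cnj[OF assms(2)] complex_norm_square[symmetric] by simp
  also have "Im (a * x * s * y + cnj (a * x * s * y)) = 0"
    unfolding complex_add_cnj by simp
  also have "Im (cnj x * y) + (cmod a)\<^sup>2 * Im (x * cnj y) - 0 = (\<rho> * \<rho>) * Im (cnj x * y)"
    by (simp add: r2 algebra_simps)
  finally show ?thesis using r0 by simp
qed

lemma szego_bound:
  assumes "cmod a \<le> r" "r < 1" "cmod s = 1"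
  shows "cmod (szego a s x) \<le> 2 / sqrt (1 - r\<^sup>2) * cmod x"
proof -
  have r0: "0 \<le> r" using assms(1) norm_ge_zero order_trans by blast
  have p: "0 < sqrt (1 - r\<^sup>2)" using r0 assms(2) by (simp add: power_less_one_iff abs_square_less_1)
  have "sqrt (1 - r\<^sup>2) \<le> sqrt (1 - (cmod a)\<^sup>2)"
    using assms(1) by (simp add: power_mono)
  moreover have "cmod (s * x - cnj a * cnj x) \<le> 2 * cmod x"
  proof -
    have "cmod (s * x - cnj a * cnj x) \<le> cmod (s * x) + cmod (cnj a * cnj x)"
      by (rule norm_triangle_ineq4)
    also have "\<dots> \<le> cmod x + 1 * cmod x"
      unfolding norm_mult complex_mod_cnj assms(3)
      using assms by (intro add_mono mult_right_mono) auto
    finally show ?thesis by simp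
  qed
  ultimately have "cmod (s * x - cnj a * cnj x) / sqrt (1 - (cmod a)\<^sup>2) \<le> 2 * cmod x / sqrt (1 - r\<^sup>2)"
    using p by (intro frac_le) auto
  then show ?thesis using rho_pos[of a] assms(1,2) by (simp add: szego_def norm_divide)
qed

lemma fwd_add: "fwd a s (v + w) n = fwd a s v n + fwd a s w n"
  by (induction n) (simp_all add: szego_add)

lemma fwd_scale: "fwd a s (complex_of_real c * v) n = complex_of_real c * fwd a s v n"
  by (induction n) (simp_all add: szego_scale)

lemma sol_add: "sol a s (v + w) n = sol a s v n + sol a s w n"
  by (simp add: sol_def fwd_add)

lemma sol_scale: "sol a s (complex_of_real c * v) n = complex_of_real c * sol a s v n"
  by (simp add: sol_def fwd_scale)

lemma sol_at_0 [simp]: "sol a s v 0 = v"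
  by (simp add: sol_def)

lemma sol_zero [simp]: "sol a s 0 n = 0"
  using sol_scale[of a s 0 0 n] by simp

lemma sol_sum: "finite S \<Longrightarrow> sol a s (\<Sum>j\<in>S. complex_of_real (t j) * v j) n = (\<Sum>j\<in>S. complex_of_real (t j) * sol a s (v j) n)"
  by (induction S rule: finite_induct) (simp_all add: sol_add sol_scale)

lemma fwd_cong: "(\<And>k. k < n \<Longrightarrow> a k = b k) \<Longrightarrow> fwd a s v n = fwd b s v n"
  by (induction n) simp_all

lemma sol_cong:
  assumes "\<And>k. \<bar>k\<bar> \<le> \<bar>n\<bar> \<Longrightarrow> a k = b k"
  shows "sol a s v n = sol b s v n"
proof (cases "0 \<le> n")
  case True
  then show ?thesis unfolding sol_def by (auto intro!: fwd_cong assms)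
next
  case False
  then show ?thesis unfolding sol_def by (auto intro!: fwd_cong assms)
qed

lemma sol_step:
  assumes "cmod s = 1" "\<And>n. cmod (a n) < 1"
  shows "sol a s v (n + 1) = szego (a n) s (sol a s v n)"
proof (cases "0 \<le> n")
  case True
  then have "nat (n + 1) = Suc (nat n)" by simp
  with True show ?thesis by (simp add: sol_def)
next
  case False
  then obtain k where k: "n = - int k - 1"
    by (metis add.commute add_diff_cancel_left' diff_minus_eq_add int_cases int_of_nat_induct minus_diff_eq of_nat_Suc of_nat_0_le_iff)
  have n: "nat (- n) = Suc k" using k by simp
  have "sol a s v n = szego (- a n) (cnj s) (fwd (\<lambda>k. - a (- int k - 1)) (cnj s) v k)"
    using False n k by (simp add: sol_def)
  moreover have "sol a s v (n + 1) = fwd (\<lambda>k. - a (- int k - 1)) (cnj s) v k"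
    using k by (cases k) (auto simp: sol_def nat_add_distrib)
  ultimately show ?thesis using szego_inverse'[of "a n" s] assms by simp
qed

lemma sol_unique:
  assumes s: "cmod s = 1" and a: "\<And>n. cmod (a n) < 1"
    and x: "\<And>n. x (n + 1) = szego (a n) s (x n)"
  shows "x n = sol a s (x 0) n"
proof (induction n rule: int_induct[where k = 0])
  case base
  show ?case by simp
next
  case (step1 i)
  then show ?case using x[of i] by (simp add: sol_step[OF s a])
next
  case (step2 i)
  have "szego (a (i - 1)) s (x (i - 1)) = szego (a (i - 1)) s (sol a s (x 0) (i - 1))"
    using x[of "i - 1"] sol_step[OF s a, where n = "i - 1"] step2 by simp
  then show ?case using szego_inverse[OF a s] by metis
qed

lemma sol_shift:
  assumes s: "cmod s = 1" and a: "\<And>n. cmod (a n) < 1"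
  shows "sol (\<lambda>n. a (n + q)) s (sol a s v q) n = sol a s v (n + q)"
proof -
  have "sol a s v ((n + 1) + q) = szego (a (n + q)) s (sol a s v (n + q))" for n
    using sol_step[OF s a, where n = "n + q"] by (simp add: algebra_simps)
  then have "sol a s v (n + q) = sol (\<lambda>n. a (n + q)) s (sol a s v (0 + q)) n"
    by (rule sol_unique[where a = "\<lambda>n. a (n + q)" and x = "\<lambda>n. sol a s v (n + q)", OF s a])
  then show ?thesis by simp
qed

lemma sol_wronskian:
  assumes s: "cmod s = 1" and a: "\<And>n. cmod (a n) < 1"
  shows "Im (cnj (sol a s v n) * sol a s w n) = Im (cnj v * w)"
proof (induction n rule: int_induct[where k = 0])
  case base
  show ?case by simp
next
  case (step1 i)
  then show ?case unfolding sol_step[OF s a] szego_wronskian[OF a s] by simp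
next
  case (step2 i)
  have "Im (cnj (sol a s v i) * sol a s w i) = Im (cnj (sol a s v (i - 1)) * sol a s w (i - 1))"
    using sol_step[OF s a, where v = v and n = "i - 1"] sol_step[OF s a, where v = w and n = "i - 1"]
      szego_wronskian[OF a s, of "i - 1"] by simp
  with step2 show ?case by simp
qed

lemma tendsto_szego:
  assumes "(a \<longlongrightarrow> a0) F" "(s \<longlongrightarrow> s0) F" "(x \<longlongrightarrow> x0) F" "cmod a0 < 1"
  shows "((\<lambda>i. szego (a i) (s i) (x i)) \<longlongrightarrow> szego a0 s0 x0) F"
  unfolding szego_def using rho_pos[OF assms(4)]
  by (intro tendsto_intros assms) auto

lemma tendsto_fwd:
  assumes "\<And>n. ((\<lambda>i. a i n) \<longlongrightarrow> a0 n) F" "(s \<longlongrightarrow> s0) F" "(v \<longlongrightarrow> v0) F" "\<And>n. cmod (a0 n) < 1"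
  shows "((\<lambda>i. fwd (a i) (s i) (v i) n) \<longlongrightarrow> fwd a0 s0 v0 n) F"
proof (induction n)
  case 0
  then show ?case using assms by simp
next
  case (Suc n)
  show ?case unfolding fwd.simps by (intro tendsto_szego assms Suc)
qed

lemma tendsto_sol:
  assumes "\<And>n. ((\<lambda>i. a i n) \<longlongrightarrow> a0 n) F" "(s \<longlongrightarrow> s0) F" "(v \<longlongrightarrow> v0) F" "\<And>n. cmod (a0 n) < 1"
  shows "((\<lambda>i. sol (a i) (s i) (v i) n) \<longlongrightarrow> sol a0 s0 v0 n) F"
proof (cases "0 \<le> n")
  case True
  then show ?thesis unfolding sol_def using assms by (auto intro!: tendsto_fwd)
next
  case False
  then show ?thesis unfolding sol_def using assms
    by (auto intro!: tendsto_fwd tendsto_intros)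
qed

section \<open>Normalised square-summable solutions\<close>

text \<open>An inequality instead of norm 1, and finite windows instead of an infinite sum: in a
  pointwise limit mass may escape to infinity, and only this form survives it.\<close>

definition localized :: "(int \<Rightarrow> complex) \<Rightarrow> complex \<Rightarrow> complex \<Rightarrow> bool"
  where "localized a s v \<longleftrightarrow> cmod s = 1 \<and> (\<forall>M::nat. (\<Sum>n=-int M..int M. (cmod (sol a s v n))\<^sup>2) \<le> 1)"

lemma square_summable_tendsto_0:
  fixes x :: "nat \<Rightarrow> complex"
  assumes "\<And>M. (\<Sum>n<M. (cmod (x n))\<^sup>2) \<le> B"
  shows "x \<longlonglongrightarrow> 0"
proof -
  have "summable (\<lambda>n. (cmod (x n))\<^sup>2)"
    by (rule summableI_nonneg_bounded) (use assms in auto)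
  then have "(\<lambda>n. sqrt ((cmod (x n))\<^sup>2)) \<longlonglongrightarrow> sqrt 0"
    by (intro tendsto_real_sqrt summable_LIMSEQ_zero)
  then show ?thesis by (simp add: tendsto_norm_zero_iff)
qed

lemma loc_tendsto_0:
  assumes "localized a s v"
  shows "(\<lambda>n. sol a s v (int n)) \<longlonglongrightarrow> 0" "(\<lambda>n. sol a s v (- int n)) \<longlonglongrightarrow> 0"
proof -
  have b: "(\<Sum>n=-int M..int M. (cmod (sol a s v n))\<^sup>2) \<le> 1" for M
    using assms by (auto simp: localized_def)
  have "(\<Sum>n<M. (cmod (sol a s v (int n)))\<^sup>2) \<le> 1" for M
  proof -
    have "(\<Sum>n<M. (cmod (sol a s v (int n)))\<^sup>2) = (\<Sum>n\<in>int ` {..<M}. (cmod (sol a s v n))\<^sup>2)"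
      by (subst sum.reindex) (auto simp: inj_on_def)
    also have "\<dots> \<le> (\<Sum>n=-int M..int M. (cmod (sol a s v n))\<^sup>2)"
      by (rule sum_mono2) auto
    finally show ?thesis using b[of M] by simp
  qed
  then show "(\<lambda>n. sol a s v (int n)) \<longlonglongrightarrow> 0"
    by (rule square_summable_tendsto_0)
  have "(\<Sum>n<M. (cmod (sol a s v (- int n)))\<^sup>2) \<le> 1" for M
  proof -
    have "(\<Sum>n<M. (cmod (sol a s v (- int n)))\<^sup>2) = (\<Sum>n\<in>(\<lambda>n. - int n) ` {..<M}. (cmod (sol a s v n))\<^sup>2)"
      by (subst sum.reindex) (auto simp: inj_on_def)
    also have "\<dots> \<le> (\<Sum>n=-int M..int M. (cmod (sol a s v n))\<^sup>2)"
      by (rule sum_mono2) auto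
    finally show ?thesis using b[of M] by simp
  qed
  then show "(\<lambda>n. sol a s v (- int n)) \<longlonglongrightarrow> 0"
    by (rule square_summable_tendsto_0)
qed

text \<open>Each window sum depends continuously on finitely many coefficients, the parameter and
  the initial value.\<close>

lemma loc_closed:
  assumes "\<And>n. (\<lambda>i. A i n) \<longlonglongrightarrow> a n" "s \<longlonglongrightarrow> s0" "v \<longlonglongrightarrow> v0" "\<And>n. cmod (a n) < 1"
    and "\<And>i. localized (A i) (s i) (v i)"
  shows "localized a s0 v0"
proof -
  have "cmod s0 = 1"
    using tendsto_norm[OF assms(2)] assms(5) by (simp add: localized_def LIMSEQ_const_iff)
  moreover have "(\<Sum>n=-int M..int M. (cmod (sol a s0 v0 n))\<^sup>2) \<le> 1" for M
  proof (rule LIMSEQ_le_const2)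
    show "(\<lambda>i. \<Sum>n=-int M..int M. (cmod (sol (A i) (s i) (v i) n))\<^sup>2) \<longlonglongrightarrow> (\<Sum>n=-int M..int M. (cmod (sol a s0 v0 n))\<^sup>2)"
      by (intro tendsto_intros tendsto_sol assms)
    show "\<exists>N. \<forall>n\<ge>N. (\<Sum>na = - int M..int M. (cmod (sol (A n) (s n) (v n) na))\<^sup>2) \<le> 1"
      using assms(5) by (auto simp: localized_def)
  qed
  ultimately show ?thesis by (simp add: localized_def)
qed

text \<open>The recursion in scattering form: \<open>(x\<^sub>n\<^sub>+\<^sub>1, cnj x\<^sub>n)\<close> is \<open>s\<close> times a unitary image of
  \<open>(x\<^sub>n, cnj x\<^sub>n\<^sub>+\<^sub>1)\<close>, so solutions behave like eigenvectors of a unitary operator with eigenvalue \<open>s\<close>.\<close>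

lemma szego_scattering:
  assumes a: "cmod a < 1" and s: "cmod s = 1" and t: "cmod t = 1"
    and x': "x' = szego a s x" and y': "y' = szego a t y"
  shows "x' * cnj y' + cnj (x * cnj y) = s * cnj t * (x * cnj y + cnj (x' * cnj y'))"
proof -
  define \<rho> where "\<rho> = complex_of_real (sqrt (1 - (cmod a)\<^sup>2))"
  have r0: "\<rho> \<noteq> 0" using rho_pos[OF a] by (simp add: \<rho>_def)
  have "1 - (cmod a)\<^sup>2 \<ge> 0" using rho_pos[OF a] by simp
  then have r2: "\<rho> * \<rho> = 1 - a * cnj a"
    unfolding \<rho>_def complex_norm_square[symmetric] of_real_mult[symmetric]
    by (simp del: of_real_mult)
  have cr: "cnj \<rho> = \<rho>" by (simp add: \<rho>_def)
  have sc: "cnj x = s * (\<rho> * cnj x' + a * x)" "x' = s * (\<rho> * x - cnj a * cnj x')"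
    if s: "cmod s = 1" and x': "x' = szego a s x" for s x x'
  proof -
    have e: "\<rho> * x' = s * x - cnj a * cnj x"
      using r0 by (simp add: x' szego_def \<rho>_def)
    have e2: "\<rho> * cnj x' = cnj s * cnj x - a * x"
      using arg_cong[OF e, of cnj] cr by simp
    show *: "cnj x = s * (\<rho> * cnj x' + a * x)"
      by (simp add: e2 mult.assoc[symmetric] unit_mult_cnj[OF s])
    have "\<rho> * x' = \<rho> * (s * (\<rho> * x - cnj a * cnj x'))"
    proof -
      have "\<rho> * (s * (\<rho> * x - cnj a * cnj x')) = s * ((\<rho> * \<rho>) * x) - cnj a * (s * (\<rho> * cnj x'))"
        by (simp add: algebra_simps)
      also have "\<dots> = s * x - cnj a * (s * (\<rho> * cnj x' + a * x))"
        by (simp add: r2 algebra_simps)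
      finally show ?thesis using e * by simp
    qed
    then show "x' = s * (\<rho> * x - cnj a * cnj x')" using r0 by simp
  qed
  define X where "X = cnj x'"
  define Y where "Y = cnj y"
  have y1: "y = cnj t * (\<rho> * y' + cnj a * cnj y)"
    using arg_cong[OF sc(1)[OF t y'], of cnj] cr by simp
  have y2: "cnj y' = cnj t * (\<rho> * cnj y - a * y')"
    using arg_cong[OF sc(2)[OF t y'], of cnj] cr by simp
  define p where "p = \<rho> * x - cnj a * X"
  define q where "q = \<rho> * Y - a * y'"
  define r where "r = \<rho> * X + a * x"
  define w where "w = \<rho> * y' + cnj a * Y"
  have "x' = s * p" "cnj y' = cnj t * q" "cnj x = s * r" "y = cnj t * w"
    using sc[OF s x'] y1 y2 by (simp_all add: p_def q_def r_def w_def X_def Y_def)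
  then have "x' * cnj y' + cnj x * y = (s * p) * (cnj t * q) + (s * r) * (cnj t * w)" by simp
  also have "\<dots> = s * cnj t * (p * q + r * w)" by (simp add: algebra_simps)
  also have "p * q + r * w = (\<rho> * x - cnj a * X) * (\<rho> * Y - a * y') + (\<rho> * X + a * x) * (\<rho> * y' + cnj a * Y)"
    by (simp add: p_def q_def r_def w_def)
  also have "(\<rho> * x - cnj a * X) * (\<rho> * Y - a * y') + (\<rho> * X + a * x) * (\<rho> * y' + cnj a * Y)
     = (\<rho> * \<rho> + a * cnj a) * (x * Y + X * y')"
    by (simp add: algebra_simps)
  also have "\<dots> = x * Y + X * y'" by (simp add: r2)
  finally show ?thesis by (simp add: X_def Y_def algebra_simps)
qed

text \<open>Eigenvectors of a unitary operator for different eigenvalues are orthogonal. Summing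
  \<open>szego_scattering\<close> over a window gives \<open>2 * Re Z * (1 - u)\<close> up to
  boundary terms, and these vanish because localized solutions decay. Only the real part appears, as
  it should: \<open>s\<close> and \<open>- s\<close> belong to the same spectral parameter, and
  multiplication by \<open>\<i>\<close> times an alternating sign exchanges their solutions.\<close>

lemma loc_orthogonal:
  assumes a: "\<And>n. cmod (a n) < 1" and x: "localized a s v" and y: "localized a t w" and ne: "s \<noteq> t"
  shows "(\<lambda>M. Re (\<Sum>n=-int M..int M. sol a s v n * cnj (sol a t w n))) \<longlonglongrightarrow> 0"
proof -
  have s: "cmod s = 1" and t: "cmod t = 1" using x y by (auto simp: localized_def)
  define p where "p n = sol a s v n * cnj (sol a t w n)" for n
  define u where "u = s * cnj t"
  have u1: "u \<noteq> 1"
  proof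
    assume "u = 1"
    then have "s * cnj t * t = t" by (simp add: u_def)
    then have "s = t" by (simp add: mult.assoc unit_mult_cnj[OF t])
    with ne show False by simp
  qed
  have step: "p (n + 1) + cnj (p n) = u * (p n + cnj (p (n + 1)))" for n
    unfolding p_def u_def
    by (rule szego_scattering[OF a s t]) (simp_all add: sol_step[OF s a] sol_step[OF t a])
  define Z where "Z M = (\<Sum>n=-int M..int M. p n)" for M
  have bound: "cmod (complex_of_real (2 * Re (Z M)) * (1 - u)) \<le> 2 * (cmod (p (int M)) + cmod (p (- int M)))" for M
  proof -
    have i1: "(\<Sum>n\<in>{-int M..<int M}. p n) = Z M - p (int M)"
    proof -
      have "{-int M..int M} = insert (int M) {-int M..<int M}" by auto
      then show ?thesis by (simp add: Z_def)
    qed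
    have i2: "(\<Sum>n\<in>{-int M..<int M}. p (n + 1)) = Z M - p (- int M)"
    proof -
      have "(\<Sum>n\<in>{-int M..<int M}. p (n + 1)) = (\<Sum>n\<in>{-int M<..int M}. p n)"
        by (rule sum.reindex_bij_witness[where i = "\<lambda>n. n - 1" and j = "\<lambda>n. n + 1"]) auto
      moreover have "{-int M..int M} = insert (- int M) {-int M<..int M}" by auto
      ultimately show ?thesis by (simp add: Z_def)
    qed
    have "(\<Sum>n\<in>{-int M..<int M}. p (n + 1) + cnj (p n)) = (\<Sum>n\<in>{-int M..<int M}. u * (p n + cnj (p (n + 1))))"
      using step by simp
    then have "(\<Sum>n\<in>{-int M..<int M}. p (n + 1)) + cnj (\<Sum>n\<in>{-int M..<int M}. p n)
       = u * ((\<Sum>n\<in>{-int M..<int M}. p n) + cnj (\<Sum>n\<in>{-int M..<int M}. p (n + 1)))"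
      by (simp add: sum.distrib sum_distrib_left[symmetric])
    then have "Z M - p (- int M) + cnj (Z M - p (int M)) = u * (Z M - p (int M) + cnj (Z M - p (- int M)))"
      unfolding i1 i2 .
    then have "(Z M + cnj (Z M)) * (1 - u) = p (- int M) + cnj (p (int M)) - u * (p (int M) + cnj (p (- int M)))"
      by (simp add: algebra_simps)
    then have "cmod (complex_of_real (2 * Re (Z M)) * (1 - u))
        = cmod (p (- int M) + cnj (p (int M)) - u * (p (int M) + cnj (p (- int M))))"
      by (simp add: complex_add_cnj)
    also have "\<dots> \<le> (cmod (p (- int M)) + cmod (p (int M))) + cmod u * (cmod (p (int M)) + cmod (p (- int M)))"
      by (intro norm_triangle_le_diff add_mono) (auto simp: norm_mult intro!: norm_triangle_le mult_left_mono)
    finally show ?thesis using s t by (simp add: u_def norm_mult)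
  qed
  have "(\<lambda>M. 2 * (cmod (p (int M)) + cmod (p (- int M)))) \<longlonglongrightarrow> 2 * (cmod (0 * cnj 0) + cmod (0 * cnj 0))"
    unfolding p_def by (intro tendsto_intros loc_tendsto_0[OF x] loc_tendsto_0[OF y])
  then have lim: "(\<lambda>M. 2 * (cmod (p (int M)) + cmod (p (- int M)))) \<longlonglongrightarrow> 0" by simp
  have "(\<lambda>M. complex_of_real (2 * Re (Z M)) * (1 - u)) \<longlonglongrightarrow> 0"
    by (rule Lim_null_comparison[OF always_eventually lim]) (use bound in blast)
  from tendsto_divide[OF this tendsto_const[of "1 - u"]] u1
  have "(\<lambda>M. complex_of_real (2 * Re (Z M))) \<longlonglongrightarrow> 0" by simp
  from tendsto_divide[OF tendsto_Re[OF this] tendsto_const[of 2]] show ?thesis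
    by (simp add: Z_def p_def)
qed

text \<open>Orthogonality is only asymptotic in the window. On a large window the Gram matrix has
  diagonal entries at most 1 and small off-diagonal ones, so the bound holds in the limit; it passes
  to the window \<open>M\<close> because window sums of squares increase.\<close>

lemma loc_bessel:
  assumes a: "\<And>n. cmod (a n) < 1" and S: "finite S" and l: "\<And>s. s \<in> S \<Longrightarrow> localized a s (v s)"
  shows "(\<Sum>n=-int M..int M. (cmod (\<Sum>s\<in>S. complex_of_real (t s) * sol a s (v s) n))\<^sup>2) \<le> (\<Sum>s\<in>S. (t s)\<^sup>2)"
    (is "?F M \<le> _")
proof -
  define x where "x s = sol a s (v s)" for s
  define Z where "Z s s' N = Re (\<Sum>n=-int N..int N. x s n * cnj (x s' n))" for s s' N
  \<comment> \<open>The quadratic form with its diagonal entries replaced by the upper bound 1;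
    unlike the form itself it has a known limit.\<close>
  define E where "E N = (\<Sum>s\<in>S. \<Sum>s'\<in>S. if s = s' then (t s)\<^sup>2 else t s * t s' * Z s s' N)" for N :: nat
  have sq: "(cmod (\<Sum>s\<in>S. complex_of_real (t s) * x s n))\<^sup>2 = (\<Sum>s\<in>S. \<Sum>s'\<in>S. t s * t s' * Re (x s n * cnj (x s' n)))" for n
  proof -
    have "complex_of_real ((cmod (\<Sum>s\<in>S. complex_of_real (t s) * x s n))\<^sup>2)
      = (\<Sum>s\<in>S. \<Sum>s'\<in>S. complex_of_real (t s * t s') * (x s n * cnj (x s' n)))"
      unfolding complex_norm_square cnj_sum sum_product by (intro sum.cong refl) simp
    from arg_cong[OF this, of Re] show ?thesis by (simp del: of_real_mult)
  qed
  have F: "?F N = (\<Sum>s\<in>S. \<Sum>s'\<in>S. t s * t s' * Z s s' N)" for N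
  proof -
    have "?F N = (\<Sum>n=-int N..int N. \<Sum>s\<in>S. \<Sum>s'\<in>S. t s * t s' * Re (x s n * cnj (x s' n)))"
      by (simp only: x_def[symmetric] sq)
    also have "\<dots> = (\<Sum>s\<in>S. \<Sum>n=-int N..int N. \<Sum>s'\<in>S. t s * t s' * Re (x s n * cnj (x s' n)))"
      by (rule sum.swap)
    also have "\<dots> = (\<Sum>s\<in>S. \<Sum>s'\<in>S. \<Sum>n=-int N..int N. t s * t s' * Re (x s n * cnj (x s' n)))"
      by (intro sum.cong refl) (rule sum.swap)
    also have "\<dots> = (\<Sum>s\<in>S. \<Sum>s'\<in>S. t s * t s' * Z s s' N)"
      unfolding Z_def Re_sum sum_distrib_left ..
    finally show ?thesis .
  qed
  have diag: "Z s s N \<le> 1" if "s \<in> S" for s N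
    using l[OF that] by (simp add: Z_def localized_def x_def complex_norm_square[symmetric] del: of_real_power)
  have FE: "?F N \<le> E N" for N
    unfolding F E_def
  proof (intro sum_mono)
    fix s s' assume "s \<in> S"
    then show "t s * t s' * Z s s' N \<le> (if s = s' then (t s)\<^sup>2 else t s * t s' * Z s s' N)"
      using mult_left_mono[OF diag[OF \<open>s \<in> S\<close>, of N], of "(t s)\<^sup>2"] by (auto simp: power2_eq_square)
  qed
  have "E \<longlonglongrightarrow> (\<Sum>s\<in>S. \<Sum>s'\<in>S. if s = s' then (t s)\<^sup>2 else t s * t s' * 0)"
    unfolding E_def
  proof (intro tendsto_sum)
    fix s s' assume *: "s \<in> S" "s' \<in> S"
    show "(\<lambda>N. if s = s' then (t s)\<^sup>2 else t s * t s' * Z s s' N) \<longlonglongrightarrow> (if s = s' then (t s)\<^sup>2 else t s * t s' * 0)"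
      using loc_orthogonal[OF a l[OF *(1)] l[OF *(2)]]
      by (cases "s = s'") (auto simp: Z_def x_def intro!: tendsto_mult_right_zero)
  qed
  also have "(\<Sum>s\<in>S. \<Sum>s'\<in>S. if s = s' then (t s)\<^sup>2 else t s * t s' * 0) = (\<Sum>s\<in>S. (t s)\<^sup>2)"
  proof (rule sum.cong[OF refl])
    fix s assume "s \<in> S"
    have "(\<Sum>s'\<in>S. if s = s' then (t s)\<^sup>2 else t s * t s' * 0) = (\<Sum>s'\<in>S. if s = s' then (t s)\<^sup>2 else 0)"
      by (rule sum.cong) auto
    also have "\<dots> = (t s)\<^sup>2" using S \<open>s \<in> S\<close> by (simp add: sum.delta')
    finally show "(\<Sum>s'\<in>S. if s = s' then (t s)\<^sup>2 else t s * t s' * 0) = (t s)\<^sup>2" .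
  qed
  finally have lim: "E \<longlonglongrightarrow> (\<Sum>s\<in>S. (t s)\<^sup>2)" .
  show ?thesis
  proof (rule LIMSEQ_le_const[OF lim], intro exI allI impI)
    fix N assume "M \<le> N"
    then have "?F M \<le> ?F N" by (intro sum_mono2) auto
    with FE[of N] show "?F M \<le> E N" by simp
  qed
qed

lemma real_parallel:
  assumes "v \<noteq> 0" "Im (cnj v * w) = 0"
  obtains b where "w = complex_of_real b * v"
proof -
  have "cnj v * w = complex_of_real (Re (cnj v * w))"
    using assms(2) by (simp add: complex_eq_iff)
  then have "v * (cnj v * w) = complex_of_real (Re (cnj v * w)) * v" by (simp add: mult.commute)
  then have "complex_of_real ((cmod v)\<^sup>2) * w = complex_of_real (Re (cnj v * w)) * v"
    by (simp only: complex_norm_square mult.assoc)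
  then have "w = complex_of_real (Re (cnj v * w) / (cmod v)\<^sup>2) * v"
    using assms(1) by (simp add: field_simps)
  then show ?thesis by (rule that)
qed

text \<open>The Wronskian of two solutions is constant, and it tends to 0 when both decay.\<close>

lemma loc_parallel:
  assumes a: "\<And>n. cmod (a n) < 1" and x: "localized a s v" and y: "localized a s w"
  shows "Im (cnj v * w) = 0"
proof -
  have s: "cmod s = 1" using x by (simp add: localized_def)
  have "(\<lambda>n. Im (cnj (sol a s v (int n)) * sol a s w (int n))) \<longlonglongrightarrow> Im (cnj 0 * 0)"
    by (intro tendsto_intros loc_tendsto_0[OF x] loc_tendsto_0[OF y])
  then show ?thesis unfolding sol_wronskian[OF s a] by (simp add: LIMSEQ_const_iff)
qed

section \<open>Weighted families of localized solutions: Bessel bound and compactness\<close>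

definition localized_family :: "real \<Rightarrow> (int \<Rightarrow> complex) \<Rightarrow> complex set \<Rightarrow> (complex \<Rightarrow> nat) \<Rightarrow> (complex \<Rightarrow> complex) \<Rightarrow> bool"
  where "localized_family c a S l v \<longleftrightarrow> finite S \<and> (\<forall>s\<in>S. localized a s (v s) \<and> 1 \<le> l s \<and> c * real (l s) \<le> (cmod (v s))\<^sup>2)"

text \<open>A weight counts how many multiples of \<open>c\<close> the squared value at the origin
  holds. When eigenvalues collide in a limit their weights add; squares are summed so that a
  collision is visible as a strict increase.\<close>

definition degeneracy_ge :: "real \<Rightarrow> (int \<Rightarrow> complex) \<Rightarrow> nat \<Rightarrow> bool"
  where "degeneracy_ge c a d \<longleftrightarrow> (\<exists>S l v. localized_family c a S l v \<and> d \<le> (\<Sum>s\<in>S. (l s)\<^sup>2))"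

definition localized_at :: "real \<Rightarrow> (int \<Rightarrow> complex) \<Rightarrow> complex \<Rightarrow> bool"
  where "localized_at c a s \<longleftrightarrow> (\<exists>v. localized a s v \<and> c \<le> (cmod v)\<^sup>2)"

text \<open>Bessel's inequality at the single site 0. For a unit \<open>u\<close> put
  \<open>t s = Re (u * v s)\<close>; then \<open>T\<close>, the sum of the
  \<open>(t s)\<^sup>2\<close>, is the real part of \<open>u\<close> times the combination of the
  \<open>v s\<close> with coefficients \<open>t s\<close>, whose squared norm is at most
  \<open>T\<close>. So \<open>T\<^sup>2 \<le> T\<close>. The two real directions
  \<open>u = 1\<close> and \<open>u = \<i>\<close> add up to the bound 2.\<close>

lemma fam_bound:
  assumes a: "\<And>n. cmod (a n) < 1" and f: "localized_family c a S l v"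
  shows "c * real (\<Sum>s\<in>S. l s) \<le> 2"
proof -
  have S: "finite S" using f by (simp add: localized_family_def)
  have half: "(\<Sum>s\<in>S. (Re (u * v s))\<^sup>2) \<le> 1" if u: "cmod u = 1" for u
  proof -
    define t where "t s = Re (u * v s)" for s
    define T where "T = (\<Sum>s\<in>S. (t s)\<^sup>2)"
    have "(\<Sum>n=-int 0..int 0. (cmod (\<Sum>s\<in>S. complex_of_real (t s) * sol a s (v s) n))\<^sup>2) \<le> T"
      unfolding T_def using f by (intro loc_bessel[OF a S]) (auto simp: localized_family_def)
    then have "(cmod (\<Sum>s\<in>S. complex_of_real (t s) * v s))\<^sup>2 \<le> T" by simp
    moreover have T: "T = Re (u * (\<Sum>s\<in>S. complex_of_real (t s) * v s))"
    proof -
      have "u * (\<Sum>s\<in>S. complex_of_real (t s) * v s) = (\<Sum>s\<in>S. complex_of_real (t s) * (u * v s))"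
        by (simp add: sum_distrib_left algebra_simps)
      then show ?thesis by (simp add: T_def t_def power2_eq_square)
    qed
    moreover have "\<bar>Re (u * (\<Sum>s\<in>S. complex_of_real (t s) * v s))\<bar> \<le> cmod (\<Sum>s\<in>S. complex_of_real (t s) * v s)"
      using abs_Re_le_cmod[of "u * (\<Sum>s\<in>S. complex_of_real (t s) * v s)"] u by (simp add: norm_mult)
    then have "T\<^sup>2 \<le> (cmod (\<Sum>s\<in>S. complex_of_real (t s) * v s))\<^sup>2"
      unfolding T[symmetric] using abs_le_square_iff by fastforce
    ultimately have "T\<^sup>2 \<le> T" by linarith
    then have "T \<le> 1"
      by (cases "T \<le> 0") (auto simp: power2_eq_square)
    then show ?thesis by (simp add: T_def t_def)
  qed
  have "c * real (\<Sum>s\<in>S. l s) = (\<Sum>s\<in>S. c * real (l s))" by (simp add: sum_distrib_left)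
  also have "\<dots> \<le> (\<Sum>s\<in>S. (cmod (v s))\<^sup>2)" using f by (intro sum_mono) (auto simp: localized_family_def)
  also have "\<dots> = (\<Sum>s\<in>S. (Re (1 * v s))\<^sup>2) + (\<Sum>s\<in>S. (Re (\<i> * v s))\<^sup>2)"
    unfolding sum.distrib[symmetric] by (intro sum.cong refl) (simp add: cmod_power2)
  also have "\<dots> \<le> 1 + 1" by (intro add_mono half) auto
  finally show ?thesis by simp
qed

lemma multi_subseq:
  fixes X :: "nat \<Rightarrow> nat \<Rightarrow> 'b::heine_borel"
  assumes "\<And>j. j < B \<Longrightarrow> bounded (range (\<lambda>i. X i j))"
  shows "\<exists>\<phi>. strict_mono \<phi> \<and> (\<forall>j<B. \<exists>x. (\<lambda>i. X (\<phi> i) j) \<longlonglongrightarrow> x)"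
  using assms
proof (induction B)
  case 0
  then show ?case by (intro exI[of _ "\<lambda>i. i"]) (auto simp: strict_mono_def)
next
  case (Suc B)
  then obtain \<phi> where \<phi>: "strict_mono \<phi>" "\<forall>j<B. \<exists>x. (\<lambda>i. X (\<phi> i) j) \<longlonglongrightarrow> x" by auto
  have "bounded (range (\<lambda>i. X (\<phi> i) B))"
    by (rule bounded_subset[OF Suc.prems[of B]]) auto
  then obtain x r where r: "strict_mono r" "((\<lambda>i. X (\<phi> i) B) \<circ> r) \<longlonglongrightarrow> x"
    using bounded_imp_convergent_subsequence by blast
  show ?case
  proof (intro exI[of _ "\<phi> \<circ> r"] conjI allI impI)
    show "strict_mono (\<phi> \<circ> r)" using \<phi>(1) r(1) by (rule strict_mono_o)
    fix j assume "j < Suc B"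
    show "\<exists>x. (\<lambda>i. X ((\<phi> \<circ> r) i) j) \<longlonglongrightarrow> x"
    proof (cases "j = B")
      case True
      then show ?thesis using r(2) by (auto simp: o_def)
    next
      case False
      then have "j < B" using \<open>j < Suc B\<close> by simp
      then obtain y where "(\<lambda>i. X (\<phi> i) j) \<longlonglongrightarrow> y" using \<phi>(2) by blast
      from LIMSEQ_subseq_LIMSEQ[OF this r(1)] show ?thesis by (auto simp: o_def)
    qed
  qed
qed

lemma nat_limit_eventually_const:
  fixes k :: "nat \<Rightarrow> nat"
  assumes "(\<lambda>i. real (k i)) \<longlonglongrightarrow> x"
  obtains K where "x = real K" "\<forall>\<^sub>F i in sequentially. k i = K"
proof -
  have "\<forall>\<^sub>F i in sequentially. dist (real (k i)) x < 1/2"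
    using assms by (rule tendstoD) simp
  then obtain N where N: "\<And>i. i \<ge> N \<Longrightarrow> dist (real (k i)) x < 1/2"
    by (auto simp: eventually_sequentially)
  have "k i = k N" if "i \<ge> N" for i
  proof -
    have "\<bar>real (k i) - real (k N)\<bar> < 1"
      using N[OF that] N[of N] unfolding dist_real_def by linarith
    then show ?thesis by linarith
  qed
  then have e: "\<forall>\<^sub>F i in sequentially. k i = k N" unfolding eventually_sequentially by blast
  then have "\<forall>\<^sub>F i in sequentially. real (k i) = real (k N)" by (rule eventually_mono) simp
  then have "(\<lambda>i. real (k i)) \<longlonglongrightarrow> real (k N)" by (rule tendsto_eventually)
  with assms have "x = real (k N)" by (rule LIMSEQ_unique)
  then show ?thesis using e by (rule that)
qed

lemma loc_value_bound: "localized a s v \<Longrightarrow> (cmod v)\<^sup>2 \<le> 1"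
  unfolding localized_def by (auto dest: spec[of _ "0::nat"])

text \<open>Numbers of eigenvalues, weights, parameters and initial values are all bounded, so they
  converge along a subsequence. The real difficulty is a collision: the limit vectors of colliding
  eigenvalues are real multiples of each other, but before the limit they were orthogonal, so one
  suitable combination of them is still normalised and collects the squared values of all of them at
  the origin.\<close>

lemma fam_limit:
  assumes c: "c > 0" and a: "\<And>n. cmod (a n) < 1" and A1: "\<And>i n. cmod (A i n) < 1"
    and lim: "\<And>n. (\<lambda>i. A i n) \<longlonglongrightarrow> a n"
    and f: "\<And>i. localized_family c (A i) (S i) (l i) (v i)" and d: "\<And>i. d \<le> (\<Sum>s\<in>S i. (l i s)\<^sup>2)"
  obtains \<phi> :: "nat \<Rightarrow> nat" and e m z L w where "strict_mono \<phi>"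
    "\<And>i. bij_betw (e i) {..<m::nat} (S (\<phi> i))"
    "\<And>i j. j < m \<Longrightarrow> l (\<phi> i) (e i j) = L j"
    "\<And>j. j < m \<Longrightarrow> (\<lambda>i. e i j) \<longlonglongrightarrow> z j"
    "localized_family c a (z ` {..<m}) (\<lambda>\<sigma>. \<Sum>j\<in>{j. j < m \<and> z j = \<sigma>}. L j) w"
    "d \<le> (\<Sum>j<m. (L j)\<^sup>2)" "\<And>j. j < m \<Longrightarrow> 1 \<le> L j"
proof -
  \<comment> \<open>\<open>B\<close> exceeds every cardinality, since weights are at least 1 and sum
    to at most \<open>2 / c\<close>. Being a successor it also provides the index 0, at which the
    cardinality is read off.\<close>
  define B where "B = Suc (nat \<lceil>2 / c\<rceil>)"
  have fin: "finite (S i)" for i using f[of i] by (simp add: localized_family_def)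
  have lsum: "real (\<Sum>s\<in>S i. l i s) \<le> 2 / c" for i
    using fam_bound[OF A1 f, of i] c by (simp add: field_simps)
  have lb: "real (l i s) \<le> 2 / c" if "s \<in> S i" for i s
  proof -
    have "l i s \<le> (\<Sum>s\<in>S i. l i s)" using fin that by (intro member_le_sum) auto
    then show ?thesis using lsum[of i] by linarith
  qed
  have cb: "real (card (S i)) \<le> 2 / c" for i
  proof -
    have "(\<Sum>s\<in>S i. 1) \<le> (\<Sum>s\<in>S i. l i s)"
      using f[of i] by (intro sum_mono) (auto simp: localized_family_def)
    then have "card (S i) \<le> (\<Sum>s\<in>S i. l i s)" by simp
    from order_trans[OF of_nat_mono[OF this] lsum[of i]] show ?thesis .
  qed
  have cB: "card (S i) < B" for i
  proof -
    have "real (card (S i)) \<le> real (nat \<lceil>2 / c\<rceil>)"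
      using cb[of i] by (meson le_nat_iff of_nat_ceiling order_trans real_nat_ceiling_ge)
    then show ?thesis by (simp add: B_def)
  qed
  have "\<exists>e. bij_betw e {..<card (S i)} (S i)" for i
    using ex_bij_betw_nat_finite[OF fin[of i]] by (simp add: atLeast0LessThan)
  then obtain e0 where e0: "\<And>i. bij_betw (e0 i) {..<card (S i)} (S i)" by metis
  have e0S: "e0 i j \<in> S i" if "j < card (S i)" for i j
    using bij_betwE[OF e0[of i]] that by auto
  \<comment> \<open>All data are packed into one sequence in a bounded product, so that a single
    subsequence handles them; the cardinality is repeated in every entry because it is not yet
    constant.\<close>
  define X where "X i j = (if j < card (S i) then (e0 i j, v i (e0 i j), real (l i (e0 i j)), real (card (S i)))
     else (0, 0, 0, real (card (S i))))" for i j
  have "X i j \<in> cball 0 1 \<times> cball 0 1 \<times> {0..2/c} \<times> {0..2/c}" for i j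
  proof (cases "j < card (S i)")
    case True
    from e0S[OF this] have "localized (A i) (e0 i j) (v i (e0 i j))" using f[of i] by (simp add: localized_family_def)
    then have "cmod (e0 i j) = 1" "cmod (v i (e0 i j)) \<le> 1"
      using loc_value_bound[of "A i" "e0 i j" "v i (e0 i j)"] by (auto simp: localized_def power_le_one_iff abs_square_le_1)
    then show ?thesis using True lb[OF e0S[OF True]] cb[of i] by (simp add: X_def)
  next
    case False
    then show ?thesis using cb[of i] c by (simp add: X_def)
  qed
  then have "range (\<lambda>i. X i j) \<subseteq> cball 0 1 \<times> cball 0 1 \<times> {0..2/c} \<times> {0..2/c}" for j
    unfolding image_subset_iff by blast
  then have "bounded (range (\<lambda>i. X i j))" for j
    by (rule bounded_subset[rotated]) (intro bounded_Times bounded_cball bounded_closed_interval)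
  from multi_subseq[of B X, OF this] obtain \<phi>0 where p0: "strict_mono \<phi>0"
    and "\<forall>j<B. \<exists>x. (\<lambda>i. X (\<phi>0 i) j) \<longlonglongrightarrow> x" by blast
  then obtain xx where xx: "\<And>j. j < B \<Longrightarrow> (\<lambda>i. X (\<phi>0 i) j) \<longlonglongrightarrow> xx j" by metis
  have "(\<lambda>i. real (card (S (\<phi>0 i)))) \<longlonglongrightarrow> snd (snd (snd (xx 0)))"
    using tendsto_snd[OF tendsto_snd[OF tendsto_snd[OF xx[of 0]]]]
    by (simp add: X_def B_def if_distrib[of snd] cong: if_cong)
  then obtain m where m: "\<forall>\<^sub>F i in sequentially. card (S (\<phi>0 i)) = m"
    by (rule nat_limit_eventually_const)
  then obtain i0 where "card (S (\<phi>0 i0)) = m" by (auto simp: eventually_sequentially)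
  then have mB: "m < B" using cB[of "\<phi>0 i0"] by simp
  have "\<exists>K. \<forall>\<^sub>F i in sequentially. l (\<phi>0 i) (e0 (\<phi>0 i) j) = K" if j: "j < m" for j
  proof -
    have "j < B" using j mB by simp
    from tendsto_fst[OF tendsto_snd[OF tendsto_snd[OF xx[OF this]]]]
    have "(\<lambda>i. fst (snd (snd (X (\<phi>0 i) j)))) \<longlonglongrightarrow> fst (snd (snd (xx j)))" .
    moreover have "\<forall>\<^sub>F i in sequentially. fst (snd (snd (X (\<phi>0 i) j))) = real (l (\<phi>0 i) (e0 (\<phi>0 i) j))"
      using m by eventually_elim (use j in \<open>simp add: X_def\<close>)
    ultimately have "(\<lambda>i. real (l (\<phi>0 i) (e0 (\<phi>0 i) j))) \<longlonglongrightarrow> fst (snd (snd (xx j)))"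
      by (rule Lim_transform_eventually)
    then show ?thesis by (rule nat_limit_eventually_const) auto
  qed
  then obtain L where L: "\<And>j. j < m \<Longrightarrow> \<forall>\<^sub>F i in sequentially. l (\<phi>0 i) (e0 (\<phi>0 i) j) = L j" by metis
  have "\<forall>\<^sub>F i in sequentially. \<forall>j\<in>{..<m}. l (\<phi>0 i) (e0 (\<phi>0 i) j) = L j"
    by (intro eventually_ball_finite) (use L in auto)
  with m have "\<forall>\<^sub>F i in sequentially. card (S (\<phi>0 i)) = m \<and> (\<forall>j<m. l (\<phi>0 i) (e0 (\<phi>0 i) j) = L j)"
    by eventually_elim auto
  then obtain N where N: "\<And>i. i \<ge> N \<Longrightarrow> card (S (\<phi>0 i)) = m \<and> (\<forall>j<m. l (\<phi>0 i) (e0 (\<phi>0 i) j) = L j)"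
    by (auto simp: eventually_sequentially)
  \<comment> \<open>The first \<open>N\<close> terms are dropped, after which cardinalities and
    weights no longer depend on \<open>i\<close>.\<close>
  define \<phi> where "\<phi> i = \<phi>0 (i + N)" for i
  define e where "e i = e0 (\<phi> i)" for i
  define z where "z j = fst (xx j)" for j
  define u where "u j = fst (snd (xx j))" for j
  have \<phi>: "strict_mono \<phi>" using p0 by (auto simp: \<phi>_def strict_mono_def)
  have cm: "card (S (\<phi> i)) = m" for i using N[of "i + N"] by (simp add: \<phi>_def)
  have bij: "bij_betw (e i) {..<m} (S (\<phi> i))" for i using e0[of "\<phi> i"] by (simp add: e_def cm)
  have eS: "e i j \<in> S (\<phi> i)" if "j < m" for i j using e0S[of j "\<phi> i"] that by (simp add: e_def cm)
  have lL: "l (\<phi> i) (e i j) = L j" if "j < m" for i j using N[of "i + N"] that by (simp add: \<phi>_def e_def)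
  have XX: "(\<lambda>i. X (\<phi> i) j) \<longlonglongrightarrow> xx j" if "j < m" for j
    using LIMSEQ_ignore_initial_segment[OF xx[of j], of N] that mB by (simp add: \<phi>_def)
  have ez: "(\<lambda>i. e i j) \<longlonglongrightarrow> z j" if "j < m" for j
    using tendsto_fst[OF XX[OF that]] that by (simp add: X_def cm z_def e_def)
  have vu: "(\<lambda>i. v (\<phi> i) (e i j)) \<longlonglongrightarrow> u j" if "j < m" for j
    using tendsto_fst[OF tendsto_snd[OF XX[OF that]]] that by (simp add: X_def cm u_def e_def)
  have limA: "(\<lambda>i. A (\<phi> i) n) \<longlonglongrightarrow> a n" for n
    using LIMSEQ_subseq_LIMSEQ[OF lim \<phi>] by (simp add: o_def)
  have fe: "localized (A (\<phi> i)) (e i j) (v (\<phi> i) (e i j)) \<and> 1 \<le> L j \<and> c * real (L j) \<le> (cmod (v (\<phi> i) (e i j)))\<^sup>2" if "j < m" for i j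
    using f[of "\<phi> i"] eS[OF that, of i] lL[OF that, of i] by (auto simp: localized_family_def)
  have L1: "1 \<le> L j" if "j < m" for j using fe[OF that] by blast
  have locu: "localized a (z j) (u j)" if "j < m" for j
    by (rule loc_closed[OF limA ez[OF that] vu[OF that] a]) (use fe[OF that] in blast)
  have cu: "c * real (L j) \<le> (cmod (u j))\<^sup>2" if "j < m" for j
    by (rule LIMSEQ_le_const[OF tendsto_power[OF tendsto_norm[OF vu[OF that]]]]) (use fe[OF that] in blast)
  have group: "\<exists>w. localized a \<sigma> w \<and> c * real (\<Sum>j\<in>{j. j < m \<and> z j = \<sigma>}. L j) \<le> (cmod w)\<^sup>2" if "\<sigma> \<in> z ` {..<m}" for \<sigma>
  proof -
    define G where "G = {j. j < m \<and> z j = \<sigma>}"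
    from that obtain j0 where j0: "j0 \<in> G" by (auto simp: G_def)
    have Gm: "j < m" "z j = \<sigma>" if "j \<in> G" for j using that by (auto simp: G_def)
    have finG: "finite G" by (simp add: G_def)
    have u0: "u j0 \<noteq> 0"
    proof
      assume "u j0 = 0"
      with cu[OF Gm(1)[OF j0]] L1[OF Gm(1)[OF j0]] c show False by (simp add: mult_le_0_iff)
    qed
    define e' where "e' = u j0 / complex_of_real (cmod (u j0))"
    have e'1: "cmod e' = 1" using u0 by (simp add: e'_def norm_divide)
    have "\<exists>b. u j = complex_of_real b * e'" if "j \<in> G" for j
    proof -
      have "Im (cnj (u j0) * u j) = 0"
        using loc_parallel[OF a, where s = \<sigma>, OF locu[OF Gm(1)[OF j0], unfolded Gm(2)[OF j0]]
          locu[OF Gm(1)[OF that], unfolded Gm(2)[OF that]]] .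
      from real_parallel[OF u0 this] obtain b where "u j = complex_of_real b * u j0" .
      then have "u j = complex_of_real (b * cmod (u j0)) * e'" using u0 by (simp add: e'_def)
      then show ?thesis by blast
    qed
    then obtain b where b: "\<And>j. j \<in> G \<Longrightarrow> u j = complex_of_real (b j) * e'" by metis
    define Q where "Q = (\<Sum>j\<in>G. (b j)\<^sup>2)"
    have Qu: "Q = (\<Sum>j\<in>G. (cmod (u j))\<^sup>2)"
      unfolding Q_def by (intro sum.cong refl) (simp add: b norm_mult e'1)
    have cQ: "c * real (\<Sum>j\<in>G. L j) \<le> Q"
      unfolding Qu by (simp add: sum_distrib_left) (intro sum_mono cu Gm(1))
    have "0 < Q" unfolding Qu using finG j0 u0 by (intro sum_pos2[of _ j0]) auto
    \<comment> \<open>A unit vector of coefficients, proportional to the coordinates of the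
      \<open>u j\<close> along \<open>e'\<close>. It makes all terms point the same way, so the
      combination has squared value \<open>Q\<close> at the origin, the sum of the individual
      squared values.\<close>
    define b' where "b' j = b j / sqrt Q" for j
    have b'1: "(\<Sum>j\<in>G. (b' j)\<^sup>2) = 1"
      using \<open>0 < Q\<close> by (simp add: b'_def power_divide sum_divide_distrib[symmetric] Q_def[symmetric])
    define w where "w = (\<Sum>j\<in>G. complex_of_real (b' j) * u j)"
    have w: "w = complex_of_real (sqrt Q) * e'"
    proof -
      have "w = (\<Sum>j\<in>G. complex_of_real ((b j)\<^sup>2 / sqrt Q) * e')"
        unfolding w_def by (intro sum.cong refl) (simp add: b b'_def power2_eq_square)
      also have "\<dots> = complex_of_real (Q / sqrt Q) * e'"
        by (simp add: Q_def sum_divide_distrib sum_distrib_right)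
      finally show ?thesis using \<open>0 < Q\<close> by (simp add: real_div_sqrt)
    qed
    have "(\<Sum>n=-int M..int M. (cmod (sol a \<sigma> w n))\<^sup>2) \<le> 1" for M
    proof (rule LIMSEQ_le_const2)
      have inj: "inj_on (e i) G" for i using bij[of i] by (auto simp: bij_betw_def inj_on_def G_def)
      have "(\<lambda>i. \<Sum>n=-int M..int M. (cmod (\<Sum>j\<in>G. complex_of_real (b' j) * sol (A (\<phi> i)) (e i j) (v (\<phi> i) (e i j)) n))\<^sup>2)
        \<longlonglongrightarrow> (\<Sum>n=-int M..int M. (cmod (\<Sum>j\<in>G. complex_of_real (b' j) * sol a (z j) (u j) n))\<^sup>2)"
        by (intro tendsto_intros tendsto_sol limA a ez vu Gm(1))
      also have "(\<lambda>n. \<Sum>j\<in>G. complex_of_real (b' j) * sol a (z j) (u j) n) = (\<lambda>n. sol a \<sigma> w n)"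
        unfolding w_def sol_sum[OF finG] by (intro ext sum.cong refl) (simp add: Gm)
      finally show "(\<lambda>i. \<Sum>n=-int M..int M. (cmod (\<Sum>j\<in>G. complex_of_real (b' j) * sol (A (\<phi> i)) (e i j) (v (\<phi> i) (e i j)) n))\<^sup>2)
        \<longlonglongrightarrow> (\<Sum>n=-int M..int M. (cmod (sol a \<sigma> w n))\<^sup>2)" .
      have "(\<Sum>n=-int M..int M. (cmod (\<Sum>j\<in>G. complex_of_real (b' j) * sol (A (\<phi> i)) (e i j) (v (\<phi> i) (e i j)) n))\<^sup>2) \<le> 1" for i
      proof -
        \<comment> \<open>Before the limit the colliding parameters are still distinct, so
          \<open>loc_bessel\<close> applies to them; it sums over the parameters, and the
          coefficients are carried over along the injection \<open>e i\<close>.\<close>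
        define t where "t s = b' (the_inv_into G (e i) s)" for s
        have t: "t (e i j) = b' j" if "j \<in> G" for j using inj[of i] that by (simp add: t_def the_inv_into_f_f)
        have "(\<Sum>n=-int M..int M. (cmod (\<Sum>s\<in>e i ` G. complex_of_real (t s) * sol (A (\<phi> i)) s (v (\<phi> i) s) n))\<^sup>2)
           \<le> (\<Sum>s\<in>e i ` G. (t s)\<^sup>2)"
          by (rule loc_bessel[OF A1]) (use finG fe Gm in auto)
        then show ?thesis by (simp add: sum.reindex[OF inj] t b'1 cong: sum.cong)
      qed
      then show "\<exists>N. \<forall>n\<ge>N. (\<Sum>na=-int M..int M. (cmod (\<Sum>j\<in>G. complex_of_real (b' j) * sol (A (\<phi> n)) (e n j) (v (\<phi> n) (e n j)) na))\<^sup>2) \<le> 1"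
        by blast
    qed
    moreover have "cmod \<sigma> = 1" using locu[OF Gm(1)[OF j0]] Gm(2)[OF j0] by (simp add: localized_def)
    ultimately have "localized a \<sigma> w" by (simp add: localized_def)
    moreover have "(cmod w)\<^sup>2 = Q" using \<open>0 < Q\<close> by (simp add: w norm_mult e'1)
    ultimately show ?thesis using cQ by (auto simp: G_def)
  qed
  then obtain w where w: "\<And>\<sigma>. \<sigma> \<in> z ` {..<m} \<Longrightarrow> localized a \<sigma> (w \<sigma>) \<and> c * real (\<Sum>j\<in>{j. j < m \<and> z j = \<sigma>}. L j) \<le> (cmod (w \<sigma>))\<^sup>2"
    by metis
  have "1 \<le> (\<Sum>j\<in>{j. j < m \<and> z j = \<sigma>}. L j)" if "\<sigma> \<in> z ` {..<m}" for \<sigma>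
  proof -
    from that obtain j0 where "j0 < m" "z j0 = \<sigma>" by auto
    then have "L j0 \<le> (\<Sum>j\<in>{j. j < m \<and> z j = \<sigma>}. L j)" by (intro member_le_sum) auto
    with L1[OF \<open>j0 < m\<close>] show ?thesis by linarith
  qed
  with w have F: "localized_family c a (z ` {..<m}) (\<lambda>\<sigma>. \<Sum>j\<in>{j. j < m \<and> z j = \<sigma>}. L j) w"
    by (auto simp: localized_family_def)
  have dL: "d \<le> (\<Sum>j<m. (L j)\<^sup>2)"
  proof -
    have "(\<Sum>s\<in>S (\<phi> 0). (l (\<phi> 0) s)\<^sup>2) = (\<Sum>j<m. (l (\<phi> 0) (e 0 j))\<^sup>2)"
      by (rule sum.reindex_bij_betw[OF bij, symmetric])
    then show ?thesis using d[of "\<phi> 0"] lL by simp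
  qed
  show ?thesis by (rule that[OF \<phi> bij lL ez F dL L1])
qed

lemma sum_squares_le:
  fixes L :: "'i \<Rightarrow> nat"
  assumes "finite G"
  shows "(\<Sum>j\<in>G. (L j)\<^sup>2) \<le> (\<Sum>j\<in>G. L j)\<^sup>2"
proof -
  have "(\<Sum>j\<in>G. (L j)\<^sup>2) \<le> (\<Sum>j\<in>G. L j * (\<Sum>j\<in>G. L j))"
    unfolding power2_eq_square using assms by (intro sum_mono mult_left_mono member_le_sum) auto
  then show ?thesis by (simp add: sum_distrib_right power2_eq_square)
qed

lemma sum_squares_less:
  fixes L :: "'i \<Rightarrow> nat"
  assumes G: "finite G" and L: "\<And>j. j \<in> G \<Longrightarrow> 1 \<le> L j" and j: "j \<in> G" "j' \<in> G" "j \<noteq> j'"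
  shows "(\<Sum>j\<in>G. (L j)\<^sup>2) < (\<Sum>j\<in>G. L j)\<^sup>2"
proof -
  have "L j + L j' = (\<Sum>j\<in>{j, j'}. L j)" using j by simp
  also have "\<dots> \<le> (\<Sum>j\<in>G. L j)" using G j by (intro sum_mono2) auto
  finally have "L j < (\<Sum>j\<in>G. L j)" using L[OF j(2)] by simp
  then have lt: "L j * L j < L j * (\<Sum>j\<in>G. L j)" using L[OF j(1)] by simp
  have "(\<Sum>j\<in>G. L j * L j) < (\<Sum>j\<in>G. L j * (\<Sum>j\<in>G. L j))"
  proof (rule sum_strict_mono_ex1[OF G])
    show "\<forall>x\<in>G. L x * L x \<le> L x * sum L G" using G by (auto intro!: mult_left_mono member_le_sum)
    show "\<exists>a\<in>G. L a * L a < L a * sum L G" using lt j(1) by blast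
  qed
  then show ?thesis by (simp add: sum_distrib_right power2_eq_square)
qed

text \<open>A limit only merges eigenvalues into groups whose weights add, and the square of a sum
  of naturals is at least the sum of the squares.\<close>

lemma Deg_closed:
  assumes c: "c > 0" and a: "\<And>n. cmod (a n) < 1" and A1: "\<And>i n. cmod (A i n) < 1"
    and lim: "\<And>n. (\<lambda>i. A i n) \<longlonglongrightarrow> a n" and D: "\<And>i. degeneracy_ge c (A i) d"
  shows "degeneracy_ge c a d"
proof -
  from D obtain S l v where f: "\<And>i. localized_family c (A i) (S i) (l i) (v i)" and d: "\<And>i. d \<le> (\<Sum>s\<in>S i. (l i s)\<^sup>2)"
    unfolding degeneracy_ge_def by metis
  obtain \<phi> :: "nat \<Rightarrow> nat" and e m z L w where "strict_mono \<phi>" "\<And>i. bij_betw (e i) {..<m::nat} (S (\<phi> i))"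
    "\<And>i j. j < m \<Longrightarrow> l (\<phi> i) (e i j) = L j" "\<And>j. j < m \<Longrightarrow> (\<lambda>i. e i j) \<longlonglongrightarrow> z j"
    and F: "localized_family c a (z ` {..<m}) (\<lambda>\<sigma>. \<Sum>j\<in>{j. j < m \<and> z j = \<sigma>}. L j) w"
    and d: "d \<le> (\<Sum>j<m. (L j)\<^sup>2)" and "\<And>j. j < m \<Longrightarrow> 1 \<le> L j"
    by (rule fam_limit[OF c a A1 lim f d]) blast
  have "(\<Sum>j<m. (L j)\<^sup>2) = (\<Sum>\<sigma>\<in>z ` {..<m}. \<Sum>j\<in>{j\<in>{..<m}. z j = \<sigma>}. (L j)\<^sup>2)"
    by (rule sum.image_gen) simp
  also have "\<dots> \<le> (\<Sum>\<sigma>\<in>z ` {..<m}. (\<Sum>j\<in>{j. j < m \<and> z j = \<sigma>}. L j)\<^sup>2)"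
    by (intro sum_mono) (use sum_squares_le[where L = L] in auto)
  finally show ?thesis using F d unfolding degeneracy_ge_def by (meson order_trans)
qed

lemma Deg_bound:
  assumes c: "c > 0" and a: "\<And>n. cmod (a n) < 1" and D: "degeneracy_ge c a d"
  shows "real d \<le> (2 / c)\<^sup>2"
proof -
  from D obtain S l v where f: "localized_family c a S l v" and d: "d \<le> (\<Sum>s\<in>S. (l s)\<^sup>2)" by (auto simp: degeneracy_ge_def)
  have "finite S" using f by (simp add: localized_family_def)
  from order_trans[OF d sum_squares_le[OF this]] have "real d \<le> (real (\<Sum>s\<in>S. l s))\<^sup>2"
    by (metis of_nat_le_iff of_nat_power)
  also have "\<dots> \<le> (2 / c)\<^sup>2"
    using fam_bound[OF a f] c by (intro power_mono) (auto simp: field_simps intro: sum_nonneg)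
  finally show ?thesis .
qed

lemma Deg_1_iff:
  assumes "c > 0"
  shows "degeneracy_ge c a 1 \<longleftrightarrow> (\<exists>s. localized_at c a s)"
proof
  assume "degeneracy_ge c a 1"
  then obtain S l v where f: "localized_family c a S l v" and d: "1 \<le> (\<Sum>s\<in>S. (l s)\<^sup>2)" by (auto simp: degeneracy_ge_def)
  then obtain s where s: "s \<in> S" by fastforce
  with f have *: "localized a s (v s)" "1 \<le> l s" "c * real (l s) \<le> (cmod (v s))\<^sup>2" by (auto simp: localized_family_def)
  have "c * 1 \<le> c * real (l s)" using *(2) assms by (intro mult_left_mono) auto
  with * show "\<exists>s. localized_at c a s" unfolding localized_at_def by (intro exI[of _ s] exI[of _ "v s"]) auto
next
  assume "\<exists>s. localized_at c a s"
  then obtain s v where "localized a s v" "c \<le> (cmod v)\<^sup>2" by (auto simp: localized_at_def)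
  then have "localized_family c a {s} (\<lambda>_. 1) (\<lambda>_. v)" by (simp add: localized_family_def)
  then show "degeneracy_ge c a 1" unfolding degeneracy_ge_def by (intro exI[of _ "{s}"] exI[of _ "\<lambda>_. 1"] exI[of _ "\<lambda>_. v"]) auto
qed

lemma fam_insert:
  assumes f: "localized_family c a S l v" and u: "localized a s u" "1 \<le> k" "c * real k \<le> (cmod u)\<^sup>2"
  shows "localized_family c a (insert s S) (l(s := k)) (v(s := u))"
  using f u by (auto simp: localized_family_def)

text \<open>The form in which maximality gets contradicted: a parameter missing from the family, or
  a vector that supports a larger weight at a listed one, improves the integer count by at least
  one.\<close>

lemma Deg_insert:
  assumes f: "localized_family c a S l v" and u: "localized a s u" "1 \<le> k" "c * real k \<le> (cmod u)\<^sup>2"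
    and lt: "s \<notin> S \<or> l s < k" and d: "d \<le> (\<Sum>s\<in>S. (l s)\<^sup>2)"
  shows "degeneracy_ge c a (Suc d)"
proof -
  have S: "finite S" using f by (simp add: localized_family_def)
  have "(\<Sum>s\<in>S. (l s)\<^sup>2) < (\<Sum>x\<in>insert s S. ((l(s := k)) x)\<^sup>2)"
  proof (cases "s \<in> S")
    case True
    then have "l s < k" using lt by simp
    then have "(l s)\<^sup>2 < k\<^sup>2" by (intro power_strict_mono) auto
    have "(\<Sum>s\<in>S. (l s)\<^sup>2) = (l s)\<^sup>2 + (\<Sum>x\<in>S - {s}. (l x)\<^sup>2)"
      using True S by (simp add: sum.remove)
    moreover have "(\<Sum>x\<in>insert s S. ((l(s := k)) x)\<^sup>2) = k\<^sup>2 + (\<Sum>x\<in>S - {s}. (l x)\<^sup>2)"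
      using True S by (simp add: insert_absorb sum.remove)
    ultimately show ?thesis using \<open>(l s)\<^sup>2 < k\<^sup>2\<close> by simp
  next
    case False
    then have "(\<Sum>x\<in>S. ((l(s := k)) x)\<^sup>2) = (\<Sum>s\<in>S. (l s)\<^sup>2)" by (intro sum.cong) auto
    then show ?thesis using False S u(2) by simp
  qed
  with d fam_insert[OF f u] show ?thesis unfolding degeneracy_ge_def
    by (intro exI[of _ "insert s S"] exI[of _ "l(s := k)"] exI[of _ "v(s := u)"]) auto
qed

section \<open>Neighbourhoods for pointwise convergence of the coefficients\<close>

definition near :: "nat \<Rightarrow> (int \<Rightarrow> complex) \<Rightarrow> (int \<Rightarrow> complex) \<Rightarrow> bool"
  where "near k a b \<longleftrightarrow> (\<forall>n. cmod (b n) < 1) \<and> (\<forall>n. \<bar>n\<bar> \<le> int k \<longrightarrow> cmod (b n - a n) < 1 / (real k + 1))"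

lemma near_limit:
  assumes "\<And>k. near k a (b k)"
  shows "(\<lambda>k. b k n) \<longlonglongrightarrow> a n"
proof (rule LIM_zero_cancel, rule Lim_null_comparison)
  show "\<forall>\<^sub>F k in sequentially. norm (b k n - a n) \<le> 1 / (real k + 1)"
    using eventually_ge_at_top[of "nat \<bar>n\<bar>"]
    by eventually_elim (use assms in \<open>auto simp: near_def intro!: less_imp_le\<close>)
  show "(\<lambda>k. 1 / (real k + 1)) \<longlonglongrightarrow> 0"
    using LIMSEQ_inverse_real_of_nat by (simp add: inverse_eq_divide add.commute)
qed

text \<open>The sets \<open>near k a\<close> form a neighbourhood base of \<open>a\<close> among
  sequences in the open disk. A property met somewhere along every convergent sequence therefore
  holds on a whole neighbourhood; this turns compactness arguments into uniform radii.\<close>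

lemma near_principle:
  assumes "\<And>b. (\<And>i n. cmod (b i n) < 1) \<Longrightarrow> (\<And>n. (\<lambda>i. b i n) \<longlonglongrightarrow> a n) \<Longrightarrow> \<exists>i::nat. P (b i)"
  shows "\<exists>k. \<forall>b. near k a b \<longrightarrow> P b"
proof (rule ccontr)
  assume "\<not> ?thesis"
  then obtain b where b: "\<And>k. near k a (b k)" "\<And>k. \<not> P (b k)" by metis
  from assms[of b] b near_limit[OF b(1)] show False by (auto simp: near_def)
qed

lemma near_eventually:
  assumes "\<And>i n. cmod (A i n) < 1" "\<And>n. (\<lambda>i. A i n) \<longlonglongrightarrow> a n"
  shows "\<forall>\<^sub>F i in sequentially. near k a (A i)"
proof -
  have "\<forall>\<^sub>F i in sequentially. \<forall>n\<in>{-int k..int k}. dist (A i n) (a n) < 1 / (real k + 1)"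
    by (intro eventually_ball_finite ballI tendstoD[OF assms(2)]) auto
  then show ?thesis
    by (rule eventually_mono) (use assms(1) in \<open>auto simp: near_def dist_norm abs_le_iff\<close>)
qed

lemma near_mono:
  assumes "near k a b" "k' \<le> k"
  shows "near k' a b"
  unfolding near_def
proof (intro conjI allI impI)
  show "cmod (b n) < 1" for n using assms(1) by (simp add: near_def)
  show "cmod (b n - a n) < 1 / (real k' + 1)" if "\<bar>n\<bar> \<le> int k'" for n
  proof -
    have "cmod (b n - a n) < 1 / (real k + 1)" using assms that by (simp add: near_def)
    also have "\<dots> \<le> 1 / (real k' + 1)" using assms(2) by (intro divide_left_mono) auto
    finally show ?thesis .
  qed
qed

section \<open>Rigidity of the eigenvalues at maximal degeneracy\<close>

lemma not_Deg_near:
  assumes "c > 0" "\<And>n. cmod (a n) < 1" "\<not> degeneracy_ge c a d"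
  shows "\<exists>k. \<forall>b. near k a b \<longrightarrow> \<not> degeneracy_ge c b d"
proof (rule near_principle, rule ccontr)
  fix b assume b: "\<And>i n. cmod (b i n) < 1" "\<And>n. (\<lambda>i. b i n) \<longlonglongrightarrow> a n" and "\<not> (\<exists>i::nat. \<not> degeneracy_ge c (b i) d)"
  then have "\<And>i. degeneracy_ge c (b i) d" by blast
  from Deg_closed[OF assms(1,2) b this] assms(3) show False by simp
qed

text \<open>By maximality every parameter with a localized solution of size \<open>c\<close> already
  occurs in the finite set \<open>S\<close>; hence \<open>s1\<close> is isolated, and no localized
  vector at \<open>s1\<close> has room for one more unit of weight.\<close>

lemma rigid_choice:
  assumes c: "c > 0" and D: "degeneracy_ge c a d" and nD: "\<not> degeneracy_ge c a (Suc d)" and d: "1 \<le> d"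
  obtains s1 l1 \<eta> v1 where "cmod s1 = 1" "1 \<le> l1" "0 < \<eta>" "\<eta> \<le> 1/2" "localized a s1 v1" "c * real l1 \<le> (cmod v1)\<^sup>2"
    "\<And>s. localized_at c a s \<Longrightarrow> dist s s1 \<le> \<eta> \<Longrightarrow> s = s1"
    "\<And>v. localized a s1 v \<Longrightarrow> (cmod v)\<^sup>2 < c * real (l1 + 1)"
proof -
  from D obtain S l v where f: "localized_family c a S l v" and dS: "d \<le> (\<Sum>s\<in>S. (l s)\<^sup>2)" by (auto simp: degeneracy_ge_def)
  then obtain s1 where s1: "s1 \<in> S" using d by fastforce
  have ptS: "s \<in> S" if "localized_at c a s" for s
    using that Deg_insert[OF f _ _ _ _ dS, of s _ 1] nD by (auto simp: localized_at_def)
  have "finite (S - {s1})" using f by (simp add: localized_family_def)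
  then obtain e where e: "e > 0" "\<And>s. s \<in> S - {s1} \<Longrightarrow> e \<le> dist s1 s"
    using finite_set_avoid[of "S - {s1}" s1] by blast
  show ?thesis
  \<comment> \<open>The cap 1/2 keeps the arc around \<open>s1\<close> so short that a point on it
    is determined by its height, see \<open>circle_height_inj\<close>.\<close>
  proof (rule that[of s1 "l s1" "min (e/2) (1/2)" "v s1"])
    show "cmod s1 = 1" "1 \<le> l s1" "localized a s1 (v s1)" "c * real (l s1) \<le> (cmod (v s1))\<^sup>2"
      using f s1 by (auto simp: localized_family_def localized_def)
    show "s = s1" if "localized_at c a s" "dist s s1 \<le> min (e/2) (1/2)" for s
      using ptS[OF that(1)] that(2) e(1) e(2)[of s] by (force simp: dist_commute)
    show "(cmod u)\<^sup>2 < c * real (l s1 + 1)" if "localized a s1 u" for u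
      using Deg_insert[OF f that _ _ _ dS, of "l s1 + 1"] nD by force
  qed (use e in auto)
qed

text \<open>Near \<open>a\<close> the degeneracy cannot exceed \<open>d\<close>. If it does not drop
  either, the eigenvalue \<open>s1\<close> can neither split nor lose weight: in the limit of a
  sequence of counterexamples any merging would lift the degeneracy of \<open>a\<close> above
  \<open>d\<close>. So exactly one eigenvalue stays in the arc, with the full weight
  \<open>l1\<close>, and it can be followed.\<close>

lemma rigid_near:
  assumes c: "c > 0" and a: "\<And>n. cmod (a n) < 1" and D: "degeneracy_ge c a d" and nD: "\<not> degeneracy_ge c a (Suc d)"
    and l1: "1 \<le> l1" and v1: "localized a s1 v1" "c * real l1 \<le> (cmod v1)\<^sup>2" and \<eta>: "0 < \<eta>"
    and iso: "\<And>s. localized_at c a s \<Longrightarrow> dist s s1 \<le> \<eta> \<Longrightarrow> s = s1"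
  shows "\<exists>k. \<forall>b. near k a b \<longrightarrow> degeneracy_ge c b d \<longrightarrow>
    (\<exists>s v. dist s s1 \<le> \<eta> \<and> localized b s v \<and> c * real l1 \<le> (cmod v)\<^sup>2) \<and>
    (\<forall>s s'. dist s s1 \<le> \<eta> \<longrightarrow> dist s' s1 \<le> \<eta> \<longrightarrow> localized_at c b s \<longrightarrow> localized_at c b s' \<longrightarrow> s = s')"
    (is "\<exists>k. \<forall>b. near k a b \<longrightarrow> ?P b")
proof (rule near_principle, rule ccontr)
  fix A assume A1: "\<And>i n. cmod (A i n) < 1" and lim: "\<And>n. (\<lambda>i. A i n) \<longlonglongrightarrow> a n"
    and neg: "\<not> (\<exists>i::nat. ?P (A i))"
  then have DA: "\<And>i. degeneracy_ge c (A i) d" by blast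
  then obtain S l v where f: "\<And>i. localized_family c (A i) (S i) (l i) (v i)" and dS: "\<And>i. d \<le> (\<Sum>s\<in>S i. (l i s)\<^sup>2)"
    unfolding degeneracy_ge_def by metis
  obtain \<phi> :: "nat \<Rightarrow> nat" and e m z L w where
    \<phi>: "strict_mono \<phi>" and bij: "\<And>i. bij_betw (e i) {..<m::nat} (S (\<phi> i))"
    and lL: "\<And>i j. j < m \<Longrightarrow> l (\<phi> i) (e i j) = L j"
    and ez: "\<And>j. j < m \<Longrightarrow> (\<lambda>i. e i j) \<longlonglongrightarrow> z j"
    and F: "localized_family c a (z ` {..<m}) (\<lambda>\<sigma>. \<Sum>j\<in>{j. j < m \<and> z j = \<sigma>}. L j) w"
    and d: "d \<le> (\<Sum>j<m. (L j)\<^sup>2)" and L1: "\<And>j. j < m \<Longrightarrow> 1 \<le> L j"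
    by (rule fam_limit[OF c a A1 lim f dS]) blast
  define G where "G \<sigma> = {j. j < m \<and> z j = \<sigma>}" for \<sigma>
  define l' where "l' \<sigma> = (\<Sum>j\<in>G \<sigma>. L j)" for \<sigma>
  have finG: "finite (G \<sigma>)" for \<sigma> by (simp add: G_def)
  have "l' = (\<lambda>\<sigma>. \<Sum>j\<in>{j. j < m \<and> z j = \<sigma>}. L j)" by (auto simp: l'_def G_def)
  with F have F': "localized_family c a (z ` {..<m}) l' w" by simp
  have split: "(\<Sum>j<m. (L j)\<^sup>2) = (\<Sum>\<sigma>\<in>z ` {..<m}. \<Sum>j\<in>G \<sigma>. (L j)\<^sup>2)"
    unfolding G_def using sum.image_gen[of "{..<m}" "\<lambda>j. (L j)\<^sup>2" z] by simp
  have le: "(\<Sum>\<sigma>\<in>z ` {..<m}. \<Sum>j\<in>G \<sigma>. (L j)\<^sup>2) \<le> (\<Sum>\<sigma>\<in>z ` {..<m}. (l' \<sigma>)\<^sup>2)"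
    unfolding l'_def by (intro sum_mono sum_squares_le finG)
  have dl': "d \<le> (\<Sum>\<sigma>\<in>z ` {..<m}. (l' \<sigma>)\<^sup>2)" using d split le by simp
  have upper: "(\<Sum>\<sigma>\<in>z ` {..<m}. (l' \<sigma>)\<^sup>2) \<le> d"
    using nD F' unfolding degeneracy_ge_def by (metis not_less_eq_eq)
  \<comment> \<open>If two of the limits coincided, the merged weights would give a sum of squares
    above \<open>d\<close>, against \<open>upper\<close>.\<close>
  have inj: "j = j'" if "j < m" "j' < m" "z j = z j'" for j j'
  proof (rule ccontr)
    assume "j \<noteq> j'"
    have "(\<Sum>\<sigma>\<in>z ` {..<m}. \<Sum>j\<in>G \<sigma>. (L j)\<^sup>2) < (\<Sum>\<sigma>\<in>z ` {..<m}. (l' \<sigma>)\<^sup>2)"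
    proof (rule sum_strict_mono_ex1)
      show "\<forall>\<sigma>\<in>z ` {..<m}. (\<Sum>j\<in>G \<sigma>. (L j)\<^sup>2) \<le> (l' \<sigma>)\<^sup>2"
        unfolding l'_def by (intro ballI sum_squares_le finG)
      have "(\<Sum>j\<in>G (z j). (L j)\<^sup>2) < (l' (z j))\<^sup>2"
        unfolding l'_def by (rule sum_squares_less[OF finG _ _ _ \<open>j \<noteq> j'\<close>]) (use that L1 in \<open>auto simp: G_def\<close>)
      then show "\<exists>\<sigma>\<in>z ` {..<m}. (\<Sum>j\<in>G \<sigma>. (L j)\<^sup>2) < (l' \<sigma>)\<^sup>2" using that by auto
    qed simp
    with d split upper show False by simp
  qed
  have Gj: "G (z j) = {j}" if "j < m" for j using inj that by (auto simp: G_def)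
  \<comment> \<open>If \<open>s1\<close> were missing from the limit family, or listed with a weight
    below \<open>l1\<close>, inserting \<open>v1\<close> would raise the degeneracy of
    \<open>a\<close> beyond \<open>d\<close>.\<close>
  have "s1 \<in> z ` {..<m}"
    using Deg_insert[OF F' v1(1) l1 v1(2) _ dl'] nD by blast
  then obtain j1 where j1: "j1 < m" "z j1 = s1" by auto
  have "\<not> l' s1 < l1" using Deg_insert[OF F' v1(1) l1 v1(2) _ dl'] nD by blast
  moreover have "l' s1 = L j1" using Gj[OF j1(1)] j1 by (simp add: l'_def)
  ultimately have Ll: "l1 \<le> L j1" by simp
  have far: "\<eta> < dist (z j) s1" if "j < m" "j \<noteq> j1" for j
  proof -
    have "localized a (z j) (w (z j))" "1 \<le> l' (z j)" "c * real (l' (z j)) \<le> (cmod (w (z j)))\<^sup>2"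
      using F' that by (auto simp: localized_family_def)
    moreover from this have "c * 1 \<le> c * real (l' (z j))" using c by (intro mult_left_mono) auto
    ultimately have "localized_at c a (z j)" unfolding localized_at_def by (intro exI[of _ "w (z j)"]) auto
    moreover have "z j \<noteq> s1" using inj[OF that(1) j1(1)] j1 that by auto
    ultimately show ?thesis using iso[of "z j"] by force
  qed
  from not_Deg_near[OF c a nD] obtain k where k: "\<And>b. near k a b \<Longrightarrow> \<not> degeneracy_ge c b (Suc d)" by blast
  have "\<forall>\<^sub>F i in sequentially. near k a (A (\<phi> i))"
    by (rule near_eventually) (use A1 LIMSEQ_subseq_LIMSEQ[OF lim \<phi>] in \<open>auto simp: o_def\<close>)
  moreover have "\<forall>\<^sub>F i in sequentially. dist (e i j1) s1 < \<eta>"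
    using ez[OF j1(1)] \<eta> unfolding j1(2) by (rule tendstoD)
  moreover have "\<forall>\<^sub>F i in sequentially. \<forall>j\<in>{..<m} - {j1}. \<eta> < dist (e i j) s1"
  proof (intro eventually_ball_finite ballI)
    fix j assume "j \<in> {..<m} - {j1}"
    then show "\<forall>\<^sub>F i in sequentially. \<eta> < dist (e i j) s1"
      by (intro order_tendstoD(1)[OF tendsto_dist[OF ez tendsto_const]] far) auto
  qed simp
  ultimately have "\<forall>\<^sub>F i in sequentially. near k a (A (\<phi> i)) \<and> dist (e i j1) s1 < \<eta> \<and> (\<forall>j\<in>{..<m} - {j1}. \<eta> < dist (e i j) s1)"
    by eventually_elim auto
  then obtain i where i: "near k a (A (\<phi> i))" "dist (e i j1) s1 < \<eta>" "\<And>j. j < m \<Longrightarrow> j \<noteq> j1 \<Longrightarrow> \<eta> < dist (e i j) s1"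
    by (auto simp: eventually_sequentially)
  have notin: "s = e i j1" if "s \<in> S (\<phi> i)" "dist s s1 \<le> \<eta>" for s
  proof -
    have "s \<in> e i ` {..<m}" using bij[of i] that(1) by (simp add: bij_betw_def)
    then obtain j where "j < m" "s = e i j" by auto
    then show ?thesis using i(3)[of j] that(2) by force
  qed
  have "e i j1 \<in> S (\<phi> i)" using bij[of i] j1(1) by (auto simp: bij_betw_def)
  then have fe: "localized (A (\<phi> i)) (e i j1) (v (\<phi> i) (e i j1))" "c * real (L j1) \<le> (cmod (v (\<phi> i) (e i j1)))\<^sup>2"
    using f[of "\<phi> i"] lL[OF j1(1), of i] by (auto simp: localized_family_def)
  have "c * real l1 \<le> c * real (L j1)" using Ll c by (intro mult_left_mono) auto
  with fe i(2) have "\<exists>s v. dist s s1 \<le> \<eta> \<and> localized (A (\<phi> i)) s v \<and> c * real l1 \<le> (cmod v)\<^sup>2"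
    by (intro exI[of _ "e i j1"] exI[of _ "v (\<phi> i) (e i j1)"]) auto
  \<comment> \<open>A second eigenvalue in the arc is not in the family; inserting it with weight 1
    would exceed the bound on the degeneracy that holds near \<open>a\<close>.\<close>
  moreover have "s = e i j1" if "dist s s1 \<le> \<eta>" "localized_at c (A (\<phi> i)) s" for s
  proof (rule ccontr)
    assume "s \<noteq> e i j1"
    with notin that have "s \<notin> S (\<phi> i)" by blast
    with that(2) Deg_insert[OF f[of "\<phi> i"] _ _ _ _ dS[of "\<phi> i"], of s _ 1] k[OF i(1)] show False
      by (auto simp: localized_at_def)
  qed
  ultimately show False using neg by blast
qed

lemma loc_shift:
  assumes b: "\<And>n. cmod (b n) < 1" and l: "localized b s v"
  shows "localized (\<lambda>n. b (n + q)) s (sol b s v q)"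
proof -
  have s: "cmod s = 1" using l by (simp add: localized_def)
  have sh: "sol (\<lambda>n. b (n + q)) s (sol b s v q) n = sol b s v (n + q)" for n by (rule sol_shift[OF s b])
  have "(\<Sum>n=-int M..int M. (cmod (sol (\<lambda>n. b (n + q)) s (sol b s v q) n))\<^sup>2) \<le> 1" for M
  proof -
    have "(\<Sum>n=-int M..int M. (cmod (sol (\<lambda>n. b (n + q)) s (sol b s v q) n))\<^sup>2)
       = (\<Sum>n\<in>(\<lambda>n. n + q) ` {-int M..int M}. (cmod (sol b s v n))\<^sup>2)"
      by (subst sum.reindex) (auto simp: inj_on_def sh)
    also have "\<dots> \<le> (\<Sum>n=-int (M + nat \<bar>q\<bar>)..int (M + nat \<bar>q\<bar>). (cmod (sol b s v n))\<^sup>2)"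
      by (rule sum_mono2) auto
    also have "\<dots> \<le> 1" using l unfolding localized_def by blast
    finally show ?thesis .
  qed
  with s show ?thesis by (simp add: localized_def)
qed

text \<open>One normalised solution cannot carry the full weight \<open>l1\<close> both at 0 and at
  a distant site \<open>q\<close> where the coefficients look like \<open>a\<close> again. In the
  limit its two parts become parallel solutions \<open>V\<close> and \<open>W\<close> for
  \<open>a\<close>, whose window masses together stay below 1; merged into a single vector they
  would give weight \<open>2 * l1\<close> at \<open>s1\<close>.\<close>

lemma rigid_split:
  assumes c: "c > 0" and a: "\<And>n. cmod (a n) < 1" and l1: "1 \<le> l1"
    and iso: "\<And>s. localized_at c a s \<Longrightarrow> dist s s1 \<le> \<eta> \<Longrightarrow> s = s1"
    and mx: "\<And>v. localized a s1 v \<Longrightarrow> (cmod v)\<^sup>2 < c * real (l1 + 1)"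
  shows "\<exists>k. \<forall>b q s v. near k a b \<longrightarrow> near k a (\<lambda>n. b (n + q)) \<longrightarrow> 2 * int k < \<bar>q\<bar> \<longrightarrow> dist s s1 \<le> \<eta> \<longrightarrow>
    localized b s v \<longrightarrow> c * real l1 \<le> (cmod v)\<^sup>2 \<longrightarrow> \<not> c * real l1 \<le> (cmod (sol b s v q))\<^sup>2"
proof (rule ccontr)
  assume "\<not> ?thesis"
  then obtain b q s v where H: "\<And>k. near k a (b k)" "\<And>k. near k a (\<lambda>n. b k (n + q k))" "\<And>k::nat. 2 * int k < \<bar>q k\<bar>"
    "\<And>k. dist (s k) s1 \<le> \<eta>" "\<And>k. localized (b k) (s k) (v k)" "\<And>k. c * real l1 \<le> (cmod (v k))\<^sup>2"
    "\<And>k. c * real l1 \<le> (cmod (sol (b k) (s k) (v k) (q k)))\<^sup>2"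
    by metis
  define w where "w k = sol (b k) (s k) (v k) (q k)" for k
  have b1: "cmod (b k n) < 1" for k n using H(1) by (auto simp: near_def)
  have s1: "cmod (s k) = 1" for k using H(5) by (auto simp: localized_def)
  have locw: "localized (\<lambda>n. b k (n + q k)) (s k) (w k)" for k
    unfolding w_def by (rule loc_shift[OF b1 H(5)])
  have "(s k, v k, w k) \<in> cball 0 1 \<times> cball 0 1 \<times> cball 0 1" for k
    using s1[of k] loc_value_bound[OF H(5)[of k]] loc_value_bound[OF locw[of k]] by (simp add: abs_square_le_1)
  then have "range (\<lambda>k. (s k, v k, w k)) \<subseteq> cball 0 1 \<times> cball 0 1 \<times> cball 0 1" by blast
  then have "bounded (range (\<lambda>k. (s k, v k, w k)))"
    by (rule bounded_subset[rotated]) (intro bounded_Times bounded_cball)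
  then obtain x r where r: "strict_mono (r :: nat \<Rightarrow> nat)" "((\<lambda>k. (s k, v k, w k)) \<circ> r) \<longlonglongrightarrow> x"
    using bounded_imp_convergent_subsequence by blast
  define S V W where "S = fst x" and "V = fst (snd x)" and "W = snd (snd x)"
  have lims: "(\<lambda>k. s (r k)) \<longlonglongrightarrow> S" "(\<lambda>k. v (r k)) \<longlonglongrightarrow> V" "(\<lambda>k. w (r k)) \<longlonglongrightarrow> W"
    using tendsto_fst[OF r(2)] tendsto_fst[OF tendsto_snd[OF r(2)]] tendsto_snd[OF tendsto_snd[OF r(2)]]
    by (simp_all add: o_def S_def V_def W_def)
  have lima: "(\<lambda>k. b (r k) n) \<longlonglongrightarrow> a n" for n
    using LIMSEQ_subseq_LIMSEQ[OF near_limit[of a b n, OF H(1)] r(1)] by (simp add: o_def)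
  have limb: "(\<lambda>k. b (r k) (n + q (r k))) \<longlonglongrightarrow> a n" for n
    using LIMSEQ_subseq_LIMSEQ[OF near_limit[of a "\<lambda>k n. b k (n + q k)" n, OF H(2)] r(1)] by (simp add: o_def)
  have LV: "localized a S V" by (rule loc_closed[OF lima lims(1,2) a H(5)])
  have LW: "localized a S W"
    by (rule loc_closed[where A = "\<lambda>k n. b (r k) (n + q (r k))", OF limb lims(1) lims(3) a locw])
  have cV: "c * real l1 \<le> (cmod V)\<^sup>2"
    by (rule LIMSEQ_le_const[OF tendsto_power[OF tendsto_norm[OF lims(2)]]]) (use H(6) in blast)
  have cW: "c * real l1 \<le> (cmod W)\<^sup>2"
    by (rule LIMSEQ_le_const[OF tendsto_power[OF tendsto_norm[OF lims(3)]]]) (use H(7) in \<open>auto simp: w_def\<close>)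
  have "dist S s1 \<le> \<eta>"
    by (rule LIMSEQ_le_const2[OF tendsto_dist[OF lims(1) tendsto_const]]) (use H(4) in blast)
  moreover have cl: "c \<le> c * real l1" using c l1 by simp
  then have "localized_at c a S" unfolding localized_at_def using LV cV by (intro exI[of _ V]) auto
  ultimately have S: "S = s1" by (intro iso)
  have "0 < c * real l1" using c l1 by simp
  then have "V \<noteq> 0" using cV by auto
  obtain \<beta> where \<beta>: "W = complex_of_real \<beta> * V"
    using real_parallel[OF \<open>V \<noteq> 0\<close> loc_parallel[OF a LV LW]] .
  \<comment> \<open>The multiple of \<open>V\<close> whose squared modulus is, at every site, the
    sum of those of \<open>V\<close> and \<open>W = \<beta> * V\<close>.\<close>
  define U where "U = complex_of_real (sqrt (1 + \<beta>\<^sup>2)) * V"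
  have pos: "0 \<le> 1 + \<beta>\<^sup>2" by (simp add: add_nonneg_nonneg)
  have U2: "(cmod (sol a s1 U n))\<^sup>2 = (cmod (sol a s1 V n))\<^sup>2 + (cmod (sol a s1 W n))\<^sup>2" for n
    unfolding U_def \<beta> sol_scale using pos by (simp add: norm_mult power_mult_distrib algebra_simps)
  have "(\<Sum>n=-int M..int M. (cmod (sol a s1 U n))\<^sup>2) \<le> 1" for M
  proof (rule LIMSEQ_le_const2)
    show "(\<lambda>k. (\<Sum>n=-int M..int M. (cmod (sol (b (r k)) (s (r k)) (v (r k)) n))\<^sup>2) +
        (\<Sum>n=-int M..int M. (cmod (sol (\<lambda>n. b (r k) (n + q (r k))) (s (r k)) (w (r k)) n))\<^sup>2)) \<longlonglongrightarrow>
      (\<Sum>n=-int M..int M. (cmod (sol a s1 U n))\<^sup>2)"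
      unfolding U2 sum.distrib unfolding S[symmetric] by (intro tendsto_intros tendsto_sol lima limb lims a)
    show "\<exists>N. \<forall>k\<ge>N. (\<Sum>n=-int M..int M. (cmod (sol (b (r k)) (s (r k)) (v (r k)) n))\<^sup>2) +
        (\<Sum>n=-int M..int M. (cmod (sol (\<lambda>n. b (r k) (n + q (r k))) (s (r k)) (w (r k)) n))\<^sup>2) \<le> 1"
    proof (intro exI allI impI)
      fix k assume "M \<le> k"
      then have "M \<le> r k" using seq_suble[OF r(1), of k] by simp
      \<comment> \<open>The windows of radius \<open>M\<close> around 0 and around \<open>q\<close>
        are disjoint, so both sums are parts of the mass of one normalised solution.\<close>
      then have q: "2 * int M < \<bar>q (r k)\<bar>" using H(3)[of "r k"] by simp
      define y where "y n = (cmod (sol (b (r k)) (s (r k)) (v (r k)) n))\<^sup>2" for n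
      have "(\<Sum>n=-int M..int M. (cmod (sol (\<lambda>n. b (r k) (n + q (r k))) (s (r k)) (w (r k)) n))\<^sup>2)
         = (\<Sum>n\<in>(\<lambda>n. n + q (r k)) ` {-int M..int M}. y n)"
      proof -
        have "sol (\<lambda>n. b (r k) (n + q (r k))) (s (r k)) (w (r k)) n = sol (b (r k)) (s (r k)) (v (r k)) (n + q (r k))" for n
          unfolding w_def by (rule sol_shift[OF s1 b1])
        then show ?thesis unfolding y_def by (subst sum.reindex) (auto simp: inj_on_def)
      qed
      then have "(\<Sum>n=-int M..int M. y n) + (\<Sum>n=-int M..int M. (cmod (sol (\<lambda>n. b (r k) (n + q (r k))) (s (r k)) (w (r k)) n))\<^sup>2)
         = (\<Sum>n\<in>{-int M..int M} \<union> (\<lambda>n. n + q (r k)) ` {-int M..int M}. y n)"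
        using q by (subst sum.union_disjoint) auto
      also have "\<dots> \<le> (\<Sum>n=-int (M + nat \<bar>q (r k)\<bar>)..int (M + nat \<bar>q (r k)\<bar>). y n)"
        by (rule sum_mono2) (auto simp: y_def)
      also have "\<dots> \<le> 1" using H(5)[of "r k"] unfolding y_def localized_def by blast
      finally show "(\<Sum>n=-int M..int M. (cmod (sol (b (r k)) (s (r k)) (v (r k)) n))\<^sup>2) +
        (\<Sum>n=-int M..int M. (cmod (sol (\<lambda>n. b (r k) (n + q (r k))) (s (r k)) (w (r k)) n))\<^sup>2) \<le> 1"
        by (simp add: y_def)
    qed
  qed
  moreover have "cmod s1 = 1" using LV S by (simp add: localized_def)
  ultimately have "localized a s1 U" by (simp add: localized_def)
  from mx[OF this] have "(cmod U)\<^sup>2 < c * real (l1 + 1)" .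
  moreover have "(cmod U)\<^sup>2 = (cmod V)\<^sup>2 + (cmod W)\<^sup>2" using U2[of 0] by simp
  ultimately have "c * real l1 + c * real l1 < c * real (l1 + 1)" using cV cW by linarith
  then show False using c l1 by (simp add: algebra_simps)
qed

text \<open>Here the solution seen at \<open>q\<close> is not assumed to be the continuation of the
  one seen at 0. But both decay and have the same parameter, so they agree up to a real factor
  \<open>\<beta>\<close>; the larger of the two is big at both sites, and \<open>rigid_split\<close>
  applies to it.\<close>

lemma rigid_distinct:
  assumes c: "c > 0" and a: "\<And>n. cmod (a n) < 1" and l1: "1 \<le> l1"
    and iso: "\<And>s. localized_at c a s \<Longrightarrow> dist s s1 \<le> \<eta> \<Longrightarrow> s = s1"
    and mx: "\<And>v. localized a s1 v \<Longrightarrow> (cmod v)\<^sup>2 < c * real (l1 + 1)"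
  shows "\<exists>k. \<forall>b q s v w. near k a b \<longrightarrow> near k a (\<lambda>n. b (n + q)) \<longrightarrow> 2 * int k < \<bar>q\<bar> \<longrightarrow> dist s s1 \<le> \<eta> \<longrightarrow>
    localized b s v \<longrightarrow> c * real l1 \<le> (cmod v)\<^sup>2 \<longrightarrow> localized (\<lambda>n. b (n + q)) s w \<longrightarrow> \<not> c * real l1 \<le> (cmod w)\<^sup>2"
proof -
  from rigid_split[where a = a and c = c and ?s1.0 = s1 and \<eta> = \<eta> and ?l1.0 = l1, OF assms] obtain k where k: "\<And>b q s v. near k a b \<Longrightarrow> near k a (\<lambda>n. b (n + q)) \<Longrightarrow>
    2 * int k < \<bar>q\<bar> \<Longrightarrow> dist s s1 \<le> \<eta> \<Longrightarrow> localized b s v \<Longrightarrow> c * real l1 \<le> (cmod v)\<^sup>2 \<Longrightarrow> \<not> c * real l1 \<le> (cmod (sol b s v q))\<^sup>2"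
    by blast
  show ?thesis
  proof (intro exI[of _ k] allI impI notI)
    fix b q s v w
    assume nb: "near k a b" and nq: "near k a (\<lambda>n. b (n + q))" and q: "2 * int k < \<bar>q\<bar>" and s: "dist s s1 \<le> \<eta>"
      and v: "localized b s v" "c * real l1 \<le> (cmod v)\<^sup>2" and w: "localized (\<lambda>n. b (n + q)) s w" "c * real l1 \<le> (cmod w)\<^sup>2"
    have b1: "cmod (b n) < 1" for n using nb by (auto simp: near_def)
    have s1: "cmod s = 1" using v by (simp add: localized_def)
    define u where "u = sol b s v q"
    have "0 < c * real l1" using c l1 by simp
    then have "w \<noteq> 0" "v \<noteq> 0" using w(2) v(2) by auto
    have "localized (\<lambda>n. b (n + q)) s u" unfolding u_def by (rule loc_shift[OF b1 v(1)])
    from real_parallel[OF \<open>w \<noteq> 0\<close> loc_parallel[OF b1 w(1) this]] obtain \<beta> where \<beta>: "u = complex_of_real \<beta> * w" .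
    show False
    proof (cases "1 \<le> \<bar>\<beta>\<bar>")
      case True
      then have "1 \<le> \<beta>\<^sup>2" using abs_le_square_iff[of 1 \<beta>] by simp
      then have "1 * (cmod w)\<^sup>2 \<le> \<beta>\<^sup>2 * (cmod w)\<^sup>2" by (intro mult_right_mono) auto
      then have "(cmod w)\<^sup>2 \<le> (cmod u)\<^sup>2" by (simp add: \<beta> norm_mult power_mult_distrib)
      with w(2) have "c * real l1 \<le> (cmod u)\<^sup>2" by linarith
      then show False using k[OF nb nq q s v] by (simp add: u_def)
    next
      case False
      \<comment> \<open>\<open>w\<close> carried back to the origin. Since \<open>v\<close> is
        \<open>\<beta>\<close> times \<open>v'\<close> with \<open>\<beta>\<close> of modulus below
        1, \<open>v'\<close> is at least as large as \<open>v\<close>, and its value at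
        \<open>q\<close> is \<open>w\<close>.\<close>
      define v' where "v' = sol (\<lambda>n. b (n + q)) s w (- q)"
      have v'loc: "localized b s v'"
        using loc_shift[OF _ w(1), of "- q"] b1 by (simp add: v'_def)
      have w': "sol b s v' q = w"
        using sol_shift[OF s1, where a = "\<lambda>n. b (n + q)" and q = "- q" and n = q and v = w] b1
        by (simp add: v'_def)
      have "v = sol (\<lambda>n. b (n + q)) s u (- q)"
        using sol_shift[where a = b and v = v and q = q and n = "- q", OF s1 b1] by (simp add: u_def)
      then have "v = complex_of_real \<beta> * v'" by (simp add: \<beta> sol_scale v'_def)
      moreover have "\<beta>\<^sup>2 \<le> 1" using False abs_le_square_iff[of \<beta> 1] by simp
      then have "\<beta>\<^sup>2 * (cmod v')\<^sup>2 \<le> 1 * (cmod v')\<^sup>2" by (intro mult_right_mono) auto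
      ultimately have "(cmod v)\<^sup>2 \<le> 1 * (cmod v')\<^sup>2"
        by (simp add: norm_mult power_mult_distrib)
      with v(2) have "c * real l1 \<le> (cmod v')\<^sup>2" by linarith
      from k[OF nb nq q s v'loc this] w(2) show False unfolding w' by blast
    qed
  qed
qed

section \<open>Perturbing the sampling function\<close>

lemma sol_cong_nonneg:
  assumes "0 \<le> n" "\<And>k. 0 \<le> k \<Longrightarrow> a k = b k"
  shows "sol a s v n = sol b s v n"
  using assms unfolding sol_def by (auto intro!: fwd_cong)

lemma sol_cong_nonpos:
  assumes "n \<le> 0" "\<And>k. k < 0 \<Longrightarrow> a k = b k"
  shows "sol a s v n = sol b s v n"
  using assms unfolding sol_def by (auto intro!: fwd_cong)

text \<open>On the left half-line nothing changes, so a decaying solution \<open>u\<close> for the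
  new coefficients is a real multiple of \<open>v\<close> at 0; on the right half-line nothing
  changes either, so it must be a real multiple of the old solution at 1. The choice of
  \<open>\<beta>\<close> multiplies the numerator \<open>y\<close> of the step across site 0 by
  \<open>1 - \<i> * \<kappa>\<close>, which turns it off its real line, and the two requirements
  become incompatible.\<close>

lemma pt_site_change:
  assumes c: "c > 0" and a: "\<And>n. cmod (a n) < 1" and v: "localized a s v" "c \<le> (cmod v)\<^sup>2" and \<kappa>: "\<kappa> > 0"
    and \<beta>: "cnj \<beta> = \<i> * complex_of_real \<kappa> * (s * v - cnj (a 0) * cnj v) / cnj v"
    and a1: "\<And>n. cmod (a1 n) < 1" "a1 = (\<lambda>n. if n = 0 then a 0 + \<beta> else a n)"
  shows "\<not> localized_at c a1 s"
proof
  assume "localized_at c a1 s"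
  then obtain u where u: "localized a1 s u" "c \<le> (cmod u)\<^sup>2" by (auto simp: localized_at_def)
  have v0: "v \<noteq> 0" and u0: "u \<noteq> 0" using c v(2) u(2) by auto
  have s: "cmod s = 1" using v by (simp add: localized_def)
  define y where "y = s * v - cnj (a 0) * cnj v"
  have y0: "y \<noteq> 0"
  proof
    assume "y = 0"
    then have "cmod (s * v) = cmod (cnj (a 0) * cnj v)" by (simp add: y_def)
    then show False using v0 s a[of 0] by (simp add: norm_mult)
  qed
  have "(\<lambda>n. Im (cnj (sol a s v (- int n)) * sol a1 s u (- int n))) \<longlonglongrightarrow> Im (cnj 0 * 0)"
    by (intro tendsto_intros loc_tendsto_0[OF v(1)] loc_tendsto_0[OF u(1)])
  moreover have "sol a1 s u (- int n) = sol a s u (- int n)" for n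
    by (rule sol_cong_nonpos) (auto simp: a1(2))
  ultimately have "Im (cnj v * u) = 0"
    using sol_wronskian[where a = a, OF s a] by (simp add: LIMSEQ_const_iff)
  from real_parallel[OF v0 this] obtain r where r: "u = complex_of_real r * v" .
  with u0 have r0: "r \<noteq> 0" by auto
  define X where "X = sol a s v 1"
  define Y where "Y = sol a1 s u 1"
  have shX: "sol (\<lambda>n. a (n + 1)) s X n = sol a s v (n + 1)" for n
    unfolding X_def by (rule sol_shift[OF s a])
  have shY: "sol (\<lambda>n. a1 (n + 1)) s Y n = sol a1 s u (n + 1)" for n
    unfolding Y_def by (rule sol_shift[OF s a1(1)])
  have eqY: "sol (\<lambda>n. a (n + 1)) s Y (int n) = sol a1 s u (int (Suc n))" for n
    using shY[of "int n"] sol_cong_nonneg[of "int n" "\<lambda>n. a (n + 1)" "\<lambda>n. a1 (n + 1)" s Y]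
    by (simp add: a1(2) add.commute)
  have eqX: "sol (\<lambda>n. a (n + 1)) s X (int n) = sol a s v (int (Suc n))" for n
    using shX[of "int n"] by (simp add: add.commute)
  have "(\<lambda>n. Im (cnj (sol a s v (int (Suc n))) * sol a1 s u (int (Suc n)))) \<longlonglongrightarrow> Im (cnj 0 * 0)"
    by (intro tendsto_intros LIMSEQ_Suc[OF loc_tendsto_0(1)[OF v(1)]] LIMSEQ_Suc[OF loc_tendsto_0(1)[OF u(1)]])
  then have W: "Im (cnj X * Y) = 0"
    unfolding eqX[symmetric] eqY[symmetric]
    using sol_wronskian[where a = "\<lambda>n. a (n + 1)", OF s a] by (simp add: LIMSEQ_const_iff)
  define R R1 where "R = sqrt (1 - (cmod (a 0))\<^sup>2)" and "R1 = sqrt (1 - (cmod (a1 0))\<^sup>2)"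
  have R: "R > 0" "R1 > 0" using rho_pos a a1(1) by (simp_all add: R_def R1_def)
  have X: "X = y / complex_of_real R"
    using sol_step[where a = a, OF s a, of v 0] by (simp add: X_def szego_def y_def R_def)
  have "cnj (a1 0) * cnj u = complex_of_real r * (cnj (a 0) * cnj v + cnj \<beta> * cnj v)"
    by (simp add: a1(2) r algebra_simps)
  also have "cnj \<beta> * cnj v = \<i> * complex_of_real \<kappa> * y" using v0 by (simp add: \<beta> y_def)
  finally have "s * u - cnj (a1 0) * cnj u = complex_of_real r * (y - \<i> * complex_of_real \<kappa> * y)"
    by (simp add: r y_def algebra_simps)
  then have Y: "Y = complex_of_real r * (y - \<i> * complex_of_real \<kappa> * y) / complex_of_real R1"
    using sol_step[where a = a1, OF s a1(1), of u 0] by (simp add: Y_def szego_def R1_def)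
  have "cnj X * Y = complex_of_real (r / (R * R1) * (cmod y)\<^sup>2) * (1 - \<i> * complex_of_real \<kappa>)"
    unfolding X Y of_real_mult of_real_divide complex_norm_square using R by (simp add: field_simps)
  then have "Im (cnj X * Y) = - (r / (R * R1) * (cmod y)\<^sup>2) * \<kappa>" by simp
  with W show False using r0 R y0 \<kappa> by simp
qed

text \<open>On the half circle around \<open>s1\<close> the height \<open>Im (cnj s1 * s)\<close> is
  a coordinate. It replaces the eigenvalue by a real number, to which the intermediate value theorem
  applies.\<close>

lemma circle_height_inj:
  assumes "cmod s1 = 1" "cmod s = 1" "cmod s' = 1" "dist s s1 \<le> 1/2" "dist s' s1 \<le> 1/2"
    and eq: "Im (cnj s1 * s) = Im (cnj s1 * s')"
  shows "s = s'"
proof -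
  have pos: "0 < Re (cnj s1 * s)" if "cmod s = 1" "dist s s1 \<le> 1/2" for s
  proof -
    have "cnj s1 * s - 1 = cnj s1 * (s - s1)" using unit_mult_cnj(2)[OF assms(1)] by (simp add: algebra_simps)
    then have "cmod (cnj s1 * s - 1) \<le> 1/2" using that assms(1) by (simp add: norm_mult dist_norm)
    then have "\<bar>Re (cnj s1 * s - 1)\<bar> \<le> 1/2" using abs_Re_le_cmod order_trans by blast
    then show ?thesis unfolding minus_complex.sel one_complex.sel by linarith
  qed
  have sq: "(Re (cnj s1 * s))\<^sup>2 + (Im (cnj s1 * s))\<^sup>2 = 1" if "cmod s = 1" for s
    using that assms(1) cmod_power2[of "cnj s1 * s"] by (simp add: norm_mult)
  have "(Re (cnj s1 * s))\<^sup>2 = (Re (cnj s1 * s'))\<^sup>2" using sq[OF assms(2)] sq[OF assms(3)] eq by simp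
  then have "Re (cnj s1 * s) = Re (cnj s1 * s')"
    using pos[OF assms(2,4)] pos[OF assms(3,5)] by (metis less_imp_le power2_eq_iff_nonneg)
  with eq have "cnj s1 * s = cnj s1 * s'" by (simp only: complex_eq_iff)
  then show ?thesis using assms(1) by auto
qed

definition orbit_coeffs :: "('a::topological_space \<Rightarrow> 'a) \<Rightarrow> ('a \<Rightarrow>\<^sub>C complex) \<Rightarrow> 'a \<Rightarrow> int \<Rightarrow> complex"
  where "orbit_coeffs T f \<omega> n = apply_bcontfun f (int_iterate T n \<omega>)"

definition bump :: "complex \<Rightarrow> 'a \<Rightarrow> real \<Rightarrow> ('a::metric_space \<Rightarrow>\<^sub>C complex)"
  where "bump \<beta> p \<epsilon> = Bcontfun (\<lambda>x. \<beta> * complex_of_real (max 0 (1 - dist x p / \<epsilon>)))"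

lemma bump_apply:
  assumes "\<epsilon> > 0"
  shows "apply_bcontfun (bump \<beta> p \<epsilon>) x = \<beta> * complex_of_real (max 0 (1 - dist x p / \<epsilon>))"
proof -
  have "(\<lambda>x. \<beta> * complex_of_real (max 0 (1 - dist x p / \<epsilon>))) \<in> bcontfun"
  proof (rule bcontfun_normI)
    show "continuous_on UNIV (\<lambda>x. \<beta> * complex_of_real (max 0 (1 - dist x p / \<epsilon>)))"
      by (intro continuous_intros) (use assms in auto)
    show "norm (\<beta> * complex_of_real (max 0 (1 - dist x p / \<epsilon>))) \<le> cmod \<beta>" for x
      unfolding norm_mult norm_of_real using assms by (intro mult_left_le) auto
  qed
  then show ?thesis by (simp add: bump_def Bcontfun_inverse)
qed

lemma bump_center: "\<epsilon> > 0 \<Longrightarrow> apply_bcontfun (bump \<beta> p \<epsilon>) p = \<beta>"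
  by (simp add: bump_apply)

lemma bump_far: "\<epsilon> > 0 \<Longrightarrow> \<epsilon> \<le> dist x p \<Longrightarrow> apply_bcontfun (bump \<beta> p \<epsilon>) x = 0"
  by (simp add: bump_apply)

lemma bump_norm: "\<epsilon> > 0 \<Longrightarrow> norm (apply_bcontfun (bump \<beta> p \<epsilon>) x) \<le> cmod \<beta>"
  unfolding bump_apply norm_mult norm_of_real by (intro mult_left_le) auto

lemma int_iterate_add_1:
  assumes "bij T"
  shows "int_iterate T (n + 1) x = T (int_iterate T n x)"
proof (cases "0 \<le> n")
  case True
  then have "nat (n + 1) = Suc (nat n)" by simp
  with True show ?thesis by (simp add: int_iterate_def)
next
  case False
  then obtain k where k: "nat (- n) = Suc k" by (cases "nat (- n)") auto
  then have n: "n = - int k - 1" by linarith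
  show ?thesis
  proof (cases k)
    case 0
    then show ?thesis using n assms by (simp add: int_iterate_def bij_is_surj surj_f_inv_f)
  next
    case (Suc j)
    then have "\<not> 0 \<le> n + 1" "nat (- (n + 1)) = k" using n by auto
    then show ?thesis using False k assms by (simp add: int_iterate_def bij_is_surj surj_f_inv_f)
  qed
qed

lemma int_iterate_0 [simp]: "int_iterate T 0 x = x"
  by (simp add: int_iterate_def)

lemma int_iterate_add:
  assumes T: "bij T"
  shows "int_iterate T (m + n) x = int_iterate T m (int_iterate T n x)"
proof (induction m rule: int_induct[where k = 0])
  case base
  show ?case by simp
next
  case (step1 i)
  have "int_iterate T (i + 1 + n) x = T (int_iterate T (i + n) x)"
    using int_iterate_add_1[OF T, of "i + n" x] by (simp add: algebra_simps)
  then show ?case using step1 by (simp add: int_iterate_add_1[OF T])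
next
  case (step2 i)
  have "T (int_iterate T (i - 1 + n) x) = T (int_iterate T (i - 1) (int_iterate T n x))"
    using int_iterate_add_1[OF T, of "i - 1 + n" x] int_iterate_add_1[OF T, of "i - 1" "int_iterate T n x"] step2
    by (simp add: algebra_simps)
  then show ?case using T by (simp add: bij_is_inj inj_eq)
qed

lemma int_iterate_inj:
  assumes T: "bij T"
  shows "int_iterate T n x = int_iterate T n y \<longleftrightarrow> x = y"
  using int_iterate_add[OF T, of "- n" n x] int_iterate_add[OF T, of "- n" n y] by auto

lemma continuous_int_iterate:
  assumes "continuous_on UNIV T" "continuous_on UNIV (inv T)"
  shows "continuous_on UNIV (int_iterate T n)"
proof -
  have "continuous_on UNIV (f ^^ k)" if "continuous_on UNIV f" for f :: "'a \<Rightarrow> 'a" and k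
  proof (induction k)
    case (Suc k)
    have "f ^^ Suc k = (\<lambda>x. f ((f ^^ k) x))" by (simp add: o_def)
    then show ?case using continuous_on_compose2[OF that Suc] by simp
  qed simp
  then show ?thesis using assms by (simp add: int_iterate_def)
qed

section \<open>Coefficients along an orbit and the crossing of two eigenvalues\<close>

lemma seq_shift:
  assumes "bij T"
  shows "orbit_coeffs T f (int_iterate T q \<omega>) n = orbit_coeffs T f \<omega> (n + q)"
  by (simp add: orbit_coeffs_def int_iterate_add[OF assms])

lemma continuous_seq:
  assumes "continuous_on UNIV T" "continuous_on UNIV (inv T)"
  shows "continuous_on UNIV (\<lambda>\<omega>. orbit_coeffs T f \<omega> n)"
  unfolding orbit_coeffs_def
  by (rule continuous_on_compose2[OF _ continuous_int_iterate[OF assms]])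
     (use apply_bcontfun[of f] in \<open>auto simp: bcontfun_def\<close>)

text \<open>Limit points of eigenvalues of nearby sequences are eigenvalues of \<open>b\<close> in
  the closed arc, and the only one there is \<open>lam b\<close>.\<close>

lemma branch_continuous:
  assumes c: "c > 0" and b: "\<And>n. cmod (b n) < 1"
    and good: "\<And>b. G b \<Longrightarrow> dist (lam b) s1 \<le> \<eta> \<and> localized_at c b (lam b)"
    and uniq: "\<And>s. dist s s1 \<le> \<eta> \<Longrightarrow> localized_at c b s \<Longrightarrow> s = lam b" and \<epsilon>: "\<epsilon> > 0"
  shows "\<exists>k. \<forall>b'. near k b b' \<longrightarrow> G b' \<longrightarrow> dist (lam b') (lam b) < \<epsilon>"
proof (rule near_principle, rule ccontr)
  fix B assume B1: "\<And>i n. cmod (B i n) < 1" and lim: "\<And>n. (\<lambda>i. B i n) \<longlonglongrightarrow> b n"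
    and "\<not> (\<exists>i::nat. G (B i) \<longrightarrow> dist (lam (B i)) (lam b) < \<epsilon>)"
  then have H: "\<And>i. G (B i)" "\<And>i. \<not> dist (lam (B i)) (lam b) < \<epsilon>" by blast+
  from good[OF H(1)] have "\<exists>v. localized (B i) (lam (B i)) v \<and> c \<le> (cmod v)\<^sup>2" for i by (auto simp: localized_at_def)
  then obtain v where v: "\<And>i. localized (B i) (lam (B i)) (v i)" "\<And>i. c \<le> (cmod (v i))\<^sup>2" by metis
  have "(lam (B i), v i) \<in> cball 0 1 \<times> cball 0 1" for i
    using v(1)[of i] loc_value_bound[OF v(1)[of i]] by (auto simp: localized_def abs_square_le_1)
  then have "range (\<lambda>i. (lam (B i), v i)) \<subseteq> cball 0 1 \<times> cball 0 1" by blast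
  then have "bounded (range (\<lambda>i. (lam (B i), v i)))"
    by (rule bounded_subset[rotated]) (intro bounded_Times bounded_cball)
  then obtain x r where r: "strict_mono (r :: nat \<Rightarrow> nat)" "((\<lambda>i. (lam (B i), v i)) \<circ> r) \<longlonglongrightarrow> x"
    using bounded_imp_convergent_subsequence by blast
  have lims: "(\<lambda>i. lam (B (r i))) \<longlonglongrightarrow> fst x" "(\<lambda>i. v (r i)) \<longlonglongrightarrow> snd x"
    using tendsto_fst[OF r(2)] tendsto_snd[OF r(2)] by (simp_all add: o_def)
  have limb: "(\<lambda>i. B (r i) n) \<longlonglongrightarrow> b n" for n
    using LIMSEQ_subseq_LIMSEQ[OF lim r(1)] by (simp add: o_def)
  have "localized b (fst x) (snd x)" by (rule loc_closed[OF limb lims b v(1)])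
  moreover have "c \<le> (cmod (snd x))\<^sup>2"
    by (rule LIMSEQ_le_const[OF tendsto_power[OF tendsto_norm[OF lims(2)]]]) (use v(2) in blast)
  moreover have "dist (fst x) s1 \<le> \<eta>"
    by (rule LIMSEQ_le_const2[OF tendsto_dist[OF lims(1) tendsto_const]]) (use good[OF H(1)] in blast)
  ultimately have "fst x = lam b" by (intro uniq) (auto simp: localized_at_def)
  with lims(1) have "(\<lambda>i. dist (lam (B (r i))) (lam b)) \<longlonglongrightarrow> dist (lam b) (lam b)"
    by (intro tendsto_intros) auto
  then have "\<epsilon> \<le> dist (lam b) (lam b)"
    by (rule LIMSEQ_le_const) (use H(2) in \<open>auto simp: not_less\<close>)
  with \<epsilon> show False by simp
qed

text \<open>The path \<open>h t\<close> moves a bump from \<open>\<omega>\<close> to the return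
  point \<open>p\<close>. At \<open>t = 0\<close> the eigenvalue seen from \<open>\<omega>\<close>
  is displaced and the one seen from \<open>p\<close> is not; at \<open>t = 1\<close> the roles are
  exchanged. Throughout, \<open>f + h t\<close> stays in the ball where the degeneracy is at least
  \<open>d\<close> at both points, so both eigenvalues are unique in the arc and move continuously,
  and they must meet.\<close>

lemma no_crossing:
  fixes T :: "'a::metric_space \<Rightarrow> 'a" and f :: "'a \<Rightarrow>\<^sub>C complex"
  assumes T: "bij T" and cT: "continuous_on UNIV T" "continuous_on UNIV (inv T)"
    and aper: "\<And>n. n \<noteq> 0 \<Longrightarrow> int_iterate T n \<omega> \<noteq> \<omega>"
    and c: "c > 0" and d: "1 \<le> d" and nD: "\<not> degeneracy_ge c (orbit_coeffs T f \<omega>) (Suc d)" and \<rho>: "\<rho> > 0"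
    and samp: "\<And>g. dist f g < \<rho> \<Longrightarrow> g \<in> sampling_functions"
    and Dball: "\<And>g. dist f g < \<rho> \<Longrightarrow> degeneracy_ge c (orbit_coeffs T g \<omega>) d"
    and rec: "\<And>U. open U \<Longrightarrow> \<omega> \<in> U \<Longrightarrow> \<exists>q\<ge>1. int_iterate T (int q) \<omega> \<in> U \<and>
       (\<forall>g. dist f g < \<rho> \<longrightarrow> degeneracy_ge c (orbit_coeffs T g (int_iterate T (int q) \<omega>)) d)"
  shows False
proof -
  define a where "a = orbit_coeffs T f \<omega>"
  have s1: "cmod (orbit_coeffs T g p n) < 1" if "dist f g < \<rho>" for g p n
    using samp[OF that] by (auto simp: sampling_functions_def orbit_coeffs_def)
  have a: "cmod (a n) < 1" for n using s1[of f] \<rho> by (simp add: a_def)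
  have D: "degeneracy_ge c a d" using Dball[of f] \<rho> by (simp add: a_def)
  obtain z l1 \<eta> v1 where z: "cmod z = 1" and l1: "1 \<le> l1" and \<eta>: "0 < \<eta>" "\<eta> \<le> 1/2"
    and v1: "localized a z v1" "c * real l1 \<le> (cmod v1)\<^sup>2"
    and iso: "\<And>s. localized_at c a s \<Longrightarrow> dist s z \<le> \<eta> \<Longrightarrow> s = z"
    and mx: "\<And>v. localized a z v \<Longrightarrow> (cmod v)\<^sup>2 < c * real (l1 + 1)"
    by (rule rigid_choice[OF c D nD[folded a_def] d]) blast
  have cl: "c \<le> c * real l1" using c l1 by simp
  obtain k1 where k1: "\<And>b. near k1 a b \<Longrightarrow> degeneracy_ge c b d \<Longrightarrow>
      (\<exists>s v. dist s z \<le> \<eta> \<and> localized b s v \<and> c * real l1 \<le> (cmod v)\<^sup>2) \<and>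
      (\<forall>s s'. dist s z \<le> \<eta> \<longrightarrow> dist s' z \<le> \<eta> \<longrightarrow> localized_at c b s \<longrightarrow> localized_at c b s' \<longrightarrow> s = s')"
    using rigid_near[where a = a and c = c, OF c a D nD[folded a_def] l1 v1 \<eta>(1) iso] by blast
  obtain k2 where k2: "\<And>b q s v w. near k2 a b \<Longrightarrow> near k2 a (\<lambda>n. b (n + q)) \<Longrightarrow> 2 * int k2 < \<bar>q\<bar> \<Longrightarrow> dist s z \<le> \<eta> \<Longrightarrow>
    localized b s v \<Longrightarrow> c * real l1 \<le> (cmod v)\<^sup>2 \<Longrightarrow> localized (\<lambda>n. b (n + q)) s w \<Longrightarrow> \<not> c * real l1 \<le> (cmod w)\<^sup>2"
    using rigid_distinct[where a = a and c = c, OF c a l1 iso mx] by blast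
  define k where "k = max k1 k2"
  define G where "G b \<longleftrightarrow> near k a b \<and> degeneracy_ge c b d" for b
  define lam where "lam b = (SOME s. dist s z \<le> \<eta> \<and> localized_at c b s)" for b
  have ex: "\<exists>s v. dist s z \<le> \<eta> \<and> localized b s v \<and> c * real l1 \<le> (cmod v)\<^sup>2" if "G b" for b
    using k1[of b] near_mono[of k a b k1] that by (auto simp: G_def k_def)
  have uni: "s = s'" if "G b" "dist s z \<le> \<eta>" "dist s' z \<le> \<eta>" "localized_at c b s" "localized_at c b s'" for b s s'
    using k1[of b] near_mono[of k a b k1] that by (auto simp: G_def k_def)
  have lam: "dist (lam b) z \<le> \<eta> \<and> localized_at c b (lam b)" if "G b" for b
  proof -
    from ex[OF that] obtain s v where "dist s z \<le> \<eta>" "localized b s v" "c * real l1 \<le> (cmod v)\<^sup>2" by blast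
    then have "dist s z \<le> \<eta> \<and> localized_at c b s" using cl by (auto simp: localized_at_def)
    then show ?thesis unfolding lam_def by (rule someI)
  qed
  have lamv: "\<exists>v. localized b (lam b) v \<and> c * real l1 \<le> (cmod v)\<^sup>2" if "G b" for b
  proof -
    from ex[OF that] obtain s v where sv: "dist s z \<le> \<eta>" "localized b s v" "c * real l1 \<le> (cmod v)\<^sup>2" by blast
    then have "localized_at c b s" using cl by (auto simp: localized_at_def)
    then have "s = lam b" using uni[OF that sv(1)] lam[OF that] by blast
    with sv show ?thesis by blast
  qed
  have cont: "\<exists>k. \<forall>b'. near k b b' \<longrightarrow> G b' \<longrightarrow> dist (lam b') (lam b) < \<epsilon>" if "G b" "\<epsilon> > 0" for b \<epsilon>
  proof (rule branch_continuous[where ?s1.0 = z and \<eta> = \<eta> and c = c, OF c])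
    show "cmod (b n) < 1" for n using that(1) by (auto simp: G_def near_def)
    show "dist (lam b) z \<le> \<eta> \<and> localized_at c b (lam b)" if "G b" for b by (rule lam[OF that])
    show "s = lam b" if "dist s z \<le> \<eta>" "localized_at c b s" for s
      using uni[OF \<open>G b\<close> that(1) _ that(2)] lam[OF \<open>G b\<close>] by blast
  qed (rule that(2))

  text \<open>A small change \<open>\<beta>\<close> of the coefficient at site 0 moves the eigenvalue.\<close>
  define \<nu> where "\<nu> = 1 / (real k + 1)"
  have \<nu>: "\<nu> > 0" by (simp add: \<nu>_def)
  \<comment> \<open>The perturbation satisfies \<open>cmod \<beta> \<le> 2 * \<kappa>\<close>. The
    divisor 8 keeps it below \<open>\<rho>\<close> and below \<open>\<nu> / 4\<close>, which leaves
    room for the error at the return site.\<close>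
  define \<kappa> where "\<kappa> = min \<rho> \<nu> / 8"
  have \<kappa>: "\<kappa> > 0" using \<rho> \<nu> by (simp add: \<kappa>_def)
  define \<beta> where "\<beta> = cnj (\<i> * complex_of_real \<kappa> * (z * v1 - cnj (a 0) * cnj v1) / cnj v1)"
  have "0 < (cmod v1)\<^sup>2" using v1(2) cl c by linarith
  then have v10: "v1 \<noteq> 0" by auto
  have \<beta>2: "cmod \<beta> \<le> 2 * \<kappa>"
  proof -
    have "cmod (z * v1 - cnj (a 0) * cnj v1) \<le> cmod (z * v1) + cmod (cnj (a 0) * cnj v1)" by (rule norm_triangle_ineq4)
    also have "\<dots> \<le> cmod v1 + 1 * cmod v1"
      unfolding norm_mult complex_mod_cnj z using a[of 0] by (intro add_mono mult_right_mono) auto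
    finally have "cmod (z * v1 - cnj (a 0) * cnj v1) / cmod v1 \<le> 2" using v10 by (simp add: field_simps)
    then have "\<kappa> * (cmod (z * v1 - cnj (a 0) * cnj v1) / cmod v1) \<le> \<kappa> * 2" using \<kappa> by (intro mult_left_mono) auto
    moreover have "cmod \<beta> = \<kappa> * (cmod (z * v1 - cnj (a 0) * cnj v1) / cmod v1)"
      unfolding \<beta>_def complex_mod_cnj norm_mult norm_divide using \<kappa> by simp
    ultimately show ?thesis by simp
  qed
  have "\<kappa> \<le> \<rho> / 8" "\<kappa> \<le> \<nu> / 8"
    unfolding \<kappa>_def by (intro divide_right_mono min.cobounded1 min.cobounded2; simp)+
  then have \<beta>\<rho>: "cmod \<beta> < \<rho>" and \<beta>k: "cmod \<beta> \<le> \<nu> / 4" using \<beta>2 \<rho> by linarith+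
  have \<beta>k': "cmod \<beta> < 1 / (real k + 1)" using \<beta>k \<nu> unfolding \<nu>_def[symmetric] by linarith
  have dB: "dist f (f + h) < \<rho>" if "\<And>x. cmod (apply_bcontfun h x) \<le> cmod \<beta>" for h
  proof -
    have "norm h \<le> cmod \<beta>" by (rule norm_bound) (use that in auto)
    then show ?thesis using \<beta>\<rho> by (simp add: dist_norm)
  qed
  define a1 where "a1 = (\<lambda>n. if n = 0 then a 0 + \<beta> else a n)"
  \<comment> \<open>\<open>a1\<close> differs from \<open>a\<close> at site 0 only, which no
    continuous sampling function need produce. Bumps of shrinking radius approximate it, because by
    aperiodicity the orbit visits \<open>\<omega>\<close> at time 0 only; closedness of the
    degeneracy then transfers the bound to \<open>a1\<close>.\<close>
  define fi where "fi i = f + bump \<beta> \<omega> (1 / real (Suc i))" for i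
  have fi: "dist f (fi i) < \<rho>" for i
    unfolding fi_def by (rule dB) (simp add: bump_norm)
  have fi0: "orbit_coeffs T (fi i) \<omega> 0 = a1 0" for i by (simp add: orbit_coeffs_def fi_def a1_def a_def bump_center)
  have a1n: "cmod (a1 n) < 1" for n
    using a s1[OF fi, of 0 \<omega> 0] fi0[of 0] by (cases "n = 0") (auto simp: a1_def)
  have "(\<lambda>i. orbit_coeffs T (fi i) \<omega> n) \<longlonglongrightarrow> a1 n" for n
  proof (cases "n = 0")
    case True
    then show ?thesis using fi0 by simp
  next
    case False
    then have "0 < dist (int_iterate T n \<omega>) \<omega>" using aper by simp
    from LIMSEQ_D[OF LIMSEQ_inverse_real_of_nat this] obtain N where N: "\<And>i. N \<le> i \<Longrightarrow> 1 / real (Suc i) < dist (int_iterate T n \<omega>) \<omega>"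
      by (auto simp: inverse_eq_divide)
    have "\<forall>\<^sub>F i in sequentially. orbit_coeffs T (fi i) \<omega> n = a1 n"
      unfolding eventually_sequentially
      by (intro exI[of _ N]) (use False N in \<open>auto simp: orbit_coeffs_def fi_def a1_def a_def intro!: bump_far less_imp_le\<close>)
    then show ?thesis by (rule tendsto_eventually)
  qed
  then have Da1: "degeneracy_ge c a1 d"
    by (rule Deg_closed[where a = a1 and A = "\<lambda>i. orbit_coeffs T (fi i) \<omega>", OF c a1n s1[OF fi] _ Dball[OF fi]])
  have na1: "near k a a1" using a1n \<beta>k' by (auto simp: near_def a1_def)
  have Ga1: "G a1" using Da1 na1 by (simp add: G_def)
  have Ga: "G a" using D a by (simp add: G_def near_def)
  have npt: "\<not> localized_at c a1 z"
    by (rule pt_site_change[where a = a and v = v1 and \<beta> = \<beta> and \<kappa> = \<kappa>, OF c a v1(1) _ \<kappa> _ a1n a1_def])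
       (use v1(2) cl in \<open>auto simp: \<beta>_def\<close>)
  have lama: "lam a = z" using iso lam[OF Ga] by blast
  define g where "g s = Im (cnj z * s)" for s
  have gdist: "\<bar>g s - g s'\<bar> \<le> dist s s'" for s s'
  proof -
    have "\<bar>Im (cnj z * (s - s'))\<bar> \<le> cmod (cnj z * (s - s'))" by (rule abs_Im_le_cmod)
    also have "\<dots> = dist s s'" using z by (simp add: norm_mult dist_norm)
    also have "Im (cnj z * (s - s')) = g s - g s'" by (simp add: g_def algebra_simps)
    finally show ?thesis .
  qed
  have unit: "cmod (lam b) = 1" if "G b" for b using lam[OF that] by (auto simp: localized_at_def localized_def)
  have ginj: "s = s'" if "cmod s = 1" "cmod s' = 1" "dist s z \<le> \<eta>" "dist s' z \<le> \<eta>" "g s = g s'" for s s'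
    by (rule circle_height_inj[OF z that(1,2)]) (use that \<eta> in \<open>auto simp: g_def\<close>)
  \<comment> \<open>The displacement of the eigenvalue under \<open>\<beta>\<close>, nonzero because
    \<open>z\<close> is no longer an eigenvalue for \<open>a1\<close>. All later deviations are kept
    below half of it, so the sign of the difference is known at both ends of the path.\<close>
  define \<gamma> where "\<gamma> = \<bar>g (lam a1)\<bar>"
  have gz: "g z = 0" using unit_mult_cnj(2)[OF z] by (simp add: g_def)
  have \<gamma>: "\<gamma> > 0"
  proof (rule ccontr)
    assume "\<not> \<gamma> > 0"
    then have "g (lam a1) = g z" using gz by (simp add: \<gamma>_def)
    then have "lam a1 = z" using ginj[OF unit[OF Ga1] z] lam[OF Ga1] \<eta> by simp
    then show False using lam[OF Ga1] npt by simp
  qed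
  obtain kA where kA: "\<And>b'. near kA a1 b' \<Longrightarrow> G b' \<Longrightarrow> dist (lam b') (lam a1) < \<gamma> / 2"
    using cont[OF Ga1, of "\<gamma>/2"] \<gamma> by auto
  obtain kB where kB: "\<And>b'. near kB a b' \<Longrightarrow> G b' \<Longrightarrow> dist (lam b') z < \<gamma> / 2"
    using cont[OF Ga, of "\<gamma>/2"] \<gamma> lama by auto
  define K where "K = max k (max kA kB)"
  \<comment> \<open>Half of the required radius: at the return site the total error is at most
    \<open>\<mu> + cmod \<beta>\<close>, with \<open>\<mu> \<le> \<nu> / 2\<close> and
    \<open>cmod \<beta> \<le> \<nu> / 4\<close>.\<close>
  define \<mu> where "\<mu> = 1 / (real K + 1) / 2"
  have \<mu>: "\<mu> > 0" by (simp add: \<mu>_def)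
  have "1 / (real K + 1) \<le> \<nu>" unfolding \<nu>_def by (intro divide_left_mono) (auto simp: K_def)
  moreover have "2 * \<mu> = 1 / (real K + 1)" by (simp add: \<mu>_def field_simps)
  ultimately have Kk: "2 * \<mu> \<le> \<nu>" by simp

  text \<open>A return time \<open>q\<close> beyond the window, at which the sequence looks like \<open>a\<close>.\<close>
  define U where "U = (\<Inter>n\<in>{-int K..int K}. {p. cmod (orbit_coeffs T f p n - a n) < \<mu>})
     - (\<lambda>j. int_iterate T j \<omega>) ` ({-2 * int K..2 * int K} - {0})"
  have "open U"
    unfolding U_def
  proof (intro open_Diff open_INT ballI)
    show "open {p. cmod (orbit_coeffs T f p n - a n) < \<mu>}" for n
      by (intro open_Collect_less continuous_intros continuous_seq cT)
  qed (auto intro!: finite_imp_closed)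
  moreover have "\<omega> \<in> U" using \<mu> aper by (force simp: U_def a_def)
  ultimately obtain q where q1: "q \<ge> 1" and qU: "int_iterate T (int q) \<omega> \<in> U"
    and qD: "\<And>g. dist f g < \<rho> \<Longrightarrow> degeneracy_ge c (orbit_coeffs T g (int_iterate T (int q) \<omega>)) d"
    using rec by blast
  \<comment> \<open>The orbit points at short nonzero times were removed from \<open>U\<close>, so a
    return to \<open>U\<close> is late enough for the two windows to be disjoint.\<close>
  have qK: "2 * K < q"
  proof (rule ccontr)
    assume "\<not> 2 * K < q"
    then have "int q \<in> {-2 * int K..2 * int K} - {0}" using q1 by auto
    then show False using qU by (auto simp: U_def)
  qed
  define p where "p = int_iterate T (int q) \<omega>"
  have pa: "cmod (orbit_coeffs T f \<omega> (n + int q) - a n) < \<mu>" if "\<bar>n\<bar> \<le> int K" for n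
    using qU that unfolding U_def by (auto simp: seq_shift[OF T] abs_le_iff)
  \<comment> \<open>All sites that the window around 0 or the one around \<open>q\<close> can see.
    With \<open>\<epsilon>\<close> below the mutual distances of these orbit points, each bump
    touches exactly one site of \<open>J\<close>.\<close>
  define J where "J = {-int (q + K)..int (q + K)}"
  have "finite (J \<times> J)" by (simp add: J_def)
  then have "finite {(i, j) \<in> J \<times> J. i \<noteq> j}" by (rule rev_finite_subset) auto
  then have "finite ((\<lambda>(i, j). dist (int_iterate T i \<omega>) (int_iterate T j \<omega>)) ` {(i, j) \<in> J \<times> J. i \<noteq> j})"
    by (rule finite_imageI)
  moreover have "0 < x" if "x \<in> (\<lambda>(i, j). dist (int_iterate T i \<omega>) (int_iterate T j \<omega>)) ` {(i, j) \<in> J \<times> J. i \<noteq> j}" for x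
  proof -
    from that obtain i j where x: "x = dist (int_iterate T i \<omega>) (int_iterate T j \<omega>)" "i \<noteq> j" by auto
    have "int_iterate T i \<omega> \<noteq> int_iterate T j \<omega>"
      using aper[of "i - j"] x(2) int_iterate_add[OF T, of j "i - j" \<omega>] int_iterate_inj[OF T, of j] by auto
    then show ?thesis using x by simp
  qed
  ultimately obtain \<epsilon> where \<epsilon>: "\<epsilon> > 0"
    "\<And>x. x \<in> (\<lambda>(i, j). dist (int_iterate T i \<omega>) (int_iterate T j \<omega>)) ` {(i, j) \<in> J \<times> J. i \<noteq> j} \<Longrightarrow> \<epsilon> \<le> x"
    by (metis (no_types, lifting) Min_in Min_le empty_iff gt_ex)
  have sep: "\<epsilon> \<le> dist (int_iterate T i \<omega>) (int_iterate T j \<omega>)" if "i \<in> J" "j \<in> J" "i \<noteq> j" for i j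
    by (rule \<epsilon>(2)) (use that in auto)
  define h where "h t = (1 - t) *\<^sub>R bump \<beta> \<omega> \<epsilon> + t *\<^sub>R bump \<beta> p \<epsilon>" for t
  have hJ: "apply_bcontfun (h t) (int_iterate T j \<omega>) =
      (1 - t) *\<^sub>R (if j = 0 then \<beta> else 0) + t *\<^sub>R (if j = int q then \<beta> else 0)" if "j \<in> J" for j t
  proof -
    have "0 \<in> J" "int q \<in> J" by (auto simp: J_def)
    then show ?thesis
      using sep[OF that, of 0] sep[OF that, of "int q"] \<epsilon>(1)
      by (auto simp: h_def p_def bump_center bump_far)
  qed
  have hb: "cmod (apply_bcontfun (h t) x) \<le> cmod \<beta>" if "t \<in> {0..1}" for t x
  proof -
    have "cmod (apply_bcontfun (h t) x) \<le> (1 - t) * cmod \<beta> + t * cmod \<beta>"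
      unfolding h_def plus_bcontfun.rep_eq scaleR_bcontfun.rep_eq
      using that \<epsilon>(1) by (intro norm_triangle_le add_mono) (auto intro!: mult_left_mono bump_norm)
    then show ?thesis by (simp add: algebra_simps)
  qed
  have hball: "dist f (f + h t) < \<rho>" if "t \<in> {0..1}" for t by (rule dB) (rule hb[OF that])
  define b where "b t = orbit_coeffs T (f + h t) \<omega>" for t
  define b' where "b' t = orbit_coeffs T (f + h t) p" for t
  have b'b: "b' t = (\<lambda>n. b t (n + int q))" for t
    by (auto simp: b'_def b_def p_def seq_shift[OF T])
  have bval: "b t j = orbit_coeffs T f \<omega> j + ((1 - t) *\<^sub>R (if j = 0 then \<beta> else 0) + t *\<^sub>R (if j = int q then \<beta> else 0))" if "j \<in> J" for t j
    using hJ[OF that, of t] by (simp add: b_def orbit_coeffs_def)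
  have b0: "b t n = a n + (1 - t) *\<^sub>R (if n = 0 then \<beta> else 0)" if "\<bar>n\<bar> \<le> int K" for t n
    using that qK by (subst bval) (auto simp: J_def a_def)
  have b'0: "b' t n = orbit_coeffs T f \<omega> (n + int q) + t *\<^sub>R (if n = 0 then \<beta> else 0)" if "\<bar>n\<bar> \<le> int K" for t n
    unfolding b'b using that qK by (subst bval) (auto simp: J_def)
  have b1: "cmod (b t n) < 1" "cmod (b' t n) < 1" if "t \<in> {0..1}" for t n
    using s1[OF hball[OF that]] by (simp_all add: b_def b'_def)
  have tb: "cmod (u *\<^sub>R (if n = 0 then \<beta> else 0)) \<le> cmod \<beta>" if "u \<in> {0..1}" for u and n :: int
    using that by (auto intro!: mult_left_le_one_le)
  have Gb: "G (b t)" if t: "t \<in> {0..1}" for t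
  proof -
    have "cmod (b t n - a n) < 1 / (real k + 1)" if n: "\<bar>n\<bar> \<le> int k" for n
    proof -
      have nK: "\<bar>n\<bar> \<le> int K" using n by (simp add: K_def)
      have eq: "b t n - a n = (1 - t) *\<^sub>R (if n = 0 then \<beta> else 0)" unfolding b0[OF nK] by simp
      have "cmod (b t n - a n) \<le> cmod \<beta>" unfolding eq by (rule tb) (use t in auto)
      then show ?thesis using \<beta>k' by linarith
    qed
    then have "near k a (b t)" using b1[OF t] by (simp add: near_def)
    then show ?thesis using Dball[OF hball[OF t]] by (simp add: G_def b_def)
  qed
  have Gb': "G (b' t)" if t: "t \<in> {0..1}" for t
  proof -
    have "cmod (b' t n - a n) < 1 / (real k + 1)" if n: "\<bar>n\<bar> \<le> int k" for n
    proof -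
      have nK: "\<bar>n\<bar> \<le> int K" using n by (simp add: K_def)
      have "b' t n - a n = (orbit_coeffs T f \<omega> (n + int q) - a n) + t *\<^sub>R (if n = 0 then \<beta> else 0)"
        unfolding b'0[OF nK] by simp
      then have "cmod (b' t n - a n) \<le> cmod (orbit_coeffs T f \<omega> (n + int q) - a n) + cmod (t *\<^sub>R (if n = 0 then \<beta> else 0))"
        by (simp only: norm_triangle_ineq)
      also have "\<dots> \<le> \<mu> + cmod \<beta>"
        using pa[OF nK] tb[OF t, of n] by linarith
      also have "\<dots> < \<nu>" using Kk \<beta>k \<nu> by linarith
      finally show ?thesis by (simp add: \<nu>_def)
    qed
    then have "near k a (b' t)" using b1[OF t] by (simp add: near_def)
    then show ?thesis using qD[OF hball[OF t]] by (simp add: G_def b'_def p_def)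
  qed
  \<comment> \<open>Stated for an arbitrary path of sequences, because it is needed both for
    \<open>b\<close> and for its translate \<open>b'\<close>.\<close>
  have contb: "continuous_on {0..1} (\<lambda>t. lam (B t))"
    if GB: "\<And>t. t \<in> {0..1} \<Longrightarrow> G (B t)" and Bc: "\<And>n. continuous_on {0..1} (\<lambda>t. B t n)" for B :: "real \<Rightarrow> int \<Rightarrow> complex"
  proof (subst continuous_on_sequentially, intro allI ballI impI)
    fix x :: "nat \<Rightarrow> real" and t assume "t \<in> {0..1}" and "(\<forall>n. x n \<in> {0..1}) \<and> x \<longlonglongrightarrow> t"
    then have x: "\<And>n. x n \<in> {0..1}" "x \<longlonglongrightarrow> t" and t: "t \<in> {0..1}" by auto
    have xB: "(\<lambda>i. B (x i) n) \<longlonglongrightarrow> B t n" for n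
      using continuous_on_tendsto_compose[OF Bc x(2) t] x(1) by simp
    show "((\<lambda>t. lam (B t)) \<circ> x) \<longlonglongrightarrow> lam (B t)"
    proof (rule tendstoI)
      fix \<epsilon> :: real assume "\<epsilon> > 0"
      from cont[OF GB[OF t] this] obtain k' where k': "\<And>b'. near k' (B t) b' \<Longrightarrow> G b' \<Longrightarrow> dist (lam b') (lam (B t)) < \<epsilon>"
        by blast
      have "\<forall>\<^sub>F i in sequentially. near k' (B t) (B (x i))"
        by (rule near_eventually[OF _ xB]) (use GB[OF x(1)] in \<open>auto simp: G_def near_def\<close>)
      then show "\<forall>\<^sub>F i in sequentially. dist (((\<lambda>t. lam (B t)) \<circ> x) i) (lam (B t)) < \<epsilon>"
        by eventually_elim (use k' GB[OF x(1)] in auto)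
    qed
  qed
  have cb: "continuous_on {0..1} (\<lambda>t. b t n)" "continuous_on {0..1} (\<lambda>t. b' t n)" for n
    unfolding b_def b'_def orbit_coeffs_def h_def plus_bcontfun.rep_eq scaleR_bcontfun.rep_eq
    by (intro continuous_intros)+
  define H where "H t = g (lam (b t)) - g (lam (b' t))" for t
  have contH: "continuous_on {0..1} H"
    unfolding H_def g_def by (intro continuous_intros contb Gb Gb' cb)
  \<comment> \<open>Equal heights mean equal eigenvalues, one with a solution concentrated at 0 and
    one at \<open>q\<close> for the same sequence; this is what \<open>rigid_distinct\<close>
    excludes.\<close>
  have H0: "H t \<noteq> 0" if t: "t \<in> {0..1}" for t
  proof
    assume "H t = 0"
    then have eq: "lam (b t) = lam (b' t)"
      using ginj[OF unit[OF Gb[OF t]] unit[OF Gb'[OF t]]] lam[OF Gb[OF t]] lam[OF Gb'[OF t]] by (simp add: H_def)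
    obtain v w where v: "localized (b t) (lam (b t)) v" "c * real l1 \<le> (cmod v)\<^sup>2"
      and w: "localized (b' t) (lam (b t)) w" "c * real l1 \<le> (cmod w)\<^sup>2"
      using lamv[OF Gb[OF t]] lamv[OF Gb'[OF t]] eq by auto
    have "near k2 a (b t)" "near k2 a (b' t)"
      using Gb[OF t] Gb'[OF t] near_mono[of k a _ k2] by (auto simp: G_def k_def)
    moreover have "2 * int k2 < \<bar>int q\<bar>" using qK by (auto simp: K_def k_def)
    ultimately show False
      using k2[of "b t" "int q" "lam (b t)" v w] v w lam[OF Gb[OF t]] unfolding b'b by blast
  qed
  have mu1: "\<mu> < 1 / (real j + 1)" if "j \<le> K" for j
  proof -
    have "\<mu> < 1 / (real K + 1)" by (simp add: \<mu>_def field_simps)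
    also have "\<dots> \<le> 1 / (real j + 1)" using that by (intro divide_left_mono) auto
    finally show ?thesis .
  qed
  have K: "kA \<le> K" "kB \<le> K" by (auto simp: K_def)
  have t01: "(0::real) \<in> {0..1}" "(1::real) \<in> {0..1}" by auto
  have "near kA a1 (b 0)"
    unfolding near_def using b1[OF t01(1)] b0[of _ 0] K by (auto simp: a1_def)
  from kA[OF this Gb[OF t01(1)]] have e1: "\<bar>g (lam (b 0)) - g (lam a1)\<bar> < \<gamma> / 2"
    using gdist[of "lam (b 0)" "lam a1"] by simp
  have "cmod (b' 0 n - a n) < 1 / (real kB + 1)" if "\<bar>n\<bar> \<le> int kB" for n
  proof -
    have n: "\<bar>n\<bar> \<le> int K" using that K by simp
    have "b' 0 n - a n = orbit_coeffs T f \<omega> (n + int q) - a n" by (simp add: b'0[OF n])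
    then show ?thesis using pa[OF n] mu1[OF K(2)] by simp
  qed
  then have "near kB a (b' 0)" using b1[OF t01(1)] by (simp add: near_def)
  from kB[OF this Gb'[OF t01(1)]] have e2: "\<bar>g (lam (b' 0))\<bar> < \<gamma> / 2"
    using gdist[of "lam (b' 0)" z] gz by simp
  have "near kB a (b 1)"
    unfolding near_def using b1[OF t01(2)] b0[of _ 1] K by auto
  from kB[OF this Gb[OF t01(2)]] have e3: "\<bar>g (lam (b 1))\<bar> < \<gamma> / 2"
    using gdist[of "lam (b 1)" z] gz by simp
  have "cmod (b' 1 n - a1 n) < 1 / (real kA + 1)" if "\<bar>n\<bar> \<le> int kA" for n
  proof -
    have n: "\<bar>n\<bar> \<le> int K" using that K by simp
    have "b' 1 n - a1 n = orbit_coeffs T f \<omega> (n + int q) - a n" by (auto simp: b'0[OF n] a1_def)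
    then show ?thesis using pa[OF n] mu1[OF K(1)] by simp
  qed
  then have "near kA a1 (b' 1)" using b1[OF t01(2)] by (simp add: near_def)
  from kA[OF this Gb'[OF t01(2)]] have e4: "\<bar>g (lam (b' 1)) - g (lam a1)\<bar> < \<gamma> / 2"
    using gdist[of "lam (b' 1)" "lam a1"] by simp
  show False
  proof (cases "g (lam a1) > 0")
    case True
    then have "H 0 \<ge> 0" "H 1 \<le> 0" using e1 e2 e3 e4 unfolding H_def \<gamma>_def by linarith+
    from IVT2'[OF this(2,1) _ contH] H0 show False by force
  next
    case False
    then have "H 0 \<le> 0" "H 1 \<ge> 0" using e1 e2 e3 e4 \<gamma> unfolding H_def \<gamma>_def by linarith+
    from IVT'[OF this(1,2) _ contH] H0 show False by force
  qed
qed

section \<open>Separability and recurrence: from one base point to almost every base point\<close>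

lemma separable_bcontfun:
  assumes comp: "compact (UNIV :: 'a::metric_space set)"
  obtains F :: "('a::metric_space \<Rightarrow>\<^sub>C complex) set" where "countable F" "\<And>f \<rho>. \<rho> > 0 \<Longrightarrow> \<exists>g\<in>F. dist f g < \<rho>"
proof -
  have "\<exists>X. finite X \<and> (UNIV :: 'a set) \<subseteq> (\<Union>x\<in>X. ball x (1 / real (Suc j)))" for j
    using comp unfolding compact_eq_totally_bounded by (auto simp del: of_nat_Suc)
  then obtain X :: "nat \<Rightarrow> 'a set" where X: "\<And>j. finite (X j)" "\<And>j. (UNIV :: 'a set) \<subseteq> (\<Union>x\<in>X j. ball x (1 / real (Suc j)))"
    by metis
  obtain Q :: "complex set" where Q: "countable Q" "\<And>S. open S \<Longrightarrow> S \<noteq> {} \<Longrightarrow> \<exists>d\<in>Q. d \<in> S"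
    by (rule countable_dense_setE) blast
  \<comment> \<open>A class fixes a modulus of continuity and approximate values on a finite net, so
    any two of its members are within \<open>4 / real (Suc l)\<close>. One function per class
    suffices; for an empty class the choice is arbitrary and harmless.\<close>
  define C where "C = (\<lambda>(j, l, h). {f :: 'a \<Rightarrow>\<^sub>C complex. (\<forall>x\<in>X j. dist (apply_bcontfun f x) (h x) < 1 / real (Suc l)) \<and>
     (\<forall>x y. dist x y < 1 / real (Suc j) \<longrightarrow> dist (apply_bcontfun f x) (apply_bcontfun f y) < 1 / real (Suc l))})"
  define Ks where "Ks = (SIGMA j:(UNIV :: nat set). (UNIV :: nat set) \<times> Pi\<^sub>E (X j) (\<lambda>_. Q))"
  have "countable Ks"
    unfolding Ks_def by (intro countable_SIGMA countable_PiE X Q) auto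
  have close: "dist f g \<le> 4 / real (Suc l)" if "f \<in> C (j, l, h)" "g \<in> C (j, l, h)" for f g j l h
  proof (rule dist_bound)
    fix y
    have "y \<in> (\<Union>x\<in>X j. ball x (1 / real (Suc j)))" using X(2)[of j] by blast
    then obtain x where x: "x \<in> X j" "dist x y < 1 / real (Suc j)" by (auto simp del: of_nat_Suc)
    have "dist (apply_bcontfun f x) (h x) < 1 / real (Suc l)" "dist (apply_bcontfun g x) (h x) < 1 / real (Suc l)"
      "dist (apply_bcontfun f x) (apply_bcontfun f y) < 1 / real (Suc l)"
      "dist (apply_bcontfun g x) (apply_bcontfun g y) < 1 / real (Suc l)"
      using that x by (auto simp: C_def simp del: of_nat_Suc)
    moreover have "dist (apply_bcontfun f y) (apply_bcontfun g y) \<le> dist (apply_bcontfun f x) (apply_bcontfun f y)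
       + dist (apply_bcontfun f x) (h x) + dist (apply_bcontfun g x) (h x) + dist (apply_bcontfun g x) (apply_bcontfun g y)"
      by metric
    moreover have "4 / real (Suc l) = 4 * (1 / real (Suc l))" by simp
    ultimately show "dist (apply_bcontfun f y) (apply_bcontfun g y) \<le> 4 / real (Suc l)"
      by linarith
  qed
  show ?thesis
  proof (rule that[of "(\<lambda>k. SOME f. f \<in> C k) ` Ks"])
    show "countable ((\<lambda>k. SOME f. f \<in> C k) ` Ks)" using \<open>countable Ks\<close> by simp
    fix f :: "'a \<Rightarrow>\<^sub>C complex" and \<rho> :: real assume "\<rho> > 0"
    then obtain l where "1 / real (Suc l) < \<rho> / 4"
      using reals_Archimedean[of "\<rho> / 4"] by (auto simp: inverse_eq_divide)
    then have l: "4 / real (Suc l) < \<rho>" by (simp add: field_simps)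
    have "continuous_on UNIV (apply_bcontfun f)" using apply_bcontfun[of f] by (simp add: bcontfun_def)
    then have "uniformly_continuous_on UNIV (apply_bcontfun f)" using comp by (rule compact_uniformly_continuous)
    then obtain \<delta> where \<delta>: "\<delta> > 0" "\<And>x y. dist y x < \<delta> \<Longrightarrow> dist (apply_bcontfun f y) (apply_bcontfun f x) < 1 / real (Suc l)"
      unfolding uniformly_continuous_on_def by (metis UNIV_I of_nat_0_less_iff zero_less_Suc zero_less_divide_1_iff)
    obtain j where j: "1 / real (Suc j) < \<delta>" using reals_Archimedean[OF \<delta>(1)] by (auto simp: inverse_eq_divide)
    have "\<exists>d\<in>Q. d \<in> ball (apply_bcontfun f x) (1 / real (Suc l))" for x by (rule Q(2)) auto
    then obtain h0 where h0: "\<And>x. h0 x \<in> Q" "\<And>x. dist (apply_bcontfun f x) (h0 x) < 1 / real (Suc l)"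
      unfolding mem_ball by metis
    define h where "h = restrict h0 (X j)"
    have "f \<in> C (j, l, h)" using \<delta>(2) j h0 by (auto simp: C_def h_def simp del: of_nat_Suc)
    then have "(SOME f. f \<in> C (j, l, h)) \<in> C (j, l, h)" by (rule someI)
    from close[OF \<open>f \<in> C (j, l, h)\<close> this] l have "dist f (SOME f. f \<in> C (j, l, h)) < \<rho>" by linarith
    moreover have "(j, l, h) \<in> Ks" using h0(1) by (auto simp: Ks_def h_def)
    ultimately show "\<exists>g\<in>(\<lambda>k. SOME f. f \<in> C k) ` Ks. dist f g < \<rho>" by blast
  qed
qed

lemma sampling_functions_open:
  fixes f :: "'a::metric_space \<Rightarrow>\<^sub>C complex"
  assumes comp: "compact (UNIV :: 'a set)" and f: "f \<in> sampling_functions"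
  obtains r \<delta> where "r < 1" "\<delta> > 0" "\<And>x. cmod (apply_bcontfun f x) \<le> r" "\<And>g. dist f g < \<delta> \<Longrightarrow> g \<in> sampling_functions"
proof -
  have "continuous_on UNIV (\<lambda>x. cmod (apply_bcontfun f x))"
    using apply_bcontfun[of f] by (intro continuous_on_norm) (simp add: bcontfun_def)
  from continuous_attains_sup[OF comp _ this] obtain x0 where x0: "\<And>x. cmod (apply_bcontfun f x) \<le> cmod (apply_bcontfun f x0)"
    by auto
  define r where "r = cmod (apply_bcontfun f x0)"
  have r: "r < 1" using f by (auto simp: r_def sampling_functions_def)
  show ?thesis
  proof (rule that[OF r, of "1 - r"])
    show "1 - r > 0" using r by simp
    show "cmod (apply_bcontfun f x) \<le> r" for x using x0 by (simp add: r_def)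
    fix g assume g: "dist f g < 1 - r"
    have "cmod (apply_bcontfun g x) < 1" for x
    proof -
      have "dist (apply_bcontfun f x) (apply_bcontfun g x) < 1 - r" using dist_bounded[of f x g] g by simp
      moreover have "cmod (apply_bcontfun g x) \<le> cmod (apply_bcontfun f x) + dist (apply_bcontfun f x) (apply_bcontfun g x)"
        by (metis dist_commute dist_norm norm_triangle_sub)
      ultimately show ?thesis using x0[of x] by (simp add: r_def)
    qed
    then show "g \<in> sampling_functions" by (simp add: sampling_functions_def)
  qed
qed

text \<open>The points of \<open>A\<close> that never return form a wandering set \<open>W\<close>:
  its preimages are disjoint and of equal measure, so in a finite measure space \<open>W\<close> is
  null.\<close>

lemma poincare_recurrence:
  fixes T :: "'a::topological_space \<Rightarrow> 'a"
  assumes M: "finite_measure M" "sets M = sets borel" and T: "T \<in> borel_measurable borel"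
    and pres: "\<And>A. A \<in> sets borel \<Longrightarrow> emeasure M (T -` A) = emeasure M A" and A: "A \<in> sets borel"
  shows "AE \<omega> in M. \<omega> \<in> A \<longrightarrow> (\<exists>q\<ge>1. (T ^^ q) \<omega> \<in> A)"
proof -
  interpret finite_measure M by (rule M)
  have sp: "space M = UNIV" using sets_eq_imp_space_eq[OF M(2)] by simp
  have vim: "(T ^^ q) -` B \<in> sets borel" if "B \<in> sets borel" for B q
  proof (induction q)
    case (Suc q)
    have "(T ^^ Suc q) -` B = T -` ((T ^^ q) -` B)" by (auto simp: funpow_swap1)
    then show ?case using measurable_sets[OF T Suc] by (simp del: funpow.simps)
  qed (use that in auto)
  have pr: "emeasure M ((T ^^ q) -` B) = emeasure M B" if "B \<in> sets borel" for B q
  proof (induction q)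
    case (Suc q)
    have "(T ^^ Suc q) -` B = T -` ((T ^^ q) -` B)" by (auto simp: funpow_swap1)
    then show ?case using pres[OF vim[OF that, of q]] Suc by (simp del: funpow.simps)
  qed simp
  define W where "W = A - (\<Union>q\<in>{1..}. (T ^^ q) -` A)"
  have W: "W \<in> sets borel" unfolding W_def using vim[OF A] by (intro sets.Diff A sets.countable_UN') auto
  have disj: "disjoint_family (\<lambda>q. (T ^^ q) -` W)"
  proof -
    have no: False if "(T ^^ p) x \<in> W" "(T ^^ q) x \<in> W" "p < q" for p q x
    proof -
      have "(T ^^ (q - p)) ((T ^^ p) x) = (T ^^ q) x"
        using that(3) by (metis add.commute comp_apply funpow_add le_add_diff_inverse less_imp_le)
      then show False using that unfolding W_def by (auto dest!: bspec[of _ _ "q - p"])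
    qed
    show ?thesis unfolding disjoint_family_on_def using no by (metis disjoint_iff linorder_neqE_nat vimage_eq)
  qed
  have "measure M W = 0"
  proof (rule ccontr)
    assume "measure M W \<noteq> 0"
    then have pos: "measure M W > 0" using measure_nonneg[of M W] by linarith
    obtain N where N: "measure M UNIV < real N * measure M W"
      using reals_Archimedean3[OF pos] by blast
    have "measure M (\<Union>q\<in>{..<N}. (T ^^ q) -` W) = (\<Sum>q<N. measure M ((T ^^ q) -` W))"
      by (rule finite_measure_finite_Union)
         (use disj vim[OF W] M(2) in \<open>auto simp: disjoint_family_on_def\<close>)
    also have "\<dots> = real N * measure M W" by (simp add: measure_def pr[OF W])
    finally have "measure M (\<Union>q\<in>{..<N}. (T ^^ q) -` W) = real N * measure M W" .
    moreover have "measure M (\<Union>q\<in>{..<N}. (T ^^ q) -` W) \<le> measure M UNIV"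
      using bounded_measure sp by metis
    ultimately show False using N by simp
  qed
  then have "W \<in> null_sets M" using W M(2) by (auto simp: emeasure_eq_measure)
  from AE_not_in[OF this] show ?thesis by eventually_elim (auto simp: W_def)
qed

lemma compact_countable_basis:
  assumes comp: "compact (UNIV :: 'a::metric_space set)"
  obtains B :: "'a::metric_space set set" where "countable B" "topological_basis B"
proof -
  have "\<exists>X. finite X \<and> (UNIV :: 'a set) \<subseteq> (\<Union>x\<in>X. ball x (1 / real (Suc j)))" for j
    using comp unfolding compact_eq_totally_bounded by (auto simp del: of_nat_Suc)
  then obtain X :: "nat \<Rightarrow> 'a set" where X: "\<And>j. finite (X j)" "\<And>j. (UNIV :: 'a set) \<subseteq> (\<Union>x\<in>X j. ball x (1 / real (Suc j)))"
    by metis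
  define B where "B = (\<Union>j. (\<lambda>x. ball x (1 / real (Suc j))) ` X j)"
  have "topological_basis B"
  proof (rule topological_basisI)
    fix U and x :: 'a assume "open U" "x \<in> U"
    then obtain e where e: "e > 0" "ball x e \<subseteq> U" using open_contains_ball by blast
    obtain j :: nat where j: "inverse (real (Suc j)) < e / 2" using reals_Archimedean[of "e / 2"] e(1) by auto
    obtain y where y: "y \<in> X j" "x \<in> ball y (1 / real (Suc j))" using X(2)[of j] by blast
    have "ball y (1 / real (Suc j)) \<subseteq> ball x e"
    proof
      fix z assume "z \<in> ball y (1 / real (Suc j))"
      then have "dist x z < e" using dist_triangle[of x z y] y(2) j by (simp add: dist_commute inverse_eq_divide)
      then show "z \<in> ball x e" by simp
    qed
    then show "\<exists>V\<in>B. x \<in> V \<and> V \<subseteq> U" using y e(2) by (intro bexI[of _ "ball y (1 / real (Suc j))"]) (auto simp: B_def)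
  qed (auto simp: B_def)
  moreover have "countable B" unfolding B_def using X(1) by (auto intro: countable_finite)
  ultimately show ?thesis by (rule that[rotated])
qed

text \<open>If density fails at \<open>\<omega>\<close>, then a whole ball of sampling functions,
  which may be taken from a countable list, is degenerate there; it remains to show that each set
  \<open>E k 1\<close> is null. Otherwise let \<open>d\<close> be the largest degeneracy for which
  some \<open>E k d\<close> has positive measure. Almost every point of such a set returns to it
  arbitrarily close to itself, and some function in the ball is not degenerate of order
  \<open>d + 1\<close> there; \<open>no_crossing\<close> rules this out.\<close>

lemma AE_point_dense:
  fixes T :: "'a::metric_space \<Rightarrow> 'a"
  assumes comp: "compact (UNIV :: 'a set)" and T: "bij T"
    and cT: "continuous_on UNIV T" "continuous_on UNIV (inv T)"
    and M: "finite_measure M" "sets M = sets borel"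
    and pres: "\<And>A. A \<in> sets borel \<Longrightarrow> emeasure M (T -` A) = emeasure M A"
    and aper: "AE \<omega> in M. \<forall>n. n \<noteq> 0 \<longrightarrow> int_iterate T n \<omega> \<noteq> \<omega>" and c: "c > 0"
  shows "AE \<omega> in M. \<forall>f\<in>sampling_functions. \<forall>\<rho>>0. \<exists>g\<in>sampling_functions. dist f g < \<rho> \<and> (\<forall>s. \<not> localized_at c (orbit_coeffs T g \<omega>) s)"
proof -
  obtain F :: "('a \<Rightarrow>\<^sub>C complex) set" where F: "countable F" "\<And>f \<rho>. \<rho> > 0 \<Longrightarrow> \<exists>g\<in>F. dist f g < \<rho>"
    using separable_bcontfun[OF comp] by blast
  \<comment> \<open>Only balls that consist entirely of sampling functions are listed; their centres
    come from the countable dense set.\<close>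
  define Ks where "Ks = {(g, j) \<in> F \<times> (UNIV :: nat set). \<forall>f. dist g f < 1 / real (Suc j) \<longrightarrow> f \<in> sampling_functions}"
  have cK: "countable Ks" by (rule countable_subset[of _ "F \<times> UNIV"]) (auto simp: Ks_def F)
  \<comment> \<open>Closed, hence measurable, because the degeneracy passes to limits and the
    coefficients depend continuously on the base point.\<close>
  define E where "E = (\<lambda>(g, j) d. {\<omega>. \<forall>f. dist g f < 1 / real (Suc j) \<longrightarrow> degeneracy_ge c (orbit_coeffs T f \<omega>) d})"
  have samp: "cmod (orbit_coeffs T f \<omega> n) < 1" if "f \<in> sampling_functions" for f \<omega> n
    using that by (auto simp: sampling_functions_def orbit_coeffs_def)
  have clE: "closed (E k d)" if "k \<in> Ks" for k d
  proof -
    obtain g j where k: "k = (g, j)" by (cases k)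
    show ?thesis unfolding closed_sequential_limits
    proof (intro allI impI, elim conjE)
      fix x l assume x: "\<forall>n. x n \<in> E k d" and lim: "x \<longlonglongrightarrow> l"
      have "degeneracy_ge c (orbit_coeffs T f l) d" if f: "dist g f < 1 / real (Suc j)" for f
      proof (rule Deg_closed[where a = "orbit_coeffs T f l" and A = "\<lambda>i. orbit_coeffs T f (x i)", OF c])
        have fs: "f \<in> sampling_functions" using \<open>k \<in> Ks\<close> f by (auto simp: k Ks_def)
        show "cmod (orbit_coeffs T f l n) < 1" "cmod (orbit_coeffs T f (x i) n) < 1" for n i by (rule samp[OF fs])+
        show "(\<lambda>i. orbit_coeffs T f (x i) n) \<longlonglongrightarrow> orbit_coeffs T f l n" for n
          using continuous_on_tendsto_compose[OF continuous_seq[OF cT] lim] by simp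
        show "degeneracy_ge c (orbit_coeffs T f (x i)) d" for i using x f by (auto simp: E_def k)
      qed
      then show "l \<in> E k d" by (auto simp: E_def k)
    qed
  qed
  then have mE: "E k d \<in> sets borel" if "k \<in> Ks" for k d using that by (intro borel_closed)
  have null: "E k 1 \<in> null_sets M" if k0: "k \<in> Ks" for k
  proof (rule ccontr)
    assume nn: "E k 1 \<notin> null_sets M"
    \<comment> \<open>Bounded by \<open>Deg_bound\<close>, so the maximum exists; it ranges over all
      balls of the list at once.\<close>
    define DD where "DD = {d. 1 \<le> d \<and> (\<exists>k\<in>Ks. E k d \<notin> null_sets M)}"
    have bd: "d \<le> nat \<lceil>(2 / c)\<^sup>2\<rceil>" if "d \<in> DD" for d
    proof -
      from that obtain k where k: "k \<in> Ks" "E k d \<notin> null_sets M" by (auto simp: DD_def)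
      then have "E k d \<noteq> {}" by auto
      then obtain \<omega> where "\<omega> \<in> E k d" by blast
      moreover obtain g j where kk: "k = (g, j)" by (cases k)
      ultimately have "degeneracy_ge c (orbit_coeffs T g \<omega>) d" by (auto simp: E_def)
      moreover have "g \<in> sampling_functions" using k(1) by (auto simp: kk Ks_def)
      ultimately have "real d \<le> (2 / c)\<^sup>2" using Deg_bound[where a = "orbit_coeffs T g \<omega>", OF c samp] by blast
      then show ?thesis by linarith
    qed
    have "finite DD" by (rule finite_subset[of _ "{..nat \<lceil>(2 / c)\<^sup>2\<rceil>}"]) (use bd in auto)
    moreover have "1 \<in> DD" using nn k0 by (auto simp: DD_def)
    ultimately have mx: "Max DD \<in> DD" "\<And>d. d \<in> DD \<Longrightarrow> d \<le> Max DD" by (auto intro: Max_in)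
    define d where "d = Max DD"
    from mx(1) obtain k1 where d1: "1 \<le> d" and k1: "k1 \<in> Ks" "E k1 d \<notin> null_sets M" by (auto simp: DD_def d_def)
    obtain g j where kk: "k1 = (g, j)" by (cases k1)
    have "Suc d \<notin> DD" using mx(2)[of "Suc d"] by (auto simp: d_def)
    then have "E k1 (Suc d) \<in> null_sets M" using k1(1) by (auto simp: DD_def)
    from AE_not_in[OF this] have ae1: "AE \<omega> in M. \<omega> \<notin> E k1 (Suc d)" .
    obtain Bs :: "'a set set" where Bs: "countable Bs" "topological_basis Bs" using compact_countable_basis[OF comp] by blast
    \<comment> \<open>Recurrence is applied to \<open>E k1 d \<inter> U\<close> for all
      \<open>U\<close> in a countable base. A return thus lands near the starting point and again in
      the set where the whole ball is degenerate.\<close>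
    have ae2: "AE \<omega> in M. \<forall>U\<in>Bs. \<omega> \<in> E k1 d \<inter> U \<longrightarrow> (\<exists>q\<ge>1. (T ^^ q) \<omega> \<in> E k1 d \<inter> U)"
    proof (subst AE_ball_countable[OF Bs(1)], intro ballI)
      fix U assume "U \<in> Bs"
      then have "open U" using Bs(2) by (auto simp: topological_basis_open)
      then have "E k1 d \<inter> U \<in> sets borel" using mE[OF k1(1), of d] by simp
      then show "AE \<omega> in M. \<omega> \<in> E k1 d \<inter> U \<longrightarrow> (\<exists>q\<ge>1. (T ^^ q) \<omega> \<in> E k1 d \<inter> U)"
        by (intro poincare_recurrence[where T = T] M borel_measurable_continuous_onI[OF cT(1)] pres)
    qed
    from ae1 ae2 aper have "AE \<omega> in M. \<omega> \<notin> E k1 d"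
    proof eventually_elim
      case (elim \<omega>)
      show "\<omega> \<notin> E k1 d"
      proof
        assume \<omega>: "\<omega> \<in> E k1 d"
        from elim(1) obtain f where f: "dist g f < 1 / real (Suc j)" "\<not> degeneracy_ge c (orbit_coeffs T f \<omega>) (Suc d)"
          by (auto simp: E_def kk)
        define \<rho> where "\<rho> = 1 / real (Suc j) - dist g f"
        have sub: "dist g h < 1 / real (Suc j)" if "dist f h < \<rho>" for h
          using dist_triangle[of g h f] that by (simp add: \<rho>_def)
        show False
        proof (rule no_crossing[OF T cT _ c d1 f(2)])
          show "\<rho> > 0" using f(1) by (simp add: \<rho>_def)
          show "int_iterate T n \<omega> \<noteq> \<omega>" if "n \<noteq> 0" for n using elim(3) that by blast
          show "h \<in> sampling_functions" if "dist f h < \<rho>" for h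
            using k1(1) sub[OF that] by (auto simp: Ks_def kk)
          show "degeneracy_ge c (orbit_coeffs T h \<omega>) d" if "dist f h < \<rho>" for h
            using \<omega> sub[OF that] by (auto simp: E_def kk)
          fix U assume U: "open U" "\<omega> \<in> U"
          then obtain U' where U': "U' \<in> Bs" "\<omega> \<in> U'" "U' \<subseteq> U" using topological_basisE[OF Bs(2)] by metis
          then obtain q where q: "q \<ge> 1" "(T ^^ q) \<omega> \<in> E k1 d" "(T ^^ q) \<omega> \<in> U'" using elim(2) \<omega> by auto
          have "int_iterate T (int q) \<omega> = (T ^^ q) \<omega>" by (simp add: int_iterate_def)
          then show "\<exists>q\<ge>1. int_iterate T (int q) \<omega> \<in> U \<and> (\<forall>h. dist f h < \<rho> \<longrightarrow> degeneracy_ge c (orbit_coeffs T h (int_iterate T (int q) \<omega>)) d)"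
            using q U'(3) sub by (intro exI[of _ q]) (auto simp: E_def kk)
        qed
      qed
    qed
    then have "E k1 d \<in> null_sets M"
      using AE_iff_null_sets[of "E k1 d" M] mE[OF k1(1)] M(2) by simp
    with k1(2) show False by simp
  qed
  have "(\<Union>k\<in>Ks. E k 1) \<in> null_sets M" by (rule null_sets_UN'[OF cK null])
  from AE_not_in[OF this] show ?thesis
  proof eventually_elim
    case (elim \<omega>)
    show ?case
    proof (rule ccontr)
      assume "\<not> ?thesis"
      then obtain f \<rho> where f: "f \<in> sampling_functions" "\<rho> > 0"
        and H: "\<And>g. g \<in> sampling_functions \<Longrightarrow> dist f g < \<rho> \<Longrightarrow> \<exists>s. localized_at c (orbit_coeffs T g \<omega>) s" by blast
      obtain r \<delta> where \<delta>: "\<delta> > 0" "\<And>g. dist f g < \<delta> \<Longrightarrow> g \<in> sampling_functions"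
        by (rule sampling_functions_open[OF comp f(1)]) blast
      have "0 < min \<rho> \<delta> / 2" using f(2) \<delta>(1) by simp
      from reals_Archimedean[OF this] obtain j where j: "1 / real (Suc j) < min \<rho> \<delta> / 2"
        unfolding inverse_eq_divide by blast
      obtain g where g: "g \<in> F" "dist f g < 1 / real (Suc j)" using F(2)[of "1 / real (Suc j)" f] by auto
      have sub: "dist f h < min \<rho> \<delta>" if "dist g h < 1 / real (Suc j)" for h
        using dist_triangle[of f h g] that g(2) j by linarith
      then have "(g, j) \<in> Ks" using g(1) \<delta>(2) by (auto simp: Ks_def)
      moreover have "\<omega> \<in> E (g, j) 1"
        using sub H \<delta>(2) by (auto simp: E_def Deg_1_iff[OF c, simplified])
      ultimately show False using elim by blast
    qed
  qed
qed

section \<open>Growth of solutions\<close>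

lemma fwd_wronskian:
  assumes "cmod s = 1" "\<And>n. cmod (a n) < 1"
  shows "Im (cnj (fwd a s v n) * fwd a s w n) = Im (cnj v * w)"
proof (induction n)
  case (Suc n)
  then show ?case unfolding fwd.simps szego_wronskian[OF assms(2,1)] .
qed simp

lemma fwd_surj:
  assumes "cmod s = 1" "\<And>n. cmod (a n) < 1"
  shows "\<exists>y. fwd a s y n = x"
proof (induction n arbitrary: x)
  case (Suc n)
  then obtain y where "fwd a s y n = szego (- a n) (cnj s) x" by blast
  then show ?case using szego_inverse'[OF assms(2,1)] by (intro exI[of _ y]) simp
qed simp

lemma fwd_Suc_shift: "fwd a s v (Suc n) = fwd (\<lambda>k. a (Suc k)) s (szego (a 0) s v) n"
  by (induction n) simp_all

lemma fwd_shift: "fwd a s v (m + n) = fwd (\<lambda>k. a (m + k)) s (fwd a s v m) n"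
  by (induction n) simp_all

lemma fwd_bound:
  assumes "\<And>n. cmod (a n) \<le> r" "r < 1" "cmod s = 1"
  shows "cmod (fwd a s v n) \<le> (2 / sqrt (1 - r\<^sup>2)) ^ n * cmod v"
proof (induction n)
  case (Suc n)
  have r0: "0 \<le> r" using assms(1)[of 0] norm_ge_zero order_trans by blast
  have "cmod (fwd a s v (Suc n)) \<le> 2 / sqrt (1 - r\<^sup>2) * cmod (fwd a s v n)"
    using szego_bound[OF assms(1,2,3)] by simp
  also have "\<dots> \<le> 2 / sqrt (1 - r\<^sup>2) * ((2 / sqrt (1 - r\<^sup>2)) ^ n * cmod v)"
    using Suc r0 assms(2) by (intro mult_left_mono) (auto simp: power_le_one abs_square_le_1)
  finally show ?case by (simp add: mult.assoc)
qed simp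

lemma fwd_lipschitz:
  assumes a: "\<And>n. cmod (a n) \<le> r" "r < 1" and s: "cmod s = 1" "cmod t = 1" and C: "C = 2 / sqrt (1 - r\<^sup>2)"
  shows "cmod (fwd a s v n - fwd a t v n) \<le> real n * C ^ n * cmod (s - t) * cmod v"
proof (induction n)
  case (Suc n)
  have r0: "0 \<le> r" using a(1)[of 0] norm_ge_zero order_trans by blast
  have p: "0 < sqrt (1 - r\<^sup>2)" using r0 a(2) by (simp add: abs_square_less_1)
  have C0: "0 \<le> C" using p by (simp add: C)
  have le: "sqrt (1 - r\<^sup>2) \<le> sqrt (1 - (cmod (a n))\<^sup>2)" using a(1) by (simp add: power_mono)
  define x y where "x = fwd a s v n" and "y = fwd a t v n"
  have "szego (a n) s x - szego (a n) t y = szego (a n) s (x - y) + (s - t) * y / complex_of_real (sqrt (1 - (cmod (a n))\<^sup>2))"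
    by (simp add: szego_def algebra_simps add_divide_distrib diff_divide_distrib)
  then have "cmod (szego (a n) s x - szego (a n) t y) \<le> cmod (szego (a n) s (x - y)) + cmod ((s - t) * y / complex_of_real (sqrt (1 - (cmod (a n))\<^sup>2)))"
    by (simp only: norm_triangle_ineq)
  also have "\<dots> \<le> C * cmod (x - y) + C * (cmod (s - t) * cmod y)"
  proof (rule add_mono)
    show "cmod (szego (a n) s (x - y)) \<le> C * cmod (x - y)" unfolding C by (rule szego_bound[OF a s(1)])
    have "cmod ((s - t) * y / complex_of_real (sqrt (1 - (cmod (a n))\<^sup>2))) = cmod (s - t) * cmod y / sqrt (1 - (cmod (a n))\<^sup>2)"
      using p le by (simp add: norm_mult norm_divide)
    also have "\<dots> \<le> (2 * (cmod (s - t) * cmod y)) / sqrt (1 - r\<^sup>2)" using p le by (intro frac_le) auto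
    finally show "cmod ((s - t) * y / complex_of_real (sqrt (1 - (cmod (a n))\<^sup>2))) \<le> C * (cmod (s - t) * cmod y)"
      by (simp add: C)
  qed
  also have "\<dots> \<le> C * (real n * C ^ n * cmod (s - t) * cmod v) + C * (cmod (s - t) * (C ^ n * cmod v))"
    using Suc fwd_bound[where a = a and v = v and n = n, OF a s(2)] C0 by (intro add_mono mult_left_mono) (auto simp: x_def y_def C)
  also have "\<dots> = real (Suc n) * C ^ Suc n * cmod (s - t) * cmod v" by (simp add: algebra_simps)
  finally show ?case by (simp add: x_def y_def)
qed simp

text \<open>Moving \<open>a\<close> away from the point \<open>u\<close> of the unit circle that is aligned with \<open>x\<close> stretches the
  image of \<open>x\<close> without turning it.\<close>

lemma boost:
  assumes a: "cmod a \<le> r" and r: "r + \<delta> < 1" and \<delta>: "0 < \<delta>" and s: "cmod s = 1"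
  obtains a' t where "cmod (a' - a) \<le> \<delta>" "sqrt (1 + \<delta> / 2) \<le> t" "szego a' s x = complex_of_real t * szego a s x"
proof (cases "x = 0")
  case True
  then show ?thesis using that[of a "sqrt (1 + \<delta> / 2)"] \<delta> by simp
next
  case False
  define \<tau> where "\<tau> = 1 + \<delta> / 2"
  \<comment> \<open>The point of the unit circle with \<open>cnj u * cnj x = s * x\<close>. The new
    coefficient lies on the line through \<open>u\<close> and \<open>a\<close>, beyond
    \<open>a\<close>, so the numerator of the step is only multiplied by the real factor
    \<open>\<tau>\<close>.\<close>
  define u where "u = cnj (s * x / cnj x)"
  have u: "cmod u = 1" using False s by (simp add: u_def norm_mult norm_divide)
  define a' where "a' = complex_of_real \<tau> * a - complex_of_real (\<tau> - 1) * u"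
  have "a' - a = complex_of_real (\<delta> / 2) * (a - u)" by (simp add: a'_def \<tau>_def algebra_simps)
  then have "cmod (a' - a) = cmod (complex_of_real (\<delta> / 2)) * cmod (a - u)" by (simp only: norm_mult)
  also have "\<dots> = \<delta> / 2 * cmod (a - u)" using \<delta> by simp
  also have "\<dots> \<le> \<delta> / 2 * 2"
    using \<delta> a r u norm_triangle_ineq4[of a u] by (intro mult_left_mono) auto
  finally have d: "cmod (a' - a) \<le> \<delta>" by simp
  have "cmod a' \<le> cmod a + cmod (a' - a)" by (metis add.commute diff_add_cancel norm_triangle_ineq)
  then have a'1: "cmod a' < 1" using d a r by linarith
  have a1: "cmod a < 1" using a r \<delta> by linarith
  define R R' where "R = sqrt (1 - (cmod a)\<^sup>2)" and "R' = sqrt (1 - (cmod a')\<^sup>2)"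
  have R: "R > 0" "R' > 0" using rho_pos a1 a'1 by (auto simp: R_def R'_def)
  \<comment> \<open>The value of a squared norm on a line through \<open>u\<close> and
    \<open>a\<close>. As \<open>u\<close> has modulus 1, dropping the last, nonnegative term gives
    \<open>1 - (cmod a')\<^sup>2 \<le> \<tau> * (1 - (cmod a)\<^sup>2)\<close>, and the stretching
    factor is at least \<open>sqrt \<tau>\<close>.\<close>
  have "(cmod a')\<^sup>2 = \<tau> * (cmod a)\<^sup>2 - (\<tau> - 1) * (cmod u)\<^sup>2 + \<tau> * (\<tau> - 1) * (cmod (a - u))\<^sup>2"
    unfolding cmod_power2 by (simp add: a'_def power2_eq_square algebra_simps)
  moreover have "0 \<le> \<tau> * (\<tau> - 1) * (cmod (a - u))\<^sup>2" using \<delta> by (simp add: \<tau>_def)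
  ultimately have "1 - (cmod a')\<^sup>2 \<le> \<tau> * (1 - (cmod a)\<^sup>2)" using u by (simp add: algebra_simps)
  then have R2: "R'\<^sup>2 \<le> \<tau> * R\<^sup>2" using R unfolding R_def R'_def by simp
  define t where "t = \<tau> * R / R'"
  have t0: "t \<ge> 0" using R \<delta> by (simp add: t_def \<tau>_def)
  have \<tau>0: "\<tau> > 0" using \<delta> by (simp add: \<tau>_def)
  have "\<tau> * R'\<^sup>2 \<le> \<tau> * (\<tau> * R\<^sup>2)" using R2 \<tau>0 by simp
  then have "\<tau> \<le> t\<^sup>2" using R by (simp add: t_def field_simps power2_eq_square)
  then have "sqrt \<tau> \<le> t" using t0 real_le_lsqrt by (simp add: real_le_lsqrt \<tau>0 less_imp_le)
  moreover have "cnj u * cnj x = s * x" using False by (simp add: u_def)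
  then have "complex_of_real (\<tau> - 1) * (cnj u * cnj x) = complex_of_real (\<tau> - 1) * (s * x)" by simp
  then have "s * x - cnj a' * cnj x = complex_of_real \<tau> * (s * x - cnj a * cnj x)"
    by (simp add: a'_def algebra_simps)
  then have "szego a' s x = complex_of_real t * szego a s x"
    using R by (simp add: szego_def R_def[symmetric] R'_def[symmetric] t_def)
  ultimately show ?thesis using that[of a' t] d by (simp add: \<tau>_def)
qed

text \<open>A boost stretches a given vector, but the unperturbed recursion might contract it
  meanwhile. The first coefficient is used to avoid this: by the Wronskian some unit vector is not
  contracted by the next \<open>m\<close> steps, and changing the first coefficient moves the image
  of \<open>w\<close> along it, so one of two choices is not contracted by more than a factor of
  order \<open>\<delta>\<close>. The \<open>m\<close> boosts then compound without turning the
  vector.\<close>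

lemma block_growth:
  assumes r: "r + \<delta> < 1" and \<delta>: "0 < \<delta>"
  shows "\<exists>K\<ge>1. \<forall>a s w. (\<forall>n. cmod (a n) \<le> r) \<longrightarrow> cmod s = 1 \<longrightarrow> cmod w = 1 \<longrightarrow>
    (\<exists>a'. (\<forall>n. cmod (a' n - a n) \<le> \<delta>) \<and> \<Lambda> \<le> cmod (fwd a' s w K))"
proof -
  define q where "q = sqrt (1 + \<delta> / 2)"
  have q: "q > 1" using \<delta> by (simp add: q_def)
  obtain m where m: "\<Lambda> / (\<delta> / 2) < q ^ m" using real_arch_pow[OF q] by blast
  then have m: "\<Lambda> < q ^ m * (\<delta> / 2)" using \<delta> by (simp add: field_simps)
  show ?thesis
  proof (intro exI[of _ "Suc m"] conjI allI impI)
    fix a :: "nat \<Rightarrow> complex" and s w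
    assume a: "\<forall>n. cmod (a n) \<le> r" and s: "cmod s = 1" and w: "cmod w = 1"
    define b where "b n = a (Suc n)" for n
    have b: "cmod (b n) \<le> r" for n using a by (simp add: b_def)
    have b1: "cmod (b n) < 1" for n using b[of n] r \<delta> by linarith
    have "Im (cnj (fwd b s 1 m) * fwd b s \<i> m) = 1" using fwd_wronskian[where a = b, OF s b1] by simp
    then have "1 \<le> cmod (fwd b s 1 m) * cmod (fwd b s \<i> m)"
      using abs_Im_le_cmod[of "cnj (fwd b s 1 m) * fwd b s \<i> m"] by (simp add: norm_mult)
    have "1 \<le> cmod (fwd b s 1 m) \<or> 1 \<le> cmod (fwd b s \<i> m)"
    proof (rule ccontr)
      assume "\<not> ?thesis"
      then have "cmod (fwd b s 1 m) * cmod (fwd b s \<i> m) < 1 * 1" by (intro mult_strict_mono') auto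
      with \<open>1 \<le> cmod (fwd b s 1 m) * cmod (fwd b s \<i> m)\<close> show False by simp
    qed
    then obtain e where e: "cmod e = 1" "1 \<le> cmod (fwd b s e m)" by (metis norm_ii norm_one)
    \<comment> \<open>Chosen so that the unnormalised image \<open>y\<close> changes by exactly
      \<open>\<delta> * e\<close>. The images under \<open>a 0\<close> and
      \<open>a 0 + \<beta>\<close> then differ by at least \<open>\<delta>\<close> after
      \<open>m\<close> steps, and one of them has norm at least \<open>\<delta> / 2\<close>.\<close>
    define \<beta> where "\<beta> = cnj (- complex_of_real \<delta> * e / cnj w)"
    have w0: "w \<noteq> 0" using w by auto
    have \<beta>: "cmod \<beta> = \<delta>" using w e(1) \<delta> by (simp add: \<beta>_def norm_mult norm_divide)
    define y where "y c = s * w - cnj c * cnj w" for c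
    have "y (a 0 + \<beta>) = y (a 0) + complex_of_real \<delta> * e"
      using w0 by (simp add: y_def \<beta>_def algebra_simps)
    then have "fwd b s (y (a 0 + \<beta>)) m - fwd b s (y (a 0)) m = complex_of_real \<delta> * fwd b s e m"
      by (simp add: fwd_add fwd_scale)
    then have "\<delta> \<le> cmod (fwd b s (y (a 0 + \<beta>)) m - fwd b s (y (a 0)) m)"
      using \<delta> e(2) by (simp add: norm_mult)
    also have "\<dots> \<le> cmod (fwd b s (y (a 0 + \<beta>)) m) + cmod (fwd b s (y (a 0)) m)" by (rule norm_triangle_ineq4)
    finally have "\<delta> / 2 \<le> cmod (fwd b s (y (a 0 + \<beta>)) m) \<or> \<delta> / 2 \<le> cmod (fwd b s (y (a 0)) m)" by linarith
    then obtain c where c: "c = a 0 \<or> c = a 0 + \<beta>" "\<delta> / 2 \<le> cmod (fwd b s (y c) m)" by blast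
    have ca: "cmod (c - a 0) \<le> \<delta>" using c(1) \<beta> \<delta> by auto
    have "cmod c \<le> cmod (a 0) + cmod (c - a 0)" by (metis add.commute diff_add_cancel norm_triangle_ineq)
    then have c1: "cmod c < 1" using ca a[rule_format, of 0] r by linarith
    define R where "R = sqrt (1 - (cmod c)\<^sup>2)"
    have R: "0 < R" "R \<le> 1" using rho_pos[OF c1] by (simp_all add: R_def)
    define w' where "w' = szego c s w"
    have "y c = complex_of_real R * w'" using R by (simp add: w'_def szego_def R_def[symmetric] y_def)
    then have "\<delta> / 2 \<le> R * cmod (fwd b s w' m)" using c(2) R by (simp add: fwd_scale norm_mult)
    also have "\<dots> \<le> 1 * cmod (fwd b s w' m)" using R by (intro mult_right_mono) auto
    finally have w': "\<delta> / 2 \<le> cmod (fwd b s w' m)" by simp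
    have "\<exists>a' t. cmod (a' - b n) \<le> \<delta> \<and> q \<le> t \<and> szego a' s (fwd b s w' n) = complex_of_real t * szego (b n) s (fwd b s w' n)" for n
      using boost[OF b r \<delta> s] unfolding q_def by metis
    then obtain b' t where b': "\<And>n. cmod (b' n - b n) \<le> \<delta>" "\<And>n. q \<le> t n"
      "\<And>n. szego (b' n) s (fwd b s w' n) = complex_of_real (t n) * szego (b n) s (fwd b s w' n)" by metis
    have P: "\<exists>P\<ge>q ^ n. fwd b' s w' n = complex_of_real P * fwd b s w' n" for n
    proof (induction n)
      case 0
      show ?case by (intro exI[of _ 1]) simp
    next
      case (Suc n)
      then obtain P where P: "P \<ge> q ^ n" "fwd b' s w' n = complex_of_real P * fwd b s w' n" by blast
      have "0 \<le> P" using P(1) q by (meson less_imp_le order_trans zero_le_power zero_less_one)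
      then have "q ^ n * q \<le> P * t n" using P(1) b'(2)[of n] q by (intro mult_mono) auto
      then have "q ^ Suc n \<le> P * t n" by (simp add: mult.commute)
      moreover have "fwd b' s w' (Suc n) = complex_of_real (P * t n) * fwd b s w' (Suc n)"
        using b'(3)[of n] by (simp add: P(2) szego_scale)
      ultimately show ?case by blast
    qed
    from P[of m] obtain P where P: "P \<ge> q ^ m" "fwd b' s w' m = complex_of_real P * fwd b s w' m" by blast
    define a' where "a' n = (case n of 0 \<Rightarrow> c | Suc n \<Rightarrow> b' n)" for n
    show "\<exists>a'. (\<forall>n. cmod (a' n - a n) \<le> \<delta>) \<and> \<Lambda> \<le> cmod (fwd a' s w (Suc m))"
    proof (intro exI[of _ a'] conjI allI)
      show "cmod (a' n - a n) \<le> \<delta>" for n using ca b'(1) by (auto simp: a'_def b_def split: nat.split)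
      have "fwd a' s w (Suc m) = fwd b' s w' m" unfolding fwd_Suc_shift by (simp add: a'_def w'_def)
      moreover have "q ^ m * (\<delta> / 2) \<le> P * cmod (fwd b s w' m)"
        using P(1) w' q \<delta> by (intro mult_mono) (auto intro: order_trans[OF _ P(1)])
      moreover have "0 \<le> P" using P(1) q by (meson less_imp_le order_trans zero_le_power zero_less_one)
      ultimately show "\<Lambda> \<le> cmod (fwd a' s w (Suc m))" using m by (simp add: P(2) norm_mult)
    qed
  qed simp
qed

text \<open>Uniform hyperbolicity on an arc: relative to the frames \<open>w\<close>, the block matrices at \<open>s\<^sub>0\<close> are upper
  triangular, so the cone \<open>\<bar>Im\<bar> \<le> \<epsilon> Re\<close> is mapped into itself and stretched, for all \<open>s\<close> close to \<open>s\<^sub>0\<close>.\<close>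

lemma hyperbolic_arc:
  assumes r: "r + \<delta> < 1" and \<delta>: "0 < \<delta>" and r0: "0 \<le> r"
  shows "\<exists>K\<ge>1. \<exists>\<eta>>0. \<forall>J a s0. (\<forall>n. cmod (a n) \<le> r) \<longrightarrow> cmod s0 = 1 \<longrightarrow>
    (\<exists>a'. (\<forall>n. cmod (a' n - a n) \<le> \<delta>) \<and> (\<forall>s. cmod s = 1 \<longrightarrow> cmod (s - s0) \<le> \<eta> \<longrightarrow> 2 ^ J \<le> cmod (fwd a' s 1 (J * K))))"
proof -
  \<comment> \<open>Growth 4 per block at \<open>s0\<close>: in the cone estimate one unit goes to
    the off-diagonal entry and one to the change from \<open>s0\<close> to \<open>s\<close>, so a
    factor 2 remains.\<close>
  obtain K where K1: "K \<ge> 1" and K: "\<And>a s w. (\<And>n. cmod (a n) \<le> r) \<Longrightarrow> cmod s = 1 \<Longrightarrow> cmod w = 1 \<Longrightarrow>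
    \<exists>a'. (\<forall>n. cmod (a' n - a n) \<le> \<delta>) \<and> 4 \<le> cmod (fwd a' s w K)"
    using block_growth[OF r \<delta>, of 4] by blast
  define r' where "r' = r + \<delta>"
  define C where "C = 2 / sqrt (1 - r'\<^sup>2)"
  have r': "0 \<le> r'" "r' < 1" using r r0 \<delta> by (auto simp: r'_def)
  have p: "0 < sqrt (1 - r'\<^sup>2)" "sqrt (1 - r'\<^sup>2) \<le> 1" using r' by (auto simp: abs_square_less_1)
  have "2 \<le> C" using p by (simp add: C_def field_simps)
  then have CK: "1 \<le> C ^ K" by (simp add: one_le_power)
  \<comment> \<open>The off-diagonal entry of a block is at most \<open>C ^ K\<close>, so with this
    slope of the cone it contributes at most \<open>A\<close>. The radius \<open>\<eta>\<close>
    below is chosen so that the Lipschitz error is at most \<open>\<epsilon> * A\<close>.\<close>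
  define \<epsilon> where "\<epsilon> = 1 / C ^ K"
  define L where "L = real K * C ^ K"
  have \<epsilon>: "0 < \<epsilon>" "\<epsilon> \<le> 1" using CK by (auto simp: \<epsilon>_def)
  have "1 * 1 \<le> L" unfolding L_def using K1 CK by (intro mult_mono) auto
  then have L: "1 \<le> L" by simp
  define \<eta> where "\<eta> = \<epsilon> / (2 * L)"
  have \<eta>: "\<eta> > 0" using \<epsilon> L by (simp add: \<eta>_def)
  have L\<eta>: "2 * (L * \<eta>) = \<epsilon>" using L by (simp add: \<eta>_def)
  have near_r: "cmod (a' n) \<le> r'" if "\<And>n. cmod (a n) \<le> r" "\<And>n. cmod (a' n - a n) \<le> \<delta>" for a a' :: "nat \<Rightarrow> complex" and n
  proof -
    have "cmod (a' n) \<le> cmod (a n) + cmod (a' n - a n)" by (metis add.commute diff_add_cancel norm_triangle_ineq)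
    then show ?thesis using that[of n] by (simp add: r'_def)
  qed
  have main: "\<exists>a' w. cmod w = 1 \<and> (\<forall>n. cmod (a' n - a n) \<le> \<delta>) \<and> (\<forall>s. cmod s = 1 \<longrightarrow> cmod (s - s0) \<le> \<eta> \<longrightarrow>
      2 ^ J \<le> Re (cnj w * fwd a' s 1 (J * K)) \<and> \<bar>Im (cnj w * fwd a' s 1 (J * K))\<bar> \<le> \<epsilon> * Re (cnj w * fwd a' s 1 (J * K)))"
    if a: "\<And>n. cmod (a n) \<le> r" and s0: "cmod s0 = 1" for J a s0
  proof (induction J)
    case 0
    show ?case by (intro exI[of _ a] exI[of _ 1]) (use \<delta> \<epsilon> in auto)
  next
    case (Suc J)
    then obtain a' w where w: "cmod w = 1" and a': "\<And>n. cmod (a' n - a n) \<le> \<delta>"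
      and H: "\<And>s. cmod s = 1 \<Longrightarrow> cmod (s - s0) \<le> \<eta> \<Longrightarrow>
      2 ^ J \<le> Re (cnj w * fwd a' s 1 (J * K)) \<and> \<bar>Im (cnj w * fwd a' s 1 (J * K))\<bar> \<le> \<epsilon> * Re (cnj w * fwd a' s 1 (J * K))" by blast
    obtain c where c: "\<And>n. cmod (c n - a (J * K + n)) \<le> \<delta>" "4 \<le> cmod (fwd c s0 w K)"
      using K[of "\<lambda>n. a (J * K + n)" s0 w, OF a s0 w] by blast
    have cr: "cmod (c n) \<le> r'" for n using near_r[of "\<lambda>n. a (J * K + n)" c, OF a c(1)] .
    have c1: "cmod (c n) < 1" for n using cr[of n] r' by linarith
    define a'' where "a'' n = (if n < J * K then a' n else c (n - J * K))" for n
    define g where "g = cmod (fwd c s0 w K)"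
    have g: "g \<ge> 4" using c(2) by (simp add: g_def)
    define w' where "w' = fwd c s0 w K / complex_of_real g"
    have "fwd c s0 w K \<noteq> 0" using c(2) by (metis norm_zero not_numeral_le_zero)
    then have w': "cmod w' = 1" using g by (simp add: w'_def norm_divide g_def)
    have Tw: "fwd c s0 w K = complex_of_real g * w'" using g by (simp add: w'_def)
    \<comment> \<open>The image of the second frame vector \<open>\<i> * w\<close>, read in the new
      frame: \<open>Re b'\<close> is the off-diagonal entry, and by area preservation
      \<open>Im b' = 1 / g\<close> is the contracting one.\<close>
    define b' where "b' = cnj w' * fwd c s0 (\<i> * w) K"
    have "Im (cnj (fwd c s0 w K) * fwd c s0 (\<i> * w) K) = Im (cnj w * (\<i> * w))"
      by (rule fwd_wronskian[OF s0 c1])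
    also have "cnj w * (\<i> * w) = \<i>" using unit_mult_cnj(2)[OF w] by (simp add: algebra_simps)
    finally have d': "g * Im b' = 1" by (simp add: Tw b'_def algebra_simps)
    have "cmod (fwd c s0 (\<i> * w) K) \<le> C ^ K * cmod (\<i> * w)"
      unfolding C_def by (rule fwd_bound[OF cr r'(2) s0])
    then have "cmod b' \<le> C ^ K" using w w' by (simp add: b'_def norm_mult)
    then have b': "\<bar>Re b'\<bar> \<le> C ^ K" using abs_Re_le_cmod order_trans by blast
    show ?case
    proof (intro exI[of _ a''] exI[of _ w'] conjI allI impI)
      show "cmod w' = 1" by (rule w')
      show "cmod (a'' n - a n) \<le> \<delta>" for n using a'[of n] c(1)[of "n - J * K"] by (auto simp: a''_def)
      fix s assume s: "cmod s = 1" "cmod (s - s0) \<le> \<eta>"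
      define v where "v = fwd a' s 1 (J * K)"
      define A B where "A = Re (cnj w * v)" and "B = Im (cnj w * v)"
      have A: "2 ^ J \<le> A" "\<bar>B\<bar> \<le> \<epsilon> * A" using H[OF s] by (simp_all add: A_def B_def v_def)
      have A0: "0 \<le> A" using A(1) by (meson order_trans zero_le_numeral zero_le_power)
      have "cnj w * v = complex_of_real A + \<i> * complex_of_real B" by (simp add: A_def B_def complex_eq_iff)
      then have "w * (cnj w * v) = w * (complex_of_real A + \<i> * complex_of_real B)" by simp
      moreover have "w * (cnj w * v) = v"
        by (simp only: mult.assoc[symmetric] unit_mult_cnj(1)[OF w] mult_1_left)
      ultimately have v: "v = complex_of_real A * w + complex_of_real B * (\<i> * w)"
        by (simp add: algebra_simps)
      have "fwd a'' s 1 (J * K) = v" unfolding v_def by (rule fwd_cong) (simp add: a''_def)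
      then have F: "fwd a'' s 1 (Suc J * K) = fwd c s v K"
        using fwd_shift[of a'' s 1 "J * K" K] by (simp add: a''_def add.commute)
      define err where "err = cnj w' * (fwd c s v K - fwd c s0 v K)"
      have "cmod v \<le> A + \<bar>B\<bar>" unfolding v
        by (rule order_trans[OF norm_triangle_ineq]) (use w A0 in \<open>simp add: norm_mult\<close>)
      also have "\<dots> \<le> A + 1 * A" using A(2) mult_right_mono[OF \<epsilon>(2) A0] by simp
      finally have cv: "cmod v \<le> 2 * A" by simp
      have "cmod err = cmod (fwd c s v K - fwd c s0 v K)" using w' by (simp add: err_def norm_mult)
      also have "\<dots> \<le> real K * C ^ K * cmod (s - s0) * cmod v" by (rule fwd_lipschitz[OF cr r'(2) s(1) s0 C_def])
      also have "\<dots> \<le> L * \<eta> * (2 * A)"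
        unfolding L_def[symmetric] using s(2) cv L A0 \<eta> by (intro mult_mono) auto
      also have "L * \<eta> * (2 * A) = (2 * (L * \<eta>)) * A" by simp
      also have "\<dots> = \<epsilon> * A" unfolding L\<eta> ..
      finally have err: "cmod err \<le> \<epsilon> * A" .
      have "cnj w' * fwd c s0 v K = complex_of_real (A * g) * (cnj w' * w') + complex_of_real B * b'"
        unfolding v fwd_add fwd_scale Tw b'_def by (simp add: algebra_simps)
      then have eq: "cnj w' * fwd c s v K = complex_of_real (A * g) + complex_of_real B * b' + err"
        using unit_mult_cnj(2)[OF w'] by (simp add: err_def algebra_simps)
      have "\<bar>B * Re b'\<bar> \<le> (\<epsilon> * A) * C ^ K" unfolding abs_mult using A b' A0 \<epsilon> by (intro mult_mono) auto
      also have "C ^ K \<noteq> 0" using CK by linarith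
      then have "(\<epsilon> * A) * C ^ K = A" by (simp add: \<epsilon>_def)
      finally have BRe: "\<bar>B * Re b'\<bar> \<le> A" .
      have "4 * A \<le> A * g" using mult_left_mono[OF g A0] by simp
      moreover have "\<bar>Re err\<bar> \<le> A" using abs_Re_le_cmod[of err] err mult_right_mono[OF \<epsilon>(2) A0] by linarith
      moreover have "Re (cnj w' * fwd c s v K) = A * g + B * Re b' + Re err" by (simp add: eq)
      ultimately have Re2: "2 * A \<le> Re (cnj w' * fwd c s v K)" using BRe by linarith
      have "\<bar>Im b'\<bar> \<le> 1"
      proof -
        have "Im b' = 1 / g" using d' g by (simp add: field_simps)
        then show ?thesis using g by simp
      qed
      then have "\<bar>B * Im b'\<bar> \<le> \<bar>B\<bar> * 1" unfolding abs_mult by (intro mult_left_mono) auto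
      then have "\<bar>B * Im b'\<bar> \<le> \<epsilon> * A" using A(2) by simp
      moreover have "\<bar>Im err\<bar> \<le> \<epsilon> * A" using abs_Im_le_cmod[of err] err by linarith
      moreover have "Im (cnj w' * fwd c s v K) = B * Im b' + Im err" by (simp add: eq)
      ultimately have "\<bar>Im (cnj w' * fwd c s v K)\<bar> \<le> \<epsilon> * (2 * A)" by linarith
      also have "\<dots> \<le> \<epsilon> * Re (cnj w' * fwd c s v K)" using Re2 \<epsilon> by (intro mult_left_mono) auto
      finally show "\<bar>Im (cnj w' * fwd a'' s 1 (Suc J * K))\<bar> \<le> \<epsilon> * Re (cnj w' * fwd a'' s 1 (Suc J * K))" unfolding F .
      show "2 ^ Suc J \<le> Re (cnj w' * fwd a'' s 1 (Suc J * K))" unfolding F using Re2 A(1) by simp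
    qed
  qed
  show ?thesis
  proof (intro exI[of _ K] exI[of _ \<eta>] conjI allI impI K1 \<eta>)
    fix J :: nat and a :: "nat \<Rightarrow> complex" and s0 assume "\<forall>n. cmod (a n) \<le> r" "cmod s0 = 1"
    then obtain a' w where w: "cmod w = 1" and a': "\<And>n. cmod (a' n - a n) \<le> \<delta>"
      and H: "\<And>s. cmod s = 1 \<Longrightarrow> cmod (s - s0) \<le> \<eta> \<Longrightarrow> 2 ^ J \<le> Re (cnj w * fwd a' s 1 (J * K))"
      using main[of a s0 J] by blast
    have "2 ^ J \<le> cmod (fwd a' s 1 (J * K))" if "cmod s = 1" "cmod (s - s0) \<le> \<eta>" for s
      using H[OF that] complex_Re_le_cmod[of "cnj w * fwd a' s 1 (J * K)"] w by (simp add: norm_mult)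
    then show "\<exists>a'. (\<forall>n. cmod (a' n - a n) \<le> \<delta>) \<and> (\<forall>s. cmod s = 1 \<longrightarrow> cmod (s - s0) \<le> \<eta> \<longrightarrow> 2 ^ J \<le> cmod (fwd a' s 1 (J * K)))"
      using a' by blast
  qed
qed

text \<open>Area preservation: if \<open>e\<close> is stretched to \<open>g\<close>, the vector
  whose image is \<open>\<i> * g\<close> has to be contracted by the same factor.\<close>

lemma contracted_vector:
  assumes s: "cmod s = 1" and a: "\<And>n. cmod (a n) < 1" and L: "0 < L" and e: "e \<noteq> 0" "L * cmod e \<le> cmod (fwd a s e m)"
  obtains y where "cmod y = 1" "cmod (fwd a s y m) \<le> 1 / L"
proof -
  define g where "g = fwd a s e m"
  have g: "g \<noteq> 0" using e L by (auto simp: g_def mult_le_0_iff)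
  obtain y where y: "fwd a s y m = \<i> * g" using fwd_surj[where a = a, OF s a] by blast
  have "Im (cnj e * y) = Im (cnj g * (\<i> * g))"
    using fwd_wronskian[where a = a and v = e and w = y and n = m, OF s a] y by (simp add: g_def)
  also have "cnj g * (\<i> * g) = \<i> * complex_of_real ((cmod g)\<^sup>2)" by (simp only: complex_norm_square) (simp add: algebra_simps)
  finally have "(cmod g)\<^sup>2 \<le> cmod e * cmod y"
    using abs_Im_le_cmod[of "cnj e * y"] by (simp add: norm_mult)
  moreover have "L * cmod e * cmod y \<le> cmod g * cmod y" using e(2) by (intro mult_right_mono) (auto simp: g_def)
  moreover have "L * (cmod g)\<^sup>2 \<le> L * (cmod e * cmod y)" using calculation(1) L by (intro mult_left_mono) auto
  ultimately have "L * (cmod g)\<^sup>2 \<le> cmod g * cmod y"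
    unfolding mult.assoc by linarith
  then have gy: "L * cmod g \<le> cmod y" using g by (simp add: power2_eq_square)
  have "0 < L * cmod g" using L g by simp
  then have y0: "0 < cmod y" using gy by linarith
  define y' where "y' = complex_of_real (1 / cmod y) * y"
  have "cmod y' = 1" using y0 by (simp add: y'_def norm_divide)
  moreover have "cmod (fwd a s y' m) = cmod g / cmod y" unfolding y'_def fwd_scale y by (simp add: norm_mult norm_divide)
  moreover have "cmod g / cmod y \<le> 1 / L" using gy y0 L by (simp add: field_simps)
  ultimately show ?thesis using that by simp
qed

text \<open>\<open>hyperbolic_arc\<close> handles one short arc; finitely many arcs cover the
  circle, and each gets its own block of length \<open>J * K\<close>, placed one after another. For
  given \<open>s\<close> only the block of its arc is known to stretch, and earlier blocks may undo
  this. But if a block stretches by \<open>2 ^ J\<close>, then the recursion from the origin up to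
  its entrance or up to its exit has norm at least the square root of that. This is why the site
  \<open>m\<close> depends on \<open>s\<close>.\<close>

lemma half_line_growth:
  assumes r: "r + \<delta> < 1" and \<delta>: "0 < \<delta>" and r0: "0 \<le> r"
  shows "\<exists>D\<ge>1. \<forall>J\<ge>1. \<forall>a. (\<forall>n. cmod (a n) \<le> r) \<longrightarrow> (\<exists>a'. (\<forall>n. cmod (a' n - a n) \<le> \<delta>) \<and>
    (\<forall>s. cmod s = 1 \<longrightarrow> (\<exists>m\<le>D * J. \<exists>y. cmod y = 1 \<and> cmod (fwd a' s y m) \<le> 1 / sqrt (2 ^ J))))"
proof -
  obtain K \<eta> where K1: "K \<ge> 1" and \<eta>: "\<eta> > 0" and K: "\<And>J a s0. (\<And>n. cmod (a n) \<le> r) \<Longrightarrow> cmod s0 = 1 \<Longrightarrow>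
    \<exists>a'. (\<forall>n. cmod (a' n - a n) \<le> \<delta>) \<and> (\<forall>s. cmod s = 1 \<longrightarrow> cmod (s - s0) \<le> \<eta> \<longrightarrow> 2 ^ J \<le> cmod (fwd a' s 1 (J * K)))"
    using hyperbolic_arc[OF assms] by blast
  have "compact (sphere (0::complex) 1)" by (rule compact_sphere)
  then obtain net where net: "finite net" "net \<subseteq> sphere (0::complex) 1" "sphere 0 1 \<subseteq> (\<Union>x\<in>net. ball x \<eta>)"
  proof (rule compactE_image[of _ "sphere 0 1" "\<lambda>x. ball x \<eta>"])
    show "sphere 0 1 \<subseteq> (\<Union>x\<in>sphere (0::complex) 1. ball x \<eta>)" using \<eta> by (auto intro: centre_in_ball[THEN iffD2])
  qed auto
  define Q where "Q = card net"
  obtain z where z: "bij_betw z {0..<Q} net" using ex_bij_betw_nat_finite[OF net(1)] by (auto simp: Q_def)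
  have zs: "cmod (z i) = 1" if "i < Q" for i
  proof -
    have "z i \<in> net" using z that by (auto simp: bij_betw_def)
    then have "z i \<in> sphere 0 1" using net(2) by blast
    then show ?thesis by simp
  qed
  have cover: "\<exists>i<Q. cmod (s - z i) \<le> \<eta>" if "cmod s = 1" for s
  proof -
    have "s \<in> sphere 0 1" using that by simp
    then have "s \<in> (\<Union>x\<in>net. ball x \<eta>)" using net(3) by blast
    then obtain x where x: "x \<in> net" "dist x s < \<eta>" by auto
    then obtain i where "i < Q" "x = z i" using z by (auto simp: bij_betw_def)
    then show ?thesis using x(2) by (intro exI[of _ i]) (auto simp: dist_norm norm_minus_commute)
  qed
  have "Q \<ge> 1" using cover[of 1] by auto
  show ?thesis
  proof (intro exI[of _ "Q * K"] conjI allI impI)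
    show "1 \<le> Q * K" using \<open>Q \<ge> 1\<close> K1 by simp
    fix J :: nat and a :: "nat \<Rightarrow> complex"
    assume J: "1 \<le> J" and a: "\<forall>n. cmod (a n) \<le> r"
    define N where "N = J * K"
    have N: "N > 0" using J K1 by (simp add: N_def)
    have "\<exists>c. (\<forall>n. cmod (c n - a (i * N + n)) \<le> \<delta>) \<and> (\<forall>s. cmod s = 1 \<longrightarrow> cmod (s - z i) \<le> \<eta> \<longrightarrow> 2 ^ J \<le> cmod (fwd c s 1 N))" if "i < Q" for i
      using K[of "\<lambda>n. a (i * N + n)" "z i" J] a zs[OF that] by (simp add: N_def)
    then obtain c where c: "\<And>i n. i < Q \<Longrightarrow> cmod (c i n - a (i * N + n)) \<le> \<delta>"
      "\<And>i s. i < Q \<Longrightarrow> cmod s = 1 \<Longrightarrow> cmod (s - z i) \<le> \<eta> \<Longrightarrow> 2 ^ J \<le> cmod (fwd (c i) s 1 N)" by metis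
    define a' where "a' n = (if n div N < Q then c (n div N) (n mod N) else a n)" for n
    have a'd: "cmod (a' n - a n) \<le> \<delta>" for n
      using c(1)[of "n div N" "n mod N"] \<delta> by (auto simp: a'_def)
    have a'1: "cmod (a' n) < 1" for n
    proof -
      have "cmod (a' n) \<le> cmod (a n) + cmod (a' n - a n)" by (metis add.commute diff_add_cancel norm_triangle_ineq)
      then show ?thesis using a'd[of n] a r by (smt (verit))
    qed
    have "\<exists>m\<le>Q * N. \<exists>y. cmod y = 1 \<and> cmod (fwd a' s y m) \<le> 1 / sqrt (2 ^ J)" if s: "cmod s = 1" for s
    proof -
      obtain i where i: "i < Q" "cmod (s - z i) \<le> \<eta>" using cover[OF s] by blast
      have "a' (i * N + n) = c i n" if "n < N" for n using that i(1) by (simp add: a'_def)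
      then have blk: "fwd (\<lambda>k. a' (i * N + k)) s 1 N = fwd (c i) s 1 N" by (intro fwd_cong) auto
      \<comment> \<open>The initial value that arrives at the entrance of the block as the vector
        1.\<close>
      obtain y where y: "fwd a' s y (i * N) = 1" using fwd_surj[where a = a', OF s a'1] by blast
      have big: "2 ^ J \<le> cmod (fwd a' s y (i * N + N))"
        unfolding fwd_shift y blk by (rule c(2)[OF i(1) s i(2)])
      have y0: "y \<noteq> 0" using y fwd_scale[of a' s 0 0 "i * N"] by auto
      define L where "L = sqrt (2 ^ J)"
      have L: "L > 0" "L * L = 2 ^ J" by (simp_all add: L_def)
      have "(i + 1) * N \<le> Q * N" using i(1) by (intro mult_right_mono) auto
      then have le: "i * N + N \<le> Q * N" by (simp add: algebra_simps)
      then have le': "i * N \<le> Q * N" by linarith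
      show ?thesis
      \<comment> \<open>If \<open>y\<close> is short, it is stretched by at least \<open>L\<close>
        at the exit of the block, and another vector is contracted there; if it is long, it has
        itself been contracted to length 1 at the entrance.\<close>
      proof (cases "cmod y \<le> L")
        case True
        then have "L * cmod y \<le> cmod (fwd a' s y (i * N + N))"
          using big L mult_left_mono[OF True, of L] by linarith
        from contracted_vector[where a = a', OF s a'1 L(1) y0 this] obtain y' where
          "cmod y' = 1" "cmod (fwd a' s y' (i * N + N)) \<le> 1 / L" .
        then show ?thesis using le unfolding L_def by blast
      next
        case False
        define y' where "y' = complex_of_real (1 / cmod y) * y"
        have "cmod y' = 1" using y0 by (simp add: y'_def norm_divide)
        moreover have "fwd a' s y' (i * N) = complex_of_real (1 / cmod y)" unfolding y'_def fwd_scale y by simp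
        then have "cmod (fwd a' s y' (i * N)) \<le> 1 / L" using False L by (simp add: norm_divide frac_le)
        ultimately show ?thesis using le' unfolding L_def by blast
      qed
    qed
    then show "\<exists>a'. (\<forall>n. cmod (a' n - a n) \<le> \<delta>) \<and>
       (\<forall>s. cmod s = 1 \<longrightarrow> (\<exists>m\<le>Q * K * J. \<exists>y. cmod y = 1 \<and> cmod (fwd a' s y m) \<le> 1 / sqrt (2 ^ J)))"
      using a'd unfolding N_def by (intro exI[of _ a']) (auto simp: mult.assoc mult.commute[of J])
  qed
qed

text \<open>The recursion uses a square root of the spectral parameter, hence
  \<open>\<theta> / 2\<close>: the angle \<open>\<theta>\<close> runs once around the spectral
  circle.\<close>

definition bad_angles :: "(int \<Rightarrow> complex) \<Rightarrow> nat \<Rightarrow> real \<Rightarrow> real set"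
  where "bad_angles a M R = {\<theta> \<in> {0..2 * pi}. \<exists>v. cmod v = 1 \<and> (\<Sum>n=-int M..int M. cmod (sol a (cis (\<theta> / 2)) v n)) \<le> R}"

lemma closed_bad_angles:
  assumes a: "\<And>n. cmod (a n) < 1"
  shows "closed (bad_angles a M R)"
  unfolding closed_sequential_limits
proof (intro allI impI, elim conjE)
  fix \<theta> l assume \<theta>: "\<forall>n. \<theta> n \<in> bad_angles a M R" and lim: "\<theta> \<longlonglongrightarrow> l"
  then have "\<forall>n. \<exists>v. cmod v = 1 \<and> (\<Sum>k=-int M..int M. cmod (sol a (cis (\<theta> n / 2)) v k)) \<le> R"
    by (auto simp: bad_angles_def)
  then obtain v where v: "\<And>n. cmod (v n) = 1" "\<And>n. (\<Sum>k=-int M..int M. cmod (sol a (cis (\<theta> n / 2)) (v n) k)) \<le> R"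
    by metis
  have "bounded (range v)" using v(1) by (auto intro!: boundedI[of _ 1])
  then obtain x r where r: "strict_mono (r :: nat \<Rightarrow> nat)" "(v \<circ> r) \<longlonglongrightarrow> x"
    using bounded_imp_convergent_subsequence by blast
  have l: "(\<lambda>n. \<theta> (r n)) \<longlonglongrightarrow> l" using LIMSEQ_subseq_LIMSEQ[OF lim r(1)] by (simp add: o_def)
  have "(\<lambda>n. \<Sum>k=-int M..int M. cmod (sol a (cis (\<theta> (r n) / 2)) (v (r n)) k)) \<longlonglongrightarrow> (\<Sum>k=-int M..int M. cmod (sol a (cis (l / 2)) x k))"
    unfolding cis_conv_exp using l r(2) a by (intro tendsto_intros tendsto_sol) (auto simp: o_def)
  then have "(\<Sum>k=-int M..int M. cmod (sol a (cis (l / 2)) x k)) \<le> R"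
    by (rule LIMSEQ_le_const2) (use v(2) in blast)
  moreover have "cmod x = 1" using tendsto_norm[OF r(2)] v(1) by (simp add: o_def LIMSEQ_const_iff)
  moreover have "l \<in> {0..2 * pi}"
    using \<theta> by (intro closed_sequentially[OF closed_atLeastAtMost _ lim]) (auto simp: bad_angles_def)
  ultimately show "l \<in> bad_angles a M R" by (auto simp: bad_angles_def)
qed

text \<open>The points \<open>\<tau> + \<i> \<tau>\<^sup>2\<close> lie on a parabola, so that a thin strip contains at most two of them.\<close>

lemma parabola_strip:
  fixes w :: complex and \<epsilon> d c :: real
  assumes w: "cmod w = 1" and d: "0 < d"
    and t: "\<And>i. i \<in> {1, 2, 3} \<Longrightarrow> \<bar>c + (t i * Im w + (t i)\<^sup>2 * Re w)\<bar> \<le> \<epsilon>"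
    and b: "\<And>i. i \<in> {1, 2, 3} \<Longrightarrow> 0 \<le> t i \<and> t i \<le> (1::real)"
    and sep: "d \<le> \<bar>t 1 - t 2\<bar>" "d \<le> \<bar>t 1 - t 3\<bar>" "d \<le> \<bar>t 2 - t (3::nat)\<bar>"
  shows "1 \<le> 14 * \<epsilon> / d\<^sup>2"
proof -
  have d1: "d \<le> 1" using sep(1) b[of 1] b[of 2] by (simp add: abs_if split: if_splits)
  \<comment> \<open>First divided differences of the quadratic eliminate \<open>c\<close>; comparing
    two of them below isolates \<open>Re w\<close>.\<close>
  have diff: "\<bar>Im w + (t i + t j) * Re w\<bar> \<le> 2 * \<epsilon> / d" if "i \<in> {1, 2, 3}" "j \<in> {1, 2, 3}" "d \<le> \<bar>t i - t j\<bar>" for i j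
  proof -
    have "(t i - t j) * (Im w + (t i + t j) * Re w)
      = (c + (t i * Im w + (t i)\<^sup>2 * Re w)) - (c + (t j * Im w + (t j)\<^sup>2 * Re w))"
      by (simp add: algebra_simps power2_eq_square)
    then have "\<bar>t i - t j\<bar> * \<bar>Im w + (t i + t j) * Re w\<bar> \<le> 2 * \<epsilon>"
      using t[OF that(1)] t[OF that(2)] by (simp add: abs_mult[symmetric])
    moreover have "d * \<bar>Im w + (t i + t j) * Re w\<bar> \<le> \<bar>t i - t j\<bar> * \<bar>Im w + (t i + t j) * Re w\<bar>"
      using that(3) by (intro mult_right_mono) auto
    ultimately show ?thesis using d by (simp add: field_simps)
  qed
  define e where "e = 2 * \<epsilon> / d"
  have 12: "\<bar>Im w + (t 1 + t 2) * Re w\<bar> \<le> e" and 13: "\<bar>Im w + (t 1 + t 3) * Re w\<bar> \<le> e"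
    unfolding e_def using sep by (auto intro!: diff)
  have "(t 2 - t 3) * Re w = (Im w + (t 1 + t 2) * Re w) - (Im w + (t 1 + t 3) * Re w)" by (simp add: algebra_simps)
  then have "\<bar>t 2 - t 3\<bar> * \<bar>Re w\<bar> \<le> 2 * e" using 12 13 by (simp add: abs_mult[symmetric])
  moreover have "d * \<bar>Re w\<bar> \<le> \<bar>t 2 - t 3\<bar> * \<bar>Re w\<bar>" using sep(3) by (intro mult_right_mono) auto
  ultimately have Re: "\<bar>Re w\<bar> \<le> 2 * e / d" using d by (simp add: field_simps)
  have e0: "0 \<le> e" using 12 by linarith
  then have "e * d \<le> e * 1" using d1 by (intro mult_left_mono)
  then have ed: "e \<le> e / d" using d by (simp add: field_simps)
  have "\<bar>(t 1 + t 2) * Re w\<bar> \<le> 2 * \<bar>Re w\<bar>" unfolding abs_mult using b[of 1] b[of 2] by (intro mult_right_mono) auto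
  then have "\<bar>Im w\<bar> \<le> e + 2 * \<bar>Re w\<bar>" using 12 by linarith
  then have "\<bar>Re w\<bar> + \<bar>Im w\<bar> \<le> e + 3 * (2 * e / d)" using Re by linarith
  also have "\<dots> \<le> 7 * (e / d)" using ed by linarith
  finally have "1 \<le> 7 * (e / d)" using cmod_le[of w] w by linarith
  then show ?thesis by (simp add: e_def power2_eq_square)
qed

lemma card_ge_3:
  assumes "3 \<le> card S"
  obtains f :: "nat \<Rightarrow> 'b" where "f 1 \<in> S" "f 2 \<in> S" "f 3 \<in> S" "f 1 \<noteq> f 2" "f 1 \<noteq> f 3" "f 2 \<noteq> f 3"
proof -
  obtain T where T: "T \<subseteq> S" "card T = 3" using obtain_subset_with_card_n[OF assms] by metis
  then obtain x y z where xyz: "T = {x, y, z}" "x \<noteq> y" "y \<noteq> z" "x \<noteq> z" using card_3_iff[of T] by blast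
  show ?thesis by (rule that[of "\<lambda>i. if i = 1 then x else if i = 2 then y else z"]) (use T xyz in auto)
qed

section \<open>Making the set of bad angles small by a perturbation\<close>

lemma exp_beats_linear:
  assumes "0 < \<epsilon>"
  obtains J :: nat where "1 \<le> J" "2 ^ k * (2 * real (D * J + 1) + 1) / sqrt (2 ^ J) < \<epsilon>"
proof -
  define q where "q = 1 / sqrt (2::real)"
  have q: "0 \<le> q" "q < 1" by (auto simp: q_def)
  have l1: "(\<lambda>J. q ^ J) \<longlonglongrightarrow> 0" using q by (intro LIMSEQ_power_zero) auto
  have "(\<lambda>J. of_nat J * q ^ J) \<longlonglongrightarrow> 0" using q by (intro powser_times_n_limit_0) auto
  then have "(\<lambda>J. 2 ^ k * (2 * real D * (of_nat J * q ^ J) + 3 * q ^ J)) \<longlonglongrightarrow> 2 ^ k * (2 * real D * 0 + 3 * 0)"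
    by (intro tendsto_intros l1)
  then have "(\<lambda>J. 2 ^ k * (2 * real D * (of_nat J * q ^ J) + 3 * q ^ J)) \<longlonglongrightarrow> 0" by simp
  from order_tendstoD(2)[OF this assms] have "\<forall>\<^sub>F J in sequentially. 2 ^ k * (2 * real D * (of_nat J * q ^ J) + 3 * q ^ J) < \<epsilon>" .
  with eventually_ge_at_top[of "1::nat"]
  have "\<forall>\<^sub>F J in sequentially. 1 \<le> J \<and> 2 ^ k * (2 * real D * (of_nat J * q ^ J) + 3 * q ^ J) < \<epsilon>"
    by eventually_elim auto
  then obtain J where J: "1 \<le> J" "2 ^ k * (2 * real D * (of_nat J * q ^ J) + 3 * q ^ J) < \<epsilon>"
    by (auto simp: eventually_sequentially)
  have "q ^ J = 1 / sqrt (2 ^ J)" by (simp add: q_def power_divide real_sqrt_power)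
  then have "2 ^ k * (2 * real (D * J + 1) + 1) / sqrt (2 ^ J) = 2 ^ k * (2 * real (D * J + 1) + 1) * q ^ J" by simp
  also have "\<dots> = 2 ^ k * (2 * real D * (of_nat J * q ^ J) + 3 * q ^ J)" by (simp add: algebra_simps)
  finally have "2 ^ k * (2 * real (D * J + 1) + 1) / sqrt (2 ^ J) = 2 ^ k * (2 * real D * (of_nat J * q ^ J) + 3 * q ^ J)" .
  then show ?thesis using J that by simp
qed

text \<open>Growing blocks are placed on both sides of site 0. At a bad angle the Wronskian with the
  contracted vectors \<open>ym\<close> and \<open>yp\<close> forces the solution to leave site 0
  nearly parallel to both, so \<open>Im (cnj yp * (s * ym - cnj c * cnj ym))\<close> is tiny. This
  condition confines the coefficient \<open>c\<close> at site 0 to a thin strip, and of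
  \<open>P\<close> candidates on a parabola at most two lie in it. The bad sets of the candidates
  therefore cover every angle at most twice, and one of them has measure at most
  \<open>4 * pi / real P\<close>.\<close>

lemma ac_perturb:
  fixes \<alpha> :: "int \<Rightarrow> complex"
  assumes \<alpha>: "\<And>n. cmod (\<alpha> n) \<le> r" and r: "r < 1" and \<delta>0: "0 < \<delta>0"
  shows "\<exists>\<alpha>' M. (\<forall>n. cmod (\<alpha>' n - \<alpha> n) \<le> \<delta>0) \<and> (\<forall>n. cmod (\<alpha>' n) < 1) \<and>
    measure lborel (bad_angles \<alpha>' M (2 ^ k * (2 * real M + 1))) < 1 / 2 ^ k"
proof -
  define \<delta> where "\<delta> = min \<delta>0 ((1 - r) / 2)"
  have \<delta>: "0 < \<delta>" "\<delta> \<le> \<delta>0" using \<delta>0 r by (auto simp: \<delta>_def)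
  have "\<delta> \<le> (1 - r) / 2" unfolding \<delta>_def by (rule min.cobounded2)
  then have "2 * \<delta> \<le> 1 - r" by simp
  then have r\<delta>: "r + \<delta> < 1" using r \<delta>(1) by argo
  have r0: "0 \<le> r" using \<alpha>[of 0] norm_ge_zero order_trans by blast
  obtain D where D: "\<And>J a. 1 \<le> J \<Longrightarrow> (\<And>n. cmod (a n) \<le> r) \<Longrightarrow> \<exists>a'. (\<forall>n. cmod (a' n - a n) \<le> \<delta>) \<and>
    (\<forall>s. cmod s = 1 \<longrightarrow> (\<exists>m\<le>D * J. \<exists>y. cmod y = 1 \<and> cmod (fwd a' s y m) \<le> 1 / sqrt (2 ^ J)))"
    using half_line_growth[OF r\<delta> \<delta>(1) r0] by blast
  obtain P :: nat where P: "4 * pi * 2 ^ k < real P" using reals_Archimedean2 by blast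
  have P0: "0 < real P" using P pi_gt_zero by (smt (verit) mult_pos_pos zero_less_power)
  \<comment> \<open>Half of \<open>\<delta>\<close>, because the points
    \<open>\<tau> + \<i> * \<tau>\<^sup>2\<close> used below have modulus at most 2.\<close>
  define \<delta>' where "\<delta>' = \<delta> / 2"
  have \<delta>': "\<delta>' > 0" using \<delta> by (simp add: \<delta>'_def)
  define d where "d = 1 / real P"
  have d: "d > 0" using P0 by (simp add: d_def)
  define \<tau> where "\<tau> i = real i / real P" for i
  have \<tau>01: "0 \<le> \<tau> i \<and> \<tau> i \<le> 1" if "i < P" for i using that by (simp add: \<tau>_def)
  have \<tau>sep: "d \<le> \<bar>\<tau> i - \<tau> j\<bar>" if "i \<noteq> j" for i j
  proof -
    have "1 \<le> \<bar>real i - real j\<bar>" using that by linarith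
    then show ?thesis using P0 by (simp add: \<tau>_def d_def diff_divide_distrib[symmetric] divide_right_mono)
  qed
  \<comment> \<open>The bound 1/2 keeps the component of a unit vector along \<open>ym\<close> at
    least 1/2. The constant 90 exceeds 84, the product of 14 from \<open>parabola_strip\<close> and
    6 from the strip estimate.\<close>
  have "0 < min (1/2) (\<delta>' * d\<^sup>2 / 90)" using \<delta>' d by simp
  from exp_beats_linear[OF this, of k D] obtain J where J: "1 \<le> J"
    "2 ^ k * (2 * real (D * J + 1) + 1) / sqrt (2 ^ J) < min (1/2) (\<delta>' * d\<^sup>2 / 90)" by blast
  \<comment> \<open>The right-hand blocks act only after the step across site 0, hence the
    additional site.\<close>
  define M where "M = D * J + 1"
  define R where "R = 2 ^ k * (2 * real M + 1)"
  define \<epsilon> where "\<epsilon> = R / sqrt (2 ^ J)"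
  have R0: "R \<ge> 0" by (simp add: R_def)
  have \<epsilon>: "\<epsilon> < 1/2" "\<epsilon> < \<delta>' * d\<^sup>2 / 90" "0 \<le> \<epsilon>" using J(2) R0 by (simp_all add: \<epsilon>_def R_def M_def)
  obtain ar where ar: "\<And>n. cmod (ar n - \<alpha> (int n + 1)) \<le> \<delta>"
    "\<And>s. cmod s = 1 \<Longrightarrow> \<exists>m\<le>D * J. \<exists>y. cmod y = 1 \<and> cmod (fwd ar s y m) \<le> 1 / sqrt (2 ^ J)"
    using D[OF J(1), of "\<lambda>n. \<alpha> (int n + 1)"] \<alpha> by blast
  \<comment> \<open>The left half-line in the form used by \<open>sol\<close>: reversed, negated,
    and later run with \<open>cnj s\<close>.\<close>
  obtain al where al: "\<And>n. cmod (al n - (- \<alpha> (- int n - 1))) \<le> \<delta>"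
    "\<And>s. cmod s = 1 \<Longrightarrow> \<exists>m\<le>D * J. \<exists>y. cmod y = 1 \<and> cmod (fwd al s y m) \<le> 1 / sqrt (2 ^ J)"
    using D[OF J(1), of "\<lambda>n. - \<alpha> (- int n - 1)"] \<alpha> by auto
  define c where "c i = \<alpha> 0 + complex_of_real \<delta>' * Complex (\<tau> i) ((\<tau> i)\<^sup>2)" for i
  define a where "a i n = (if n = 0 then c i else if n > 0 then ar (nat (n - 1)) else - al (nat (- n - 1)))" for i and n :: int
  have ad: "cmod (a i n - \<alpha> n) \<le> \<delta>" if "i < P" for i n
  proof -
    consider "n = 0" | "n > 0" | "n < 0" by linarith
    then show ?thesis
    proof cases
      case 1
      have "cmod (Complex (\<tau> i) ((\<tau> i)\<^sup>2)) \<le> \<bar>\<tau> i\<bar> + \<bar>(\<tau> i)\<^sup>2\<bar>" using cmod_le[of "Complex (\<tau> i) ((\<tau> i)\<^sup>2)"] by simp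
      also have "\<dots> \<le> 1 + 1" using \<tau>01[OF that] by (intro add_mono) (auto simp: power_le_one)
      finally have "\<delta>' * cmod (Complex (\<tau> i) ((\<tau> i)\<^sup>2)) \<le> \<delta>' * 2" using \<delta>' by (intro mult_left_mono) auto
      then show ?thesis using 1 \<delta>' by (simp add: a_def c_def norm_mult \<delta>'_def)
    next
      case 2
      then show ?thesis using ar(1)[of "nat (n - 1)"] by (simp add: a_def)
    next
      case 3
      then show ?thesis using al(1)[of "nat (- n - 1)"] by (simp add: a_def norm_minus_commute add.commute)
    qed
  qed
  have a1: "cmod (a i n) < 1" if "i < P" for i n
  proof -
    have "cmod (a i n) \<le> cmod (\<alpha> n) + cmod (a i n - \<alpha> n)" by (metis add.commute diff_add_cancel norm_triangle_ineq)
    then show ?thesis using ad[OF that, of n] \<alpha>[of n] r\<delta> by linarith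
  qed
  have ar1: "cmod (ar n) < 1" for n
    using ar(1)[of n] \<alpha>[of "int n + 1"] r\<delta> norm_triangle_ineq2[of "ar n" "\<alpha> (int n + 1)"] by linarith
  have al1: "cmod (al n) < 1" for n
    using al(1)[of n] \<alpha>[of "- int n - 1"] r\<delta> norm_triangle_ineq2[of "al n" "- \<alpha> (- int n - 1)"] by simp
  have solr: "sol (a i) s v (1 + int m) = fwd ar s (szego (c i) s v) m" for i s v m
  proof -
    have "nat (1 + int m) = Suc m" by simp
    then have "sol (a i) s v (1 + int m) = fwd (\<lambda>k. a i (int k)) s v (Suc m)" by (simp add: sol_def)
    also have "\<dots> = fwd (\<lambda>k. a i (int (Suc k))) s (szego (a i (int 0)) s v) m" by (rule fwd_Suc_shift)
    finally show ?thesis by (simp add: a_def)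
  qed
  have soll: "sol (a i) s v (- int m) = fwd al (cnj s) v m" for i s v m
  proof (cases "m = 0")
    case False
    then have "sol (a i) s v (- int m) = fwd (\<lambda>k. - a i (- int k - 1)) (cnj s) v m" by (simp add: sol_def)
    also have "\<dots> = fwd al (cnj s) v m" by (intro fwd_cong) (simp add: a_def)
    finally show ?thesis .
  qed simp
  define Bad where "Bad i = bad_angles (a i) M R" for i
  have few: "card {i \<in> {..<P}. \<theta> \<in> Bad i} \<le> 2" for \<theta>
  proof (rule ccontr)
    assume "\<not> ?thesis"
    then have "3 \<le> card {i \<in> {..<P}. \<theta> \<in> Bad i}" by linarith
    then obtain f :: "nat \<Rightarrow> nat" where f: "f 1 \<in> {i \<in> {..<P}. \<theta> \<in> Bad i}" "f 2 \<in> {i \<in> {..<P}. \<theta> \<in> Bad i}"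
      "f 3 \<in> {i \<in> {..<P}. \<theta> \<in> Bad i}" "f 1 \<noteq> f 2" "f 1 \<noteq> f 3" "f 2 \<noteq> f 3" by (rule card_ge_3)
    define s where "s = cis (\<theta> / 2)"
    have s: "cmod s = 1" "cmod (cnj s) = 1" by (simp_all add: s_def)
    obtain mp yp where yp: "mp \<le> D * J" "cmod yp = 1" "cmod (fwd ar s yp mp) \<le> 1 / sqrt (2 ^ J)" using ar(2)[OF s(1)] by blast
    obtain mm ym where ym: "mm \<le> D * J" "cmod ym = 1" "cmod (fwd al (cnj s) ym mm) \<le> 1 / sqrt (2 ^ J)" using al(2)[OF s(2)] by blast
    define w where "w = yp * ym"
    have w: "cmod w = 1" using yp ym by (simp add: w_def norm_mult)
    define \<kappa> where "\<kappa> = Im (cnj yp * (s * ym)) + Im (w * \<alpha> 0)"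
    have strip: "\<bar>\<kappa> + \<delta>' * (\<tau> i * Im w + (\<tau> i)\<^sup>2 * Re w)\<bar> \<le> 6 * \<epsilon>" if i: "i < P" "\<theta> \<in> Bad i" for i
    proof -
      from i(2) obtain v where v: "cmod v = 1" "(\<Sum>n=-int M..int M. cmod (sol (a i) s v n)) \<le> R"
        by (auto simp: Bad_def bad_angles_def s_def)
      have vb: "cmod (sol (a i) s v n) \<le> R" if "\<bar>n\<bar> \<le> int M" for n
      proof -
        have "cmod (sol (a i) s v n) \<le> (\<Sum>n=-int M..int M. cmod (sol (a i) s v n))"
          using that by (intro member_le_sum) auto
        then show ?thesis using v(2) by linarith
      qed
      \<comment> \<open>The Wronskian at site \<open>m\<close> is a product of a contracted factor
        and one bounded by \<open>R\<close>; being constant, it is as small at the start.\<close>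
      have small: "\<bar>Im (cnj y * x)\<bar> \<le> \<epsilon>" if "cmod (fwd A t y m) \<le> 1 / sqrt (2 ^ J)" "cmod (fwd A t x m) \<le> R" "cmod t = 1" "\<And>n. cmod (A n) < 1" for A t y x m
      proof -
        have "\<bar>Im (cnj y * x)\<bar> \<le> cmod (fwd A t y m) * cmod (fwd A t x m)"
          using fwd_wronskian[where a = A and v = y and w = x and n = m, OF that(3,4)]
            abs_Im_le_cmod[of "cnj (fwd A t y m) * fwd A t x m"] by (simp add: norm_mult)
        also have "\<dots> \<le> 1 / sqrt (2 ^ J) * R" using that(1,2) by (intro mult_mono) auto
        finally show ?thesis by (simp add: \<epsilon>_def)
      qed
      have im: "\<bar>Im (cnj ym * v)\<bar> \<le> \<epsilon>"
      proof (rule small[OF ym(3) _ s(2) al1])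
        have "\<bar>- int mm\<bar> \<le> int M" using ym(1) unfolding M_def by linarith
        from vb[OF this] show "cmod (fwd al (cnj s) v mm) \<le> R" unfolding soll .
      qed
      have ip: "\<bar>Im (cnj yp * szego (c i) s v)\<bar> \<le> \<epsilon>"
      proof (rule small[OF yp(3) _ s(1) ar1])
        have "\<bar>1 + int mp\<bar> \<le> int M" using yp(1) unfolding M_def by linarith
        from vb[OF this] show "cmod (fwd ar s (szego (c i) s v) mp) \<le> R" unfolding solr .
      qed
      have ci: "cmod (c i) < 1" using a1[OF i(1), of 0] by (simp add: a_def)
      define \<rho> where "\<rho> = sqrt (1 - (cmod (c i))\<^sup>2)"
      have \<rho>: "0 < \<rho>" "\<rho> \<le> 1" using rho_pos[OF ci] by (simp_all add: \<rho>_def)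
      define F where "F x = Im (cnj yp * (s * x - cnj (c i) * cnj x))" for x
      have F2: "\<bar>F x\<bar> \<le> 2 * cmod x" for x
      proof -
        have "\<bar>F x\<bar> \<le> cmod (s * x - cnj (c i) * cnj x)"
          unfolding F_def using abs_Im_le_cmod[of "cnj yp * (s * x - cnj (c i) * cnj x)"] yp(2) by (simp add: norm_mult)
        also have "\<dots> \<le> cmod (s * x) + cmod (cnj (c i) * cnj x)" by (rule norm_triangle_ineq4)
        also have "\<dots> \<le> cmod x + 1 * cmod x"
          unfolding norm_mult complex_mod_cnj s(1) using ci by (intro add_mono mult_right_mono) auto
        finally show ?thesis by simp
      qed
      have "F v = \<rho> * Im (cnj yp * szego (c i) s v)"
        using \<rho> by (simp add: F_def szego_def \<rho>_def[symmetric] Im_divide_of_real)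
      then have "\<bar>F v\<bar> \<le> 1 * \<epsilon>" unfolding abs_mult using \<rho> ip \<epsilon> by (simp only: abs_mult) (intro mult_mono; simp)
      then have Fv: "\<bar>F v\<bar> \<le> \<epsilon>" by simp
      \<comment> \<open>Coordinates of \<open>v\<close> along \<open>ym\<close> and across it. The
        second is small by \<open>im\<close>, so the first is not, and the smallness of
        \<open>F v\<close> passes to \<open>F ym\<close>.\<close>
      define A B where "A = Re (cnj ym * v)" and "B = Im (cnj ym * v)"
      have "cnj ym * v = complex_of_real A + \<i> * complex_of_real B" by (simp add: A_def B_def complex_eq_iff)
      then have "ym * (cnj ym * v) = ym * (complex_of_real A + \<i> * complex_of_real B)" by simp
      moreover have "ym * (cnj ym * v) = v" by (simp only: mult.assoc[symmetric] unit_mult_cnj(1)[OF ym(2)] mult_1_left)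
      ultimately have v': "v = complex_of_real A * ym + complex_of_real B * (\<i> * ym)" by (simp add: algebra_simps)
      have "F v = A * F ym + B * F (\<i> * ym)" unfolding F_def v' by (simp add: algebra_simps)
      moreover have "\<bar>B * F (\<i> * ym)\<bar> \<le> \<epsilon> * 2"
        unfolding abs_mult using im F2[of "\<i> * ym"] ym(2) \<epsilon>(3) by (intro mult_mono) (auto simp: B_def norm_mult)
      ultimately have AF: "\<bar>A\<bar> * \<bar>F ym\<bar> \<le> 3 * \<epsilon>" using Fv by (simp add: abs_mult[symmetric])
      have "1 \<le> \<bar>A\<bar> + \<bar>B\<bar>" using cmod_le[of "cnj ym * v"] ym(2) v(1) by (simp add: A_def B_def norm_mult)
      then have "1/2 \<le> \<bar>A\<bar>" using im \<epsilon>(1) by (simp add: B_def)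
      then have "1/2 * \<bar>F ym\<bar> \<le> \<bar>A\<bar> * \<bar>F ym\<bar>" by (intro mult_right_mono) auto
      then have "\<bar>F ym\<bar> \<le> 6 * \<epsilon>" using AF by linarith
      moreover have "F ym = Im (cnj yp * (s * ym)) + Im (w * c i)"
        by (simp add: F_def w_def algebra_simps)
      moreover have "Im (w * c i) = Im (w * \<alpha> 0) + \<delta>' * (\<tau> i * Im w + (\<tau> i)\<^sup>2 * Re w)"
        by (simp add: c_def algebra_simps)
      ultimately show ?thesis by (simp add: \<kappa>_def)
    qed
    have "1 \<le> 14 * (6 * \<epsilon> / \<delta>') / d\<^sup>2"
    proof (rule parabola_strip[OF w d, where t = "\<lambda>i. \<tau> (f i)" and c = "\<kappa> / \<delta>'"])
      fix i :: nat assume "i \<in> {1, 2, 3}"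
      then have i: "f i < P" "\<theta> \<in> Bad (f i)" using f(1,2,3) by auto
      show "0 \<le> \<tau> (f i) \<and> \<tau> (f i) \<le> 1" using \<tau>01[OF i(1)] .
      have "\<kappa> / \<delta>' + (\<tau> (f i) * Im w + (\<tau> (f i))\<^sup>2 * Re w) = (\<kappa> + \<delta>' * (\<tau> (f i) * Im w + (\<tau> (f i))\<^sup>2 * Re w)) / \<delta>'"
        using \<delta>' by (simp add: field_simps)
      then show "\<bar>\<kappa> / \<delta>' + (\<tau> (f i) * Im w + (\<tau> (f i))\<^sup>2 * Re w)\<bar> \<le> 6 * \<epsilon> / \<delta>'"
        using strip[OF i] \<delta>' by (simp add: abs_divide divide_right_mono)
    qed (use \<tau>sep f in auto)
    then have "\<delta>' * d\<^sup>2 \<le> 84 * \<epsilon>" using \<delta>' d by (simp add: field_simps)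
    then show False using \<epsilon> by linarith
  qed
  have closed: "closed (Bad i)" if "i < P" for i unfolding Bad_def by (rule closed_bad_angles[OF a1[OF that]])
  have fm: "Bad i \<in> fmeasurable lborel" if "i < P" for i
  proof (rule fmeasurableI2[of "{0..2*pi}"])
    show "Bad i \<subseteq> {0..2*pi}" by (auto simp: Bad_def bad_angles_def)
    show "Bad i \<in> sets lborel" using closed[OF that] by simp
  qed (auto simp: fmeasurable_def)
  have int: "integrable lborel (indicat_real (Bad i))" if "i < P" for i
    using fm[OF that] by (simp add: fmeasurable_def integrable_real_indicator)
  \<comment> \<open>Integrating the counting function, which is at most 2 on
    \<open>{0..2 * pi}\<close> by \<open>few\<close>.\<close>
  have "(\<Sum>i<P. measure lborel (Bad i)) = (\<Sum>i<P. LINT x|lborel. indicat_real (Bad i) x)" by simp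
  also have "\<dots> = (LINT x|lborel. (\<Sum>i<P. indicat_real (Bad i) x))"
    by (rule Bochner_Integration.integral_sum[symmetric]) (use int in auto)
  also have "\<dots> \<le> (LINT x|lborel. 2 * indicat_real {0..2*pi} x)"
  proof (rule integral_mono)
    show "integrable lborel (\<lambda>x. \<Sum>i<P. indicat_real (Bad i) x)" using int by (intro Bochner_Integration.integrable_sum) auto
    show "integrable lborel (\<lambda>x. 2 * indicat_real {0..2*pi} x)" by simp
    fix x :: real
    show "(\<Sum>i<P. indicat_real (Bad i) x) \<le> 2 * indicat_real {0..2*pi} x"
    proof (cases "x \<in> {0..2*pi}")
      case True
      have "(\<Sum>i<P. indicat_real (Bad i) x) = real (card {i \<in> {..<P}. x \<in> Bad i})"
        by (simp add: indicator_def sum.If_cases Int_def)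
      then show ?thesis using few[of x] True by simp
    next
      case False
      then have "x \<notin> Bad i" for i by (auto simp: Bad_def bad_angles_def)
      then show ?thesis using False by simp
    qed
  qed
  also have "\<dots> = 4 * pi" by simp
  finally have sum: "(\<Sum>i<P. measure lborel (Bad i)) \<le> 4 * pi" .
  have "\<exists>i<P. measure lborel (Bad i) < 1 / 2 ^ k"
  proof (rule ccontr)
    assume "\<not> ?thesis"
    then have "1 / 2 ^ k \<le> measure lborel (Bad i)" if "i < P" for i using that not_less by blast
    then have "(\<Sum>i<P. 1 / 2 ^ k) \<le> (\<Sum>i<P. measure lborel (Bad i))" by (intro sum_mono) auto
    then have "real P / 2 ^ k \<le> 4 * pi" using sum by simp
    then show False using P by (simp add: field_simps)
  qed
  then obtain i where i: "i < P" "measure lborel (Bad i) < 1 / 2 ^ k" by blast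
  show ?thesis
    by (intro exI[of _ "a i"] exI[of _ M] conjI allI a1[OF i(1)])
       (use ad[OF i(1)] \<delta>(2) i(2) in \<open>auto simp: Bad_def R_def intro: order_trans\<close>)
qed

section \<open>CMV operators on square-summable sequences\<close>

text \<open>The direct sum of the unitary 2 by 2 blocks with rows \<open>(cnj (a n), \<rho>)\<close>
  and \<open>(\<rho>, - a n)\<close> on the pairs \<open>n\<close>, \<open>n + 1\<close> with
  \<open>P n\<close>. With \<open>even\<close> and \<open>odd\<close> these are the two factors of a
  CMV operator.\<close>

definition block_op :: "(int \<Rightarrow> bool) \<Rightarrow> (int \<Rightarrow> complex) \<Rightarrow> (int \<Rightarrow> complex) \<Rightarrow> int \<Rightarrow> complex"
  where "block_op P a u n = (if P n then cnj (a n) * u n + cmv_rho a n * u (n + 1)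
    else cmv_rho a (n - 1) * u (n - 1) - a (n - 1) * u n)"

lemma infsum_finite_support:
  fixes f :: "'a \<Rightarrow> complex"
  assumes "finite A" "\<And>x. x \<notin> A \<Longrightarrow> f x = 0"
  shows "infsum f UNIV = sum f A"
proof -
  have "infsum f UNIV = infsum f A" by (rule infsum_cong_neutral) (use assms in auto)
  then show ?thesis using assms(1) by simp
qed

lemma cmv_pblk: "cmv a u = block_op even a (block_op odd a u)"
proof
  fix j :: int
  define m where "m = j div 2"
  have "cmv a u j = (\<Sum>k\<in>{2*m - 1, 2*m, 2*m + 1, 2*m + 2}. cmv_entry a j k * u k)"
    unfolding cmv_def by (rule infsum_finite_support) (auto simp: cmv_entry_def Let_def m_def)
  also have "\<dots> = cmv_entry a j (2*m - 1) * u (2*m - 1) + cmv_entry a j (2*m) * u (2*m)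
      + cmv_entry a j (2*m + 1) * u (2*m + 1) + cmv_entry a j (2*m + 2) * u (2*m + 2)"
    by simp
  also have "\<dots> = block_op even a (block_op odd a u) j"
  proof (cases "even j")
    case True
    then have j: "j = 2 * m" by (simp add: m_def)
    show ?thesis unfolding j by (simp add: cmv_entry_def Let_def block_op_def algebra_simps)
  next
    case False
    then have j: "j = 2 * m + 1" by (simp add: m_def)
    show ?thesis unfolding j by (simp add: cmv_entry_def Let_def block_op_def algebra_simps)
  qed
  finally show "cmv a u j = block_op even a (block_op odd a u) j" .
qed

lemma cmv_rho_sq: "cmod (a n) < 1 \<Longrightarrow> cmv_rho a n * cmv_rho a n = 1 - a n * cnj (a n)"
proof -
  assume "cmod (a n) < 1"
  then have "1 - (cmod (a n))\<^sup>2 \<ge> 0" using rho_pos[of "a n"] by simp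
  then show ?thesis
    unfolding cmv_rho_def complex_norm_square[symmetric] of_real_mult[symmetric] by (simp del: of_real_mult)
qed

lemma cnj_cmv_rho [simp]: "cnj (cmv_rho a n) = cmv_rho a n"
  by (simp add: cmv_rho_def)

lemma cmv_rho_cnj [simp]: "cmv_rho (\<lambda>n. cnj (a n)) n = cmv_rho a n"
  by (simp add: cmv_rho_def)

lemma cmv_rho_le_1: "cmod (cmv_rho a n) \<le> 1" if "cmod (a n) < 1"
  using rho_pos[OF that] by (simp add: cmv_rho_def)

text \<open>Each block is unitary and symmetric, so its inverse is its entrywise conjugate.\<close>

lemma pblk_involution:
  assumes a: "\<And>n. cmod (a n) < 1" and P: "\<And>n. P (n + 1) = (\<not> P n)"
  shows "block_op P (\<lambda>n. cnj (a n)) (block_op P a u) = u"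
proof
  fix n
  have P': "P (n - 1) = (\<not> P n)" using P[of "n - 1"] by simp
  show "block_op P (\<lambda>n. cnj (a n)) (block_op P a u) n = u n"
  proof (cases "P n")
    case True
    have "block_op P (\<lambda>n. cnj (a n)) (block_op P a u) n = (cmv_rho a n * cmv_rho a n + a n * cnj (a n)) * u n"
      using True P[of n] by (simp add: block_op_def algebra_simps)
    then show ?thesis using cmv_rho_sq[of a n] a by simp
  next
    case False
    have "block_op P (\<lambda>n. cnj (a n)) (block_op P a u) n = (cmv_rho a (n - 1) * cmv_rho a (n - 1) + a (n - 1) * cnj (a (n - 1))) * u n"
      using False P' by (simp add: block_op_def algebra_simps)
    then show ?thesis using cmv_rho_sq[of a "n - 1"] a by simp
  qed
qed

lemma infsum_pairs:
  fixes f :: "int \<Rightarrow> 'b::banach"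
  assumes P: "\<And>n. P (n + 1) = (\<not> P n)" and f: "f summable_on UNIV"
  shows "infsum f UNIV = infsum (\<lambda>n. f n + f (n + 1)) {n. P n}"
    and "(\<lambda>n. f (n + 1)) summable_on {n. P n}"
proof -
  have U: "(UNIV :: int set) = {n. P n} \<union> (\<lambda>n. n + 1) ` {n. P n}"
  proof -
    have "n \<in> {n. P n} \<union> (\<lambda>n. n + 1) ` {n. P n}" for n
      using P[of "n - 1"] by (cases "P n") (auto intro!: image_eqI[of _ _ "n - 1"])
    then show ?thesis by auto
  qed
  have inj: "inj_on (\<lambda>n::int. n + 1) {n. P n}" by (auto simp: inj_on_def)
  have s1: "f summable_on {n. P n}" and s2: "f summable_on (\<lambda>n. n + 1) ` {n. P n}"
    using f by (auto intro: summable_on_subset_banach)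
  show s3: "(\<lambda>n. f (n + 1)) summable_on {n. P n}"
    using s2 summable_on_reindex[OF inj, of f] by (simp add: o_def)
  have "infsum f UNIV = infsum f {n. P n} + infsum f ((\<lambda>n. n + 1) ` {n. P n})"
    by (subst U, rule infsum_Un_disjoint[OF s1 s2]) (use P in auto)
  also have "infsum f ((\<lambda>n. n + 1) ` {n. P n}) = infsum (\<lambda>n. f (n + 1)) {n. P n}"
    using infsum_reindex[OF inj, of f] by (simp add: o_def)
  finally show "infsum f UNIV = infsum (\<lambda>n. f n + f (n + 1)) {n. P n}"
    using infsum_add[OF s1 s3] by simp
qed

section \<open>The Hilbert space of square-summable sequences\<close>

definition l2_sq :: "(int \<Rightarrow> complex) \<Rightarrow> real"
  where "l2_sq u = (\<Sum>\<^sub>\<infinity>n. (cmod (u n))\<^sup>2)"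

lemma l2_product_bound: "cmod (cnj x * y) \<le> (cmod x)\<^sup>2 + (cmod y)\<^sup>2"
proof -
  have "0 \<le> (cmod x - cmod y)\<^sup>2 + (cmod x)\<^sup>2 + (cmod y)\<^sup>2" by simp
  then have "2 * (cmod x * cmod y) \<le> 2 * ((cmod x)\<^sup>2 + (cmod y)\<^sup>2)" by (simp add: power2_diff)
  then show ?thesis by (simp add: norm_mult)
qed

lemma l2_abs_summable:
  assumes "u \<in> l2_int" "v \<in> l2_int"
  shows "(\<lambda>n. cmod (cnj (u n) * v n)) summable_on UNIV"
  by (rule summable_on_comparison_test[where f = "\<lambda>n. (cmod (u n))\<^sup>2 + (cmod (v n))\<^sup>2"])
     (use assms l2_product_bound in \<open>auto simp: l2_int_def intro: summable_on_add\<close>)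

lemma l2_summable: "u \<in> l2_int \<Longrightarrow> v \<in> l2_int \<Longrightarrow> (\<lambda>n. cnj (u n) * v n) summable_on UNIV"
  by (rule abs_summable_summable[OF l2_abs_summable])

lemma pblk_l2:
  assumes a: "\<And>n. cmod (a n) < 1" and P: "\<And>n. P (n + 1) = (\<not> P n)" and u: "u \<in> l2_int"
  shows "block_op P a u \<in> l2_int"
proof -
  have P': "P (n - 1) = (\<not> P n)" for n using P[of "n - 1"] by simp
  have s: "(\<lambda>n. (cmod (u n))\<^sup>2) summable_on UNIV" using u by (simp add: l2_int_def)
  have s1: "(\<lambda>n. (cmod (u (n + 1)))\<^sup>2) summable_on UNIV"
    using s summable_on_reindex[of "\<lambda>n::int. n + 1" UNIV "\<lambda>n. (cmod (u n))\<^sup>2"] by (simp add: o_def surj_plus_right add.commute[of _ 1])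
  have s2: "(\<lambda>n. (cmod (u (n - 1)))\<^sup>2) summable_on UNIV"
    using s summable_on_reindex[of "\<lambda>n::int. n - 1" UNIV "\<lambda>n. (cmod (u n))\<^sup>2"] by (simp add: o_def surj_diff_right)
  have sq: "(cmod (x + y))\<^sup>2 \<le> 2 * ((cmod x)\<^sup>2 + (cmod y)\<^sup>2)" for x y :: complex
  proof -
    have "(cmod (x + y))\<^sup>2 \<le> (cmod x + cmod y)\<^sup>2" by (intro power_mono norm_triangle_ineq) auto
    also have "\<dots> \<le> 2 * ((cmod x)\<^sup>2 + (cmod y)\<^sup>2)"
      using sum_squares_ge_zero[of "cmod x - cmod y" 0] by (simp add: power2_eq_square algebra_simps)
    finally show ?thesis .
  qed
  have m: "(cmod (c * x))\<^sup>2 \<le> (cmod x)\<^sup>2" if "cmod c \<le> 1" for c x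
    using that by (simp add: norm_mult power_mult_distrib mult_left_le_one_le power_le_one)
  have bd: "(cmod (block_op P a u n))\<^sup>2 \<le> 2 * ((cmod (u n))\<^sup>2 + (cmod (u (n + 1)))\<^sup>2) + 2 * ((cmod (u (n - 1)))\<^sup>2 + (cmod (u n))\<^sup>2)" for n
  proof (cases "P n")
    case True
    have "(cmod (block_op P a u n))\<^sup>2 \<le> 2 * ((cmod (cnj (a n) * u n))\<^sup>2 + (cmod (cmv_rho a n * u (n + 1)))\<^sup>2)"
      using True sq by (simp add: block_op_def)
    also have "\<dots> \<le> 2 * ((cmod (u n))\<^sup>2 + (cmod (u (n + 1)))\<^sup>2)"
      using a[of n] cmv_rho_le_1[of a n] by (intro mult_left_mono add_mono m) auto
    finally show ?thesis by (rule order_trans) auto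
  next
    case False
    have "(cmod (block_op P a u n))\<^sup>2 \<le> 2 * ((cmod (cmv_rho a (n - 1) * u (n - 1)))\<^sup>2 + (cmod (- a (n - 1) * u n))\<^sup>2)"
      using False sq[of "cmv_rho a (n - 1) * u (n - 1)" "- a (n - 1) * u n"] by (simp add: block_op_def)
    also have "\<dots> \<le> 2 * ((cmod (u (n - 1)))\<^sup>2 + (cmod (u n))\<^sup>2)"
      using a[of "n - 1"] cmv_rho_le_1[of a "n - 1"] by (intro mult_left_mono add_mono m) auto
    finally show ?thesis by (rule order_trans) auto
  qed
  show ?thesis unfolding l2_int_def mem_Collect_eq
    by (rule summable_on_comparison_test[where f = "\<lambda>n. 2 * ((cmod (u n))\<^sup>2 + (cmod (u (n + 1)))\<^sup>2) + 2 * ((cmod (u (n - 1)))\<^sup>2 + (cmod (u n))\<^sup>2)"])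
       (use bd in \<open>auto intro!: summable_on_add summable_on_cmult_right s s1 s2\<close>)
qed

lemma pblk_isometry:
  assumes a: "\<And>n. cmod (a n) < 1" and P: "\<And>n. P (n + 1) = (\<not> P n)" and u: "u \<in> l2_int" and v: "v \<in> l2_int"
  shows "l2_inner (block_op P a u) (block_op P a v) = l2_inner u v"
proof -
  have e: "cnj (block_op P a u n) * block_op P a v n + cnj (block_op P a u (n + 1)) * block_op P a v (n + 1)
     = cnj (u n) * v n + cnj (u (n + 1)) * v (n + 1)" if "P n" for n
  proof -
    have "cnj (block_op P a u n) * block_op P a v n + cnj (block_op P a u (n + 1)) * block_op P a v (n + 1)
      = (a n * cnj (u n) + cmv_rho a n * cnj (u (n + 1))) * (cnj (a n) * v n + cmv_rho a n * v (n + 1))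
      + (cmv_rho a n * cnj (u n) - cnj (a n) * cnj (u (n + 1))) * (cmv_rho a n * v n - a n * v (n + 1))"
      using that P[of n] by (simp add: block_op_def)
    also have "\<dots> = (cmv_rho a n * cmv_rho a n + a n * cnj (a n)) * (cnj (u n) * v n + cnj (u (n + 1)) * v (n + 1))"
      by (simp add: algebra_simps)
    finally show ?thesis using cmv_rho_sq[of a n] a by simp
  qed
  have "l2_inner (block_op P a u) (block_op P a v) = infsum (\<lambda>n. cnj (block_op P a u n) * block_op P a v n + cnj (block_op P a u (n + 1)) * block_op P a v (n + 1)) {n. P n}"
    unfolding l2_inner_def by (rule infsum_pairs(1)[where P = P, OF P l2_summable]) (use pblk_l2[where a = a and P = P, OF a P] u v in auto)
  also have "\<dots> = infsum (\<lambda>n. cnj (u n) * v n + cnj (u (n + 1)) * v (n + 1)) {n. P n}"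
    by (rule infsum_cong) (use e in auto)
  also have "\<dots> = l2_inner u v"
    unfolding l2_inner_def by (rule infsum_pairs(1)[where P = P, OF P l2_summable[OF u v], symmetric])
  finally show ?thesis .
qed

lemma l2_inner_self: "u \<in> l2_int \<Longrightarrow> l2_inner u u = complex_of_real (l2_sq u)"
proof -
  assume "u \<in> l2_int"
  then have "((\<lambda>n. (cmod (u n))\<^sup>2) has_sum l2_sq u) UNIV" unfolding l2_sq_def l2_int_def by (simp add: has_sum_infsum)
  then have "((\<lambda>n. complex_of_real ((cmod (u n))\<^sup>2)) has_sum complex_of_real (l2_sq u)) UNIV"
    by (simp only: has_sum_of_real_iff)
  moreover have "(\<lambda>n. complex_of_real ((cmod (u n))\<^sup>2)) = (\<lambda>n. cnj (u n) * u n)"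
    by (simp only: complex_norm_square mult.commute)
  ultimately show ?thesis unfolding l2_inner_def by (simp only: infsumI)
qed

lemma n2_nonneg: "0 \<le> l2_sq u"
  unfolding l2_sq_def by (rule infsum_nonneg) simp

text \<open>Used in place of the Cauchy-Schwarz inequality: the right-hand side is linear in the
  squared norms and can be integrated over the angle, and the free \<open>t\<close> later balances a
  small tail against a bounded factor.\<close>

lemma l2_inner_amgm:
  assumes u: "u \<in> l2_int" and v: "v \<in> l2_int" and t: "t > 0"
  shows "cmod (l2_inner u v) \<le> (t * l2_sq u + l2_sq v / t) / 2"
proof -
  have su: "(\<lambda>n. (cmod (u n))\<^sup>2) summable_on UNIV" and sv: "(\<lambda>n. (cmod (v n))\<^sup>2) summable_on UNIV"
    using u v by (auto simp: l2_int_def)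
  have pw: "cmod (cnj x * y) \<le> (t / 2) * (cmod x)\<^sup>2 + (1 / (2 * t)) * (cmod y)\<^sup>2" for x y
  proof -
    have "0 \<le> (t * cmod x - cmod y)\<^sup>2" by simp
    then have "2 * t * (cmod x * cmod y) \<le> t\<^sup>2 * (cmod x)\<^sup>2 + (cmod y)\<^sup>2"
      by (simp add: power2_diff power_mult_distrib algebra_simps)
    then have "2 * t * (cmod x * cmod y) / (2 * t) \<le> (t\<^sup>2 * (cmod x)\<^sup>2 + (cmod y)\<^sup>2) / (2 * t)"
      using t by (intro divide_right_mono) auto
    then show ?thesis using t by (simp add: norm_mult add_divide_distrib power2_eq_square)
  qed
  have s1: "(\<lambda>n. (t / 2) * (cmod (u n))\<^sup>2) summable_on UNIV" by (rule summable_on_cmult_right[OF su])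
  have s2: "(\<lambda>n. (1 / (2 * t)) * (cmod (v n))\<^sup>2) summable_on UNIV" by (rule summable_on_cmult_right[OF sv])
  have "cmod (l2_inner u v) \<le> (\<Sum>\<^sub>\<infinity>n. cmod (cnj (u n) * v n))"
    unfolding l2_inner_def by (rule norm_infsum_bound[OF l2_abs_summable[OF u v]])
  also have "\<dots> \<le> (\<Sum>\<^sub>\<infinity>n. (t / 2) * (cmod (u n))\<^sup>2 + (1 / (2 * t)) * (cmod (v n))\<^sup>2)"
    by (rule infsum_mono[OF l2_abs_summable[OF u v] summable_on_add[OF s1 s2]]) (rule pw)
  also have "\<dots> = (t / 2) * l2_sq u + (1 / (2 * t)) * l2_sq v"
    unfolding l2_sq_def infsum_add[OF s1 s2] infsum_cmult_right' ..
  finally show ?thesis by (simp add: field_simps)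
qed

lemma l2_inner_add_right: "\<lbrakk>u \<in> l2_int; v \<in> l2_int; w \<in> l2_int\<rbrakk> \<Longrightarrow> l2_inner u (\<lambda>n. v n + w n) = l2_inner u v + l2_inner u w"
  unfolding l2_inner_def by (simp add: distrib_left infsum_add l2_summable)

lemma l2_inner_scale_right: "l2_inner u (\<lambda>n. c * v n) = c * l2_inner u v"
  unfolding l2_inner_def by (simp add: mult.left_commute infsum_cmult_right')

lemma l2_inner_cnj: "cnj (l2_inner u v) = l2_inner v u"
  unfolding l2_inner_def by (simp add: infsum_cnj[symmetric] mult.commute del: infsum_cnj)

lemma l2_zero [simp]: "(\<lambda>n. 0) \<in> l2_int"
  by (simp add: l2_int_def)

lemma l2_scale: "u \<in> l2_int \<Longrightarrow> (\<lambda>n. c * u n) \<in> l2_int"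
  by (simp add: l2_int_def norm_mult power_mult_distrib summable_on_cmult_right)

lemma l2_add:
  assumes "u \<in> l2_int" "v \<in> l2_int"
  shows "(\<lambda>n. u n + v n) \<in> l2_int"
proof -
  have "(cmod (x + y))\<^sup>2 \<le> 2 * (cmod x)\<^sup>2 + 2 * (cmod y)\<^sup>2" for x y :: complex
  proof -
    have "(cmod (x + y))\<^sup>2 \<le> (cmod x + cmod y)\<^sup>2" by (intro power_mono norm_triangle_ineq) auto
    also have "\<dots> \<le> 2 * (cmod x)\<^sup>2 + 2 * (cmod y)\<^sup>2"
      using sum_squares_ge_zero[of "cmod x - cmod y" 0] by (simp add: power2_eq_square algebra_simps)
    finally show ?thesis .
  qed
  moreover have "(\<lambda>n. 2 * (cmod (u n))\<^sup>2 + 2 * (cmod (v n))\<^sup>2) summable_on UNIV"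
    using assms by (auto simp: l2_int_def intro!: summable_on_add summable_on_cmult_right)
  ultimately have "(\<lambda>n. (cmod (u n + v n))\<^sup>2) summable_on UNIV"
    using summable_on_comparison_test[of "\<lambda>n. 2 * (cmod (u n))\<^sup>2 + 2 * (cmod (v n))\<^sup>2" UNIV "\<lambda>n. (cmod (u n + v n))\<^sup>2"] by simp
  then show ?thesis by (simp add: l2_int_def)
qed

lemma l2_sum: "finite S \<Longrightarrow> (\<And>j. j \<in> S \<Longrightarrow> f j \<in> l2_int) \<Longrightarrow> (\<lambda>n. \<Sum>j\<in>S. f j n) \<in> l2_int"
  by (induction S rule: finite_induct) (simp_all add: l2_add)

lemma l2_inner_sum_right:
  "finite S \<Longrightarrow> u \<in> l2_int \<Longrightarrow> (\<And>j. j \<in> S \<Longrightarrow> f j \<in> l2_int) \<Longrightarrow> l2_inner u (\<lambda>n. \<Sum>j\<in>S. f j n) = (\<Sum>j\<in>S. l2_inner u (f j))"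
proof (induction S rule: finite_induct)
  case empty
  then show ?case by (simp add: l2_inner_def)
next
  case (insert x S)
  then show ?case using l2_inner_add_right[of u "f x" "\<lambda>n. \<Sum>j\<in>S. f j n"] l2_sum[of S f] by simp
qed

lemma l2_inner_sum_left:
  assumes "finite S" "u \<in> l2_int" "\<And>j. j \<in> S \<Longrightarrow> f j \<in> l2_int"
  shows "l2_inner (\<lambda>n. \<Sum>j\<in>S. f j n) u = (\<Sum>j\<in>S. l2_inner (f j) u)"
proof -
  have "cnj (l2_inner u (\<lambda>n. \<Sum>j\<in>S. f j n)) = cnj (\<Sum>j\<in>S. l2_inner u (f j))"
    by (simp only: l2_inner_sum_right[OF assms])
  then show ?thesis by (simp add: l2_inner_cnj)
qed

lemma l2_inner_scale_left: "l2_inner (\<lambda>n. c * v n) u = cnj c * l2_inner v u"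
  using arg_cong[OF l2_inner_scale_right[of u c v], of cnj] by (simp add: l2_inner_cnj)

lemma pblk_linear:
  "block_op P a (\<lambda>n. u n + v n) = (\<lambda>n. block_op P a u n + block_op P a v n)"
  "block_op P a (\<lambda>n. c * u n) = (\<lambda>n. c * block_op P a u n)"
  by (auto simp: block_op_def fun_eq_iff algebra_simps)

lemma cmv_linear:
  "cmv a (\<lambda>n. u n + v n) = (\<lambda>n. cmv a u n + cmv a v n)"
  "cmv a (\<lambda>n. c * u n) = (\<lambda>n. c * cmv a u n)"
  unfolding cmv_pblk pblk_linear by (rule refl)+

lemma cmv_0: "cmv a (\<lambda>n. 0) = (\<lambda>n. 0)"
  using cmv_linear(2)[of a 0 "\<lambda>n. 0"] by simp

lemma cmv_sum: "finite S \<Longrightarrow> cmv a (\<lambda>n. \<Sum>j\<in>S. f j n) = (\<lambda>n. \<Sum>j\<in>S. cmv a (f j) n)"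
  by (induction S rule: finite_induct) (simp_all add: cmv_linear cmv_0)

lemma even_alt: "even (n + 1) = (\<not> even n)" "odd (n + 1) = (\<not> odd n)" for n :: int
  by auto

lemma cmv_l2: "(\<And>n. cmod (a n) < 1) \<Longrightarrow> u \<in> l2_int \<Longrightarrow> cmv a u \<in> l2_int"
  unfolding cmv_pblk by (intro pblk_l2 even_alt)

lemma cmv_isometry:
  assumes "\<And>n. cmod (a n) < 1" "u \<in> l2_int" "v \<in> l2_int"
  shows "l2_inner (cmv a u) (cmv a v) = l2_inner u v"
  unfolding cmv_pblk using assms by (simp add: pblk_isometry pblk_l2)

lemma cmv_pow_l2: "(\<And>n. cmod (a n) < 1) \<Longrightarrow> u \<in> l2_int \<Longrightarrow> (cmv a ^^ k) u \<in> l2_int"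
  by (induction k) (simp_all add: cmv_l2)

lemma cmv_pow_isometry:
  assumes "\<And>n. cmod (a n) < 1" "u \<in> l2_int" "v \<in> l2_int"
  shows "l2_inner ((cmv a ^^ k) u) ((cmv a ^^ k) v) = l2_inner u v"
  by (induction k) (simp_all add: cmv_isometry cmv_pow_l2 assms)

lemma n2_cmv_pow:
  assumes "\<And>n. cmod (a n) < 1" "u \<in> l2_int"
  shows "l2_sq ((cmv a ^^ k) u) = l2_sq u"
  using cmv_pow_isometry[OF assms assms(2), of k] cmv_pow_l2[OF assms, of k] assms(2)
  by (simp add: l2_inner_self)

text \<open>An approximate solution of \<open>cmv h = z h\<close>, \<open>z = s\<^sup>2\<close>, turns into an approximate solution of the scalar recursion.\<close>

definition half_step :: "(int \<Rightarrow> complex) \<Rightarrow> complex \<Rightarrow> (int \<Rightarrow> complex) \<Rightarrow> int \<Rightarrow> complex"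
  where "half_step a s h n = (if even n then s * h n + cnj (block_op odd a h n) else block_op odd a h n + cnj (s * h n))"

text \<open>With \<open>v = block_op odd a h\<close>, the pair formed by \<open>s * h\<close> and
  \<open>v\<close> satisfies the complex transfer equations, which commute with exchanging the two
  entries and conjugating them. \<open>half_step\<close> is twice the part of the pair fixed by this
  symmetry, so it obeys the real-linear recursion; applied to \<open>\<i> * h\<close> it gives the
  other part.\<close>

lemma half_step_recursion:
  assumes a: "cmod (a n) < 1" and s: "cmod s = 1"
  shows "cmod (half_step a s h (n + 1) - szego (a n) s (half_step a s h n))
    \<le> 2 / sqrt (1 - (cmod (a n))\<^sup>2) * (cmod (cmv a h n - s\<^sup>2 * h n) + cmod (cmv a h (n + 1) - s\<^sup>2 * h (n + 1)))"
proof -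
  define v where "v = block_op odd a h"
  define \<rho> where "\<rho> = cmv_rho a n"
  have \<rho>r: "\<rho> = complex_of_real (sqrt (1 - (cmod (a n))\<^sup>2))" by (simp add: \<rho>_def cmv_rho_def)
  have p: "0 < sqrt (1 - (cmod (a n))\<^sup>2)" using rho_pos[OF a] .
  have r0: "\<rho> \<noteq> 0" using p by (simp add: \<rho>r)
  have rr: "\<rho> * \<rho> = 1 - a n * cnj (a n)" using cmv_rho_sq[of a n, OF a] by (simp add: \<rho>_def)
  have rc: "cnj \<rho> = \<rho>" by (simp add: \<rho>_def)
  have ss: "s * cnj s = 1" by (rule unit_mult_cnj(1)[OF s])
  show ?thesis
  proof (cases "even n")
    case False
    \<comment> \<open>From an odd site to the next even one only the definition of \<open>v\<close>
      enters, so the recursion is exact there.\<close>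
    have v1: "v n = cnj (a n) * h n + \<rho> * h (n + 1)" using False by (simp add: v_def block_op_def \<rho>_def)
    have v2: "v (n + 1) = \<rho> * h n - a n * h (n + 1)" using False by (simp add: v_def block_op_def \<rho>_def)
    have q: "\<rho> * h (n + 1) = v n - cnj (a n) * h n" by (simp add: v1)
    have q2: "\<rho> * v (n + 1) = (\<rho> * \<rho>) * h n - a n * (\<rho> * h (n + 1))" unfolding v2 by (simp add: algebra_simps)
    have "\<rho> * half_step a s h (n + 1) = \<rho> * s * h (n + 1) + cnj (\<rho> * v (n + 1))"
      using False by (simp add: half_step_def v_def[symmetric] rc algebra_simps)
    also have "\<rho> * s * h (n + 1) = s * (v n - cnj (a n) * h n)" by (simp add: v1)
    also have "\<rho> * v (n + 1) = h n - a n * v n"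
      unfolding q2 unfolding rr q by (simp add: algebra_simps)
    also have "s * (v n - cnj (a n) * h n) + cnj (h n - a n * v n) = s * (v n + cnj (s * h n)) - cnj (a n) * cnj (v n + cnj (s * h n))"
      using ss by (simp add: algebra_simps)
    also have "\<dots> = \<rho> * szego (a n) s (half_step a s h n)"
      using False r0 by (simp add: half_step_def v_def[symmetric] szego_def \<rho>r[symmetric])
    finally have "half_step a s h (n + 1) = szego (a n) s (half_step a s h n)" using r0 by simp
    then show ?thesis using p by simp
  next
    case True
    \<comment> \<open>From an even site to the next odd one the factor \<open>block_op even\<close>
      enters; it is here that the operator value is replaced by \<open>s\<^sup>2 * h\<close> at the
      price of the residual \<open>e\<close>.\<close>
    define e where "e m = cmv a h m - s\<^sup>2 * h m" for m
    have c1: "cmv a h n = cnj (a n) * v n + \<rho> * v (n + 1)" using True by (simp add: cmv_pblk block_op_def[of even] v_def \<rho>_def)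
    have c2: "cmv a h (n + 1) = \<rho> * v n - a n * v (n + 1)" using True by (simp add: cmv_pblk block_op_def[of even] v_def \<rho>_def)
    have w1: "\<rho> * v (n + 1) = s * s * h n + e n - cnj (a n) * v n" using c1 by (simp add: e_def power2_eq_square)
    have w2: "s * s * h (n + 1) = \<rho> * v n - a n * v (n + 1) - e (n + 1)" using c2 by (simp add: e_def power2_eq_square)
    have "\<rho> * (\<rho> * v n - a n * v (n + 1)) = \<rho> * \<rho> * v n - a n * (\<rho> * v (n + 1))" by (simp add: algebra_simps)
    also have "\<dots> = v n - a n * (s * s * h n) - a n * e n" unfolding rr w1 by (simp add: algebra_simps)
    finally have w3: "\<rho> * (s * s * h (n + 1)) = v n - a n * (s * s * h n) - a n * e n - \<rho> * e (n + 1)"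
      unfolding w2 by (simp add: right_diff_distrib)
    have "\<rho> * (s * h (n + 1)) = cnj s * (\<rho> * (s * s * h (n + 1)))"
      using ss by (simp add: mult.assoc[symmetric] mult.commute[of "cnj s"])
    also have "\<dots> = cnj s * v n - a n * (s * h n) - cnj s * (a n * e n + \<rho> * e (n + 1))"
      unfolding w3 using ss by (simp add: algebra_simps)
    finally have w4: "\<rho> * (s * h (n + 1)) = cnj s * v n - a n * (s * h n) - cnj s * (a n * e n + \<rho> * e (n + 1))" .
    have "\<rho> * half_step a s h (n + 1) = \<rho> * v (n + 1) + cnj (\<rho> * (s * h (n + 1)))"
      using True by (simp add: half_step_def v_def[symmetric] rc algebra_simps)
    also have "\<dots> = (s * (s * h n + cnj (v n)) - cnj (a n) * cnj (s * h n + cnj (v n))) + (e n - s * cnj (a n * e n + \<rho> * e (n + 1)))"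
      unfolding w1 w4 by (simp add: algebra_simps)
    also have "s * (s * h n + cnj (v n)) - cnj (a n) * cnj (s * h n + cnj (v n)) = \<rho> * szego (a n) s (half_step a s h n)"
      using True r0 by (simp add: half_step_def v_def[symmetric] szego_def \<rho>r[symmetric])
    finally have "\<rho> * (half_step a s h (n + 1) - szego (a n) s (half_step a s h n)) = e n - s * cnj (a n * e n + \<rho> * e (n + 1))"
      by (simp add: algebra_simps)
    then have "cmod \<rho> * cmod (half_step a s h (n + 1) - szego (a n) s (half_step a s h n)) = cmod (e n - s * cnj (a n * e n + \<rho> * e (n + 1)))"
      by (metis norm_mult)
    also have "\<dots> \<le> cmod (e n) + cmod (s * cnj (a n * e n + \<rho> * e (n + 1)))" by (rule norm_triangle_ineq4)
    also have "cmod (s * cnj (a n * e n + \<rho> * e (n + 1))) = cmod (a n * e n + \<rho> * e (n + 1))"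
      unfolding norm_mult complex_mod_cnj s by simp
    also have "\<dots> \<le> cmod (a n * e n) + cmod (\<rho> * e (n + 1))" by (rule norm_triangle_ineq)
    also have "\<dots> \<le> 1 * cmod (e n) + 1 * cmod (e (n + 1))"
      unfolding norm_mult using a cmv_rho_le_1[of a n, OF a] by (intro add_mono mult_right_mono) (auto simp: \<rho>_def)
    also have "cmod (e n) + (1 * cmod (e n) + 1 * cmod (e (n + 1))) \<le> 2 * (cmod (e n) + cmod (e (n + 1)))" by simp
    finally have "cmod \<rho> * cmod (half_step a s h (n + 1) - szego (a n) s (half_step a s h n)) \<le> 2 * (cmod (e n) + cmod (e (n + 1)))"
      by simp
    moreover have "cmod \<rho> = sqrt (1 - (cmod (a n))\<^sup>2)" using p by (simp add: \<rho>r)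
    ultimately have "sqrt (1 - (cmod (a n))\<^sup>2) * cmod (half_step a s h (n + 1) - szego (a n) s (half_step a s h n)) \<le> 2 * (cmod (e n) + cmod (e (n + 1)))"
      by simp
    then have "cmod (half_step a s h (n + 1) - szego (a n) s (half_step a s h n)) \<le> 2 * (cmod (e n) + cmod (e (n + 1))) / sqrt (1 - (cmod (a n))\<^sup>2)"
      using p by (simp add: pos_le_divide_eq mult.commute)
    then show ?thesis unfolding e_def by simp
  qed
qed

section \<open>Approximate eigenvectors as approximate solutions\<close>

lemma szego_growth_const:
  assumes "0 \<le> r" "r < 1" "C = 2 / sqrt (1 - r\<^sup>2)"
  shows "1 \<le> C"
proof -
  have "0 < sqrt (1 - r\<^sup>2)" "sqrt (1 - r\<^sup>2) \<le> 1" using assms(1,2) by (auto simp: abs_square_less_1)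
  then have "2 / 1 \<le> 2 / sqrt (1 - r\<^sup>2)" by (intro divide_left_mono) auto
  then show ?thesis using assms(3) by simp
qed

text \<open>A discrete Gronwall estimate: each step multiplies the accumulated error by at most
  \<open>C\<close> and adds \<open>e\<close>. To the left the inverse step is used, which obeys the
  same bound.\<close>

lemma sol_approx:
  assumes r: "0 \<le> r" "r < 1" and a: "\<And>n. cmod (a n) \<le> r" and s: "cmod s = 1" and C: "C = 2 / sqrt (1 - r\<^sup>2)"
    and x: "\<And>n. -int M \<le> n \<Longrightarrow> n < int M \<Longrightarrow> cmod (x (n + 1) - szego (a n) s (x n)) \<le> e"
    and k: "k \<le> M"
  shows "cmod (x (int k) - sol a s (x 0) (int k)) \<le> real k * C ^ k * e"
    and "cmod (x (- int k) - sol a s (x 0) (- int k)) \<le> real k * C ^ k * e"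
proof -
  have a1: "cmod (a n) < 1" for n using a[of n] r by linarith
  have C1: "1 \<le> C" by (rule szego_growth_const[OF r C])
  have sz: "cmod (szego b t y) \<le> C * cmod y" if "cmod b \<le> r" "cmod t = 1" for b t y
    unfolding C by (rule szego_bound[OF that(1) r(2) that(2)])
  have "-int M \<le> 0" "M > 0 \<Longrightarrow> 0 < int M" by auto
  show "cmod (x (int k) - sol a s (x 0) (int k)) \<le> real k * C ^ k * e" using k
  proof (induction k)
    case (Suc k)
    define D where "D = x (int k) - sol a s (x 0) (int k)"
    have "0 \<le> e" using x[of 0] Suc.prems norm_ge_zero order_trans by (metis neg_le_0_iff_le of_nat_0_le_iff of_nat_0_less_iff Suc_le_lessD gr_zeroI less_zeroE)
    have sc: "szego b s (- 1 * y) = - szego b s y" for b y using szego_scale[of b s "-1" y] by simp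
    have "x (int (Suc k)) - sol a s (x 0) (int (Suc k)) = (x (int k + 1) - szego (a (int k)) s (x (int k))) + szego (a (int k)) s D"
      using sol_step[where a = a, OF s a1, of "x 0" "int k"] szego_add[of "a (int k)" s "x (int k)" "- 1 * sol a s (x 0) (int k)"] sc
      by (simp add: D_def add.commute)
    then have "cmod (x (int (Suc k)) - sol a s (x 0) (int (Suc k))) \<le> cmod (x (int k + 1) - szego (a (int k)) s (x (int k))) + cmod (szego (a (int k)) s D)"
      by (metis norm_triangle_ineq)
    also have "\<dots> \<le> e + C * cmod D"
      using x[of "int k"] Suc.prems sz[OF a s] by (intro add_mono) auto
    also have "\<dots> \<le> C ^ Suc k * e + C * (real k * C ^ k * e)"
    proof (intro add_mono mult_left_mono)
      have "1 * e \<le> C ^ Suc k * e" using C1 \<open>0 \<le> e\<close> by (intro mult_right_mono one_le_power) auto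
      then show "e \<le> C ^ Suc k * e" by simp
    qed (use Suc C1 in \<open>auto simp: D_def\<close>)
    also have "\<dots> = real (Suc k) * C ^ Suc k * e" by (simp add: algebra_simps)
    finally show ?case .
  qed simp
  show "cmod (x (- int k) - sol a s (x 0) (- int k)) \<le> real k * C ^ k * e" using k
  proof (induction k)
    case (Suc k)
    define m where "m = - int (Suc k)"
    have m1: "m + 1 = - int k" by (simp add: m_def)
    define D where "D = x (m + 1) - sol a s (x 0) (m + 1)"
    have ex: "cmod (x (m + 1) - szego (a m) s (x m)) \<le> e" using x[of m] Suc.prems by (auto simp: m_def)
    then have "0 \<le> e" using norm_ge_zero order_trans by blast
    have sc: "szego b t (- 1 * y) = - szego b t y" for b t y using szego_scale[of b t "-1" y] by simp
    define Y where "Y = D - (x (m + 1) - szego (a m) s (x m))"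
    have "Y = szego (a m) s (x m - sol a s (x 0) m)"
      using sol_step[where a = a, OF s a1, of "x 0" m] szego_add[of "a m" s "x m" "- 1 * sol a s (x 0) m"] sc
      by (simp add: D_def Y_def)
    then have "x m - sol a s (x 0) m = szego (- a m) (cnj s) Y" using szego_inverse[OF a1 s] by simp
    then have "cmod (x m - sol a s (x 0) m) \<le> C * cmod Y" using sz[of "- a m" "cnj s" Y] a s by simp
    also have "\<dots> \<le> C * (cmod D + e)"
      using C1 ex norm_triangle_ineq4[of D "x (m + 1) - szego (a m) s (x m)"] by (intro mult_left_mono) (auto simp: Y_def)
    also have "\<dots> \<le> C * (real k * C ^ k * e + C ^ k * e)"
    proof (intro mult_left_mono add_mono)
      have "1 * e \<le> C ^ k * e" using C1 \<open>0 \<le> e\<close> by (intro mult_right_mono one_le_power) auto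
      then show "e \<le> C ^ k * e" by simp
    qed (use Suc C1 in \<open>auto simp: D_def m1\<close>)
    also have "\<dots> = real (Suc k) * C ^ Suc k * e" by (simp add: algebra_simps)
    finally show ?case by (simp add: m_def)
  qed simp
qed

lemma sol_bound:
  assumes r: "0 \<le> r" "r < 1" and a: "\<And>n. cmod (a n) \<le> r" and s: "cmod s = 1" and C: "C = 2 / sqrt (1 - r\<^sup>2)"
  shows "cmod (sol a s v n) \<le> C ^ nat \<bar>n\<bar> * cmod v"
proof -
  have b: "cmod (fwd b t v k) \<le> C ^ k * cmod v" if "\<And>n. cmod (b n) \<le> r" "cmod t = 1" for b t k
  proof (induction k)
    case (Suc k)
    have "cmod (fwd b t v (Suc k)) \<le> C * cmod (fwd b t v k)" using szego_bound[OF that(1) r(2) that(2)] by (simp add: C)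
    also have "\<dots> \<le> C * (C ^ k * cmod v)" using Suc szego_growth_const[OF r C] by (intro mult_left_mono) auto
    finally show ?case by (simp add: mult.assoc)
  qed simp
  show ?thesis using a s by (auto simp: sol_def intro!: b)
qed

definition cmv_error :: "(int \<Rightarrow> complex) \<Rightarrow> complex \<Rightarrow> (int \<Rightarrow> complex) \<Rightarrow> nat \<Rightarrow> real"
  where "cmv_error a z h M = (\<Sum>n=-int M..int M. cmod (cmv a h n - z * h n))"

lemma half_step_approx:
  assumes r: "0 \<le> r" "r < 1" and a: "\<And>n. cmod (a n) \<le> r" and s: "cmod s = 1" and C: "C = 2 / sqrt (1 - r\<^sup>2)"
    and n: "\<bar>n\<bar> \<le> int M"
  shows "cmod (half_step a s h n - sol a s (half_step a s h 0) n) \<le> real M * C ^ Suc M * cmv_error a (s\<^sup>2) h M"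
proof -
  have a1: "cmod (a n) < 1" for n using a[of n] r by linarith
  have C1: "1 \<le> C" by (rule szego_growth_const[OF r C])
  define e where "e = C * cmv_error a (s\<^sup>2) h M"
  have E0: "0 \<le> cmv_error a (s\<^sup>2) h M" unfolding cmv_error_def by (intro sum_nonneg) auto
  have res: "cmod (half_step a s h (m + 1) - szego (a m) s (half_step a s h m)) \<le> e" if "-int M \<le> m" "m < int M" for m
  proof -
    have "cmod (cmv a h m - s\<^sup>2 * h m) + cmod (cmv a h (m + 1) - s\<^sup>2 * h (m + 1)) = (\<Sum>n\<in>{m, m + 1}. cmod (cmv a h n - s\<^sup>2 * h n))" by simp
    also have "\<dots> \<le> cmv_error a (s\<^sup>2) h M" unfolding cmv_error_def using that by (intro sum_mono2) auto
    finally have 1: "cmod (cmv a h m - s\<^sup>2 * h m) + cmod (cmv a h (m + 1) - s\<^sup>2 * h (m + 1)) \<le> cmv_error a (s\<^sup>2) h M" .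
    have p: "0 < sqrt (1 - r\<^sup>2)" using r by (simp add: abs_square_less_1)
    have "sqrt (1 - r\<^sup>2) \<le> sqrt (1 - (cmod (a m))\<^sup>2)" using a by (simp add: power_mono)
    then have 2: "2 / sqrt (1 - (cmod (a m))\<^sup>2) \<le> C" unfolding C using p by (intro frac_le) auto
    have "2 / sqrt (1 - (cmod (a m))\<^sup>2) * (cmod (cmv a h m - s\<^sup>2 * h m) + cmod (cmv a h (m + 1) - s\<^sup>2 * h (m + 1))) \<le> e"
      unfolding e_def using 1 2 C1 E0 by (intro mult_mono) auto
    then show ?thesis using half_step_recursion[where a = a and n = m and h = h, OF a1 s] by linarith
  qed
  have "cmod (half_step a s h n - sol a s (half_step a s h 0) n) \<le> real (nat \<bar>n\<bar>) * C ^ nat \<bar>n\<bar> * e"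
  proof (cases "0 \<le> n")
    case True
    then show ?thesis using sol_approx(1)[where a = a and x = "half_step a s h" and k = "nat \<bar>n\<bar>" and M = M, OF r a s C res] n by simp
  next
    case False
    then show ?thesis using sol_approx(2)[where a = a and x = "half_step a s h" and k = "nat \<bar>n\<bar>" and M = M, OF r a s C res] n by simp
  qed
  also have "\<dots> \<le> real M * C ^ M * e"
    using n C1 E0 by (intro mult_right_mono mult_mono power_increasing) (auto simp: e_def)
  finally show ?thesis by (simp add: e_def mult_ac)
qed

lemma half_step_norm:
  assumes "\<And>n. cmod (a n) < 1" "cmod s = 1"
  shows "cmod (half_step a s h n) \<le> 2 * cmod (h n) + cmod (h (n - 1)) + cmod (h (n + 1))"
proof -
  have "cmod (block_op odd a h n) \<le> cmod (h n) + cmod (h (n - 1)) + cmod (h (n + 1))"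
  proof (cases "odd n")
    case True
    have "cmod (block_op odd a h n) \<le> cmod (cnj (a n) * h n) + cmod (cmv_rho a n * h (n + 1))"
      using True by (simp add: block_op_def norm_triangle_ineq)
    also have "\<dots> \<le> 1 * cmod (h n) + 1 * cmod (h (n + 1))"
      unfolding norm_mult complex_mod_cnj using assms(1)[of n] cmv_rho_le_1[of a n] by (intro add_mono mult_right_mono) auto
    finally show ?thesis using norm_ge_zero[of "h (n - 1)"] by linarith
  next
    case False
    have "cmod (block_op odd a h n) \<le> cmod (cmv_rho a (n - 1) * h (n - 1)) + cmod (a (n - 1) * h n)"
      using False by (simp add: block_op_def norm_triangle_ineq4)
    also have "\<dots> \<le> 1 * cmod (h (n - 1)) + 1 * cmod (h n)"
      unfolding norm_mult using assms(1)[of "n - 1"] cmv_rho_le_1[of a "n - 1"] by (intro add_mono mult_right_mono) auto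
    finally show ?thesis using norm_ge_zero[of "h (n + 1)"] by linarith
  qed
  moreover have "cmod (half_step a s h n) \<le> cmod (s * h n) + cmod (block_op odd a h n)"
    unfolding half_step_def by (auto intro!: order_trans[OF norm_triangle_ineq] simp: add.commute simp del: complex_cnj_mult)
  ultimately show ?thesis using assms(2) by (simp add: norm_mult)
qed

text \<open>Up to conjugation and the unimodular \<open>s\<close>, the values of
  \<open>half_step\<close> on \<open>h\<close> and on \<open>\<i> * h\<close> are two real parts of
  the same data; their combination with \<open>\<i>\<close> returns twice \<open>h\<close>.\<close>

lemma half_step_recover:
  assumes s: "cmod s = 1"
  shows "cmod (h n) \<le> (cmod (half_step a s h n) + cmod (half_step a s (\<lambda>n. \<i> * h n) n)) / 2"
proof -
  have p: "block_op odd a (\<lambda>n. \<i> * h n) n = \<i> * block_op odd a h n" by (simp add: pblk_linear(2))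
  have "2 * cmod (h n) \<le> cmod (half_step a s h n) + cmod (half_step a s (\<lambda>n. \<i> * h n) n)"
  proof (cases "even n")
    case True
    have "2 * (s * h n) = half_step a s h n - \<i> * half_step a s (\<lambda>n. \<i> * h n) n"
      using True by (simp add: half_step_def p algebra_simps)
    then have "cmod (2 * (s * h n)) \<le> cmod (half_step a s h n) + cmod (\<i> * half_step a s (\<lambda>n. \<i> * h n) n)"
      by (metis norm_triangle_ineq4)
    then show ?thesis using s by (simp add: norm_mult)
  next
    case False
    have "2 * cnj (s * h n) = half_step a s h n + \<i> * half_step a s (\<lambda>n. \<i> * h n) n"
      using False by (simp add: half_step_def p algebra_simps)
    then have "cmod (2 * cnj (s * h n)) \<le> cmod (half_step a s h n) + cmod (\<i> * half_step a s (\<lambda>n. \<i> * h n) n)"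
      by (metis norm_triangle_ineq)
    then show ?thesis using s by (simp add: norm_mult)
  qed
  then show ?thesis by simp
qed

lemma cmv_error_scale: "cmv_error a z (\<lambda>n. c * h n) M = cmod c * cmv_error a z h M"
proof -
  have "cmv a (\<lambda>n. c * h n) n - z * (c * h n) = c * (cmv a h n - z * h n)" for n
    by (simp add: cmv_linear(2) algebra_simps)
  then show ?thesis unfolding cmv_error_def by (simp add: norm_mult sum_distrib_left)
qed

lemma cmv_error_nonneg: "0 \<le> cmv_error a z h M"
  unfolding cmv_error_def by (intro sum_nonneg) auto

lemma n2_window:
  assumes "u \<in> l2_int" "finite W"
  shows "(\<Sum>n\<in>W. (cmod (u n))\<^sup>2) \<le> l2_sq u"
  unfolding l2_sq_def by (rule finite_sum_le_infsum) (use assms in \<open>auto simp: l2_int_def\<close>)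

lemma n2_point: "u \<in> l2_int \<Longrightarrow> cmod (u n) \<le> sqrt (l2_sq u)"
  using n2_window[of u "{n}"] by (intro real_le_rsqrt) simp

lemma l2_tail:
  assumes u: "u \<in> l2_int" and \<epsilon>: "\<epsilon> > 0"
  obtains J :: nat where "(\<lambda>n. if \<bar>n\<bar> \<le> int J then 0 else u n) \<in> l2_int" "l2_sq (\<lambda>n. if \<bar>n\<bar> \<le> int J then 0 else u n) < \<epsilon>"
proof -
  have s: "(\<lambda>n. (cmod (u n))\<^sup>2) summable_on UNIV" using u by (simp add: l2_int_def)
  then have "((\<lambda>n. (cmod (u n))\<^sup>2) has_sum l2_sq u) UNIV" unfolding l2_sq_def by (rule has_sum_infsum)
  then have "\<forall>\<^sub>F F in finite_subsets_at_top UNIV. dist (\<Sum>n\<in>F. (cmod (u n))\<^sup>2) (l2_sq u) < \<epsilon>"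
    unfolding has_sum_def using \<epsilon> by (rule tendstoD)
  then obtain F where F: "finite F" "\<And>F'. finite F' \<Longrightarrow> F \<subseteq> F' \<Longrightarrow> dist (\<Sum>n\<in>F'. (cmod (u n))\<^sup>2) (l2_sq u) < \<epsilon>"
    by (auto simp: eventually_finite_subsets_at_top)
  define J where "J = nat (\<Sum>n\<in>F. \<bar>n\<bar>)"
  have "n \<in> {-int J..int J}" if "n \<in> F" for n
  proof -
    have "\<bar>n\<bar> \<le> (\<Sum>n\<in>F. \<bar>n\<bar>)" using F(1) that by (intro member_le_sum) auto
    then show ?thesis by (auto simp: J_def)
  qed
  then have d: "dist (\<Sum>n=-int J..int J. (cmod (u n))\<^sup>2) (l2_sq u) < \<epsilon>" by (intro F(2)) auto
  define W where "W = {-int J..int J}"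
  define t where "t n = (if \<bar>n\<bar> \<le> int J then 0 else u n)" for n
  have tW: "(cmod (t n))\<^sup>2 = (if n \<in> W then 0 else (cmod (u n))\<^sup>2)" for n by (auto simp: t_def W_def)
  have st: "(\<lambda>n. (cmod (t n))\<^sup>2) summable_on UNIV"
    by (rule summable_on_comparison_test[OF s]) (auto simp: tW)
  have "l2_sq t = (\<Sum>\<^sub>\<infinity>n\<in>UNIV - W. (cmod (u n))\<^sup>2)"
    unfolding l2_sq_def by (rule infsum_cong_neutral) (auto simp: tW)
  also have "l2_sq u = infsum (\<lambda>n. (cmod (u n))\<^sup>2) (W \<union> (UNIV - W))" by (simp add: l2_sq_def)
  then have "l2_sq u = (\<Sum>n\<in>W. (cmod (u n))\<^sup>2) + (\<Sum>\<^sub>\<infinity>n\<in>UNIV - W. (cmod (u n))\<^sup>2)"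
    by (subst (asm) infsum_Un_disjoint) (auto simp: W_def intro: summable_on_subset_banach[OF s])
  then have "(\<Sum>\<^sub>\<infinity>n\<in>UNIV - W. (cmod (u n))\<^sup>2) = l2_sq u - (\<Sum>n\<in>W. (cmod (u n))\<^sup>2)" by simp
  finally have "l2_sq t = l2_sq u - (\<Sum>n\<in>W. (cmod (u n))\<^sup>2)" .
  then have "l2_sq t < \<epsilon>" using d by (simp add: W_def dist_real_def)
  then show ?thesis using that[of J] st by (simp add: t_def[abs_def] l2_int_def)
qed

section \<open>Absence of atoms\<close>

text \<open>A Dini argument: window sums increase with \<open>M\<close> and are continuous in
  \<open>v\<close> on the compact unit circle.\<close>

lemma window_uniform:
  assumes a: "\<And>n. cmod (a n) < 1" and H: "\<And>v. cmod v = 1 \<Longrightarrow> \<exists>M::nat. B < (\<Sum>n=-int M..int M. (cmod (sol a s v n))\<^sup>2)"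
  shows "\<exists>M::nat. \<forall>v. cmod v = 1 \<longrightarrow> B < (\<Sum>n=-int M..int M. (cmod (sol a s v n))\<^sup>2)"
proof (rule ccontr)
  assume "\<not> ?thesis"
  then obtain v where v: "\<And>M::nat. cmod (v M) = 1" "\<And>M::nat. (\<Sum>n=-int M..int M. (cmod (sol a s (v M) n))\<^sup>2) \<le> B"
    unfolding not_ex not_all not_imp not_less by metis
  have "bounded (range v)" using v(1) by (auto intro!: boundedI[of _ 1])
  then obtain x r where r: "strict_mono (r :: nat \<Rightarrow> nat)" "(v \<circ> r) \<longlonglongrightarrow> x"
    using bounded_imp_convergent_subsequence by blast
  have "cmod x = 1" using tendsto_norm[OF r(2)] v(1) by (simp add: o_def LIMSEQ_const_iff)
  then obtain M :: nat where M: "B < (\<Sum>n=-int M..int M. (cmod (sol a s x n))\<^sup>2)" using H by blast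
  have "(\<lambda>i. \<Sum>n=-int M..int M. (cmod (sol a s (v (r i)) n))\<^sup>2) \<longlonglongrightarrow> (\<Sum>n=-int M..int M. (cmod (sol a s x n))\<^sup>2)"
    using r(2) a by (intro tendsto_intros tendsto_sol) (auto simp: o_def)
  then have "(\<Sum>n=-int M..int M. (cmod (sol a s x n))\<^sup>2) \<le> B"
  proof (rule LIMSEQ_le_const2, intro exI allI impI)
    fix i assume "M \<le> i"
    then have "M \<le> r i" using seq_suble[OF r(1), of i] by simp
    then have "(\<Sum>n=-int M..int M. (cmod (sol a s (v (r i)) n))\<^sup>2) \<le> (\<Sum>n=-int (r i)..int (r i). (cmod (sol a s (v (r i)) n))\<^sup>2)"
      by (intro sum_mono2) auto
    with v(2)[of "r i"] show "(\<Sum>n=-int M..int M. (cmod (sol a s (v (r i)) n))\<^sup>2) \<le> B" by linarith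
  qed
  with M show False by simp
qed

lemma three_squares: "(x + y + z)\<^sup>2 \<le> 3 * (x\<^sup>2 + y\<^sup>2 + z\<^sup>2)" for x y z :: real
proof -
  have "0 \<le> (x - y)\<^sup>2 + (y - z)\<^sup>2 + (x - z)\<^sup>2" by simp
  then show ?thesis by (simp add: power2_eq_square algebra_simps)
qed

text \<open>A bounded approximate eigenvector cannot follow a solution whose mass grows without
  bound: if \<open>half_step\<close> stayed away from 0 at the origin, the solution with this
  initial value would exceed on a fixed window the mass that \<open>h\<close> allows.\<close>

lemma half_step_null:
  assumes r: "0 \<le> r" "r < 1" and a: "\<And>n. cmod (a n) \<le> r" and s: "cmod s = 1"
    and H: "\<And>B v. cmod v = 1 \<Longrightarrow> \<exists>M::nat. B < (\<Sum>n=-int M..int M. (cmod (sol a s v n))\<^sup>2)"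
    and err: "\<And>M. (\<lambda>N. cmv_error a (s\<^sup>2) (h N) M) \<longlonglongrightarrow> 0"
    and Q: "\<And>N W. finite W \<Longrightarrow> (\<Sum>n\<in>W. (cmod (h N n))\<^sup>2) \<le> Q"
  shows "(\<lambda>N. half_step a s (h N) 0) \<longlonglongrightarrow> 0"
proof (rule LIMSEQ_I)
  fix \<epsilon> :: real assume \<epsilon>: "\<epsilon> > 0"
  have a1: "cmod (a n) < 1" for n using a[of n] r by linarith
  define C where "C = 2 / sqrt (1 - r\<^sup>2)"
  have Q0: "0 \<le> Q" using Q[of "{}"] by simp
  \<comment> \<open>On a window the mass of \<open>half_step\<close> is at most
    \<open>18 * Q\<close>, by the coefficients 2, 1, 1 of \<open>half_step_norm\<close> and
    \<open>three_squares\<close>. Passing to the exact solution doubles this and adds 2 for the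
    approximation error.\<close>
  define B where "B = (36 * Q + 2) / \<epsilon>\<^sup>2"
  obtain M :: nat where M: "\<And>v. cmod v = 1 \<Longrightarrow> B < (\<Sum>n=-int M..int M. (cmod (sol a s v n))\<^sup>2)"
    using window_uniform[where a = a and B = B, OF a1 H] by blast
  define E where "E N = real M * C ^ Suc M * cmv_error a (s\<^sup>2) (h N) M" for N
  have "(\<lambda>N. (2 * real M + 1) * (E N)\<^sup>2) \<longlonglongrightarrow> (2 * real M + 1) * (real M * C ^ Suc M * 0)\<^sup>2"
    unfolding E_def by (intro tendsto_intros err)
  then have "\<forall>\<^sub>F N in sequentially. (2 * real M + 1) * (E N)\<^sup>2 < 1"
    by (intro order_tendstoD(2)[where y = "(2 * real M + 1) * (real M * C ^ Suc M * 0)\<^sup>2"]) auto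
  then obtain N0 where N0: "\<And>N. N \<ge> N0 \<Longrightarrow> (2 * real M + 1) * (E N)\<^sup>2 < 1" by (auto simp: eventually_sequentially)
  show "\<exists>N0. \<forall>N\<ge>N0. norm (half_step a s (h N) 0 - 0) < \<epsilon>"
  proof (intro exI[of _ N0] allI impI)
    fix N assume N: "N0 \<le> N"
    define x where "x = half_step a s (h N)"
    have win: "(\<Sum>n=-int M..int M. (cmod (h N (n + d)))\<^sup>2) \<le> Q" for d
    proof -
      have "(\<Sum>n=-int M..int M. (cmod (h N (n + d)))\<^sup>2) = (\<Sum>n\<in>(\<lambda>n. n + d) ` {-int M..int M}. (cmod (h N n))\<^sup>2)"
        by (subst sum.reindex) (auto simp: inj_on_def)
      also have "\<dots> \<le> Q" by (rule Q) simp
      finally show ?thesis .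
    qed
    have "(\<Sum>n=-int M..int M. (cmod (x n))\<^sup>2) \<le> (\<Sum>n=-int M..int M. 12 * (cmod (h N (n + 0)))\<^sup>2 + 3 * (cmod (h N (n + (-1))))\<^sup>2 + 3 * (cmod (h N (n + 1)))\<^sup>2)"
    proof (rule sum_mono)
      fix n
      have "(cmod (x n))\<^sup>2 \<le> (2 * cmod (h N n) + cmod (h N (n - 1)) + cmod (h N (n + 1)))\<^sup>2"
        unfolding x_def by (intro power_mono half_step_norm a1 s) auto
      also have "\<dots> \<le> 3 * ((2 * cmod (h N n))\<^sup>2 + (cmod (h N (n - 1)))\<^sup>2 + (cmod (h N (n + 1)))\<^sup>2)" by (rule three_squares)
      finally show "(cmod (x n))\<^sup>2 \<le> 12 * (cmod (h N (n + 0)))\<^sup>2 + 3 * (cmod (h N (n + (-1))))\<^sup>2 + 3 * (cmod (h N (n + 1)))\<^sup>2"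
        by (simp add: power_mult_distrib)
    qed
    also have "\<dots> \<le> 12 * Q + 3 * Q + 3 * Q"
      unfolding sum.distrib sum_distrib_left[symmetric] by (intro add_mono mult_left_mono win) auto
    finally have X: "(\<Sum>n=-int M..int M. (cmod (x n))\<^sup>2) \<le> 18 * Q" by simp
    have "(\<Sum>n=-int M..int M. (cmod (sol a s (x 0) n))\<^sup>2) \<le> (\<Sum>n=-int M..int M. 2 * (cmod (x n))\<^sup>2 + 2 * (E N)\<^sup>2)"
    proof (rule sum_mono)
      fix n assume "n \<in> {-int M..int M}"
      then have "cmod (x n - sol a s (x 0) n) \<le> E N"
        unfolding x_def E_def by (intro half_step_approx[OF r a s C_def]) auto
      moreover have "cmod (sol a s (x 0) n) \<le> cmod (x n) + cmod (x n - sol a s (x 0) n)"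
        by (metis norm_minus_commute norm_triangle_sub)
      ultimately have "(cmod (sol a s (x 0) n))\<^sup>2 \<le> (cmod (x n) + E N + 0)\<^sup>2"
        by (intro power_mono) auto
      also have "\<dots> \<le> 2 * (cmod (x n))\<^sup>2 + 2 * (E N)\<^sup>2"
        using sum_squares_ge_zero[of "cmod (x n) - E N" 0] by (simp add: power2_eq_square algebra_simps)
      finally show "(cmod (sol a s (x 0) n))\<^sup>2 \<le> 2 * (cmod (x n))\<^sup>2 + 2 * (E N)\<^sup>2" .
    qed
    also have "\<dots> = 2 * (\<Sum>n=-int M..int M. (cmod (x n))\<^sup>2) + 2 * ((2 * real M + 1) * (E N)\<^sup>2)"
      by (simp add: sum.distrib sum_distrib_left algebra_simps)
    also have "\<dots> < 36 * Q + 2" using X N0[OF N] by linarith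
    finally have up: "(\<Sum>n=-int M..int M. (cmod (sol a s (x 0) n))\<^sup>2) < 36 * Q + 2" .
    show "norm (half_step a s (h N) 0 - 0) < \<epsilon>"
    proof (rule ccontr)
      assume "\<not> ?thesis"
      then have ge: "\<epsilon> \<le> cmod (x 0)" by (simp add: x_def)
      then have x0: "x 0 \<noteq> 0" using \<epsilon> by auto
      define v where "v = x 0 / complex_of_real (cmod (x 0))"
      have v: "cmod v = 1" "x 0 = complex_of_real (cmod (x 0)) * v" using x0 by (simp_all add: v_def norm_divide)
      have "B * (cmod (x 0))\<^sup>2 \<le> (\<Sum>n=-int M..int M. (cmod (sol a s v n))\<^sup>2) * (cmod (x 0))\<^sup>2"
        using M[OF v(1)] by (intro mult_right_mono) auto
      also have "\<dots> = (\<Sum>n=-int M..int M. (cmod (sol a s (x 0) n))\<^sup>2)"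
        by (subst v(2), subst sol_scale) (simp add: norm_mult power_mult_distrib sum_distrib_left mult.commute)
      finally have "B * (cmod (x 0))\<^sup>2 < 36 * Q + 2" using up by simp
      moreover have "B * \<epsilon>\<^sup>2 \<le> B * (cmod (x 0))\<^sup>2" using ge \<epsilon> Q0 by (intro mult_left_mono power_mono) (auto simp: B_def)
      moreover have "B * \<epsilon>\<^sup>2 = 36 * Q + 2" using \<epsilon> by (simp add: B_def)
      ultimately show False by simp
    qed
  qed
qed

text \<open>\<open>half_step_null\<close> is applied to \<open>h\<close> and to
  \<open>\<i> * h\<close>; the recursion carries the smallness from the origin to the site
  \<open>j\<close>, and \<open>half_step_recover\<close> returns to \<open>h\<close>.\<close>

lemma approx_eigenvector_null:
  assumes r: "0 \<le> r" "r < 1" and a: "\<And>n. cmod (a n) \<le> r" and s: "cmod s = 1"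
    and H: "\<And>B v. cmod v = 1 \<Longrightarrow> \<exists>M::nat. B < (\<Sum>n=-int M..int M. (cmod (sol a s v n))\<^sup>2)"
    and err: "\<And>M. (\<lambda>N. cmv_error a (s\<^sup>2) (h N) M) \<longlonglongrightarrow> 0"
    and Q: "\<And>N W. finite W \<Longrightarrow> (\<Sum>n\<in>W. (cmod (h N n))\<^sup>2) \<le> Q"
  shows "(\<lambda>N. h N j) \<longlonglongrightarrow> 0"
proof -
  define C where "C = 2 / sqrt (1 - r\<^sup>2)"
  define J where "J = nat \<bar>j\<bar>"
  define h' where "h' N n = \<i> * h N n" for N n
  have e': "cmv_error a (s\<^sup>2) (h' N) M = cmv_error a (s\<^sup>2) (h N) M" for N M
    unfolding h'_def cmv_error_scale by simp
  have x: "(\<lambda>N. half_step a s (h N) 0) \<longlonglongrightarrow> 0" by (rule half_step_null[OF r a s H err Q])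
  have x': "(\<lambda>N. half_step a s (h' N) 0) \<longlonglongrightarrow> 0"
    by (rule half_step_null[OF r a s H]) (use err Q in \<open>auto simp: e' h'_def norm_mult\<close>)
  have b: "cmod (half_step a s (f N) j) \<le> C ^ J * cmod (half_step a s (f N) 0) + real J * C ^ Suc J * cmv_error a (s\<^sup>2) (f N) J" for f N
  proof -
    have "cmod (half_step a s (f N) j - sol a s (half_step a s (f N) 0) j) \<le> real J * C ^ Suc J * cmv_error a (s\<^sup>2) (f N) J"
      by (rule half_step_approx[OF r a s C_def]) (simp add: J_def)
    moreover have "cmod (sol a s (half_step a s (f N) 0) j) \<le> C ^ J * cmod (half_step a s (f N) 0)"
      unfolding J_def by (rule sol_bound[OF r a s C_def])
    moreover have "cmod (half_step a s (f N) j) \<le> cmod (sol a s (half_step a s (f N) 0) j) + cmod (half_step a s (f N) j - sol a s (half_step a s (f N) 0) j)"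
      by (metis norm_triangle_sub)
    ultimately show ?thesis by linarith
  qed
  define g where "g N = ((C ^ J * cmod (half_step a s (h N) 0) + real J * C ^ Suc J * cmv_error a (s\<^sup>2) (h N) J)
     + (C ^ J * cmod (half_step a s (h' N) 0) + real J * C ^ Suc J * cmv_error a (s\<^sup>2) (h' N) J)) / 2" for N
  have "g \<longlonglongrightarrow> ((C ^ J * cmod 0 + real J * C ^ Suc J * 0) + (C ^ J * cmod 0 + real J * C ^ Suc J * 0)) / 2"
    unfolding g_def e' by (intro tendsto_intros x x' err) auto
  then have g0: "g \<longlonglongrightarrow> 0" by simp
  have "cmod (h N j) \<le> g N" for N
  proof -
    have "cmod (h N j) \<le> (cmod (half_step a s (h N) j) + cmod (half_step a s (h' N) j)) / 2"
      using half_step_recover[OF s, of "h N" j a] by (simp add: h'_def[abs_def])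
    also have "\<dots> \<le> g N" unfolding g_def using b[of h N] b[of h' N] by (intro divide_right_mono add_mono) auto
    finally show ?thesis .
  qed
  then show ?thesis by (intro Lim_null_comparison[OF _ g0] always_eventually) auto
qed

lemma l2_inner_split:
  assumes u: "u \<in> l2_int" and A: "A \<in> l2_int" and w: "w = (\<lambda>n. if \<bar>n\<bar> \<le> int J then 0 else u n)" "w \<in> l2_int"
  shows "l2_inner u A = (\<Sum>n=-int J..int J. cnj (u n) * A n) + l2_inner w A"
proof -
  define p where "p n = u n + (-1) * w n" for n
  have p: "p \<in> l2_int" unfolding p_def[abs_def] by (intro l2_add l2_scale u w(2))
  have "l2_inner p A = (\<Sum>n=-int J..int J. cnj (p n) * A n)"
    unfolding l2_inner_def by (rule infsum_finite_support) (auto simp: p_def w(1))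
  also have "\<dots> = (\<Sum>n=-int J..int J. cnj (u n) * A n)"
    by (rule sum.cong) (auto simp: p_def w(1))
  finally have "l2_inner p A = (\<Sum>n=-int J..int J. cnj (u n) * A n)" .
  moreover have "l2_inner u A = l2_inner p A + l2_inner w A"
    unfolding l2_inner_def infsum_add[OF l2_summable[OF p A] l2_summable[OF w(2) A], symmetric]
    by (rule infsum_cong) (simp add: p_def algebra_simps)
  ultimately show ?thesis by simp
qed

lemma l2_weak_null:
  assumes u: "u \<in> l2_int" and A: "\<And>N. A N \<in> l2_int" and Q: "\<And>N. l2_sq (A N) \<le> Q" and lim: "\<And>j. (\<lambda>N. A N j) \<longlonglongrightarrow> 0"
  shows "(\<lambda>N. l2_inner u (A N)) \<longlonglongrightarrow> 0"
proof (rule LIMSEQ_I)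
  fix \<epsilon> :: real assume \<epsilon>: "\<epsilon> > 0"
  have Q0: "0 \<le> Q" using Q[of 0] n2_nonneg[of "A 0"] by linarith
  \<comment> \<open>Large enough that the bounded factor contributes at most
    \<open>\<epsilon> / 2\<close> after division by \<open>t\<close>; the tail of \<open>u\<close>
    is then cut so far out that \<open>t\<close> times its norm does the same.\<close>
  define t where "t = (Q + 1) * 2 / \<epsilon>"
  have t: "t > 0" using Q0 \<epsilon> by (simp add: t_def)
  have "\<epsilon> / (2 * t) > 0" using \<epsilon> t by simp
  then obtain J :: nat where J: "(\<lambda>n. if \<bar>n\<bar> \<le> int J then 0 else u n) \<in> l2_int"
    "l2_sq (\<lambda>n. if \<bar>n\<bar> \<le> int J then 0 else u n) < \<epsilon> / (2 * t)"
    using l2_tail[OF u] by metis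
  define w where "w n = (if \<bar>n\<bar> \<le> int J then 0 else u n)" for n
  have w: "w \<in> l2_int" "l2_sq w < \<epsilon> / (2 * t)" using J by (simp_all add: w_def[abs_def])
  have split: "l2_inner u (A N) = (\<Sum>n=-int J..int J. cnj (u n) * A N n) + l2_inner w (A N)" for N
    by (rule l2_inner_split[OF u A w_def[abs_def, THEN meta_eq_to_obj_eq] w(1)])
  have "(\<lambda>N. \<Sum>n=-int J..int J. cnj (u n) * A N n) \<longlonglongrightarrow> (\<Sum>n=-int J..int J. cnj (u n) * 0)"
    by (intro tendsto_intros lim)
  then have "(\<lambda>N. \<Sum>n=-int J..int J. cnj (u n) * A N n) \<longlonglongrightarrow> 0" by simp
  from LIMSEQ_D[OF this, of "\<epsilon>/2"] \<epsilon> obtain N0 where N0: "\<And>N. N \<ge> N0 \<Longrightarrow> cmod (\<Sum>n=-int J..int J. cnj (u n) * A N n) < \<epsilon> / 2"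
    by auto
  have tail: "cmod (l2_inner w (A N)) \<le> \<epsilon> / 2" for N
  proof -
    have "cmod (l2_inner w (A N)) \<le> (t * l2_sq w + l2_sq (A N) / t) / 2" by (rule l2_inner_amgm[OF w(1) A t])
    also have "\<dots> \<le> (t * (\<epsilon> / (2 * t)) + Q / t) / 2"
      using w(2) t Q[of N] by (intro divide_right_mono add_mono mult_left_mono) auto
    also have "Q / t \<le> \<epsilon> / 2"
    proof -
      have "Q * \<epsilon> \<le> (Q + 1) * \<epsilon>" using \<epsilon> by (intro mult_right_mono) auto
      then show ?thesis using \<epsilon> Q0 by (simp add: t_def field_simps)
    qed
    finally show ?thesis using t by simp
  qed
  show "\<exists>N0. \<forall>N\<ge>N0. norm (l2_inner u (A N) - 0) < \<epsilon>"
  proof (intro exI[of _ N0] allI impI)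
    fix N assume "N0 \<le> N"
    have "norm (l2_inner u (A N) - 0) \<le> cmod (\<Sum>n=-int J..int J. cnj (u n) * A N n) + cmod (l2_inner w (A N))"
      unfolding split by (simp add: norm_triangle_ineq)
    then show "norm (l2_inner u (A N) - 0) < \<epsilon>" using N0[OF \<open>N0 \<le> N\<close>] tail[of N] by linarith
  qed
qed

lemma space_borel_circle: "space borel_circle = sphere 0 1"
  by (simp add: borel_circle_def space_restrict_space)

lemma borel_circle_measurable:
  assumes "f \<in> borel_measurable borel" "sets \<mu> = sets borel_circle"
  shows "f \<in> borel_measurable \<mu>"
  unfolding measurable_cong_sets[OF assms(2) refl] borel_circle_def
  by (rule measurable_restrict_space1[OF assms(1)])

text \<open>The mean ergodic theorem for the unitary operator divided by \<open>z\<close>: the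
  averages \<open>A N\<close> of its powers on \<open>u\<close> are approximate eigenvectors, hence
  tend to 0 at every site, while \<open>l2_inner u (A N)\<close> tends to the mass of the atom at
  \<open>z\<close>.\<close>

lemma no_atoms:
  assumes r: "0 \<le> r" "r < 1" and a: "\<And>n. cmod (a n) \<le> r" and u: "u \<in> l2_int"
    and \<mu>: "is_spectral_measure (cmv a) u \<mu>" and z: "cmod z = 1"
    and H: "\<And>s B v. cmod s = 1 \<Longrightarrow> cmod v = 1 \<Longrightarrow> \<exists>M::nat. B < (\<Sum>n=-int M..int M. (cmod (sol a s v n))\<^sup>2)"
  shows "emeasure \<mu> {z} = 0"
proof -
  have a1: "cmod (a n) < 1" for n using a[of n] r by linarith
  from \<mu> have fin: "finite_measure \<mu>" and sets: "sets \<mu> = sets borel_circle"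
    and mom: "\<And>n. l2_inner u ((cmv a ^^ n) u) = (\<integral>z. z ^ n \<partial>\<mu>)" by (auto simp: is_spectral_measure_def)
  interpret finite_measure \<mu> by (rule fin)
  have sp: "space \<mu> = sphere 0 1" using sets_eq_imp_space_eq[OF sets] space_borel_circle by simp
  \<comment> \<open>Either root would do, since \<open>H\<close> is assumed for all unimodular
    parameters.\<close>
  define s where "s = csqrt z"
  have s2: "s\<^sup>2 = z" by (simp add: s_def)
  have s: "cmod s = 1"
  proof -
    have "(cmod s)\<^sup>2 = 1" using s2 z by (metis norm_power)
    then show ?thesis by (simp add: power2_eq_1_iff) (metis norm_ge_zero neg_0_le_iff_le not_one_le_zero)
  qed
  define w where "w = cnj z"
  have w: "cmod w = 1" "z * w = 1" using z unit_mult_cnj(1)[OF z] by (simp_all add: w_def)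
  define U where "U k = (cmv a ^^ k) u" for k
  have Ul2: "U k \<in> l2_int" for k unfolding U_def by (rule cmv_pow_l2[OF a1 u])
  have Un2: "l2_sq (U k) = l2_sq u" for k unfolding U_def by (rule n2_cmv_pow[OF a1 u])
  define A where "A N n = (1 / of_nat (Suc N)) * (\<Sum>k<Suc N. w ^ k * U k n)" for N n
  have Al2: "A N \<in> l2_int" for N
    unfolding A_def[abs_def] by (intro l2_scale l2_sum Ul2) auto
  \<comment> \<open>The sum telescopes, so the residual consists of two vectors of the norm of
    \<open>u\<close>, divided by \<open>Suc N\<close>.\<close>
  have "cmv a (A N) n - z * A N n = z / of_nat (Suc N) * (w ^ Suc N * U (Suc N) n - u n)" for N n
  proof -
    have "cmv a (A N) n = (1 / of_nat (Suc N)) * (\<Sum>k<Suc N. w ^ k * U (Suc k) n)"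
      unfolding A_def[abs_def] cmv_linear(2) by (subst cmv_sum) (simp_all add: cmv_linear(2) U_def)
    moreover have "z * A N n = (1 / of_nat (Suc N)) * (\<Sum>k<Suc N. z * (w ^ k * U k n))"
      by (simp add: A_def sum_distrib_left algebra_simps)
    moreover have "w ^ k * U (Suc k) n = z * (w ^ Suc k * U (Suc k) n)" for k
      using w(2) by (simp add: mult.assoc[symmetric])
    ultimately have "cmv a (A N) n - z * A N n = (1 / of_nat (Suc N)) * (\<Sum>k<Suc N. z * (w ^ Suc k * U (Suc k) n) - z * (w ^ k * U k n))"
      by (simp add: sum_subtractf right_diff_distrib del: sum.lessThan_Suc)
    also have "(\<Sum>k<Suc N. z * (w ^ Suc k * U (Suc k) n) - z * (w ^ k * U k n)) = z * (w ^ Suc N * U (Suc N) n) - z * (w ^ 0 * U 0 n)"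
      by (rule sum_lessThan_telescope)
    finally show ?thesis by (simp add: U_def right_diff_distrib)
  qed
  then have en: "cmod (cmv a (A N) n - z * A N n) \<le> 2 * sqrt (l2_sq u) / real (Suc N)" for N n
  proof -
    have "cmod (w ^ Suc N * U (Suc N) n - u n) \<le> cmod (w ^ Suc N * U (Suc N) n) + cmod (u n)" by (rule norm_triangle_ineq4)
    also have "\<dots> \<le> sqrt (l2_sq u) + sqrt (l2_sq u)"
      using n2_point[OF Ul2, of "Suc N" n] n2_point[OF u, of n] w(1) by (intro add_mono) (auto simp: norm_mult norm_power Un2)
    finally show ?thesis using \<open>\<And>N n. cmv a (A N) n - z * A N n = _\<close>[of N n] z
      by (simp add: norm_mult norm_divide divide_right_mono del: of_nat_Suc)
  qed
  have err: "(\<lambda>N. cmv_error a (s\<^sup>2) (A N) M) \<longlonglongrightarrow> 0" for M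
  proof (rule Lim_null_comparison[OF always_eventually])
    show "\<forall>N. norm (cmv_error a (s\<^sup>2) (A N) M) \<le> (\<Sum>n=-int M..int M. 2 * sqrt (l2_sq u) * (1 / real (Suc N)))"
    proof
      fix N
      have "cmv_error a (s\<^sup>2) (A N) M \<le> (\<Sum>n=-int M..int M. 2 * sqrt (l2_sq u) * (1 / real (Suc N)))"
        unfolding s2 cmv_error_def by (intro sum_mono) (rule order_trans[OF en], simp)
      then show "norm (cmv_error a (s\<^sup>2) (A N) M) \<le> (\<Sum>n=-int M..int M. 2 * sqrt (l2_sq u) * (1 / real (Suc N)))"
        by (simp only: real_norm_def abs_of_nonneg[OF cmv_error_nonneg])
    qed
    have "(\<lambda>N. \<Sum>n=-int M..int M. 2 * sqrt (l2_sq u) * (1 / real (Suc N))) \<longlonglongrightarrow> (\<Sum>n=-int M..int M. 2 * sqrt (l2_sq u) * 0)"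
      using LIMSEQ_inverse_real_of_nat by (intro tendsto_intros) (simp add: inverse_eq_divide)
    then show "(\<lambda>N. \<Sum>n=-int M..int M. 2 * sqrt (l2_sq u) * (1 / real (Suc N))) \<longlonglongrightarrow> 0" by simp
  qed
  have Q: "(\<Sum>n\<in>W. (cmod (A N n))\<^sup>2) \<le> l2_sq u" if "finite W" for W N
  proof -
    have "(cmod (A N n))\<^sup>2 \<le> (\<Sum>k<Suc N. (cmod (U k n))\<^sup>2) / real (Suc N)" for n
    proof -
      have "cmod (\<Sum>k<Suc N. w ^ k * U k n) \<le> (\<Sum>k<Suc N. cmod (U k n))"
        by (rule order_trans[OF norm_sum]) (simp add: norm_mult norm_power w(1) del: sum.lessThan_Suc)
      then have "(cmod (\<Sum>k<Suc N. w ^ k * U k n))\<^sup>2 \<le> (\<Sum>k<Suc N. cmod (U k n))\<^sup>2" by (intro power_mono) auto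
      also have "\<dots> \<le> (\<Sum>k<Suc N. (cmod (U k n))\<^sup>2) * real (Suc N)"
        using sum_squared_le_sum_of_squares[of "\<lambda>k. cmod (U k n)" "{..<Suc N}"] by simp
      finally have "(cmod (\<Sum>k<Suc N. w ^ k * U k n))\<^sup>2 / (real (Suc N))\<^sup>2 \<le> (\<Sum>k<Suc N. (cmod (U k n))\<^sup>2) * real (Suc N) / (real (Suc N))\<^sup>2"
        by (intro divide_right_mono) auto
      then show ?thesis
        by (simp add: A_def norm_mult norm_divide power_divide power2_eq_square del: of_nat_Suc sum.lessThan_Suc)
    qed
    then have "(\<Sum>n\<in>W. (cmod (A N n))\<^sup>2) \<le> (\<Sum>n\<in>W. (\<Sum>k<Suc N. (cmod (U k n))\<^sup>2) / real (Suc N))" by (rule sum_mono)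
    also have "\<dots> = (\<Sum>k<Suc N. \<Sum>n\<in>W. (cmod (U k n))\<^sup>2) / real (Suc N)"
      unfolding sum_divide_distrib[symmetric] by (subst sum.swap) (rule refl)
    also have "\<dots> \<le> (\<Sum>k<Suc N. l2_sq u) / real (Suc N)"
      using n2_window[OF Ul2 that] by (intro divide_right_mono sum_mono) (auto simp: Un2)
    finally show ?thesis by simp
  qed
  have coord: "(\<lambda>N. A N j) \<longlonglongrightarrow> 0" for j
    by (rule approx_eigenvector_null[OF r a s H err Q]) (use s in auto)
  have "l2_sq (A N) \<le> l2_sq u" for N
    unfolding l2_sq_def[of "A N"] using Al2[of N] Q by (intro infsum_le_finite_sums) (auto simp: l2_int_def)
  from l2_weak_null[OF u Al2 this coord] have lim0: "(\<lambda>N. l2_inner u (A N)) \<longlonglongrightarrow> 0" .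
  \<comment> \<open>The same average as a polynomial on the circle; it is bounded by 1 and converges
    to the indicator of \<open>z\<close>.\<close>
  define G where "G N x = (1 / of_nat (Suc N)) * (\<Sum>k<Suc N. w ^ k * x ^ k)" for N and x :: complex
  have intp: "integrable \<mu> (\<lambda>x. x ^ k)" for k
    by (rule integrable_const_bound[of _ 1]) (auto simp: sp norm_power intro!: borel_circle_measurable[OF _ sets] AE_I2)
  have "l2_inner u (A N) = (\<integral>x. G N x \<partial>\<mu>)" for N
  proof -
    have "l2_inner u (A N) = (1 / of_nat (Suc N)) * (\<Sum>k<Suc N. w ^ k * l2_inner u (U k))"
      unfolding A_def[abs_def] l2_inner_scale_right
      by (subst l2_inner_sum_right) (auto simp: l2_inner_scale_right u intro!: l2_scale Ul2)
    also have "\<dots> = (\<integral>x. G N x \<partial>\<mu>)"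
      unfolding G_def U_def mom using intp by (simp add: Bochner_Integration.integral_sum del: sum.lessThan_Suc)
    finally show ?thesis .
  qed
  moreover have "(\<lambda>N. \<integral>x. G N x \<partial>\<mu>) \<longlonglongrightarrow> (\<integral>x. indicator {z} x \<partial>\<mu>)"
  proof (rule integral_dominated_convergence[where w = "\<lambda>_. 1"])
    have zm: "{z} \<in> sets \<mu>" using z unfolding sets borel_circle_def by (auto simp: sets_restrict_space)
    then show "indicator {z} \<in> borel_measurable \<mu>" by simp
    show "G N \<in> borel_measurable \<mu>" for N
      unfolding G_def by (intro borel_circle_measurable[OF _ sets]) simp
    show "integrable \<mu> (\<lambda>_. 1::real)" by simp
    show "AE x in \<mu>. (\<lambda>N. G N x) \<longlonglongrightarrow> indicator {z} x"
    proof (rule AE_I2)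
      fix x assume "x \<in> space \<mu>"
      then have x: "cmod x = 1" by (simp add: sp)
      define q where "q = w * x"
      have q: "cmod q = 1" using w(1) x by (simp add: q_def norm_mult)
      have Gq: "G N x = (1 / of_nat (Suc N)) * (\<Sum>k<Suc N. q ^ k)" for N
        by (simp add: G_def q_def power_mult_distrib del: sum.lessThan_Suc)
      show "(\<lambda>N. G N x) \<longlonglongrightarrow> indicator {z} x"
      proof (cases "x = z")
        case True
        then have "q = 1" using w(2) by (simp add: q_def mult.commute)
        then have "G N x = 1" for N unfolding Gq by (simp del: of_nat_Suc)
        then show ?thesis using True by simp
      next
        case False
        have "q \<noteq> 1"
        proof
          assume "q = 1"
          then have "z * (w * x) = z" by (simp add: q_def)
          then show False using False w(2) by (simp add: mult.assoc[symmetric])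
        qed
        have "norm (G N x) \<le> (2 / cmod (1 - q)) * (1 / real (Suc N))" for N
        proof -
          have "(\<Sum>k<Suc N. q ^ k) = (1 - q ^ Suc N) / (1 - q)" using \<open>q \<noteq> 1\<close> by (simp add: sum_gp_strict del: sum.lessThan_Suc)
          then have "cmod (\<Sum>k<Suc N. q ^ k) = cmod (1 - q ^ Suc N) / cmod (1 - q)" by (simp add: norm_divide)
          also have "\<dots> \<le> 2 / cmod (1 - q)"
            using norm_triangle_ineq4[of 1 "q ^ Suc N"] q by (intro divide_right_mono) (auto simp: norm_power norm_mult)
          finally have "(1 / real (Suc N)) * cmod (\<Sum>k<Suc N. q ^ k) \<le> (1 / real (Suc N)) * (2 / cmod (1 - q))"
            by (rule mult_left_mono) simp
          then show ?thesis unfolding Gq norm_mult norm_divide norm_one norm_of_nat by (simp only: mult.commute)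
        qed
        moreover have "(\<lambda>N. (2 / cmod (1 - q)) * (1 / real (Suc N))) \<longlonglongrightarrow> (2 / cmod (1 - q)) * 0"
          using LIMSEQ_inverse_real_of_nat by (intro tendsto_intros) (simp add: inverse_eq_divide)
        ultimately have "(\<lambda>N. G N x) \<longlonglongrightarrow> 0"
          by (intro Lim_null_comparison[OF always_eventually, of "\<lambda>N. G N x" "\<lambda>N. (2 / cmod (1 - q)) * (1 / real (Suc N))"]) auto
        then show ?thesis using False by simp
      qed
    qed
    show "AE x in \<mu>. norm (G N x) \<le> 1" for N
    proof (rule AE_I2)
      fix x assume "x \<in> space \<mu>"
      then have x: "cmod x = 1" by (simp add: sp)
      have "cmod (\<Sum>k<Suc N. w ^ k * x ^ k) \<le> (\<Sum>k<Suc N. 1)"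
        by (rule order_trans[OF norm_sum]) (simp add: norm_mult norm_power w(1) x del: sum.lessThan_Suc)
      then show "norm (G N x) \<le> 1" by (simp add: G_def norm_mult norm_divide field_simps del: of_nat_Suc sum.lessThan_Suc)
    qed
  qed
  ultimately have "(\<integral>x. indicator {z} x \<partial>\<mu>) = (0::complex)"
    using lim0 LIMSEQ_unique[of "\<lambda>N. l2_inner u (A N)"] by simp
  moreover have "(\<integral>x. indicator {z} x \<partial>\<mu>) = (\<integral>x. complex_of_real (indicat_real {z} x) \<partial>\<mu>)"
    by (intro Bochner_Integration.integral_cong) (auto simp: indicator_def)
  then have "(\<integral>x. indicator {z} x \<partial>\<mu>) = complex_of_real (measure \<mu> ({z} \<inter> space \<mu>))" by simp
  ultimately have "measure \<mu> {z} = 0" using z by (simp add: sp)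
  then show ?thesis by (simp add: emeasure_eq_measure)
qed

section \<open>Absence of an absolutely continuous part\<close>

definition cmv_inv :: "(int \<Rightarrow> complex) \<Rightarrow> (int \<Rightarrow> complex) \<Rightarrow> int \<Rightarrow> complex"
  where "cmv_inv a v = block_op odd (\<lambda>n. cnj (a n)) (block_op even (\<lambda>n. cnj (a n)) v)"

lemma cmv_cmv_inv:
  assumes a: "\<And>n. cmod (a n) < 1"
  shows "cmv a (cmv_inv a v) = v"
proof -
  have a': "cmod (cnj (a n)) < 1" for n using a by simp
  have "block_op P a (block_op P (\<lambda>n. cnj (a n)) w) = w" if "\<And>n. P (n + 1) = (\<not> P n)" for P w
    using pblk_involution[where a = "\<lambda>n. cnj (a n)" and P = P and u = w, OF a' that] by simp
  then show ?thesis unfolding cmv_pblk cmv_inv_def by (simp add: even_alt)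
qed

lemma cmv_inv_l2:
  assumes a: "\<And>n. cmod (a n) < 1" and v: "v \<in> l2_int"
  shows "cmv_inv a v \<in> l2_int"
  unfolding cmv_inv_def by (intro pblk_l2 even_alt v) (use a in auto)

lemma cmv_inv_isometry:
  assumes a: "\<And>n. cmod (a n) < 1" and u: "u \<in> l2_int" and v: "v \<in> l2_int"
  shows "l2_inner (cmv_inv a u) (cmv_inv a v) = l2_inner u v"
  using cmv_isometry[where a = a, OF a cmv_inv_l2[where a = a, OF a u] cmv_inv_l2[where a = a, OF a v]] by (simp add: cmv_cmv_inv[where a = a, OF a])

lemma cmv_inv_pow_l2: "(\<And>n. cmod (a n) < 1) \<Longrightarrow> v \<in> l2_int \<Longrightarrow> (cmv_inv a ^^ k) v \<in> l2_int"
  by (induction k) (simp_all add: cmv_inv_l2)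

lemma n2_cmv_inv_pow:
  assumes a: "\<And>n. cmod (a n) < 1" and u: "u \<in> l2_int"
  shows "l2_sq ((cmv_inv a ^^ k) u) = l2_sq u"
proof (induction k)
  case (Suc k)
  define x where "x = (cmv_inv a ^^ k) u"
  have x: "x \<in> l2_int" unfolding x_def by (rule cmv_inv_pow_l2[OF a u])
  have "complex_of_real (l2_sq (cmv_inv a x)) = complex_of_real (l2_sq x)"
    using cmv_inv_isometry[where a = a, OF a x x] l2_inner_self[OF x] l2_inner_self[OF cmv_inv_l2[where a = a, OF a x]] by simp
  then show ?case using Suc by (simp add: x_def)
qed simp

lemma cmv_pow_adjoint:
  assumes a: "\<And>n. cmod (a n) < 1" and w: "w \<in> l2_int" and x: "x \<in> l2_int"
  shows "l2_inner w ((cmv_inv a ^^ j) x) = l2_inner ((cmv a ^^ j) w) x"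
  using x
proof (induction j arbitrary: x)
  case (Suc j)
  have "l2_inner w ((cmv_inv a ^^ Suc j) x) = l2_inner w ((cmv_inv a ^^ j) (cmv_inv a x))" by (simp add: funpow_swap1)
  also have "\<dots> = l2_inner ((cmv a ^^ j) w) (cmv_inv a x)" by (rule Suc.IH[OF cmv_inv_l2[where a = a, OF a Suc.prems]])
  also have "\<dots> = l2_inner (cmv a ((cmv a ^^ j) w)) (cmv a (cmv_inv a x))"
    by (rule cmv_isometry[symmetric, where a = a, OF a cmv_pow_l2[where a = a, OF a w] cmv_inv_l2[where a = a, OF a Suc.prems]])
  finally show ?case by (simp add: cmv_cmv_inv[where a = a, OF a])
qed simp

definition phase_sum :: "(int \<Rightarrow> complex) \<Rightarrow> nat \<Rightarrow> real \<Rightarrow> (int \<Rightarrow> complex) \<Rightarrow> int \<Rightarrow> complex"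
  where "phase_sum a N \<theta> v n = (\<Sum>k<N. cis (- (real k * \<theta>)) * (cmv a ^^ k) v n)"

text \<open>An approximation of the density at angle \<open>\<theta>\<close> of the spectral projections applied to \<open>u\<close>.\<close>

definition approx_density :: "(int \<Rightarrow> complex) \<Rightarrow> nat \<Rightarrow> real \<Rightarrow> (int \<Rightarrow> complex) \<Rightarrow> int \<Rightarrow> complex"
  where "approx_density a N \<theta> u n = (1 / of_nat N) * (\<Sum>j<N. cis (real j * \<theta>) * (cmv_inv a ^^ j) (phase_sum a N \<theta> u) n)"

lemma fsum_abs: "phase_sum a N \<theta> v = (\<lambda>n. \<Sum>k<N. cis (- (real k * \<theta>)) * (cmv a ^^ k) v n)"
  by (simp add: phase_sum_def fun_eq_iff)

lemma fsum_l2: "(\<And>n. cmod (a n) < 1) \<Longrightarrow> v \<in> l2_int \<Longrightarrow> phase_sum a N \<theta> v \<in> l2_int"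
  unfolding phase_sum_def[abs_def] by (intro l2_sum l2_scale cmv_pow_l2) auto

lemma approx_density_l2: "(\<And>n. cmod (a n) < 1) \<Longrightarrow> u \<in> l2_int \<Longrightarrow> approx_density a N \<theta> u \<in> l2_int"
  unfolding approx_density_def[abs_def] by (intro l2_sum l2_scale cmv_inv_pow_l2 fsum_l2) auto

lemma fsum_inner:
  assumes a: "\<And>n. cmod (a n) < 1" and w: "w \<in> l2_int" and u: "u \<in> l2_int"
  shows "l2_inner (phase_sum a N \<theta> w) (phase_sum a N \<theta> u)
    = (\<Sum>j<N. \<Sum>k<N. cis (real j * \<theta>) * cis (- (real k * \<theta>)) * l2_inner ((cmv a ^^ j) w) ((cmv a ^^ k) u))"
proof -
  have "l2_inner (phase_sum a N \<theta> w) (phase_sum a N \<theta> u) = (\<Sum>j<N. l2_inner (\<lambda>n. cis (- (real j * \<theta>)) * (cmv a ^^ j) w n) (phase_sum a N \<theta> u))"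
    unfolding fsum_abs[of a N \<theta> w] by (rule l2_inner_sum_left) (auto intro!: l2_scale cmv_pow_l2 fsum_l2 a u w)
  also have "\<dots> = (\<Sum>j<N. \<Sum>k<N. cis (real j * \<theta>) * (cis (- (real k * \<theta>)) * l2_inner ((cmv a ^^ j) w) ((cmv a ^^ k) u)))"
  proof (rule sum.cong[OF refl])
    fix j
    have "l2_inner ((cmv a ^^ j) w) (phase_sum a N \<theta> u) = (\<Sum>k<N. l2_inner ((cmv a ^^ j) w) (\<lambda>n. cis (- (real k * \<theta>)) * (cmv a ^^ k) u n))"
      unfolding fsum_abs[of a N \<theta> u] by (rule l2_inner_sum_right) (auto intro!: l2_scale cmv_pow_l2 a u w)
    then show "l2_inner (\<lambda>n. cis (- (real j * \<theta>)) * (cmv a ^^ j) w n) (phase_sum a N \<theta> u)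
      = (\<Sum>k<N. cis (real j * \<theta>) * (cis (- (real k * \<theta>)) * l2_inner ((cmv a ^^ j) w) ((cmv a ^^ k) u)))"
      by (simp add: l2_inner_scale_left l2_inner_scale_right sum_distrib_left cis_cnj)
  qed
  finally show ?thesis by (simp add: mult.assoc)
qed

text \<open>With \<open>F\<close> for \<open>phase_sum\<close>, the approximate density is the
  adjoint of \<open>F\<close> applied to \<open>F u\<close>, divided by \<open>N\<close>. Tested
  against \<open>u\<close> itself it is therefore the nonnegative quantity that integrates to
  spectral mass.\<close>

lemma approx_density_inner:
  assumes a: "\<And>n. cmod (a n) < 1" and w: "w \<in> l2_int" and u: "u \<in> l2_int"
  shows "l2_inner w (approx_density a N \<theta> u) = l2_inner (phase_sum a N \<theta> w) (phase_sum a N \<theta> u) / of_nat N"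
proof -
  have F: "phase_sum a N \<theta> u \<in> l2_int" by (rule fsum_l2[OF a u])
  have "l2_inner w (approx_density a N \<theta> u) = (1 / of_nat N) * (\<Sum>j<N. l2_inner w (\<lambda>n. cis (real j * \<theta>) * (cmv_inv a ^^ j) (phase_sum a N \<theta> u) n))"
    unfolding approx_density_def[abs_def] l2_inner_scale_right
      l2_inner_sum_right[where f = "\<lambda>j n. cis (real j * \<theta>) * (cmv_inv a ^^ j) (phase_sum a N \<theta> u) n", OF finite_lessThan w l2_scale[OF cmv_inv_pow_l2[where a = a, OF a F]]] ..
  also have "(\<Sum>j<N. l2_inner w (\<lambda>n. cis (real j * \<theta>) * (cmv_inv a ^^ j) (phase_sum a N \<theta> u) n))
      = (\<Sum>j<N. l2_inner (\<lambda>n. cis (- (real j * \<theta>)) * (cmv a ^^ j) w n) (phase_sum a N \<theta> u))"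
    by (simp add: l2_inner_scale_right l2_inner_scale_left cmv_pow_adjoint[where a = a, OF a w F] cis_cnj)
  also have "\<dots> = l2_inner (phase_sum a N \<theta> w) (phase_sum a N \<theta> u)"
    unfolding fsum_abs[of a N \<theta> w] by (rule l2_inner_sum_left[symmetric]) (auto intro!: l2_scale cmv_pow_l2 a w F)
  finally show ?thesis by simp
qed

text \<open>The sum telescopes to two vectors of norm \<open>sqrt (l2_sq Z)\<close>. The root is
  traded for a linear bound with weight \<open>sqrt (real N)\<close>, because only
  \<open>l2_sq Z\<close> has a computable integral over the angle, namely
  \<open>2 * pi * real N * l2_sq u\<close>; the resulting error integrates to order
  \<open>1 / sqrt (real N)\<close>.\<close>

lemma approx_density_error:
  assumes a: "\<And>n. cmod (a n) < 1" and u: "u \<in> l2_int" and N: "0 < N"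
  shows "cmod (cmv a (approx_density a N \<theta> u) n - cis \<theta> * approx_density a N \<theta> u n)
    \<le> (l2_sq (phase_sum a N \<theta> u) / sqrt (real N) + sqrt (real N)) / real N"
proof -
  define Z where "Z = phase_sum a N \<theta> u"
  have Z: "Z \<in> l2_int" unfolding Z_def by (rule fsum_l2[OF a u])
  define V where "V j = (cmv_inv a ^^ j) Z" for j
  have V: "V j \<in> l2_int" "l2_sq (V j) = l2_sq Z" for j
    unfolding V_def using cmv_inv_pow_l2[where a = a, OF a Z] n2_cmv_inv_pow[where a = a, OF a Z] by auto
  have UV: "cmv a (V (Suc j)) = V j" for j by (simp add: V_def cmv_cmv_inv[where a = a, OF a])
  have cmvV: "cmv a (V j) \<in> l2_int" "l2_sq (cmv a (V j)) = l2_sq Z" for j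
    using cmv_l2[where a = a, OF a V(1)] n2_cmv_pow[where a = a and k = 1, OF a V(1)] V(2) by auto
  have "cmv a (approx_density a N \<theta> u) n = (1 / of_nat N) * (\<Sum>j<N. cis (real j * \<theta>) * cmv a (V j) n)"
    unfolding approx_density_def[abs_def] cmv_linear(2) Z_def[symmetric] V_def[symmetric]
    by (subst cmv_sum) (simp_all add: cmv_linear(2))
  moreover have "cis \<theta> * approx_density a N \<theta> u n = (1 / of_nat N) * (\<Sum>j<N. cis (real (Suc j) * \<theta>) * cmv a (V (Suc j)) n)"
  proof -
    have "cis (real (Suc j) * \<theta>) = cis \<theta> * cis (real j * \<theta>)" for j by (simp add: cis_mult distrib_right)
    then show ?thesis unfolding approx_density_def Z_def[symmetric] V_def[symmetric] UV
      by (simp add: sum_distrib_left mult_ac)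
  qed
  moreover define f where "f j = cis (real j * \<theta>) * cmv a (V j) n" for j
  ultimately have "cmv a (approx_density a N \<theta> u) n - cis \<theta> * approx_density a N \<theta> u n
    = (1 / of_nat N) * (\<Sum>j<N. f j - f (Suc j))"
    by (simp only: sum_subtractf right_diff_distrib f_def)
  also have "\<dots> = (1 / of_nat N) * (cis (real 0 * \<theta>) * cmv a (V 0) n - cis (real N * \<theta>) * cmv a (V N) n)"
    by (simp only: sum_lessThan_telescope') (simp add: f_def)
  finally have "cmod (cmv a (approx_density a N \<theta> u) n - cis \<theta> * approx_density a N \<theta> u n)
    = (1 / real N) * cmod (cis (real 0 * \<theta>) * cmv a (V 0) n - cis (real N * \<theta>) * cmv a (V N) n)"
    by (simp add: norm_mult norm_divide)
  also have "\<dots> \<le> (1 / real N) * (sqrt (l2_sq Z) + sqrt (l2_sq Z))"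
  proof (rule mult_left_mono)
    have "cmod (cis (real 0 * \<theta>) * cmv a (V 0) n - cis (real N * \<theta>) * cmv a (V N) n)
      \<le> cmod (cis (real 0 * \<theta>) * cmv a (V 0) n) + cmod (cis (real N * \<theta>) * cmv a (V N) n)" by (rule norm_triangle_ineq4)
    also have "\<dots> \<le> sqrt (l2_sq Z) + sqrt (l2_sq Z)"
      using n2_point[OF cmvV(1), of 0 n] n2_point[OF cmvV(1), of N n] by (intro add_mono) (simp_all add: norm_mult cmvV(2))
    finally show "cmod (cis (real 0 * \<theta>) * cmv a (V 0) n - cis (real N * \<theta>) * cmv a (V N) n) \<le> sqrt (l2_sq Z) + sqrt (l2_sq Z)" .
  qed simp
  also have "\<dots> \<le> (1 / real N) * (l2_sq Z / sqrt (real N) + sqrt (real N))"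
  proof (rule mult_left_mono)
    define q where "q = sqrt (sqrt (real N))"
    have q: "q > 0" "q * q = sqrt (real N)" using N by (simp_all add: q_def)
    define p where "p = sqrt (l2_sq Z)"
    have p: "p * p = l2_sq Z" using n2_nonneg[of Z] by (simp add: p_def)
    have "0 \<le> (p / q - q)\<^sup>2" by simp
    moreover have "(p / q - q)\<^sup>2 = p * p / (q * q) + q * q - 2 * p" using q(1) by (simp add: power2_eq_square field_simps)
    ultimately have "2 * p \<le> p * p / (q * q) + q * q" by linarith
    then show "sqrt (l2_sq Z) + sqrt (l2_sq Z) \<le> l2_sq Z / sqrt (real N) + sqrt (real N)" unfolding p q(2) by (simp add: p_def)
  qed simp
  finally show ?thesis by (simp add: Z_def)
qed

text \<open>Off the bad angles a solution with initial value \<open>x0\<close> has a window sum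
  above \<open>R * cmod x0\<close>. Since \<open>half_step\<close> of \<open>h\<close> nearly is
  such a solution, its value at 0 is at most its own window sum divided by \<open>R\<close>, up to
  the residual. The factor 4 and the window \<open>M + 1\<close> come from the neighbours in
  \<open>half_step_norm\<close>.\<close>

lemma good_angle_bound:
  assumes r: "0 \<le> r" "r < 1" and a: "\<And>n. cmod (a n) \<le> r" and R: "0 < R"
    and \<theta>: "\<theta> \<in> {0..2 * pi} - bad_angles a M R" and C: "C = 2 / sqrt (1 - r\<^sup>2)" and M': "M \<le> M'" "nat \<bar>j\<bar> \<le> M'"
  shows "cmod (h j) \<le> C ^ nat \<bar>j\<bar> * ((4 * (\<Sum>n=-int (M+1)..int (M+1). cmod (h n)) + (2 * real M + 1) * (real M' * C ^ Suc M' * cmv_error a (cis \<theta>) h M')) / R)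
    + real M' * C ^ Suc M' * cmv_error a (cis \<theta>) h M'"
proof -
  have a1: "cmod (a n) < 1" for n using a[of n] r by linarith
  have C1: "1 \<le> C" by (rule szego_growth_const[OF r C])
  define s where "s = cis (\<theta> / 2)"
  have s: "cmod s = 1" "s\<^sup>2 = cis \<theta>" by (simp_all add: s_def power2_eq_square cis_mult)
  define S where "S = (\<Sum>n=-int (M+1)..int (M+1). cmod (h n))"
  define e where "e = real M' * C ^ Suc M' * cmv_error a (cis \<theta>) h M'"
  have e0: "0 \<le> e" using C1 cmv_error_nonneg[of a "cis \<theta>" h M'] by (simp add: e_def)
  \<comment> \<open>Needed for \<open>h\<close> and for \<open>\<i> * h\<close>, which share the
    moduli and the residual.\<close>
  have key: "cmod (half_step a s g j) \<le> C ^ nat \<bar>j\<bar> * ((4 * S + (2 * real M + 1) * e) / R) + e"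
    if g: "\<And>n. cmod (g n) = cmod (h n)" "cmv_error a (cis \<theta>) g M' = cmv_error a (cis \<theta>) h M'" for g
  proof -
    define x where "x = half_step a s g"
    have ap: "cmod (x n - sol a s (x 0) n) \<le> e" if "\<bar>n\<bar> \<le> int M'" for n
      using half_step_approx[where a = a and h = g, OF r a s(1) C that] unfolding s(2) g(2) by (simp only: x_def e_def)
    have win: "(\<Sum>n=-int M..int M. cmod (h (n + d))) \<le> S" if "d \<in> {-1, 0, 1}" for d
    proof -
      have "(\<Sum>n=-int M..int M. cmod (h (n + d))) = (\<Sum>n\<in>(\<lambda>n. n + d) ` {-int M..int M}. cmod (h n))"
        by (subst sum.reindex) (auto simp: inj_on_def)
      also have "\<dots> \<le> S" unfolding S_def using that by (intro sum_mono2) auto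
      finally show ?thesis .
    qed
    have "(\<Sum>n=-int M..int M. cmod (x n)) \<le> (\<Sum>n=-int M..int M. 2 * cmod (h (n + 0)) + cmod (h (n + (-1))) + cmod (h (n + 1)))"
    proof (rule sum_mono)
      fix n
      show "cmod (x n) \<le> 2 * cmod (h (n + 0)) + cmod (h (n + (-1))) + cmod (h (n + 1))"
        using half_step_norm[where a = a and h = g and n = n, OF a1 s(1)] by (simp add: x_def g(1))
    qed
    also have "\<dots> \<le> 2 * S + S + S"
      unfolding sum.distrib sum_distrib_left[symmetric] by (intro add_mono mult_left_mono win) auto
    finally have X: "(\<Sum>n=-int M..int M. cmod (x n)) \<le> 4 * S" by simp
    have x0: "cmod (x 0) \<le> (4 * S + (2 * real M + 1) * e) / R"
    proof (cases "x 0 = 0")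
      case True
      have "0 \<le> S" unfolding S_def by (intro sum_nonneg) auto
      then show ?thesis using True e0 R by simp
    next
      case False
      define v where "v = x 0 / complex_of_real (cmod (x 0))"
      have v: "cmod v = 1" "x 0 = complex_of_real (cmod (x 0)) * v" using False by (simp_all add: v_def norm_divide)
      have "R < (\<Sum>n=-int M..int M. cmod (sol a s v n))" using \<theta> v(1) by (auto simp: bad_angles_def s_def not_le)
      then have "R * cmod (x 0) \<le> (\<Sum>n=-int M..int M. cmod (sol a s v n)) * cmod (x 0)" by (intro mult_right_mono) auto
      also have "\<dots> = (\<Sum>n=-int M..int M. cmod (sol a s (x 0) n))"
      proof -
        have "sol a s (x 0) n = complex_of_real (cmod (x 0)) * sol a s v n" for n
          using arg_cong[OF v(2), of "\<lambda>y. sol a s y n"] unfolding sol_scale .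
        then show ?thesis by (simp add: norm_mult sum_distrib_left mult.commute)
      qed
      also have "\<dots> \<le> (\<Sum>n=-int M..int M. cmod (x n) + e)"
      proof (rule sum_mono)
        fix n assume "n \<in> {-int M..int M}"
        then have "cmod (x n - sol a s (x 0) n) \<le> e" using M'(1) by (intro ap) auto
        moreover have "cmod (sol a s (x 0) n) \<le> cmod (x n) + cmod (x n - sol a s (x 0) n)"
          by (metis norm_minus_commute norm_triangle_sub)
        ultimately show "cmod (sol a s (x 0) n) \<le> cmod (x n) + e" by linarith
      qed
      also have "\<dots> = (\<Sum>n=-int M..int M. cmod (x n)) + (2 * real M + 1) * e" by (simp add: sum.distrib)
      also have "\<dots> \<le> 4 * S + (2 * real M + 1) * e" using X by simp
      finally show ?thesis using R by (simp add: field_simps)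
    qed
    have "cmod (x j) \<le> cmod (sol a s (x 0) j) + cmod (x j - sol a s (x 0) j)" by (metis norm_triangle_sub)
    also have "\<dots> \<le> C ^ nat \<bar>j\<bar> * cmod (x 0) + e"
      using M'(2) by (intro add_mono sol_bound[OF r a s(1) C] ap) auto
    also have "\<dots> \<le> C ^ nat \<bar>j\<bar> * ((4 * S + (2 * real M + 1) * e) / R) + e"
      using x0 C1 by (intro add_right_mono mult_left_mono) auto
    finally show ?thesis by (simp add: x_def)
  qed
  have halve: "(y + y) / 2 = y" for y :: real by simp
  have "cmod (h j) \<le> (cmod (half_step a s h j) + cmod (half_step a s (\<lambda>n. \<i> * h n) j)) / 2"
    by (rule half_step_recover[OF s(1)])
  also have "\<dots> \<le> ((C ^ nat \<bar>j\<bar> * ((4 * S + (2 * real M + 1) * e) / R) + e) + (C ^ nat \<bar>j\<bar> * ((4 * S + (2 * real M + 1) * e) / R) + e)) / 2"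
    by (intro divide_right_mono add_mono key) (auto simp: norm_mult cmv_error_scale)
  also have "\<dots> = C ^ nat \<bar>j\<bar> * ((4 * S + (2 * real M + 1) * e) / R) + e"
    using halve by blast
  finally have "cmod (h j) \<le> C ^ nat \<bar>j\<bar> * ((4 * S + (2 * real M + 1) * e) / R) + e" .
  then show ?thesis by (simp only: S_def e_def)
qed

section \<open>Integration over the angle\<close>

lemma set_integrable_continuous:
  fixes f :: "real \<Rightarrow> 'a::{banach, second_countable_topology}"
  assumes "continuous_on UNIV f"
  shows "set_integrable lborel {0..2 * pi} f"
  by (rule borel_integrable_atLeastAtMost'[OF continuous_on_subset[OF assms subset_UNIV]])

lemma set_integral_sum:
  fixes f :: "'i \<Rightarrow> 'a \<Rightarrow> 'b::{banach, second_countable_topology}"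
  assumes "\<And>i. i \<in> I \<Longrightarrow> set_integrable M A (f i)"
  shows "(LINT x:A|M. \<Sum>i\<in>I. f i x) = (\<Sum>i\<in>I. LINT x:A|M. f i x)"
    and "set_integrable M A (\<lambda>x. \<Sum>i\<in>I. f i x)"
proof -
  show "(LINT x:A|M. \<Sum>i\<in>I. f i x) = (\<Sum>i\<in>I. LINT x:A|M. f i x)"
    unfolding set_lebesgue_integral_def scaleR_sum_right
    by (rule Bochner_Integration.integral_sum) (use assms in \<open>simp add: set_integrable_def\<close>)
  show "set_integrable M A (\<lambda>x. \<Sum>i\<in>I. f i x)"
    unfolding set_integrable_def scaleR_sum_right
    by (rule Bochner_Integration.integrable_sum) (use assms in \<open>simp add: set_integrable_def\<close>)
qed

lemma cis_integral:
  "(LINT \<theta>:{0..2 * pi}|lborel. cis (real j * \<theta>) * cis (- (real k * \<theta>))) = (if j = k then 2 * pi else 0)"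
proof (cases "j = k")
  case True
  then have "(LINT \<theta>:{0..2 * pi}|lborel. cis (real j * \<theta>) * cis (- (real k * \<theta>))) = (LINT \<theta>:{0..2 * pi}|lborel. 1)"
    by (simp add: cis_mult)
  then show ?thesis using True by (simp add: set_lebesgue_integral_def scaleR_conv_of_real)
next
  case False
  define m where "m = real j - real k"
  have m: "m \<noteq> 0" using False by (simp add: m_def)
  have e: "cis (real j * \<theta>) * cis (- (real k * \<theta>)) = cis (m * \<theta>)" for \<theta>
    by (simp add: m_def cis_mult algebra_simps)
  define c where "c = \<i> * complex_of_real m"
  have c: "c \<noteq> 0" and cc: "cis (m * x) = exp (c * complex_of_real x)" for x
    using m by (simp_all add: c_def cis_conv_exp mult.assoc)
  have d: "((\<lambda>\<theta>. cis (m * \<theta>) / c) has_vector_derivative cis (m * x)) (at x within {0..2*pi})" for x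
  proof -
    have "((\<lambda>w. exp (c * w) / c) has_field_derivative exp (c * complex_of_real x)) (at (complex_of_real x))"
      using c by (auto intro!: derivative_eq_intros)
    from has_vector_derivative_real_field[OF this] show ?thesis by (simp add: cc)
  qed
  have "(LINT \<theta>:{0..2 * pi}|lborel. cis (m * \<theta>)) = cis (m * (2 * pi)) / c - cis (m * 0) / c"
    unfolding set_lebesgue_integral_def
    by (rule integral_FTC_atLeastAtMost[OF _ d]) (auto intro!: continuous_intros simp: cis_conv_exp)
  also have "cis (m * (2 * pi)) = 1"
  proof -
    have "m = real_of_int (int j - int k)" by (simp add: m_def)
    then show ?thesis using cis_multiple_2pi[of m] by (simp add: mult_ac)
  qed
  finally show ?thesis using False e by simp
qed

lemma trig_sum_integral:
  assumes A: "A \<in> sets lborel" "A \<subseteq> {0..2 * pi}"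
  shows "(LINT \<theta>:A|lborel. \<Sum>j<N. \<Sum>k<N. cis (real j * \<theta>) * cis (- (real k * \<theta>)) * b j k)
      = (\<Sum>j<N. \<Sum>k<N. (LINT \<theta>:A|lborel. cis (real j * \<theta>) * cis (- (real k * \<theta>))) * b j k)"
proof -
  have ci: "set_integrable lborel A (\<lambda>\<theta>. cis (real j * \<theta>) * cis (- (real k * \<theta>)) * c)" for j k c
    by (rule set_integrable_subset[OF set_integrable_continuous A]) (auto simp: cis_conv_exp intro!: continuous_intros)
  show ?thesis
    unfolding set_integral_mult_left[symmetric]
      set_integral_sum(1)[of "{..<N}" _ A "\<lambda>j \<theta>. \<Sum>k<N. cis (real j * \<theta>) * cis (- (real k * \<theta>)) * b j k", OF set_integral_sum(2)[OF ci]]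
    by (intro sum.cong refl set_integral_sum(1) ci)
qed

lemma continuous_on_fsum_inner:
  assumes a: "\<And>n. cmod (a n) < 1" and w: "w \<in> l2_int" and u: "u \<in> l2_int"
  shows "continuous_on UNIV (\<lambda>\<theta>. l2_inner (phase_sum a N \<theta> w) (phase_sum a N \<theta> u))"
  unfolding fsum_inner[where a = a, OF a w u] cis_conv_exp by (intro continuous_intros)

lemma n2_fsum:
  assumes a: "\<And>n. cmod (a n) < 1" and u: "u \<in> l2_int"
  shows "l2_sq (phase_sum a N \<theta> u) = Re (l2_inner (phase_sum a N \<theta> u) (phase_sum a N \<theta> u))"
  using l2_inner_self[OF fsum_l2[where a = a, OF a u]] by simp

lemma continuous_on_n2_fsum:
  assumes a: "\<And>n. cmod (a n) < 1" and u: "u \<in> l2_int"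
  shows "continuous_on UNIV (\<lambda>\<theta>. l2_sq (phase_sum a N \<theta> u))"
  unfolding n2_fsum[where a = a, OF a u] by (intro continuous_intros continuous_on_fsum_inner a u)

lemma integral_n2_fsum:
  assumes a: "\<And>n. cmod (a n) < 1" and u: "u \<in> l2_int"
  shows "(LINT \<theta>:{0..2 * pi}|lborel. l2_sq (phase_sum a N \<theta> u)) = 2 * pi * real N * l2_sq u"
proof -
  have "(LINT \<theta>:{0..2 * pi}|lborel. l2_inner (phase_sum a N \<theta> u) (phase_sum a N \<theta> u))
    = (\<Sum>j<N. \<Sum>k<N. (LINT \<theta>:{0..2 * pi}|lborel. cis (real j * \<theta>) * cis (- (real k * \<theta>))) * l2_inner ((cmv a ^^ j) u) ((cmv a ^^ k) u))"
    unfolding fsum_inner[where a = a, OF a u u] by (rule trig_sum_integral) auto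
  also have "\<dots> = (\<Sum>j<N. \<Sum>k<N. (if j = k then 2 * pi else 0) * l2_inner ((cmv a ^^ j) u) ((cmv a ^^ k) u))"
    by (simp only: cis_integral)
  also have "\<dots> = (\<Sum>j<N. 2 * pi * complex_of_real (l2_sq u))"
    by (rule sum.cong[OF refl]) (simp add: if_distrib if_distribR cong: if_cong,
      simp add: l2_inner_self cmv_pow_l2[where a = a, OF a u] n2_cmv_pow[where a = a, OF a u])
  finally have 1: "(LINT \<theta>:{0..2 * pi}|lborel. l2_inner (phase_sum a N \<theta> u) (phase_sum a N \<theta> u)) = complex_of_real (2 * pi * real N * l2_sq u)" by simp
  have "(LINT \<theta>:{0..2 * pi}|lborel. complex_of_real (l2_sq (phase_sum a N \<theta> u))) = complex_of_real (2 * pi * real N * l2_sq u)"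
    using 1 by (simp add: l2_inner_self[OF fsum_l2[where a = a, OF a u]])
  then show ?thesis unfolding set_integral_complex_of_real of_real_eq_iff .
qed

text \<open>The weighted inequality between the means reduces the integral to those of
  \<open>l2_sq (phase_sum a N \<theta> w)\<close> and of the same for \<open>u\<close>. By
  Parseval's identity both are proportional to \<open>N\<close>, so the bound is uniform in
  \<open>N\<close>. For a unit vector \<open>w\<close> it bounds the integral of the density at one
  site.\<close>

lemma integral_approx_density:
  assumes a: "\<And>n. cmod (a n) < 1" and w: "w \<in> l2_int" and u: "u \<in> l2_int" and N: "0 < N" and t: "0 < t"
  shows "continuous_on UNIV (\<lambda>\<theta>. l2_inner w (approx_density a N \<theta> u))"
    and "(LINT \<theta>:{0..2 * pi}|lborel. cmod (l2_inner w (approx_density a N \<theta> u))) \<le> pi * (t * l2_sq w + l2_sq u / t)"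
proof -
  show c: "continuous_on UNIV (\<lambda>\<theta>. l2_inner w (approx_density a N \<theta> u))"
    unfolding approx_density_inner[where a = a, OF a w u] using N by (intro continuous_intros continuous_on_fsum_inner a w u) auto
  define g where "g \<theta> = (t * l2_sq (phase_sum a N \<theta> w) + l2_sq (phase_sum a N \<theta> u) / t) / 2 / real N" for \<theta>
  have iw: "set_integrable lborel {0..2 * pi} (\<lambda>\<theta>. l2_sq (phase_sum a N \<theta> w))" and iu: "set_integrable lborel {0..2 * pi} (\<lambda>\<theta>. l2_sq (phase_sum a N \<theta> u))"
    by (intro set_integrable_continuous continuous_on_n2_fsum a w u)+
  have ge: "g = (\<lambda>\<theta>. (t / 2 / real N) * l2_sq (phase_sum a N \<theta> w) + (1 / t / 2 / real N) * l2_sq (phase_sum a N \<theta> u))"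
    by (simp add: g_def fun_eq_iff add_divide_distrib)
  have gi: "set_integrable lborel {0..2 * pi} g"
    unfolding ge by (intro set_integral_add set_integrable_mult_right iw iu)
  have "(LINT \<theta>:{0..2 * pi}|lborel. cmod (l2_inner w (approx_density a N \<theta> u))) \<le> (LINT \<theta>:{0..2 * pi}|lborel. g \<theta>)"
  proof (rule set_integral_mono[OF set_integrable_continuous gi])
    show "continuous_on UNIV (\<lambda>\<theta>. cmod (l2_inner w (approx_density a N \<theta> u)))" by (intro continuous_intros c)
    fix \<theta>
    have "cmod (l2_inner (phase_sum a N \<theta> w) (phase_sum a N \<theta> u)) \<le> (t * l2_sq (phase_sum a N \<theta> w) + l2_sq (phase_sum a N \<theta> u) / t) / 2"
      by (intro l2_inner_amgm fsum_l2 a w u t)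
    then have "cmod (l2_inner (phase_sum a N \<theta> w) (phase_sum a N \<theta> u)) / real N \<le> g \<theta>"
      unfolding g_def by (rule divide_right_mono) simp
    then show "cmod (l2_inner w (approx_density a N \<theta> u)) \<le> g \<theta>"
      unfolding approx_density_inner[where a = a, OF a w u] by (simp add: norm_divide)
  qed
  also have "\<dots> = (t / 2 / real N) * (2 * pi * real N * l2_sq w) + (1 / t / 2 / real N) * (2 * pi * real N * l2_sq u)"
    unfolding ge by (simp only: set_integral_add(2)[OF set_integrable_mult_right[OF iw] set_integrable_mult_right[OF iu]]
      set_integral_mult_right integral_n2_fsum[where a = a, OF a w] integral_n2_fsum[where a = a, OF a u])
  also have "\<dots> = pi * (t * l2_sq w + l2_sq u / t)" using N t by (simp add: field_simps)
  finally show "(LINT \<theta>:{0..2 * pi}|lborel. cmod (l2_inner w (approx_density a N \<theta> u))) \<le> pi * (t * l2_sq w + l2_sq u / t)" .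
qed

lemma l2_unit_vector:
  shows "(\<lambda>m. if m = n then 1 else 0) \<in> l2_int" and "l2_sq (\<lambda>m. if m = n then 1 else 0) = 1"
    and "l2_inner (\<lambda>m. if m = n then 1 else 0) h = h n"
proof -
  have e: "(\<lambda>m. (cmod (if m = n then 1 else 0))\<^sup>2) = (\<lambda>m. if m = n then 1 else 0)" by auto
  have h: "((\<lambda>m. if m = n then 1 else 0 :: real) has_sum 1) UNIV"
    by (rule has_sum_finite_neutralI[of "{n}"]) auto
  show "(\<lambda>m. if m = n then 1 else 0) \<in> l2_int"
    unfolding l2_int_def mem_Collect_eq e using h by (rule has_sum_imp_summable)
  show "l2_sq (\<lambda>m. if m = n then 1 else 0) = 1" unfolding l2_sq_def e using h by (rule infsumI)
  show "l2_inner (\<lambda>m. if m = n then 1 else 0) h = h n"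
    unfolding l2_inner_def using infsum_finite_support[of "{n}" "\<lambda>m. cnj (if m = n then 1 else 0) * h m"] by auto
qed

text \<open>The mass is \<open>l2_inner u\<close> of the approximate density. On the sites up to
  \<open>J\<close> the density is bounded by its window sum divided by \<open>R\<close>, and this
  sum has an integral proportional to the number of sites; the far part \<open>w\<close> of
  \<open>u\<close> gives the middle term. All residuals go into \<open>K\<close>, which may depend
  on everything except \<open>N\<close>.\<close>

lemma good_angles_mass:
  assumes r: "0 \<le> r" "r < 1" and a: "\<And>n. cmod (a n) \<le> r" and u: "u \<in> l2_int" and R: "0 < R"
    and C: "C = 2 / sqrt (1 - r\<^sup>2)"
    and w: "w = (\<lambda>n. if \<bar>n\<bar> \<le> int J then 0 else u n)" "w \<in> l2_int" and t: "0 < t"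
  shows "\<exists>K. \<forall>N>0. (LINT \<theta>:{0..2 * pi} - bad_angles a M R|lborel. l2_sq (phase_sum a N \<theta> u) / real N)
    \<le> (\<Sum>j=-int J..int J. cmod (u j) * C ^ nat \<bar>j\<bar>) * (4 * (2 * real M + 3) * (pi * (1 + l2_sq u)) / R)
      + pi * (t * l2_sq w + l2_sq u / t) + K / sqrt (real N)"
proof -
  have a1: "cmod (a n) < 1" for n using a[of n] r by linarith
  have C1: "1 \<le> C" by (rule szego_growth_const[OF r C])
  define M' where "M' = max M J"
  define K1 where "K1 = real M' * C ^ Suc M'"
  have K1: "0 \<le> K1" using C1 by (simp add: K1_def)
  define K2 where "K2 j = (C ^ nat \<bar>j\<bar> * ((2 * real M + 1) * K1) / R + K1) * (2 * real M' + 1)" for j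
  \<comment> \<open>The pointwise residual from \<open>approx_density_error\<close>; its integral is
    of order \<open>1 / sqrt (real N)\<close>.\<close>
  define \<beta> where "\<beta> N \<theta> = (l2_sq (phase_sum a N \<theta> u) / sqrt (real N) + sqrt (real N)) / real N" for N \<theta>
  define h where "h N \<theta> = approx_density a N \<theta> u" for N \<theta>
  define S where "S N \<theta> = (\<Sum>n=-int (M+1)..int (M+1). cmod (h N \<theta> n))" for N \<theta>
  define g where "g N \<theta> = (\<Sum>j=-int J..int J. cmod (u j) * (C ^ nat \<bar>j\<bar> * (4 / R) * S N \<theta> + K2 j * \<beta> N \<theta>)) + cmod (l2_inner w (h N \<theta>))" for N \<theta>
  define K where "K = (\<Sum>j=-int J..int J. cmod (u j) * K2 j) * (2 * pi * (1 + l2_sq u))"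
  have localized_at: "l2_sq (phase_sum a N \<theta> u) / real N \<le> g N \<theta>" if \<theta>: "\<theta> \<in> {0..2 * pi} - bad_angles a M R" and N: "0 < N" for N \<theta>
  proof -
    have hl: "h N \<theta> \<in> l2_int" unfolding h_def by (rule approx_density_l2[where a = a, OF a1 u])
    define e where "e = cmv_error a (cis \<theta>) (h N \<theta>) M'"
    have "e \<le> (\<Sum>n=-int M'..int M'. \<beta> N \<theta>)"
      unfolding e_def cmv_error_def h_def \<beta>_def by (intro sum_mono approx_density_error[where a = a, OF a1 u N])
    then have e: "e \<le> (2 * real M' + 1) * \<beta> N \<theta>" by simp
    have hj: "cmod (h N \<theta> j) \<le> C ^ nat \<bar>j\<bar> * (4 / R) * S N \<theta> + K2 j * \<beta> N \<theta>" if "j \<in> {-int J..int J}" for j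
    proof -
      have "cmod (h N \<theta> j) \<le> C ^ nat \<bar>j\<bar> * ((4 * S N \<theta> + (2 * real M + 1) * (K1 * e)) / R) + K1 * e"
        unfolding S_def K1_def e_def by (rule good_angle_bound[OF r a R \<theta> C]) (use that in \<open>auto simp: M'_def\<close>)
      also have "\<dots> = C ^ nat \<bar>j\<bar> * (4 / R) * S N \<theta> + (C ^ nat \<bar>j\<bar> * ((2 * real M + 1) * K1) / R + K1) * e"
        using R by (simp add: field_simps)
      also have "\<dots> \<le> C ^ nat \<bar>j\<bar> * (4 / R) * S N \<theta> + (C ^ nat \<bar>j\<bar> * ((2 * real M + 1) * K1) / R + K1) * ((2 * real M' + 1) * \<beta> N \<theta>)"
        using e C1 K1 R by (intro add_left_mono mult_left_mono) auto
      finally show ?thesis by (simp add: K2_def mult.assoc)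
    qed
    have "complex_of_real (l2_sq (phase_sum a N \<theta> u) / real N) = l2_inner u (h N \<theta>)"
      unfolding h_def approx_density_inner[where a = a, OF a1 u u] by (simp add: l2_inner_self[OF fsum_l2[where a = a, OF a1 u]])
    also have "\<dots> = (\<Sum>n=-int J..int J. cnj (u n) * h N \<theta> n) + l2_inner w (h N \<theta>)"
      by (rule l2_inner_split[OF u hl w])
    finally have "cmod (complex_of_real (l2_sq (phase_sum a N \<theta> u) / real N)) \<le> cmod (\<Sum>n=-int J..int J. cnj (u n) * h N \<theta> n) + cmod (l2_inner w (h N \<theta>))"
      by (simp only: norm_triangle_ineq)
    also have "cmod (\<Sum>n=-int J..int J. cnj (u n) * h N \<theta> n) \<le> (\<Sum>n=-int J..int J. cmod (u n) * cmod (h N \<theta> n))"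
      by (rule order_trans[OF norm_sum]) (simp add: norm_mult)
    also have "\<dots> \<le> (\<Sum>j=-int J..int J. cmod (u j) * (C ^ nat \<bar>j\<bar> * (4 / R) * S N \<theta> + K2 j * \<beta> N \<theta>))"
      by (intro sum_mono mult_left_mono hj) auto
    finally show ?thesis using n2_nonneg[of "phase_sum a N \<theta> u"] by (simp add: g_def norm_divide)
  qed
  have hc: "continuous_on UNIV (\<lambda>\<theta>. h N \<theta> n)" and hi: "(LINT \<theta>:{0..2 * pi}|lborel. cmod (h N \<theta> n)) \<le> pi * (1 + l2_sq u)" if "0 < N" for N n
    using integral_approx_density[where a = a and w = "\<lambda>m. if m = n then 1 else 0" and t = 1, OF a1 l2_unit_vector(1) u that zero_less_one]
    by (simp_all add: l2_unit_vector h_def[symmetric])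
  have nc: "continuous_on UNIV (\<lambda>\<theta>. l2_sq (phase_sum a N \<theta> u))" for N by (intro continuous_on_n2_fsum a1 u)
  have main: "(LINT \<theta>:{0..2 * pi} - bad_angles a M R|lborel. l2_sq (phase_sum a N \<theta> u) / real N)
    \<le> (\<Sum>j=-int J..int J. cmod (u j) * C ^ nat \<bar>j\<bar>) * (4 * (2 * real M + 3) * (pi * (1 + l2_sq u)) / R)
      + pi * (t * l2_sq w + l2_sq u / t) + K / sqrt (real N)" if N: "0 < N" for N
  proof -
    have Sc: "continuous_on UNIV (S N)" unfolding S_def[abs_def] by (intro continuous_intros hc N)
    have \<beta>c: "continuous_on UNIV (\<beta> N)" unfolding \<beta>_def[abs_def] using N by (intro continuous_intros nc) auto
    have wc: "continuous_on UNIV (\<lambda>\<theta>. l2_inner w (h N \<theta>))" unfolding h_def by (rule integral_approx_density(1)[where a = a, OF a1 w(2) u N t])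
    have gc: "continuous_on UNIV (g N)" unfolding g_def[abs_def] by (intro continuous_intros Sc \<beta>c wc)
    have S0: "0 \<le> S N \<theta>" for \<theta> unfolding S_def by (intro sum_nonneg) auto
    have \<beta>0: "0 \<le> \<beta> N \<theta>" for \<theta> unfolding \<beta>_def by (simp add: n2_nonneg)
    have K20: "0 \<le> K2 j" for j unfolding K2_def using C1 K1 R by (intro mult_nonneg_nonneg add_nonneg_nonneg divide_nonneg_nonneg) auto
    have g0: "0 \<le> g N \<theta>" for \<theta>
      unfolding g_def using S0 \<beta>0 K20 C1 R by (intro add_nonneg_nonneg sum_nonneg mult_nonneg_nonneg divide_nonneg_nonneg) auto
    have Bm: "bad_angles a M R \<in> sets lborel" using closed_bad_angles[where a = a, OF a1] by simp
    have si: "set_integrable lborel {0..2*pi} f" if "continuous_on UNIV f" for f :: "real \<Rightarrow> real" using that by (rule set_integrable_continuous)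
    have "(LINT \<theta>:{0..2 * pi} - bad_angles a M R|lborel. l2_sq (phase_sum a N \<theta> u) / real N) \<le> (LINT \<theta>:{0..2 * pi}|lborel. g N \<theta>)"
      unfolding set_lebesgue_integral_def
    proof (rule integral_mono)
      have "set_integrable lborel ({0..2 * pi} - bad_angles a M R) (\<lambda>\<theta>. l2_sq (phase_sum a N \<theta> u) / real N)"
        by (rule set_integrable_subset[OF si]) (use Bm N in \<open>auto intro!: continuous_intros nc\<close>)
      then show "integrable lborel (\<lambda>x. indicat_real ({0..2 * pi} - bad_angles a M R) x *\<^sub>R (l2_sq (phase_sum a N x u) / real N))" by (simp add: set_integrable_def)
      show "integrable lborel (\<lambda>x. indicat_real {0..2 * pi} x *\<^sub>R g N x)" using si[OF gc] by (simp add: set_integrable_def)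
      show "indicat_real ({0..2 * pi} - bad_angles a M R) x *\<^sub>R (l2_sq (phase_sum a N x u) / real N) \<le> indicat_real {0..2 * pi} x *\<^sub>R g N x" for x
        using localized_at[OF _ N, of x] g0[of x] by (auto simp: indicator_def)
    qed
    also have "(LINT \<theta>:{0..2 * pi}|lborel. g N \<theta>)
      = (\<Sum>j=-int J..int J. cmod (u j) * (C ^ nat \<bar>j\<bar> * (4 / R) * (LINT \<theta>:{0..2 * pi}|lborel. S N \<theta>) + K2 j * (LINT \<theta>:{0..2 * pi}|lborel. \<beta> N \<theta>)))
        + (LINT \<theta>:{0..2 * pi}|lborel. cmod (l2_inner w (h N \<theta>)))"
    proof -
      have iS: "set_integrable lborel {0..2*pi} (S N)" and i\<beta>: "set_integrable lborel {0..2*pi} (\<beta> N)" using si Sc \<beta>c by auto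
      have iw: "set_integrable lborel {0..2*pi} (\<lambda>\<theta>. cmod (l2_inner w (h N \<theta>)))" by (intro si continuous_intros wc)
      have ij: "set_integrable lborel {0..2*pi} (\<lambda>\<theta>. c * S N \<theta> + d * \<beta> N \<theta>)" for c d
        by (intro set_integral_add set_integrable_mult_right iS i\<beta>)
      have ej: "(LINT \<theta>:{0..2 * pi}|lborel. x * (c * S N \<theta> + d * \<beta> N \<theta>)) = x * (c * (LINT \<theta>:{0..2 * pi}|lborel. S N \<theta>) + d * (LINT \<theta>:{0..2 * pi}|lborel. \<beta> N \<theta>))" for x c d
        by (simp only: set_integral_mult_right set_integral_add(2)[OF set_integrable_mult_right[OF iS] set_integrable_mult_right[OF i\<beta>]])
      have ejs: "(LINT \<theta>:{0..2 * pi}|lborel. (\<Sum>j=-int J..int J. cmod (u j) * (C ^ nat \<bar>j\<bar> * (4 / R) * S N \<theta> + K2 j * \<beta> N \<theta>)))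
        = (\<Sum>j=-int J..int J. (LINT \<theta>:{0..2 * pi}|lborel. cmod (u j) * (C ^ nat \<bar>j\<bar> * (4 / R) * S N \<theta> + K2 j * \<beta> N \<theta>)))"
        by (intro set_integral_sum(1) set_integrable_mult_right ij)
      have ijs: "set_integrable lborel {0..2*pi} (\<lambda>\<theta>. \<Sum>j=-int J..int J. cmod (u j) * (C ^ nat \<bar>j\<bar> * (4 / R) * S N \<theta> + K2 j * \<beta> N \<theta>))"
        by (intro si continuous_intros Sc \<beta>c)
      show ?thesis unfolding g_def set_integral_add(2)[OF ijs iw] ejs ej ..
    qed
    also have "\<dots> \<le> (\<Sum>j=-int J..int J. cmod (u j) * (C ^ nat \<bar>j\<bar> * (4 / R) * ((2 * real M + 3) * (pi * (1 + l2_sq u))) + K2 j * (2 * pi * (1 + l2_sq u) / sqrt (real N)))) + pi * (t * l2_sq w + l2_sq u / t)"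
    proof (intro add_mono sum_mono mult_left_mono)
      have "(LINT \<theta>:{0..2 * pi}|lborel. S N \<theta>) = (\<Sum>n=-int (M+1)..int (M+1). (LINT \<theta>:{0..2 * pi}|lborel. cmod (h N \<theta> n)))"
        unfolding S_def by (intro set_integral_sum(1) si continuous_on_norm hc N)
      also have "\<dots> \<le> (\<Sum>n=-int (M+1)..int (M+1). pi * (1 + l2_sq u))" by (intro sum_mono hi N)
      finally show "(LINT \<theta>:{0..2 * pi}|lborel. S N \<theta>) \<le> (2 * real M + 3) * (pi * (1 + l2_sq u))" by (simp add: algebra_simps)
      have "(LINT \<theta>:{0..2 * pi}|lborel. \<beta> N \<theta>) = (LINT \<theta>:{0..2 * pi}|lborel. (1 / sqrt (real N) / real N) * l2_sq (phase_sum a N \<theta> u) + sqrt (real N) / real N)"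
        unfolding \<beta>_def by (simp add: add_divide_distrib)
      also have "\<dots> = (1 / sqrt (real N) / real N) * (2 * pi * real N * l2_sq u) + (LINT \<theta>:{0..2 * pi}|lborel. sqrt (real N) / real N)"
        using N by (subst set_integral_add(2)[OF si si]) (auto intro!: continuous_intros nc simp: integral_n2_fsum[where a = a, OF a1 u])
      also have "\<dots> = (1 / sqrt (real N) / real N) * (2 * pi * real N * l2_sq u) + (2 * pi) * (sqrt (real N) / real N)"
        by (simp add: set_lebesgue_integral_def)
      also have "\<dots> = 2 * pi * (1 + l2_sq u) / sqrt (real N)"
      proof -
        define q where "q = sqrt (real N)"
        have q: "q > 0" "real N = q * q" using N by (simp_all add: q_def)
        show ?thesis unfolding q_def[symmetric] unfolding q(2) using q(1) by (simp add: field_simps)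
      qed
      finally show "(LINT \<theta>:{0..2 * pi}|lborel. \<beta> N \<theta>) \<le> 2 * pi * (1 + l2_sq u) / sqrt (real N)" by simp
      show "(LINT \<theta>:{0..2 * pi}|lborel. cmod (l2_inner w (h N \<theta>))) \<le> pi * (t * l2_sq w + l2_sq u / t)"
        unfolding h_def by (rule integral_approx_density(2)[where a = a, OF a1 w(2) u N t])
    qed (use C1 R K20 in auto)
    also have "\<dots> = (\<Sum>j=-int J..int J. cmod (u j) * C ^ nat \<bar>j\<bar>) * (4 * (2 * real M + 3) * (pi * (1 + l2_sq u)) / R)
      + pi * (t * l2_sq w + l2_sq u / t) + K / sqrt (real N)"
    proof -
      have "(\<Sum>j\<in>W. p j * (q j * x * X + k j * y)) = (\<Sum>j\<in>W. p j * q j) * (x * X) + (\<Sum>j\<in>W. p j * k j) * y"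
        for p q k :: "int \<Rightarrow> real" and x X y W
        by (simp add: sum_distrib_left sum_distrib_right distrib_left sum.distrib mult_ac)
      then show ?thesis by (simp only: K_def) simp
    qed
    finally show ?thesis .
  qed
  then show ?thesis by blast
qed

section \<open>Spectral measures and the Fejer kernel\<close>

lemma fejer_expand:
  "complex_of_real ((cmod (\<Sum>k<N. (cis (- \<theta>) * z) ^ k))\<^sup>2)
    = (\<Sum>j<N. \<Sum>k<N. cis (real j * \<theta>) * cis (- (real k * \<theta>)) * (cnj z ^ j * z ^ k))"
proof -
  have "complex_of_real ((cmod (\<Sum>k<N. (cis (- \<theta>) * z) ^ k))\<^sup>2) = cnj (\<Sum>k<N. (cis (- \<theta>) * z) ^ k) * (\<Sum>k<N. (cis (- \<theta>) * z) ^ k)"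
    by (metis complex_norm_square mult.commute)
  also have "\<dots> = (\<Sum>j<N. \<Sum>k<N. cnj ((cis (- \<theta>) * z) ^ j) * (cis (- \<theta>) * z) ^ k)"
    by (simp only: cnj_sum sum_product)
  also have "\<dots> = (\<Sum>j<N. \<Sum>k<N. cis (real j * \<theta>) * cis (- (real k * \<theta>)) * (cnj z ^ j * z ^ k))"
    by (intro sum.cong refl) (simp add: power_mult_distrib Complex.DeMoivre cis_cnj)
  finally show ?thesis .
qed

text \<open>On the circle the integrand is a power of \<open>z\<close> or of its conjugate, and the
  isometry property shifts powers of the operator from one side of the inner product to the other;
  so the nonnegative moments determine all of these.\<close>

lemma spectral_moments:
  assumes a: "\<And>n. cmod (a n) < 1" and u: "u \<in> l2_int" and \<mu>: "is_spectral_measure (cmv a) u \<mu>"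
  shows "integrable \<mu> (\<lambda>z. cnj z ^ j * z ^ k)"
    and "(\<integral>z. cnj z ^ j * z ^ k \<partial>\<mu>) = l2_inner ((cmv a ^^ j) u) ((cmv a ^^ k) u)"
proof -
  from \<mu> have fin: "finite_measure \<mu>" and sets: "sets \<mu> = sets borel_circle"
    and mom: "\<And>n. l2_inner u ((cmv a ^^ n) u) = (\<integral>z. z ^ n \<partial>\<mu>)" by (auto simp: is_spectral_measure_def)
  interpret finite_measure \<mu> by (rule fin)
  have sp: "space \<mu> = sphere 0 1" using sets_eq_imp_space_eq[OF sets] space_borel_circle by simp
  show i: "integrable \<mu> (\<lambda>z. cnj z ^ j * z ^ k)"
    by (rule integrable_const_bound[of _ 1])
       (auto simp: sp norm_power norm_mult intro!: borel_circle_measurable[OF _ sets] AE_I2 borel_measurable_continuous_onI continuous_intros)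
  have cc: "(cnj z * z) ^ i = 1" if "z \<in> space \<mu>" for z i
    using that unit_mult_cnj[of z] by (simp add: sp mult.commute)
  show "(\<integral>z. cnj z ^ j * z ^ k \<partial>\<mu>) = l2_inner ((cmv a ^^ j) u) ((cmv a ^^ k) u)"
  proof (cases "j \<le> k")
    case True
    then obtain d where k: "k = j + d" using le_Suc_ex by blast
    have "(\<integral>z. cnj z ^ j * z ^ k \<partial>\<mu>) = (\<integral>z. z ^ d \<partial>\<mu>)"
    proof (rule Bochner_Integration.integral_cong[OF refl])
      fix z assume "z \<in> space \<mu>"
      then show "cnj z ^ j * z ^ k = z ^ d" using cc[of z j] by (simp add: k power_add power_mult_distrib mult.assoc[symmetric])
    qed
    also have "\<dots> = l2_inner u ((cmv a ^^ d) u)" by (simp add: mom)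
    also have "\<dots> = l2_inner ((cmv a ^^ j) u) ((cmv a ^^ j) ((cmv a ^^ d) u))"
      by (rule cmv_pow_isometry[where a = a, OF a u cmv_pow_l2[where a = a, OF a u], symmetric])
    finally show ?thesis by (simp add: k funpow_add)
  next
    case False
    then obtain d where k: "j = k + d" using le_Suc_ex nat_le_linear by blast
    have "(\<integral>z. cnj z ^ j * z ^ k \<partial>\<mu>) = (\<integral>z. cnj (z ^ d) \<partial>\<mu>)"
    proof (rule Bochner_Integration.integral_cong[OF refl])
      fix z assume "z \<in> space \<mu>"
      then have "cnj z ^ k * z ^ k = 1" using cc[of z k] by (simp add: power_mult_distrib)
      moreover have "cnj z ^ j * z ^ k = (cnj z ^ k * z ^ k) * cnj z ^ d" by (simp add: k power_add mult_ac)
      ultimately show "cnj z ^ j * z ^ k = cnj (z ^ d)" by simp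
    qed
    also have "\<dots> = cnj (\<integral>z. z ^ d \<partial>\<mu>)" by (rule Bochner_Integration.integral_cnj)
    also have "\<dots> = l2_inner ((cmv a ^^ d) u) u" by (simp only: mom[symmetric] l2_inner_cnj)
    also have "\<dots> = l2_inner ((cmv a ^^ k) ((cmv a ^^ d) u)) ((cmv a ^^ k) u)"
      by (rule cmv_pow_isometry[where a = a, OF a cmv_pow_l2[where a = a, OF a u] u, symmetric])
    finally show ?thesis by (simp add: k funpow_add)
  qed
qed

text \<open>By the moments, the integral of \<open>l2_sq (phase_sum a N \<theta> u) / real N\<close>
  over the good angles equals the integral against \<open>\<mu>\<close> of the Fejer kernel
  integrated over these angles. The latter converges to \<open>2 * pi\<close> at every point off the
  image of \<open>B\<close>, and dominated convergence gives the bound.\<close>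

lemma spectral_mass_bound:
  assumes a: "\<And>n. cmod (a n) < 1" and u: "u \<in> l2_int" and \<mu>: "is_spectral_measure (cmv a) u \<mu>"
    and B: "closed B" "B \<subseteq> {0..2 * pi}"
    and L: "\<And>N. 0 < N \<Longrightarrow> (LINT \<theta>:{0..2 * pi} - B|lborel. l2_sq (phase_sum a N \<theta> u) / real N) \<le> L + K / sqrt (real N)"
  shows "2 * pi * measure \<mu> (sphere 0 1 - cis ` B) \<le> L"
proof -
  from \<mu> have fin: "finite_measure \<mu>" and sets: "sets \<mu> = sets borel_circle" by (auto simp: is_spectral_measure_def)
  interpret finite_measure \<mu> by (rule fin)
  have sp: "space \<mu> = sphere 0 1" using sets_eq_imp_space_eq[OF sets] space_borel_circle by simp
  define G where "G = {0..2 * pi} - B"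
  have Bl: "B \<in> sets lborel" using B(1) by simp
  have G: "G \<in> sets lborel" "G \<subseteq> {0..2 * pi}" using Bl by (auto simp: G_def)
  define c where "c j k = (LINT \<theta>:G|lborel. cis (real j * \<theta>) * cis (- (real k * \<theta>)))" for j k
  define F where "F N z \<theta> = (cmod (\<Sum>k<N. (cis (- \<theta>) * z) ^ k))\<^sup>2" for N z \<theta>
  define JC where "JC N z = (\<Sum>j<N. \<Sum>k<N. c j k * (cnj z ^ j * z ^ k))" for N z
  \<comment> \<open>Defined through the trigonometric polynomial, which makes measurability evident;
    the formula as an integral of the kernel follows as \<open>J\<close>.\<close>
  define J where "J N z = Re (JC N z) / real N" for N z
  have FA: "set_integrable lborel A (F N z)"
    "complex_of_real (LINT \<theta>:A|lborel. F N z \<theta>) = (\<Sum>j<N. \<Sum>k<N. (LINT \<theta>:A|lborel. cis (real j * \<theta>) * cis (- (real k * \<theta>))) * (cnj z ^ j * z ^ k))"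
    if "A \<in> sets lborel" "A \<subseteq> {0..2 * pi}" for A N z
  proof -
    show "set_integrable lborel A (F N z)"
      unfolding F_def[abs_def] by (rule set_integrable_subset[OF set_integrable_continuous that]) (auto simp: cis_conv_exp intro!: continuous_intros)
    show "complex_of_real (LINT \<theta>:A|lborel. F N z \<theta>) = (\<Sum>j<N. \<Sum>k<N. (LINT \<theta>:A|lborel. cis (real j * \<theta>) * cis (- (real k * \<theta>))) * (cnj z ^ j * z ^ k))"
      unfolding set_integral_complex_of_real[symmetric] F_def fejer_expand by (rule trig_sum_integral[OF that])
  qed
  have J: "J N z = (LINT \<theta>:G|lborel. F N z \<theta>) / real N" for N z
    unfolding J_def JC_def c_def FA(2)[OF G, symmetric] by simp
  have full: "(LINT \<theta>:{0..2 * pi}|lborel. F N z \<theta>) = 2 * pi * real N" if "cmod z = 1" for N z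
  proof -
    have "complex_of_real (LINT \<theta>:{0..2 * pi}|lborel. F N z \<theta>) = (\<Sum>j<N. \<Sum>k<N. (if j = k then 2 * pi else 0) * (cnj z ^ j * z ^ k))"
      by (subst FA(2)) (simp_all only: cis_integral, simp_all)
    also have "\<dots> = (\<Sum>j<N. 2 * pi * (cnj z * z) ^ j)"
      by (rule sum.cong[OF refl]) (simp add: if_distrib if_distribR power_mult_distrib cong: if_cong)
    also have "\<dots> = complex_of_real (2 * pi * real N)" using unit_mult_cnj[OF that] by (simp add: mult.commute[of "cnj z"])
    finally show ?thesis by (simp only: of_real_eq_iff)
  qed
  have split: "(LINT \<theta>:{0..2 * pi}|lborel. F N z \<theta>) = (LINT \<theta>:G|lborel. F N z \<theta>) + (LINT \<theta>:B|lborel. F N z \<theta>)" for N z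
  proof -
    have "{0..2 * pi} = G \<union> B" using B(2) by (auto simp: G_def)
    then show ?thesis by (simp only:) (rule set_integral_Un, use FA(1)[OF G] FA(1)[OF Bl B(2)] in \<open>auto simp: G_def\<close>)
  qed
  have nn: "0 \<le> (LINT \<theta>:A|lborel. F N z \<theta>)" for A N z
    unfolding set_lebesgue_integral_def by (rule Bochner_Integration.integral_nonneg) (simp add: F_def)
  have J0: "0 \<le> J N z" for N z unfolding J by (simp add: nn)
  have J2: "J N z \<le> 2 * pi" if "cmod z = 1" for N z
  proof (cases "N = 0")
    case False
    have "(LINT \<theta>:G|lborel. F N z \<theta>) \<le> 2 * pi * real N" using full[OF that, of N] split[of N z] nn[of B N z] by linarith
    then show ?thesis unfolding J using False by (simp add: field_simps)
  qed (simp add: J)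
  have Jlim: "(\<lambda>N. J (Suc N) z) \<longlonglongrightarrow> 2 * pi" if z: "cmod z = 1" "z \<notin> cis ` B" for z
  proof -
    have cB: "compact B" using B by (metis bounded_closed_interval bounded_subset compact_eq_bounded_closed)
    then have "closed (cis ` B)" by (intro compact_imp_closed compact_continuous_image) (auto simp: cis_conv_exp intro!: continuous_intros)
    then obtain d where d: "d > 0" "\<And>y. y \<in> cis ` B \<Longrightarrow> d \<le> dist z y"
      using separate_point_closed[OF _ z(2)] by blast
    \<comment> \<open>At distance \<open>d\<close> from the bad points the geometric sum is at most
      \<open>2 / d\<close> for every \<open>N\<close>, while the full integral is
      \<open>2 * pi * real N\<close>; so the good angles carry almost all of it.\<close>
    have FB: "F N z \<theta> \<le> 4 / d\<^sup>2" if "\<theta> \<in> B" for N \<theta>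
    proof -
      define q where "q = cis (- \<theta>) * z"
      have q: "cmod q = 1" using z by (simp add: q_def norm_mult)
      have "z - cis \<theta> = cis \<theta> * (q - 1)" by (simp add: q_def right_diff_distrib mult.assoc[symmetric] cis_mult)
      then have dq: "d \<le> cmod (1 - q)" using d(2)[of "cis \<theta>"] that by (simp add: dist_norm norm_mult norm_minus_commute)
      then have q1: "q \<noteq> 1" using d(1) by auto
      have "cmod (\<Sum>k<N. q ^ k) = cmod (1 - q ^ N) / cmod (1 - q)" using q1 by (simp add: sum_gp_strict norm_divide)
      also have "\<dots> \<le> 2 / d"
        using norm_triangle_ineq4[of 1 "q ^ N"] q dq d(1) by (intro frac_le) (auto simp: norm_power)
      finally have "(cmod (\<Sum>k<N. q ^ k))\<^sup>2 \<le> (2 / d)\<^sup>2" by (intro power_mono) auto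
      then show ?thesis by (simp add: F_def q_def power_divide)
    qed
    have low: "2 * pi - 8 * pi / d\<^sup>2 * (1 / real (Suc N)) \<le> J (Suc N) z" for N
    proof -
      have "(LINT \<theta>:B|lborel. F (Suc N) z \<theta>) \<le> (LINT \<theta>:{0..2 * pi}|lborel. 4 / d\<^sup>2)"
        unfolding set_lebesgue_integral_def
      proof (rule integral_mono)
        show "integrable lborel (\<lambda>x. indicat_real B x *\<^sub>R F (Suc N) z x)" using FA(1)[OF Bl B(2)] by (simp add: set_integrable_def)
        show "integrable lborel (\<lambda>x. indicat_real {0..2 * pi} x *\<^sub>R (4 / d\<^sup>2))" by simp
        show "indicat_real B x *\<^sub>R F (Suc N) z x \<le> indicat_real {0..2 * pi} x *\<^sub>R (4 / d\<^sup>2)" for x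
          using FB[of x "Suc N"] B(2) by (auto simp: indicator_def)
      qed
      also have "\<dots> = 8 * pi / d\<^sup>2" by (simp add: set_lebesgue_integral_def)
      finally have "2 * pi * real (Suc N) - 8 * pi / d\<^sup>2 \<le> (LINT \<theta>:G|lborel. F (Suc N) z \<theta>)"
        using full[OF z(1), of "Suc N"] split[of "Suc N" z] by linarith
      then have "(2 * pi * real (Suc N) - 8 * pi / d\<^sup>2) / real (Suc N) \<le> J (Suc N) z" unfolding J by (intro divide_right_mono) auto
      then show ?thesis by (simp add: diff_divide_distrib del: of_nat_Suc)
    qed
    have "(\<lambda>N. 2 * pi - 8 * pi / d\<^sup>2 * (1 / real (Suc N))) \<longlonglongrightarrow> 2 * pi - 8 * pi / d\<^sup>2 * 0"
      using LIMSEQ_inverse_real_of_nat by (intro tendsto_intros) (simp add: inverse_eq_divide)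
    then have l: "(\<lambda>N. 2 * pi - 8 * pi / d\<^sup>2 * (1 / real (Suc N))) \<longlonglongrightarrow> 2 * pi" by simp
    show ?thesis by (rule tendsto_sandwich[OF _ _ l tendsto_const]) (use low J2[OF z(1)] in \<open>auto intro!: always_eventually\<close>)
  qed
  have JCm: "continuous_on UNIV (JC N)" for N unfolding JC_def[abs_def] by (intro continuous_intros)
  have Jm: "J N \<in> borel_measurable \<mu>" for N
    unfolding J_def[abs_def] by (intro borel_circle_measurable[OF _ sets] borel_measurable_continuous_onI)
      (cases "N = 0"; auto intro!: continuous_intros JCm)
  have Ji: "integrable \<mu> (J N)" for N
    by (rule integrable_const_bound[of _ "2 * pi"]) (use J0 J2 Jm in \<open>auto simp: sp intro!: AE_I2\<close>)
  have JI: "(\<integral>z. J N z \<partial>\<mu>) = (LINT \<theta>:G|lborel. l2_sq (phase_sum a N \<theta> u) / real N)" for N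
  proof -
    have "complex_of_real (LINT \<theta>:G|lborel. l2_sq (phase_sum a N \<theta> u)) = (LINT \<theta>:G|lborel. l2_inner (phase_sum a N \<theta> u) (phase_sum a N \<theta> u))"
      unfolding set_integral_complex_of_real[symmetric] l2_inner_self[OF fsum_l2[where a = a, OF a u]] ..
    also have "\<dots> = (\<Sum>j<N. \<Sum>k<N. c j k * (\<integral>z. cnj z ^ j * z ^ k \<partial>\<mu>))"
      unfolding fsum_inner[where a = a, OF a u u] trig_sum_integral[OF G] c_def spectral_moments(2)[where a = a, OF a u \<mu>] ..
    also have "\<dots> = (\<integral>z. JC N z \<partial>\<mu>)"
      unfolding JC_def using spectral_moments(1)[where a = a, OF a u \<mu>]
      by (simp add: Bochner_Integration.integral_sum Bochner_Integration.integrable_sum)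
    finally have 1: "complex_of_real (LINT \<theta>:G|lborel. l2_sq (phase_sum a N \<theta> u)) = (\<integral>z. JC N z \<partial>\<mu>)" .
    have "integrable \<mu> (JC N)" unfolding JC_def[abs_def] using spectral_moments(1)[where a = a, OF a u \<mu>]
      by (intro Bochner_Integration.integrable_sum) simp
    then have "(\<integral>z. Re (JC N z) \<partial>\<mu>) = Re (\<integral>z. JC N z \<partial>\<mu>)" by (rule integral_Re)
    also have "\<dots> = (LINT \<theta>:G|lborel. l2_sq (phase_sum a N \<theta> u))" unfolding 1[symmetric] by simp
    finally show ?thesis by (simp add: J_def)
  qed
  define S where "S = sphere 0 1 - cis ` B"
  have Sm: "S \<in> sets \<mu>"
  proof -
    have "compact B" using B by (metis bounded_closed_interval bounded_subset compact_eq_bounded_closed)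
    then have "closed (cis ` B)" by (intro compact_imp_closed compact_continuous_image) (auto simp: cis_conv_exp intro!: continuous_intros)
    then have "- cis ` B \<in> sets borel" by auto
    then show ?thesis unfolding sets borel_circle_def S_def by (auto simp: sets_restrict_space Diff_eq)
  qed
  have lim: "(\<lambda>N. \<integral>z. indicat_real S z * J (Suc N) z \<partial>\<mu>) \<longlonglongrightarrow> (\<integral>z. indicat_real S z * (2 * pi) \<partial>\<mu>)"
  proof (rule integral_dominated_convergence[where w = "\<lambda>_. 2 * pi"])
    show "(\<lambda>z. indicat_real S z * (2 * pi)) \<in> borel_measurable \<mu>" using Sm by simp
    show "(\<lambda>z. indicat_real S z * J (Suc N) z) \<in> borel_measurable \<mu>" for N using Sm Jm by simp
    show "AE z in \<mu>. (\<lambda>N. indicat_real S z * J (Suc N) z) \<longlonglongrightarrow> indicat_real S z * (2 * pi)"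
    proof (rule AE_I2)
      fix z assume "z \<in> space \<mu>"
      then show "(\<lambda>N. indicat_real S z * J (Suc N) z) \<longlonglongrightarrow> indicat_real S z * (2 * pi)"
        using Jlim[of z] by (cases "z \<in> S") (auto simp: sp S_def)
    qed
    show "AE z in \<mu>. norm (indicat_real S z * J (Suc N) z) \<le> 2 * pi" for N
      using J0 J2 by (intro AE_I2) (auto simp: sp indicator_def)
  qed simp
  have up: "(\<integral>z. indicat_real S z * J (Suc N) z \<partial>\<mu>) \<le> L + K * (1 / sqrt (real (Suc N)))" for N
  proof -
    have "(\<integral>z. indicat_real S z * J (Suc N) z \<partial>\<mu>) \<le> (\<integral>z. J (Suc N) z \<partial>\<mu>)"
    proof (rule integral_mono[OF _ Ji])
      show "integrable \<mu> (\<lambda>z. indicat_real S z * J (Suc N) z)" using integrable_mult_indicator[OF Sm Ji[of "Suc N"]] by simp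
      show "indicat_real S z * J (Suc N) z \<le> J (Suc N) z" for z using J0[of "Suc N" z] by (auto simp: indicator_def)
    qed
    also have "\<dots> \<le> L + K / sqrt (real (Suc N))" unfolding JI G_def by (rule L) simp
    finally show ?thesis by simp
  qed
  have s0: "(\<lambda>N. 1 / sqrt (real (Suc N))) \<longlonglongrightarrow> 0"
  proof -
    have "(\<lambda>N. sqrt (inverse (real (Suc N)))) \<longlonglongrightarrow> sqrt 0" by (intro tendsto_real_sqrt LIMSEQ_inverse_real_of_nat)
    then show ?thesis by (simp add: real_sqrt_divide inverse_eq_divide)
  qed
  have "(\<lambda>N. L + K * (1 / sqrt (real (Suc N)))) \<longlonglongrightarrow> L + K * 0" by (intro tendsto_intros s0)
  from LIMSEQ_le[OF lim this] up have "(\<integral>z. indicat_real S z * (2 * pi) \<partial>\<mu>) \<le> L" by auto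
  moreover have "(\<integral>z. indicat_real S z * (2 * pi) \<partial>\<mu>) = 2 * pi * measure \<mu> S"
    using Sm sets.sets_into_space[OF Sm] by (simp add: Int_absorb2 mult.commute)
  ultimately have "2 * pi * measure \<mu> S \<le> L" by linarith
  then show ?thesis unfolding S_def .
qed

lemma cis_eq_0_2pi:
  assumes "cis \<theta> = cis \<phi>" "0 \<le> \<theta>" "\<theta> < 2 * pi" "0 \<le> \<phi>" "\<phi> < 2 * pi"
  shows "\<theta> = \<phi>"
proof -
  have "sin \<theta> = sin \<phi> \<and> cos \<theta> = cos \<phi>" using assms(1) by (simp add: complex_eq_iff)
  then obtain n :: int where n: "\<theta> = \<phi> + 2 * pi * n" unfolding sin_cos_eq_iff by blast
  then have "2 * pi * \<bar>real_of_int n\<bar> = \<bar>\<theta> - \<phi>\<bar>" by (simp add: abs_mult)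
  also have "\<dots> < 2 * pi * 1" using assms by linarith
  finally have "\<bar>real_of_int n\<bar> < 1" by simp
  then have "n = 0" by linarith
  then show ?thesis using n by simp
qed

lemma emeasure_arc_length_le:
  assumes B: "closed B" "B \<subseteq> {0..2 * pi}"
  shows "cis ` B \<in> sets borel_circle" and "emeasure arc_length (cis ` B) \<le> emeasure lborel B"
proof -
  have "compact B" using B by (metis bounded_closed_interval bounded_subset compact_eq_bounded_closed)
  then have cl: "closed (cis ` B)" by (intro compact_imp_closed compact_continuous_image) (auto simp: cis_conv_exp intro!: continuous_intros)
  moreover have "cis ` B \<subseteq> sphere 0 1" by auto
  ultimately show m: "cis ` B \<in> sets borel_circle"
    unfolding borel_circle_def by (auto simp: sets_restrict_space intro!: image_eqI[of _ _ "cis ` B"])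
  have cm: "cis \<in> restrict_space lborel {0..<2 * pi} \<rightarrow>\<^sub>M borel_circle"
    unfolding borel_circle_def
    by (rule measurable_restrict_space2) (auto simp: cis_conv_exp intro!: measurable_restrict_space1 borel_measurable_continuous_onI continuous_intros)
  \<comment> \<open>The arc length is parametrised by the half-open interval, whereas
    \<open>B\<close> may contain \<open>2 * pi\<close>, which has the same image as 0; the null set
    \<open>{0}\<close> accounts for this.\<close>
  have sub: "cis -` cis ` B \<inter> {0..<2 * pi} \<subseteq> B \<union> {0}"
  proof
    fix \<theta> assume "\<theta> \<in> cis -` cis ` B \<inter> {0..<2 * pi}"
    then obtain \<phi> where \<phi>: "\<phi> \<in> B" "cis \<theta> = cis \<phi>" "0 \<le> \<theta>" "\<theta> < 2 * pi" by auto
    have p: "0 \<le> \<phi>" "\<phi> \<le> 2 * pi" using \<phi>(1) B(2) by auto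
    show "\<theta> \<in> B \<union> {0}"
    proof (cases "\<phi> = 2 * pi")
      case True
      have "cis (\<theta>) = cis 0" using \<phi>(2) True by simp
      then have "\<theta> = 0" using cis_eq_0_2pi[of \<theta> 0] \<phi> by simp
      then show ?thesis by simp
    next
      case False
      then have "\<theta> = \<phi>" using cis_eq_0_2pi[of \<theta> \<phi>] \<phi> p by simp
      then show ?thesis using \<phi> by simp
    qed
  qed
  have "emeasure arc_length (cis ` B) = emeasure (restrict_space lborel {0..<2 * pi}) (cis -` cis ` B \<inter> {0..<2 * pi})"
    unfolding arc_length_def by (subst emeasure_distr[OF cm m]) (simp add: space_restrict_space)
  also have "\<dots> = emeasure lborel (cis -` cis ` B \<inter> {0..<2 * pi})"
    by (rule emeasure_restrict_space) auto
  also have "\<dots> \<le> emeasure lborel (B \<union> {0})" by (rule emeasure_mono[OF sub]) (use B in auto)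
  also have "\<dots> = emeasure lborel B"
    by (rule emeasure_Un_null_set) (use B finite_imp_null_set_lborel[of "{0::real}"] in auto)
  finally show "emeasure arc_length (cis ` B) \<le> emeasure lborel B" .
qed

text \<open>First the tail of \<open>u\<close> is fixed, then \<open>k0\<close> is chosen against
  the constant \<open>A\<close> that this produces. The bound has to be uniform in \<open>M\<close>,
  because the window that belongs to \<open>k\<close> is not under control.\<close>

lemma small_mass_off_bad_angles:
  assumes r: "0 \<le> r" "r < 1" and a: "\<And>n. cmod (a n) \<le> r" and u: "u \<in> l2_int"
    and \<mu>: "is_spectral_measure (cmv a) u \<mu>" and \<epsilon>: "0 < \<epsilon>"
  shows "\<exists>k0. \<forall>k\<ge>k0. \<forall>M. measure \<mu> (sphere 0 1 - cis ` bad_angles a M (2 ^ k * (2 * real M + 1))) \<le> \<epsilon>"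
proof -
  have a1: "cmod (a n) < 1" for n using a[of n] r by linarith
  define C where "C = 2 / sqrt (1 - r\<^sup>2)"
  have C1: "1 \<le> C" by (rule szego_growth_const[OF r C_def])
  have n0: "0 \<le> l2_sq u" by (rule n2_nonneg)
  \<comment> \<open>Makes \<open>l2_sq u / t\<close> at most \<open>\<epsilon> / 2\<close>; the tail
    \<open>w\<close> is then small relative to \<open>1 / t\<close>.\<close>
  define t where "t = 2 * (l2_sq u + 1) / \<epsilon>"
  have t: "0 < t" using n0 \<epsilon> by (simp add: t_def)
  have "0 < \<epsilon> / (2 * t)" using t \<epsilon> by simp
  then obtain J :: nat where J: "(\<lambda>n. if \<bar>n\<bar> \<le> int J then 0 else u n) \<in> l2_int"
    "l2_sq (\<lambda>n. if \<bar>n\<bar> \<le> int J then 0 else u n) < \<epsilon> / (2 * t)"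
    using l2_tail[OF u] by metis
  define w where "w = (\<lambda>n. if \<bar>n\<bar> \<le> int J then 0 else u n)"
  have w: "w \<in> l2_int" "l2_sq w < \<epsilon> / (2 * t)" using J by (simp_all add: w_def)
  have tail: "t * l2_sq w + l2_sq u / t \<le> \<epsilon>"
  proof -
    have "t * l2_sq w \<le> \<epsilon> / 2" using w(2) t by (simp add: field_simps)
    moreover have "l2_sq u / t \<le> \<epsilon> / 2"
    proof -
      have "l2_sq u * \<epsilon> \<le> (l2_sq u + 1) * \<epsilon>" using \<epsilon> by (intro mult_right_mono) auto
      then show ?thesis using \<epsilon> n0 by (simp add: t_def field_simps)
    qed
    ultimately show ?thesis by linarith
  qed
  define A where "A = (\<Sum>j=-int J..int J. cmod (u j) * C ^ nat \<bar>j\<bar>)"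
  have A0: "0 \<le> A" unfolding A_def using C1 by (intro sum_nonneg) auto
  \<comment> \<open>The constant 12 is 4 times 3, where 3 bounds
    \<open>(2 * real M + 3) / (2 * real M + 1)\<close> for all \<open>M\<close>.\<close>
  obtain k0 where k0: "12 * A * (1 + l2_sq u) / \<epsilon> < 2 ^ k0" using real_arch_pow[of 2] by auto
  show ?thesis
  proof (intro exI[of _ k0] allI impI)
    fix k M assume k: "k0 \<le> k"
    define R where "R = 2 ^ k * (2 * real M + 1)"
    have R: "0 < R" by (simp add: R_def)
    have "\<exists>K. \<forall>N>0. (LINT \<theta>:{0..2 * pi} - bad_angles a M R|lborel. l2_sq (phase_sum a N \<theta> u) / real N)
      \<le> A * (4 * (2 * real M + 3) * (pi * (1 + l2_sq u)) / R) + pi * (t * l2_sq w + l2_sq u / t) + K / sqrt (real N)"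
      unfolding A_def by (rule good_angles_mass[where M = M, OF r a u R C_def w_def w(1) t])
    then obtain K where K': "\<forall>N>0. (LINT \<theta>:{0..2 * pi} - bad_angles a M R|lborel. l2_sq (phase_sum a N \<theta> u) / real N)
      \<le> A * (4 * (2 * real M + 3) * (pi * (1 + l2_sq u)) / R) + pi * (t * l2_sq w + l2_sq u / t) + K / sqrt (real N)" ..
    note K = K'[rule_format]
    have "2 * pi * measure \<mu> (sphere 0 1 - cis ` bad_angles a M R)
      \<le> A * (4 * (2 * real M + 3) * (pi * (1 + l2_sq u)) / R) + pi * (t * l2_sq w + l2_sq u / t)"
      by (rule spectral_mass_bound[where a = a, OF a1 u \<mu> closed_bad_angles[where a = a, OF a1] _ K]) (auto simp: bad_angles_def)
    also have "\<dots> \<le> pi * \<epsilon> + pi * \<epsilon>"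
    proof (intro add_mono mult_left_mono tail)
      have "(2 * real M + 3) / (2 * real M + 1) \<le> 3" by (simp add: field_simps)
      then have "(2 * real M + 3) / (2 * real M + 1) / 2 ^ k \<le> 3 / 2 ^ k" by (rule divide_right_mono) simp
      then have "(2 * real M + 3) / R \<le> 3 / 2 ^ k" by (simp add: R_def mult.commute)
      then have "A * (4 * (pi * (1 + l2_sq u))) * ((2 * real M + 3) / R) \<le> A * (4 * (pi * (1 + l2_sq u))) * (3 / 2 ^ k)"
        using A0 n0 by (intro mult_left_mono) auto
      moreover have "A * (4 * (2 * real M + 3) * (pi * (1 + l2_sq u)) / R) = A * (4 * (pi * (1 + l2_sq u))) * ((2 * real M + 3) / R)"
        by (simp only: times_divide_eq_right mult_ac)
      ultimately have "A * (4 * (2 * real M + 3) * (pi * (1 + l2_sq u)) / R) \<le> A * (4 * (pi * (1 + l2_sq u))) * (3 / 2 ^ k)"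
        by (simp only:)
      also have "\<dots> = pi * (12 * A * (1 + l2_sq u) / 2 ^ k)" by simp
      also have "\<dots> \<le> pi * \<epsilon>"
      proof (rule mult_left_mono)
        have "12 * A * (1 + l2_sq u) / \<epsilon> < 2 ^ k" using k0 power_increasing[OF k, of "2::real"] by linarith
        then show "12 * A * (1 + l2_sq u) / 2 ^ k \<le> \<epsilon>" using \<epsilon> by (simp add: field_simps)
      qed simp
      finally show "A * (4 * (2 * real M + 3) * (pi * (1 + l2_sq u)) / R) \<le> pi * \<epsilon>" .
    qed simp
    finally have "2 * pi * measure \<mu> (sphere 0 1 - cis ` bad_angles a M R) \<le> 2 * pi * \<epsilon>" by simp
    then show "measure \<mu> (sphere 0 1 - cis ` bad_angles a M (2 ^ k * (2 * real M + 1))) \<le> \<epsilon>" by (simp add: R_def)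
  qed
qed

text \<open>The images \<open>Z k\<close> of the bad angles have summable arc length, so their limes
  superior is null by Borel-Cantelli. A point outside it lies, from some index on, in all
  complements of the \<open>Z k\<close>, whose spectral mass tends to 0.\<close>

lemma singular_support:
  assumes r: "0 \<le> r" "r < 1" and a: "\<And>n. cmod (a n) \<le> r" and u: "u \<in> l2_int"
    and \<mu>: "is_spectral_measure (cmv a) u \<mu>"
    and bad: "\<And>k::nat. \<exists>M. measure lborel (bad_angles a M (2 ^ k * (2 * real M + 1))) < 1 / 2 ^ k"
  shows "\<exists>N\<in>null_sets arc_length. emeasure \<mu> (space \<mu> - N) = 0"
proof -
  have a1: "cmod (a n) < 1" for n using a[of n] r by linarith
  from \<mu> have fin: "finite_measure \<mu>" and sets: "sets \<mu> = sets borel_circle" by (auto simp: is_spectral_measure_def)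
  interpret finite_measure \<mu> by (rule fin)
  have sp: "space \<mu> = sphere 0 1" using sets_eq_imp_space_eq[OF sets] space_borel_circle by simp
  obtain M where M: "\<And>k. measure lborel (bad_angles a (M k) (2 ^ k * (2 * real (M k) + 1))) < 1 / 2 ^ k" using bad by metis
  define B where "B k = bad_angles a (M k) (2 ^ k * (2 * real (M k) + 1))" for k
  have B: "closed (B k)" "B k \<subseteq> {0..2 * pi}" for k
    unfolding B_def using closed_bad_angles[where a = a, OF a1] by (auto simp: bad_angles_def)
  define Z where "Z k = cis ` B k" for k
  have Zm: "Z k \<in> sets borel_circle" for k unfolding Z_def by (rule emeasure_arc_length_le(1)[OF B])
  have Zs: "sets arc_length = sets borel_circle" by (simp add: arc_length_def)
  have BE: "emeasure lborel (B k) = ennreal (measure lborel (B k))" for k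
    by (rule emeasure_eq_ennreal_measure) (use emeasure_bounded_finite[of "B k"] bounded_subset[OF bounded_closed_interval B(2)] in \<open>auto simp: less_top\<close>)
  have Zle: "emeasure arc_length (Z k) \<le> ennreal (1 / 2 ^ k)" for k
    using emeasure_arc_length_le(2)[OF B, of k] M[of k] unfolding Z_def[symmetric] BE
    by (auto simp: B_def intro: order_trans ennreal_leI)
  have N: "limsup Z \<in> null_sets arc_length"
  proof (rule borel_cantelli_limsup1)
    show "Z k \<in> sets arc_length" for k using Zm Zs by simp
    show "emeasure arc_length (Z k) < \<infinity>" for k using Zle[of k] by (simp add: order_le_less_trans)
    show "summable (\<lambda>k. measure arc_length (Z k))"
    proof (rule summable_comparison_test')
      show "summable (\<lambda>k. (1/2::real) ^ k)" by (rule summable_geometric) simp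
      show "norm (measure arc_length (Z k)) \<le> (1/2) ^ k" for k
        using Zle[of k] by (simp add: measure_def enn2real_leI power_one_over)
    qed
  qed
  have "emeasure \<mu> (space \<mu> - limsup Z) = 0"
  proof -
    \<comment> \<open>Contained in the complement of \<open>Z k\<close> for every
      \<open>k \<ge> n\<close>, hence of measure below every \<open>\<epsilon>\<close>.\<close>
    define D where "D n = (\<Inter>m\<in>{n..}. space \<mu> - Z m)" for n
    have Dm: "D n \<in> sets \<mu>" for n
    proof -
      have "D n = space \<mu> - (\<Union>m\<in>{n..}. Z m)" by (auto simp: D_def)
      moreover have "(\<Union>m\<in>{n..}. Z m) \<in> sets \<mu>" using Zm sets by (intro sets.countable_UN'') auto
      ultimately show ?thesis by auto
    qed
    have D0: "emeasure \<mu> (D n) = 0" for n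
    proof -
      have "measure \<mu> (D n) \<le> 0 + \<epsilon>" if \<epsilon>: "0 < \<epsilon>" for \<epsilon>
      proof -
        obtain k0 where k0: "\<And>k M. k0 \<le> k \<Longrightarrow> measure \<mu> (sphere 0 1 - cis ` bad_angles a M (2 ^ k * (2 * real M + 1))) \<le> \<epsilon>"
          using small_mass_off_bad_angles[OF r a u \<mu> \<epsilon>] by blast
        define k where "k = max k0 n"
        have "measure \<mu> (D n) \<le> measure \<mu> (space \<mu> - Z k)"
          by (rule finite_measure_mono) (use Zm sets in \<open>auto simp: D_def k_def\<close>)
        also have "\<dots> \<le> \<epsilon>" unfolding sp Z_def B_def by (rule k0) (simp add: k_def)
        finally show ?thesis by simp
      qed
      then have "measure \<mu> (D n) \<le> 0" by (rule field_le_epsilon)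
      then show ?thesis by (simp add: emeasure_eq_measure measure_le_0_iff)
    qed
    have "space \<mu> - limsup Z = (\<Union>n. D n)" by (auto simp: D_def limsup_INF_SUP)
    moreover have "emeasure \<mu> (\<Union>n. D n) = 0" by (rule emeasure_UN_eq_0) (use Dm D0 in auto)
    ultimately show ?thesis by simp
  qed
  then show ?thesis using N by blast
qed

section \<open>Genericity\<close>

lemma bad_angles_limit:
  assumes a: "\<And>n. cmod (a n) < 1" and lim: "\<And>n. (\<lambda>i. A i n) \<longlonglongrightarrow> a n"
    and inf: "\<And>i::nat. \<exists>j\<ge>i. \<theta> \<in> bad_angles (A j) M R"
  shows "\<theta> \<in> bad_angles a M R"
proof -
  from inf obtain j where j: "\<And>i. i \<le> j i" "\<And>i. \<theta> \<in> bad_angles (A (j i)) M R" by metis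
  then have "\<forall>i. \<exists>v. cmod v = 1 \<and> (\<Sum>k=-int M..int M. cmod (sol (A (j i)) (cis (\<theta> / 2)) v k)) \<le> R"
    by (auto simp: bad_angles_def)
  then obtain v where v: "\<And>n. cmod (v n) = 1" "\<And>n. (\<Sum>k=-int M..int M. cmod (sol (A (j n)) (cis (\<theta> / 2)) (v n) k)) \<le> R"
    by metis
  have "bounded (range v)" using v(1) by (auto intro!: boundedI[of _ 1])
  then obtain x r where r: "strict_mono (r :: nat \<Rightarrow> nat)" "(v \<circ> r) \<longlonglongrightarrow> x"
    using bounded_imp_convergent_subsequence by blast
  have jr: "filterlim (\<lambda>i. j (r i)) at_top sequentially"
  proof (rule filterlim_at_top_mono[OF filterlim_ident always_eventually], intro allI)
    show "i \<le> j (r i)" for i using seq_suble[OF r(1), of i] j(1)[of "r i"] by linarith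
  qed
  have "(\<lambda>n. \<Sum>k=-int M..int M. cmod (sol (A (j (r n))) (cis (\<theta> / 2)) (v (r n)) k)) \<longlonglongrightarrow> (\<Sum>k=-int M..int M. cmod (sol a (cis (\<theta> / 2)) x k))"
    using r(2) a by (intro tendsto_intros tendsto_sol filterlim_compose[OF lim jr]) (auto simp: o_def)
  then have "(\<Sum>k=-int M..int M. cmod (sol a (cis (\<theta> / 2)) x k)) \<le> R"
    by (rule LIMSEQ_le_const2) (use v(2) in blast)
  moreover have "cmod x = 1" using tendsto_norm[OF r(2)] v(1) by (simp add: o_def LIMSEQ_const_iff)
  moreover have "\<theta> \<in> {0..2 * pi}" using j(2)[of 0] by (auto simp: bad_angles_def)
  ultimately show ?thesis by (auto simp: bad_angles_def)
qed

lemma emeasure_bad_angles: "emeasure lborel (bad_angles a M R) < \<infinity>"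
proof -
  have "bad_angles a M R \<subseteq> {0..2 * pi}" by (auto simp: bad_angles_def)
  then show ?thesis by (intro emeasure_bounded_finite bounded_subset[OF bounded_closed_interval])
qed

text \<open>The bad set is upper semicontinuous: an angle that is bad for infinitely many terms of a
  convergent sequence is bad for the limit. Since all bad sets lie in a bounded interval, continuity
  from above turns this into a statement on measures.\<close>

lemma small_bad_angles_near:
  assumes a: "\<And>n. cmod (a n) < 1" and m: "measure lborel (bad_angles a M R) < \<epsilon>"
  shows "\<exists>k. \<forall>b. near k a b \<longrightarrow> measure lborel (bad_angles b M R) < \<epsilon>"
proof (rule near_principle)
  fix b assume b: "\<And>i n. cmod (b i n) < 1" and lim: "\<And>n. (\<lambda>i. b i n) \<longlonglongrightarrow> a n"
  \<comment> \<open>Decreasing unions, so that their intersection consists of the angles that are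
    bad infinitely often.\<close>
  define D where "D n = (\<Union>i\<in>{n..}. bad_angles (b i) M R)" for n :: nat
  have bm: "bad_angles (b i) M R \<in> sets lborel" for i using closed_bad_angles[where a = "b i", OF b] by simp
  have Dm: "D n \<in> sets lborel" for n unfolding D_def using bm by (intro sets.countable_UN'') auto
  have Dsub: "D n \<subseteq> {0..2 * pi}" for n by (auto simp: D_def bad_angles_def)
  have fin: "emeasure lborel (D n) < \<infinity>" for n
    by (intro emeasure_bounded_finite bounded_subset[OF _ Dsub]) auto
  have "(\<lambda>n. measure lborel (D n)) \<longlonglongrightarrow> measure lborel (\<Inter>n. D n)"
  proof (rule Lim_measure_decseq)
    show "range D \<subseteq> sets lborel" using Dm by auto
    show "decseq D" unfolding decseq_def D_def by (intro allI impI UN_mono) auto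
    show "emeasure lborel (D i) \<noteq> \<infinity>" for i using fin[of i] by simp
  qed
  moreover have "(\<Inter>n. D n) \<subseteq> bad_angles a M R"
  proof
    fix \<theta> assume "\<theta> \<in> (\<Inter>n. D n)"
    then show "\<theta> \<in> bad_angles a M R"
      by (intro bad_angles_limit[where A = b and a = a, OF a lim]) (auto simp: D_def)
  qed
  then have "measure lborel (\<Inter>n. D n) \<le> measure lborel (bad_angles a M R)"
    by (intro measure_mono_fmeasurable) (use Dm closed_bad_angles[where a = a, OF a] emeasure_bad_angles in \<open>auto simp: fmeasurable_def\<close>)
  then have "measure lborel (\<Inter>n. D n) < \<epsilon>" using m by linarith
  ultimately have "\<forall>\<^sub>F n in sequentially. measure lborel (D n) < \<epsilon>" by (rule order_tendstoD(2))
  then obtain n where n: "measure lborel (D n) < \<epsilon>" by (auto simp: eventually_sequentially)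
  have "measure lborel (bad_angles (b n) M R) \<le> measure lborel (D n)"
    by (intro measure_mono_fmeasurable) (use Dm bm fin in \<open>auto simp: fmeasurable_def D_def\<close>)
  then show "\<exists>i. measure lborel (bad_angles (b i) M R) < \<epsilon>" using n by (intro exI[of _ n]) linarith
qed

text \<open>A small change in the supremum norm moves all coefficients by little, which is more than
  \<open>near\<close> asks for.\<close>

lemma open_near_property:
  fixes T :: "'a::metric_space \<Rightarrow> 'a"
  assumes comp: "compact (UNIV :: 'a set)"
    and P: "\<And>f. f \<in> sampling_functions \<Longrightarrow> P (orbit_coeffs T f \<omega>) \<Longrightarrow> \<exists>k. \<forall>b. near k (orbit_coeffs T f \<omega>) b \<longrightarrow> P b"
  shows "open {f \<in> sampling_functions. P (orbit_coeffs T f \<omega>)}"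
  unfolding open_dist
proof (intro ballI)
  fix f assume f: "f \<in> {f \<in> sampling_functions. P (orbit_coeffs T f \<omega>)}"
  then obtain k where k: "\<And>b. near k (orbit_coeffs T f \<omega>) b \<Longrightarrow> P b" using P by blast
  have fs: "f \<in> sampling_functions" using f by simp
  obtain r0 \<delta> where "r0 < 1" and r: "\<delta> > 0" and "\<And>x. cmod (apply_bcontfun f x) \<le> r0" and r': "\<And>g. dist f g < \<delta> \<Longrightarrow> g \<in> sampling_functions"
    using sampling_functions_open[OF comp fs] by blast
  show "\<exists>e>0. \<forall>g. dist g f < e \<longrightarrow> g \<in> {f \<in> sampling_functions. P (orbit_coeffs T f \<omega>)}"
  proof (intro exI[of _ "min \<delta> (1 / (real k + 1))"] conjI allI impI)
    fix g assume g: "dist g f < min \<delta> (1 / (real k + 1))"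
    then have gs: "g \<in> sampling_functions" by (intro r') (simp add: dist_commute)
    have "cmod (apply_bcontfun g x - apply_bcontfun f x) < 1 / (real k + 1)" for x
      using dist_bounded[of g x f] g by (simp add: dist_norm)
    then have "near k (orbit_coeffs T f \<omega>) (orbit_coeffs T g \<omega>)" using gs by (auto simp: near_def orbit_coeffs_def sampling_functions_def)
    then show "g \<in> {f \<in> sampling_functions. P (orbit_coeffs T f \<omega>)}" using k gs by simp
  qed (use r in auto)
qed

lemma apply_bcontfun_sum:
  fixes f :: "'i \<Rightarrow> ('a::topological_space \<Rightarrow>\<^sub>C complex)"
  shows "finite S \<Longrightarrow> apply_bcontfun (\<Sum>i\<in>S. f i) x = (\<Sum>i\<in>S. apply_bcontfun (f i) x)"
  by (induction S rule: finite_induct) (simp_all add: plus_bcontfun.rep_eq zero_bcontfun.rep_eq)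

lemma finite_separated:
  assumes "finite (X :: 'a::metric_space set)"
  obtains \<epsilon> where "\<epsilon> > 0" "\<And>x y. x \<in> X \<Longrightarrow> y \<in> X \<Longrightarrow> x \<noteq> y \<Longrightarrow> 2 * \<epsilon> \<le> dist x y"
proof -
  define D where "D = insert 2 ((\<lambda>(x, y). dist x y) ` {(x, y) \<in> X \<times> X. x \<noteq> y})"
  have "finite {(x, y) \<in> X \<times> X. x \<noteq> y}" by (rule finite_subset[of _ "X \<times> X"]) (use assms in auto)
  then have D: "finite D" "D \<noteq> {}" by (auto simp: D_def)
  have "Min D > 0" using D by (subst Min_gr_iff) (auto simp: D_def)
  moreover have "Min D \<le> dist x y" if "x \<in> X" "y \<in> X" "x \<noteq> y" for x y
    using D(1) that by (intro Min_le) (auto simp: D_def)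
  ultimately show ?thesis by (intro that[of "Min D / 2"]) auto
qed

text \<open>The bumps have disjoint supports because the points are separated by
  \<open>2 * \<epsilon>\<close>; hence the supremum norm of the correction is the largest of the
  changes and not their sum.\<close>

lemma interpolate:
  fixes f :: "'a::metric_space \<Rightarrow>\<^sub>C complex"
  assumes W: "finite W" and p: "inj_on p W" and \<beta>: "\<And>n. n \<in> W \<Longrightarrow> cmod (\<beta> n - apply_bcontfun f (p n)) \<le> \<delta>" and \<delta>: "0 \<le> \<delta>"
  obtains g where "dist f g \<le> \<delta>" "\<And>n. n \<in> W \<Longrightarrow> apply_bcontfun g (p n) = \<beta> n"
proof -
  obtain \<epsilon> where \<epsilon>: "\<epsilon> > 0" "\<And>x y. x \<in> p ` W \<Longrightarrow> y \<in> p ` W \<Longrightarrow> x \<noteq> y \<Longrightarrow> 2 * \<epsilon> \<le> dist x y"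
    using finite_separated[of "p ` W"] W by blast
  define h where "h n = bump (\<beta> n - apply_bcontfun f (p n)) (p n) \<epsilon>" for n
  define g where "g = f + (\<Sum>n\<in>W. h n)"
  have g: "apply_bcontfun g x = apply_bcontfun f x + (\<Sum>n\<in>W. apply_bcontfun (h n) x)" for x
    using W by (simp add: g_def plus_bcontfun.rep_eq apply_bcontfun_sum)
  have one: "(\<Sum>n\<in>W. apply_bcontfun (h n) x) = apply_bcontfun (h m) x" if m: "m \<in> W" "dist x (p m) < \<epsilon>" for x m
  proof -
    have "apply_bcontfun (h n) x = 0" if n: "n \<in> W - {m}" for n
    proof -
      have "2 * \<epsilon> \<le> dist (p m) (p n)" using n m p by (intro \<epsilon>(2)) (auto simp: inj_on_def)
      also have "\<dots> \<le> dist x (p m) + dist x (p n)" by (metis dist_commute dist_triangle)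
      finally have "\<epsilon> \<le> dist x (p n)" using m(2) by linarith
      then show ?thesis unfolding h_def by (rule bump_far[OF \<epsilon>(1)])
    qed
    then show ?thesis using W m(1) by (subst sum.remove[of W m]) auto
  qed
  show ?thesis
  proof (rule that)
    show "dist f g \<le> \<delta>"
    proof (rule dist_bound)
      fix x
      show "dist (apply_bcontfun f x) (apply_bcontfun g x) \<le> \<delta>"
      proof (cases "\<exists>m\<in>W. dist x (p m) < \<epsilon>")
        case True
        then obtain m where m: "m \<in> W" "dist x (p m) < \<epsilon>" by blast
        have "cmod (apply_bcontfun (h m) x) \<le> cmod (\<beta> m - apply_bcontfun f (p m))" unfolding h_def by (rule bump_norm[OF \<epsilon>(1)])
        also have "\<dots> \<le> \<delta>" by (rule \<beta>[OF m(1)])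
        finally show ?thesis using one[OF m] by (simp add: g dist_norm)
      next
        case False
        then have "apply_bcontfun (h n) x = 0" if "n \<in> W" for n
          unfolding h_def using that by (intro bump_far[OF \<epsilon>(1)]) (auto simp: not_less)
        then show ?thesis using \<delta> by (simp add: g)
      qed
    qed
    show "apply_bcontfun g (p n) = \<beta> n" if "n \<in> W" for n
      unfolding g using one[of n "p n"] that \<epsilon>(1) by (simp add: h_def bump_center)
  qed
qed

text \<open>The bad angles for the window \<open>M\<close> see only finitely many coefficients, and
  by aperiodicity these sit at distinct points of the orbit; so the perturbed sequence of
  \<open>ac_perturb\<close> needs to be matched only there.\<close>

lemma ac_dense:
  fixes T :: "'a::metric_space \<Rightarrow> 'a"
  assumes comp: "compact (UNIV :: 'a set)" and T: "bij T"
    and aper: "\<And>n. n \<noteq> 0 \<Longrightarrow> int_iterate T n \<omega> \<noteq> \<omega>" and f: "f \<in> sampling_functions" and \<rho>: "\<rho> > 0"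
  shows "\<exists>g\<in>sampling_functions. dist f g < \<rho> \<and> (\<exists>M. measure lborel (bad_angles (orbit_coeffs T g \<omega>) M (2 ^ k * (2 * real M + 1))) < 1 / 2 ^ k)"
proof -
  obtain r \<delta> where r: "r < 1" "\<delta> > 0" "\<And>x. cmod (apply_bcontfun f x) \<le> r" "\<And>g. dist f g < \<delta> \<Longrightarrow> g \<in> sampling_functions"
    using sampling_functions_open[OF comp f] by blast
  define \<delta>0 where "\<delta>0 = min \<rho> \<delta> / 2"
  have \<delta>0: "0 < \<delta>0" "\<delta>0 < \<rho>" "\<delta>0 < \<delta>" using \<rho> r(2) by (auto simp: \<delta>0_def)
  obtain \<alpha>' M where \<alpha>': "\<And>n. cmod (\<alpha>' n - orbit_coeffs T f \<omega> n) \<le> \<delta>0" "measure lborel (bad_angles \<alpha>' M (2 ^ k * (2 * real M + 1))) < 1 / 2 ^ k"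
    using ac_perturb[of "orbit_coeffs T f \<omega>" r \<delta>0 k] r(1,3) \<delta>0(1) by (auto simp: orbit_coeffs_def)
  define p where "p n = int_iterate T n \<omega>" for n
  have "inj p"
  proof (rule injI)
    fix m n assume e: "p m = p n"
    have "int_iterate T n (int_iterate T (m - n) \<omega>) = int_iterate T n \<omega>"
      using int_iterate_add[OF T, of n "m - n" \<omega>] e by (simp add: p_def)
    then have "int_iterate T (m - n) \<omega> = \<omega>" unfolding int_iterate_inj[OF T] .
    then show "m = n" using aper[of "m - n"] by auto
  qed
  then have inj: "inj_on p {-int M..int M}" by (rule inj_on_subset) simp
  obtain g where g: "dist f g \<le> \<delta>0" "\<And>n. n \<in> {-int M..int M} \<Longrightarrow> apply_bcontfun g (p n) = \<alpha>' n"
    using interpolate[of "{-int M..int M}" p \<alpha>' f \<delta>0] inj \<alpha>'(1) \<delta>0(1) by (auto simp: orbit_coeffs_def p_def)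
  have "bad_angles (orbit_coeffs T g \<omega>) M R = bad_angles \<alpha>' M R" for R
  proof -
    have "sol (orbit_coeffs T g \<omega>) s v n = sol \<alpha>' s v n" if "n \<in> {-int M..int M}" for s v n
    proof (rule sol_cong)
      fix k assume "\<bar>k\<bar> \<le> \<bar>n\<bar>"
      then have "k \<in> {-int M..int M}" using that by auto
      then show "orbit_coeffs T g \<omega> k = \<alpha>' k" using g(2)[of k] by (simp add: orbit_coeffs_def p_def)
    qed
    then show ?thesis by (simp add: bad_angles_def)
  qed
  then have "measure lborel (bad_angles (orbit_coeffs T g \<omega>) M (2 ^ k * (2 * real M + 1))) < 1 / 2 ^ k" using \<alpha>'(2) by simp
  moreover have "dist f g < \<rho>" "g \<in> sampling_functions" using g(1) \<delta>0 r(4)[of g] by auto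
  ultimately show ?thesis by blast
qed

text \<open>A nonzero solution with square sums bounded by \<open>B\<close> becomes localized after
  scaling by \<open>sqrt c\<close>, and keeps squared value \<open>c\<close> at the origin; some
  \<open>c = 1 / real (Suc k)\<close> is small enough. Thus the conditions for all \<open>k\<close>
  together exclude every square-summable solution.\<close>

lemma sol_unbounded:
  assumes localized_at: "\<And>k::nat. \<forall>s. \<not> localized_at (1 / real (Suc k)) a s" and s: "cmod s = 1" and v: "cmod v = 1"
  shows "\<exists>M::nat. B < (\<Sum>n=-int M..int M. (cmod (sol a s v n))\<^sup>2)"
proof (rule ccontr)
  assume "\<not> ?thesis"
  then have le: "(\<Sum>n=-int M..int M. (cmod (sol a s v n))\<^sup>2) \<le> B" for M :: nat by (auto simp: not_less)
  obtain k :: nat where k: "B < real k" using reals_Archimedean2 by blast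
  define c where "c = 1 / real (Suc k)"
  have c: "c > 0" by (simp add: c_def)
  have "(\<Sum>n=-int M..int M. (cmod (sol a s (complex_of_real (sqrt c) * v) n))\<^sup>2) \<le> 1" for M :: nat
  proof -
    have "(\<Sum>n=-int M..int M. (cmod (sol a s (complex_of_real (sqrt c) * v) n))\<^sup>2) = c * (\<Sum>n=-int M..int M. (cmod (sol a s v n))\<^sup>2)"
      unfolding sol_scale using c by (simp add: norm_mult power_mult_distrib sum_distrib_left)
    also have "\<dots> \<le> c * real (Suc k)" using le[of M] k c by (intro mult_left_mono) auto
    finally show ?thesis by (simp add: c_def)
  qed
  then have "localized a s (complex_of_real (sqrt c) * v)" using s by (simp add: localized_def)
  then have "localized_at c a s" unfolding localized_at_def using v c by (intro exI[of _ "complex_of_real (sqrt c) * v"]) (simp add: norm_mult)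
  then show False using localized_at[of k] by (simp add: c_def)
qed

text \<open>Baire's theorem for the countable family of open dense conditions, in an open subset of
  a complete metric space.\<close>

lemma generic_singular_continuousI:
  fixes T :: "'a::metric_space \<Rightarrow> 'a"
  assumes comp: "compact (UNIV :: 'a set)" and T: "bij T"
    and aper: "\<And>n. n \<noteq> 0 \<Longrightarrow> int_iterate T n \<omega> \<noteq> \<omega>"
    and dense: "\<And>k f \<rho>. f \<in> sampling_functions \<Longrightarrow> \<rho> > 0 \<Longrightarrow> \<exists>g\<in>sampling_functions. dist f g < \<rho> \<and> (\<forall>s. \<not> localized_at (1 / real (Suc k)) (orbit_coeffs T g \<omega>) s)"
  shows "generic_singular_continuous T \<omega>"
proof -
  have seq1: "cmod (orbit_coeffs T f \<omega> n) < 1" if "f \<in> sampling_functions" for f n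
    using that by (simp add: orbit_coeffs_def sampling_functions_def)
  define P where "P k = {f \<in> sampling_functions. \<exists>M. measure lborel (bad_angles (orbit_coeffs T f \<omega>) M (2 ^ k * (2 * real M + 1))) < 1 / 2 ^ k}" for k :: nat
  define Q where "Q k = {f \<in> sampling_functions. \<forall>s. \<not> localized_at (1 / real (Suc k)) (orbit_coeffs T f \<omega>) s}" for k :: nat
  define U where "U = range P \<union> range Q"
  have Po: "open (P k)" for k
    unfolding P_def
  proof (rule open_near_property[OF comp])
    fix f :: "'a \<Rightarrow>\<^sub>C complex"
    assume f: "f \<in> sampling_functions" and "\<exists>M. measure lborel (bad_angles (orbit_coeffs T f \<omega>) M (2 ^ k * (2 * real M + 1))) < 1 / 2 ^ k"
    then obtain M where "measure lborel (bad_angles (orbit_coeffs T f \<omega>) M (2 ^ k * (2 * real M + 1))) < 1 / 2 ^ k" by blast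
    from small_bad_angles_near[where a = "orbit_coeffs T f \<omega>", OF seq1[OF f] this]
    show "\<exists>i. \<forall>b. near i (orbit_coeffs T f \<omega>) b \<longrightarrow> (\<exists>M. measure lborel (bad_angles b M (2 ^ k * (2 * real M + 1))) < 1 / 2 ^ k)" by blast
  qed
  have Qo: "open (Q k)" for k
    unfolding Q_def
  proof (rule open_near_property[OF comp])
    fix f :: "'a \<Rightarrow>\<^sub>C complex"
    assume f: "f \<in> sampling_functions" and "\<forall>s. \<not> localized_at (1 / real (Suc k)) (orbit_coeffs T f \<omega>) s"
    then have "\<not> degeneracy_ge (1 / real (Suc k)) (orbit_coeffs T f \<omega>) 1" by (subst Deg_1_iff) auto
    from not_Deg_near[where a = "orbit_coeffs T f \<omega>", OF _ seq1[OF f] this]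
    obtain i where i: "\<And>b. near i (orbit_coeffs T f \<omega>) b \<Longrightarrow> \<not> degeneracy_ge (1 / real (Suc k)) b 1" by auto
    then show "\<exists>i. \<forall>b. near i (orbit_coeffs T f \<omega>) b \<longrightarrow> (\<forall>s. \<not> localized_at (1 / real (Suc k)) b s)"
      by (intro exI[of _ i]) (metis Deg_1_iff of_nat_0_less_iff zero_less_Suc zero_less_divide_1_iff)
  qed
  have sub: "S \<subseteq> sampling_functions" and opS: "open S" and dn: "\<And>f \<rho>. f \<in> sampling_functions \<Longrightarrow> \<rho> > 0 \<Longrightarrow> \<exists>g\<in>S. dist f g < \<rho>" if "S \<in> U" for S
  proof -
    consider k where "S = P k" | k where "S = Q k" using \<open>S \<in> U\<close> by (auto simp: U_def)
    then have "S \<subseteq> sampling_functions \<and> open S \<and> (\<forall>f\<in>sampling_functions. \<forall>\<rho>>0. \<exists>g\<in>S. dist f g < \<rho>)"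
    proof cases
      case 1
      then show ?thesis using Po ac_dense[OF comp T aper] by (auto simp: P_def) blast
    next
      case 2
      then show ?thesis using Qo dense by (auto simp: Q_def) blast
    qed
    then show "S \<subseteq> sampling_functions" "open S" "\<And>f \<rho>. f \<in> sampling_functions \<Longrightarrow> \<rho> > 0 \<Longrightarrow> \<exists>g\<in>S. dist f g < \<rho>" by blast+
  qed
  have so: "open (sampling_functions :: ('a \<Rightarrow>\<^sub>C complex) set)"
    unfolding open_dist
  proof (intro ballI)
    fix f :: "'a \<Rightarrow>\<^sub>C complex" assume "f \<in> sampling_functions"
    then obtain r \<delta> where "\<delta> > 0" "\<And>g. dist f g < \<delta> \<Longrightarrow> g \<in> sampling_functions"
      using sampling_functions_open[OF comp] by metis
    then show "\<exists>e>0. \<forall>g. dist g f < e \<longrightarrow> g \<in> sampling_functions" by (metis dist_commute)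
  qed
  define F where "F = \<Inter>U"
  have opin: "openin sampling_topology S" if "S \<in> U" for S
    unfolding sampling_topology_def using sub[OF that] opS[OF that] by (simp add: open_subset)
  have cU: "countable U" "U \<noteq> {}" by (auto simp: U_def)
  have G: "gdelta_in sampling_topology F"
    unfolding F_def by (intro gdelta_in_Inter cU open_imp_gdelta_in opin)
  have D: "sampling_topology closure_of F = topspace sampling_topology"
    unfolding F_def
  proof (rule Baire_category[OF disjI1])
    show "completely_metrizable_space (sampling_topology :: ('a \<Rightarrow>\<^sub>C complex) topology)"
      unfolding sampling_topology_def
      by (rule completely_metrizable_space_openin[OF completely_metrizable_space_euclidean])
         (use so in \<open>simp add: open_openin[symmetric]\<close>)
    show "openin sampling_topology S \<and> sampling_topology closure_of S = topspace sampling_topology" if "S \<in> U" for S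
    proof (intro conjI opin[OF that])
      have "sampling_functions \<subseteq> closure S"
        using dn[OF that] by (auto simp: closure_approachable dist_commute)
      then show "sampling_topology closure_of S = topspace sampling_topology"
        unfolding sampling_topology_def using sub[OF that] by (auto simp: closure_of_subtopology Int_absorb1)
    qed
  qed (rule cU)
  have "purely_singular_continuous_spectrum (cmv (\<lambda>n. apply_bcontfun f (int_iterate T n \<omega>)))" if f: "f \<in> F" for f
  proof -
    define a where "a = orbit_coeffs T f \<omega>"
    have PQ: "f \<in> P k" "f \<in> Q k" for k using f by (auto simp: F_def U_def)
    then have "f \<in> sampling_functions" by (simp add: P_def)
    then obtain r where r: "r < 1" "\<And>x. cmod (apply_bcontfun f x) \<le> r" using sampling_functions_open[OF comp] by metis
    have r0: "0 \<le> r" using r(2) norm_ge_zero order_trans by blast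
    have ar: "cmod (a n) \<le> r" for n using r(2) by (simp add: a_def orbit_coeffs_def)
    have H: "\<exists>M::nat. B < (\<Sum>n=-int M..int M. (cmod (sol a s v n))\<^sup>2)" if "cmod s = 1" "cmod v = 1" for s B v
      by (rule sol_unbounded[OF _ that]) (use PQ(2) in \<open>simp add: Q_def a_def\<close>)
    have bad: "\<exists>M. measure lborel (bad_angles a M (2 ^ k * (2 * real M + 1))) < 1 / 2 ^ k" for k :: nat
      using PQ(1)[of k] by (simp add: P_def a_def)
    have "(\<lambda>n. apply_bcontfun f (int_iterate T n \<omega>)) = a" by (simp add: a_def orbit_coeffs_def fun_eq_iff)
    moreover have "purely_singular_continuous_spectrum (cmv a)"
      unfolding purely_singular_continuous_spectrum_def singular_continuous_def
    proof (intro ballI allI impI conjI)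
      fix u \<mu> assume u: "u \<in> l2_int" "is_spectral_measure (cmv a) u \<mu>"
      show "emeasure \<mu> {z} = 0" if "z \<in> sphere 0 1" for z
        using that by (intro no_atoms[OF r0 r(1) ar u _ H]) auto
      show "\<exists>N\<in>null_sets arc_length. emeasure \<mu> (space \<mu> - N) = 0"
        by (rule singular_support[OF r0 r(1) ar u bad])
    qed
    ultimately show ?thesis by simp
  qed
  then show ?thesis unfolding generic_singular_continuous_def using G D by blast
qed

section \<open>The torus\<close>

lift_definition circle_exp :: "circle \<Rightarrow> complex" is "\<lambda>x. cis (2 * pi * x)"
proof -
  fix x y :: real assume "x - y \<in> \<int>"
  then have "cis (2 * pi * (x - y)) = 1" by (rule cis_multiple_2pi)
  moreover have "cis (2 * pi * x) = cis (2 * pi * (x - y)) * cis (2 * pi * y)" by (simp add: cis_mult algebra_simps)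
  ultimately show "cis (2 * pi * x) = cis (2 * pi * y)" by simp
qed

lemma circle_exp_to_circle [simp]: "circle_exp (to_circle x) = cis (2 * pi * x)"
  by (simp add: circle_exp.abs_eq)

lemma norm_circle_exp [simp]: "cmod (circle_exp x) = 1"
  by transfer simp

lemma circle_exp_add: "circle_exp (x + y) = circle_exp x * circle_exp y"
  by transfer (simp add: cis_mult algebra_simps)

lemma to_circle_add: "to_circle x + to_circle y = to_circle (x + y)"
  by (simp add: plus_circle.abs_eq)

lemma to_circle_eq_iff: "to_circle x = to_circle y \<longleftrightarrow> x - y \<in> \<int>"
  by (rule circle.abs_eq_iff)

lemma to_circle_near:
  obtains t where "y = to_circle t" "\<bar>t - x\<bar> \<le> 1/2"
proof -
  have "\<exists>t0. y = to_circle t0" by (induction y rule: circle.abs_induct) blast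
  then obtain t0 where t0: "y = to_circle t0" ..
  define t where "t = t0 - of_int (round (t0 - x))"
  have "to_circle t = to_circle t0" unfolding to_circle_eq_iff by (simp add: t_def)
  moreover have "\<bar>t - x\<bar> \<le> 1/2"
  proof -
    have "\<bar>of_int (round (t0 - x)) - (t0 - x)\<bar> \<le> 1/2" by (rule of_int_round_abs_le)
    then show ?thesis unfolding t_def by linarith
  qed
  ultimately show ?thesis using t0 that by metis
qed

lemma to_circle_surj: "\<exists>t. y = to_circle t"
  by (metis to_circle_near)

lemma norm_cis_diff: "(cmod (cis s - cis t))\<^sup>2 = 2 - 2 * cos (s - t)"
proof -
  have "(cmod (cis s - cis t))\<^sup>2 = ((cos s)\<^sup>2 + (sin s)\<^sup>2) + ((cos t)\<^sup>2 + (sin t)\<^sup>2) - 2 * (cos s * cos t + sin s * sin t)"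
    by (simp only: cmod_power2) (simp add: power2_eq_square algebra_simps)
  then show ?thesis by (simp add: cos_diff)
qed

lemma circle_exp_close:
  assumes d: "0 < \<delta>" "\<delta> \<le> 1/2" and e: "(cmod (circle_exp y - cis (2 * pi * x)))\<^sup>2 < 2 - 2 * cos (2 * pi * \<delta>)"
  obtains t where "y = to_circle t" "\<bar>t - x\<bar> < \<delta>"
proof -
  obtain t where t: "y = to_circle t" "\<bar>t - x\<bar> \<le> 1/2" by (rule to_circle_near)
  have "\<bar>t - x\<bar> < \<delta>"
  proof (rule ccontr)
    assume "\<not> \<bar>t - x\<bar> < \<delta>"
    then have "cos (2 * pi * \<bar>t - x\<bar>) \<le> cos (2 * pi * \<delta>)"
      using t(2) d by (intro cos_monotone_0_pi_le) auto
    moreover have "2 * pi * \<bar>t - x\<bar> = \<bar>2 * pi * t - 2 * pi * x\<bar>" by (simp add: abs_mult right_diff_distrib[symmetric])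
    then have "cos (2 * pi * \<bar>t - x\<bar>) = cos (2 * pi * t - 2 * pi * x)" by (simp only: cos_abs_real)
    ultimately show False using e unfolding t(1) circle_exp_to_circle norm_cis_diff by linarith
  qed
  with t(1) that show ?thesis by blast
qed

lemma circle_exp_inj: "circle_exp x = circle_exp y \<Longrightarrow> x = y"
proof -
  assume e: "circle_exp x = circle_exp y"
  obtain t where t: "x = to_circle t" using to_circle_surj by blast
  obtain u where u: "y = to_circle u" "\<bar>u - t\<bar> \<le> 1/2" by (rule to_circle_near)
  have "0 = 2 - 2 * cos (2 * pi * t - 2 * pi * u)"
    using norm_cis_diff[of "2 * pi * t" "2 * pi * u"] e t u by simp
  moreover have "2 * pi * \<bar>t - u\<bar> = \<bar>2 * pi * t - 2 * pi * u\<bar>" by (simp add: abs_mult right_diff_distrib[symmetric])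
  then have "cos (2 * pi * \<bar>t - u\<bar>) = cos (2 * pi * t - 2 * pi * u)" by (simp only: cos_abs_real)
  ultimately have c: "cos (2 * pi * \<bar>t - u\<bar>) = cos 0" by simp
  have "2 * pi * \<bar>t - u\<bar> \<le> pi" using u(2) by (simp add: abs_minus_commute)
  then have "2 * pi * \<bar>t - u\<bar> = 0" using cos_inj_pi[of "2 * pi * \<bar>t - u\<bar>" 0] c by simp
  then show ?thesis using t u by simp
qed

text \<open>The topology of the circle is already fixed as the quotient topology, so a metric
  inducing exactly this topology is needed: the chordal distance of the images on the unit
  circle.\<close>

instantiation circle :: metric_space
begin

definition dist_circle :: "circle \<Rightarrow> circle \<Rightarrow> real"
  where "dist_circle x y = cmod (circle_exp x - circle_exp y)"

definition uniformity_circle :: "(circle \<times> circle) filter"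
  where "uniformity_circle = (INF e\<in>{0<..}. principal {(x, y). dist x y < e})"

instance
proof
  show "uniformity = (INF e\<in>{0<..}. principal {(x, y :: circle). dist x y < e})" by (rule uniformity_circle_def)
  have open_iff: "open U \<longleftrightarrow> (\<forall>x\<in>U. \<exists>e>0. \<forall>y. dist x y < e \<longrightarrow> y \<in> U)" for U :: "circle set"
  proof
    assume "open U"
    then have o: "open (to_circle -` U)" by (simp add: open_circle_def)
    show "\<forall>x\<in>U. \<exists>e>0. \<forall>y. dist x y < e \<longrightarrow> y \<in> U"
    proof
      fix x assume "x \<in> U"
      obtain t where t: "x = to_circle t" using to_circle_surj by blast
      with \<open>x \<in> U\<close> o obtain d where d: "d > 0" "\<And>u. dist u t < d \<Longrightarrow> to_circle u \<in> U"
        unfolding open_dist by (auto simp: vimage_def)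
      define \<delta> where "\<delta> = min d (1/2)"
      have \<delta>: "0 < \<delta>" "\<delta> \<le> 1/2" using d(1) by (auto simp: \<delta>_def)
      have "cos (2 * pi * \<delta>) < cos 0" by (rule cos_monotone_0_pi) (use \<delta> in auto)
      then have p: "0 < 2 - 2 * cos (2 * pi * \<delta>)" by simp
      show "\<exists>e>0. \<forall>y. dist x y < e \<longrightarrow> y \<in> U"
      \<comment> \<open>The length of the chord over the angle
        \<open>2 * pi * \<delta>\<close>.\<close>
      proof (intro exI[of _ "sqrt (2 - 2 * cos (2 * pi * \<delta>))"] conjI allI impI)
        fix y assume "dist x y < sqrt (2 - 2 * cos (2 * pi * \<delta>))"
        then have "(cmod (circle_exp y - cis (2 * pi * t)))\<^sup>2 < (sqrt (2 - 2 * cos (2 * pi * \<delta>)))\<^sup>2"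
          by (intro power_strict_mono) (auto simp: dist_circle_def t norm_minus_commute)
        then have "(cmod (circle_exp y - cis (2 * pi * t)))\<^sup>2 < 2 - 2 * cos (2 * pi * \<delta>)" using p by simp
        from circle_exp_close[OF \<delta> this] obtain u where "y = to_circle u" "\<bar>u - t\<bar> < \<delta>" by blast
        then show "y \<in> U" using d(2)[of u] by (simp add: dist_real_def \<delta>_def)
      qed (use p in simp)
    qed
  next
    assume U: "\<forall>x\<in>U. \<exists>e>0. \<forall>y. dist x y < e \<longrightarrow> y \<in> U"
    show "open U"
      unfolding open_circle_def open_dist
    proof
      fix t assume "t \<in> to_circle -` U"
      then obtain e where e: "e > 0" "\<And>y. dist (to_circle t) y < e \<Longrightarrow> y \<in> U" using U by auto
      have "isCont (\<lambda>u. cis (2 * pi * u)) t" unfolding cis_conv_exp by (intro continuous_intros)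
      then obtain d where d: "d > 0" "\<And>u. dist u t < d \<Longrightarrow> dist (cis (2 * pi * u)) (cis (2 * pi * t)) < e"
        using e(1) unfolding continuous_at_eps_delta by blast
      show "\<exists>e>0. \<forall>y. dist y t < e \<longrightarrow> y \<in> to_circle -` U"
      proof (intro exI[of _ d] conjI allI impI d(1))
        fix u assume "dist u t < d"
        then have "to_circle u \<in> U" using d(2)[of u] by (intro e(2)) (simp add: dist_circle_def dist_norm norm_minus_commute)
        then show "u \<in> to_circle -` U" by simp
      qed
    qed
  qed
  fix U :: "circle set"
  have ev: "(\<forall>\<^sub>F (x', y) in uniformity. x' = x \<longrightarrow> y \<in> U) \<longleftrightarrow> (\<exists>e>0. \<forall>y. dist x y < e \<longrightarrow> y \<in> U)" for x
  proof -
    have "(\<forall>\<^sub>F (x', y) in uniformity. x' = x \<longrightarrow> y \<in> U) \<longleftrightarrow> (\<exists>e\<in>{0<..}. eventually (\<lambda>(x', y). x' = x \<longrightarrow> y \<in> U) (principal {(x, y). dist x y < e}))"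
      unfolding uniformity_circle_def
    proof (rule eventually_INF_base)
      fix a b :: real assume "a \<in> {0<..}" "b \<in> {0<..}"
      then show "\<exists>e\<in>{0<..}. principal {(x :: circle, y). dist x y < e} \<le> inf (principal {(x, y). dist x y < a}) (principal {(x, y). dist x y < b})"
        by (intro bexI[of _ "min a b"]) (auto simp: inf_principal)
    qed (simp add: gt_ex)
    then show ?thesis by (auto simp: eventually_principal)
  qed
  show "open U = (\<forall>x\<in>U. \<forall>\<^sub>F (x', y) in uniformity. x' = x \<longrightarrow> y \<in> U)"
    unfolding open_iff ev ..
next
  fix x y z :: circle
  show "dist x y = 0 \<longleftrightarrow> x = y" by (auto simp: dist_circle_def dest: circle_exp_inj)
  have "circle_exp x - circle_exp y = (circle_exp x - circle_exp z) - (circle_exp y - circle_exp z)" by simp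
  then show "dist x y \<le> dist x z + dist y z" unfolding dist_circle_def by (metis norm_triangle_ineq4)
qed

end

lemma continuous_on_circle_iff:
  "continuous_on S (f :: _ \<Rightarrow> circle) \<longleftrightarrow> continuous_on S (\<lambda>x. circle_exp (f x))"
  unfolding continuous_on_def tendsto_iff by (simp add: dist_circle_def dist_norm)

lemma continuous_on_circle_exp [continuous_intros]: "continuous_on S f \<Longrightarrow> continuous_on S (\<lambda>x. circle_exp (f x))"
  by (simp add: continuous_on_circle_iff)

lemma continuous_on_circle_add [continuous_intros]:
  "continuous_on S f \<Longrightarrow> continuous_on S g \<Longrightarrow> continuous_on S (\<lambda>x. f x + g x :: circle)"
  unfolding continuous_on_circle_iff circle_exp_add by (rule continuous_on_mult)

lemma continuous_on_circle_uminus [continuous_intros]: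
  assumes "continuous_on S f"
  shows "continuous_on S (\<lambda>x. - f x :: circle)"
proof -
  have "circle_exp (- x) = cnj (circle_exp x)" for x by transfer (simp add: cis_cnj)
  then show ?thesis using assms unfolding continuous_on_circle_iff by (simp add: continuous_on_cnj)
qed

lemma continuous_on_circle_diff [continuous_intros]:
  assumes "continuous_on S f" "continuous_on S g"
  shows "continuous_on S (\<lambda>x. f x - g x :: circle)"
  using continuous_on_circle_add[OF assms(1) continuous_on_circle_uminus[OF assms(2)]] by simp

lemma to_torus_nth [simp]: "to_torus x $ i = to_circle (x $ i)"
  by (simp add: to_torus_def)

lemma continuous_on_to_torus: "continuous_on UNIV (to_torus :: real ^ ('d::finite) \<Rightarrow> _)"
  unfolding to_torus_def
  by (intro continuous_on_vec_lambda continuous_on_compose2[OF continuous_on_to_circle] continuous_on_component continuous_on_id) auto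

lemma compact_torus: "compact (UNIV :: (circle ^ ('d::finite)) set)"
proof -
  have "to_torus ` cbox 0 (\<chi> i. 1) = (UNIV :: (circle ^ 'd) set)"
  proof (intro equalityI subsetI)
    fix y :: "circle ^ 'd"
    have "\<exists>t. y $ i = to_circle t \<and> 0 \<le> t \<and> t \<le> 1" for i
    proof -
      obtain t where t: "y $ i = to_circle t" "\<bar>t - 1/2\<bar> \<le> 1/2" by (rule to_circle_near)
      then have "0 \<le> t" "t \<le> 1" by linarith+
      then show ?thesis using t(1) by blast
    qed
    then obtain t where "\<And>i. y $ i = to_circle (t i) \<and> 0 \<le> t i \<and> t i \<le> 1" by metis
    then show "y \<in> to_torus ` cbox 0 (\<chi> i. 1)"
      by (intro image_eqI[of _ _ "\<chi> i. t i"]) (auto simp: vec_eq_iff mem_box_cart)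
  qed simp
  moreover have "compact (to_torus ` cbox 0 (\<chi> i. 1) :: (circle ^ 'd) set)"
    by (intro compact_continuous_image continuous_on_subset[OF continuous_on_to_torus]) auto
  ultimately show ?thesis by simp
qed

section \<open>Haar measure and fundamental domains of the lattice\<close>

definition integer_lattice :: "(real ^ 'd) set"
  where "integer_lattice = {z. \<forall>i. z $ i \<in> \<int>}"

lemma countable_lattice: "countable (integer_lattice :: (real ^ ('d::finite)) set)"
proof -
  have "integer_lattice \<subseteq> range (\<lambda>f :: 'd \<Rightarrow> int. \<chi> i. of_int (f i))"
  proof
    fix z :: "real ^ 'd" assume "z \<in> integer_lattice"
    then have "\<forall>i. \<exists>n::int. z $ i = of_int n" by (auto simp: integer_lattice_def elim: Ints_cases)
    then obtain f where "\<And>i. z $ i = of_int (f i)" by metis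
    then show "z \<in> range (\<lambda>f :: 'd \<Rightarrow> int. \<chi> i. of_int (f i))" by (intro image_eqI[of _ _ f]) (auto simp: vec_eq_iff)
  qed
  moreover have "countable (UNIV :: ('d \<Rightarrow> int) set)" by simp
  ultimately show ?thesis by (meson countable_image countable_subset)
qed

text \<open>The part of \<open>P\<close> in \<open>D\<close> is cut into countably many pieces
  according to the lattice vector that moves a point into \<open>E\<close>; translating the pieces
  back reassembles the part of \<open>P\<close> in \<open>E\<close>.\<close>

lemma fundamental_domains:
  fixes P D E :: "(real ^ ('d::finite)) set"
  assumes P: "P \<in> sets borel" "\<And>x z. z \<in> integer_lattice \<Longrightarrow> x + z \<in> P \<longleftrightarrow> x \<in> P"
    and D: "D \<in> sets borel" "\<And>x. \<exists>!z. z \<in> integer_lattice \<and> x - z \<in> D"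
    and E: "E \<in> sets borel" "\<And>x. \<exists>!z. z \<in> integer_lattice \<and> x - z \<in> E"
  shows "emeasure lborel (P \<inter> D) = emeasure lborel (P \<inter> E)"
proof -
  define A where "A z = P \<inter> D \<inter> {x. x - z \<in> E}" for z
  define B where "B z = P \<inter> {x. x + z \<in> D} \<inter> E" for z
  have sh: "{x. x - z \<in> E} \<in> sets borel" "{x. x + z \<in> D} \<in> sets borel" for z
    using E(1) D(1) by measurable
  have A: "A z \<in> sets lborel" and B: "B z \<in> sets lborel" for z
    unfolding A_def B_def using P(1) D(1) E(1) sh by auto
  have AB: "emeasure lborel (A z) = emeasure lborel (B z)" if "z \<in> integer_lattice" for z
  proof -
    have "emeasure lborel (A z) = emeasure (distr lborel borel ((+) z)) (A z)" by (simp add: lborel_distr_plus)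
    also have "\<dots> = emeasure lborel ((+) z -` A z \<inter> space lborel)" using A by (intro emeasure_distr) auto
    also have "(+) z -` A z \<inter> space lborel = B z"
    proof -
      have "z + x \<in> P \<longleftrightarrow> x \<in> P" for x using P(2)[OF that, of x] by (simp only: add.commute)
      moreover have "z + x \<in> D \<longleftrightarrow> x + z \<in> D" for x by (simp only: add.commute)
      ultimately show ?thesis by (auto simp: A_def B_def)
    qed
    finally show ?thesis .
  qed
  have disj: "disjoint_family_on A integer_lattice" "disjoint_family_on B integer_lattice"
  proof -
    show "disjoint_family_on A integer_lattice" unfolding disjoint_family_on_def A_def using E(2) by blast
    show "disjoint_family_on B integer_lattice" unfolding disjoint_family_on_def
    proof (intro ballI impI equals0I)
      fix y z x assume yz: "y \<in> integer_lattice" "z \<in> integer_lattice" "y \<noteq> z" "x \<in> B y \<inter> B z"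
      have "- y \<in> integer_lattice" "- z \<in> integer_lattice" using yz by (auto simp: integer_lattice_def)
      moreover have "x - (- y) \<in> D" "x - (- z) \<in> D" using yz(4) by (auto simp: B_def)
      ultimately have "- y = - z" using D(2)[of x] by blast
      then show False using yz(3) by simp
    qed
  qed
  have UA: "P \<inter> D = (\<Union>z\<in>integer_lattice. A z)" unfolding A_def using E(2) by blast
  have UB: "P \<inter> E = (\<Union>z\<in>integer_lattice. B z)"
  proof (intro equalityI subsetI)
    fix x assume x: "x \<in> P \<inter> E"
    obtain z where z: "z \<in> integer_lattice" "x - z \<in> D" using D(2)[of x] by blast
    then have "- z \<in> integer_lattice" "x \<in> B (- z)" using x by (auto simp: B_def integer_lattice_def)
    then show "x \<in> (\<Union>z\<in>integer_lattice. B z)" by blast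
  qed (auto simp: B_def)
  have "emeasure lborel (P \<inter> D) = (\<integral>\<^sup>+z. emeasure lborel (A z) \<partial>count_space integer_lattice)"
    unfolding UA by (rule emeasure_UN_countable) (use A disj countable_lattice in auto)
  also have "\<dots> = (\<integral>\<^sup>+z. emeasure lborel (B z) \<partial>count_space integer_lattice)"
    by (rule nn_integral_cong) (simp add: AB)
  also have "\<dots> = emeasure lborel (P \<inter> E)"
    unfolding UB by (rule emeasure_UN_countable[symmetric]) (use B disj countable_lattice in auto)
  finally show ?thesis .
qed

definition unit_cube :: "(real ^ 'd) set"
  where "unit_cube = {x. \<forall>i. 0 \<le> x $ i \<and> x $ i < 1}"

lemma unit_cube_borel: "(unit_cube :: (real ^ ('d::finite)) set) \<in> sets borel"
proof -
  have e: "(unit_cube :: (real ^ 'd) set) = (\<Inter>i. {x. 0 \<le> x $ i} \<inter> {x. x $ i < 1})" by (auto simp: unit_cube_def)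
  have "{x :: real ^ 'd. 0 \<le> x $ i} \<inter> {x. x $ i < 1} \<in> sets borel" for i :: 'd
    by (intro sets.Int borel_closed[OF closed_Collect_le] borel_open[OF open_Collect_less] continuous_intros)
  then show ?thesis unfolding e by (intro sets.finite_INT) auto
qed

lemma unit_cube_floor:
  "\<exists>!z. z \<in> integer_lattice \<and> (x :: real ^ ('d::finite)) - z \<in> unit_cube"
proof (rule ex1I)
  show "(\<chi> i. of_int \<lfloor>x $ i\<rfloor>) \<in> integer_lattice \<and> x - (\<chi> i. of_int \<lfloor>x $ i\<rfloor>) \<in> unit_cube"
    by (auto simp: integer_lattice_def unit_cube_def) linarith+
  fix z assume z: "z \<in> integer_lattice \<and> x - z \<in> unit_cube"
  have "z $ i = of_int \<lfloor>x $ i\<rfloor>" for i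
  proof -
    obtain n :: int where n: "z $ i = of_int n" using z by (auto simp: integer_lattice_def elim: Ints_cases)
    have "0 \<le> (x - z) $ i" "(x - z) $ i < 1" using z unfolding unit_cube_def by blast+
    then have "of_int n \<le> x $ i" "x $ i < of_int n + 1" using n by simp_all
    then have "\<lfloor>x $ i\<rfloor> = n" by (rule floor_unique)
    then show ?thesis using n by simp
  qed
  then show "z = (\<chi> i. of_int \<lfloor>x $ i\<rfloor>)" by (simp add: vec_eq_iff)
qed

lemma bounded_unit_cube: "bounded (unit_cube :: (real ^ ('d::finite)) set)"
  by (rule bounded_subset[OF bounded_cbox[of 0 "\<chi> i. 1"]]) (auto simp: unit_cube_def mem_box_cart less_imp_le)

lemma sets_torus_measure: "sets torus_measure = sets borel"
  by (simp add: torus_measure_def)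

lemma emeasure_torus:
  fixes A :: "(circle ^ ('d::finite)) set"
  assumes "A \<in> sets borel"
  shows "emeasure torus_measure A = emeasure lborel (to_torus -` A \<inter> unit_cube)"
proof -
  have q: "{x :: real ^ 'd. \<forall>i. 0 \<le> x $ i \<and> x $ i < 1} = unit_cube" by (simp add: unit_cube_def)
  have m: "to_torus \<in> restrict_space lborel (unit_cube :: (real ^ 'd) set) \<rightarrow>\<^sub>M borel"
    by (rule measurable_restrict_space1) (simp add: borel_measurable_to_torus)
  show ?thesis
    unfolding torus_measure_def q emeasure_distr[OF m assms]
    using unit_cube_borel by (subst emeasure_restrict_space) (auto simp: space_restrict_space)
qed

lemma finite_torus_measure: "finite_measure (torus_measure :: (circle ^ ('d::finite)) measure)"
proof (rule finite_measureI)
  have "space (torus_measure :: (circle ^ 'd) measure) = UNIV" by (simp add: torus_measure_def)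
  then show "emeasure (torus_measure :: (circle ^ 'd) measure) (space torus_measure) \<noteq> \<infinity>"
    using emeasure_torus[of "UNIV :: (circle ^ 'd) set"] emeasure_bounded_finite[OF bounded_unit_cube[where 'd = 'd]] by simp
qed

lemma emeasure_lborel_image:
  fixes L :: "real ^ ('d::finite) \<Rightarrow> real ^ 'd"
  assumes L: "linear L" "\<And>S. S \<in> lmeasurable \<Longrightarrow> measure lebesgue (L ` S) = measure lebesgue S" and S: "S \<in> sets borel" "bounded S"
    and im: "(\<lambda>x. L x + c) ` S \<in> sets borel"
  shows "emeasure lborel ((\<lambda>x. L x + c) ` S) = emeasure lborel S"
proof -
  have em: "emeasure lborel X = ennreal (measure lebesgue X)" if "X \<in> sets borel" "bounded X" for X :: "(real ^ 'd) set"
    using that emeasure_bounded_finite[OF that(2)] by (simp add: emeasure_eq_ennreal_measure less_top[symmetric])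
  have Sl: "S \<in> lmeasurable" by (rule bounded_set_imp_lmeasurable) (use S in auto)
  have i: "(\<lambda>x. L x + c) ` S = (+) c ` (L ` S)" by (auto simp: image_image add.commute)
  have "measure lebesgue ((+) c ` (L ` S)) = measure lebesgue (L ` S)" by (rule measure_translation)
  also have "\<dots> = measure lebesgue S" by (rule L(2)[OF Sl])
  finally have "measure lebesgue ((\<lambda>x. L x + c) ` S) = measure lebesgue S" unfolding i .
  moreover have "bounded ((\<lambda>x. L x + c) ` S)"
    unfolding i using bounded_linear_image[OF S(2)] L(1) by (intro bounded_translation) (simp add: linear_conv_bounded_linear)
  ultimately show ?thesis using em[OF S] em[OF im] by simp
qed

text \<open>The lift \<open>G\<close> of \<open>T\<close> preserves volume and carries the unit cube
  to a set which is again a fundamental domain, because \<open>L\<close> maps the lattice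
  bijectively to itself; a periodic set has the same volume in both domains.\<close>

lemma torus_measure_invariant:
  fixes T :: "circle ^ ('d::finite) \<Rightarrow> circle ^ 'd" and L L' :: "real ^ 'd \<Rightarrow> real ^ 'd"
  assumes L: "linear L" "\<And>S. S \<in> lmeasurable \<Longrightarrow> measure lebesgue (L ` S) = measure lebesgue S" and T: "\<And>x. T (to_torus x) = to_torus (L x + c)"
    and cT: "continuous_on UNIV T" and L': "\<And>x. L' (L x) = x" "\<And>x. L (L' x) = x" "linear L'"
    and lat: "\<And>z. z \<in> integer_lattice \<Longrightarrow> L z \<in> integer_lattice" "\<And>z. z \<in> integer_lattice \<Longrightarrow> L' z \<in> integer_lattice" and A: "A \<in> sets borel"
  shows "emeasure torus_measure (T -` A) = emeasure torus_measure A"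
proof -
  define P where "P = to_torus -` A"
  have P: "P \<in> sets borel" unfolding P_def by (rule measurable_sets_borel[OF borel_measurable_to_torus A])
  have per: "x + z \<in> P \<longleftrightarrow> x \<in> P" if "z \<in> integer_lattice" for x z
  proof -
    have "to_torus (x + z) = to_torus x" using that by (auto simp: vec_eq_iff integer_lattice_def to_circle_eq_iff)
    then show ?thesis by (simp add: P_def)
  qed
  define G where "G x = L x + c" for x
  define H where "H y = L' (y - c)" for y
  have HG: "H (G x) = x" "G (H x) = x" for x by (simp_all add: G_def H_def L')
  have cG: "continuous_on UNIV G" "continuous_on UNIV H"
  proof -
    have c: "continuous_on UNIV L" "continuous_on UNIV L'"
      using L(1) L'(3) by (auto intro!: linear_continuous_on simp: linear_conv_bounded_linear)
    show "continuous_on UNIV G" unfolding G_def by (intro continuous_intros c)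
    show "continuous_on UNIV H" unfolding H_def by (rule continuous_on_compose2[OF c(2)]) (auto intro!: continuous_intros)
  qed
  have img: "G ` X = H -` X" for X
  proof (intro equalityI subsetI)
    fix y assume "y \<in> H -` X"
    then show "y \<in> G ` X" using HG(2)[of y] by (intro image_eqI[of _ _ "H y"]) auto
  qed (auto simp: HG)
  have imgb: "G ` X \<in> sets borel" if "X \<in> sets borel" for X
    unfolding img using borel_measurable_continuous_onI[OF cG(2)] that by (simp add: measurable_sets_borel)
  have preb: "G -` X \<in> sets borel" if "X \<in> sets borel" for X
    using borel_measurable_continuous_onI[OF cG(1)] that by (simp add: measurable_sets_borel)
  have TA: "T -` A \<in> sets borel"
    using borel_measurable_continuous_onI[OF cT] A by (simp add: measurable_sets_borel)
  have "emeasure torus_measure (T -` A) = emeasure lborel (G -` P \<inter> unit_cube)"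
    unfolding emeasure_torus[OF TA] by (rule arg_cong[where f = "emeasure lborel"]) (auto simp: P_def G_def T)
  also have "\<dots> = emeasure lborel (G ` (G -` P \<inter> unit_cube))"
  proof -
    have Ge: "G = (\<lambda>x. L x + c)" by (simp add: G_def fun_eq_iff)
    have S: "G -` P \<inter> unit_cube \<in> sets borel" by (intro sets.Int preb P unit_cube_borel)
    have "bounded (G -` P \<inter> unit_cube)" by (rule bounded_subset[OF bounded_unit_cube]) auto
    from emeasure_lborel_image[OF L S this, of c] imgb[OF S] show ?thesis unfolding Ge by simp
  qed
  also have "G ` (G -` P \<inter> unit_cube) = P \<inter> G ` unit_cube" by auto
  also have "emeasure lborel (P \<inter> G ` unit_cube) = emeasure lborel (P \<inter> unit_cube)"
  proof (rule fundamental_domains[OF P per imgb[OF unit_cube_borel] _ unit_cube_borel unit_cube_floor])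
    fix x
    have m: "x - z \<in> G ` unit_cube \<longleftrightarrow> H x - L' z \<in> unit_cube" for z
    proof -
      have "L' (x - z - c) = L' (x - c) - L' z" unfolding linear_diff[OF L'(3)] by simp
      then show ?thesis unfolding img by (simp add: H_def)
    qed
    obtain w where w: "w \<in> integer_lattice" "H x - w \<in> unit_cube" "\<And>w'. w' \<in> integer_lattice \<Longrightarrow> H x - w' \<in> unit_cube \<Longrightarrow> w' = w"
      using unit_cube_floor[of "H x"] by blast
    show "\<exists>!z. z \<in> integer_lattice \<and> x - z \<in> G ` unit_cube"
    proof (rule ex1I[of _ "L w"])
      show "L w \<in> integer_lattice \<and> x - L w \<in> G ` unit_cube" using w(1,2) lat(1)[OF w(1)] m[of "L w"] L'(1)[of w] by simp
      fix z assume z: "z \<in> integer_lattice \<and> x - z \<in> G ` unit_cube"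
      then have "L' z = w" using lat(2) w(3) by (simp add: m)
      then show "z = L w" using L'(2) by metis
    qed
  qed
  also have "\<dots> = emeasure torus_measure A" by (simp add: emeasure_torus[OF A] P_def)
  finally show ?thesis .
qed

section \<open>The shift and the skew-shift: invariance and aperiodicity\<close>

lemma shift_continuous: "continuous_on UNIV (shift a)"
  unfolding shift_def[abs_def] plus_vec_def by (intro continuous_intros)

lemma shift_bij: "bij (shift a)" and inv_shift: "inv (shift a) = shift (- a)"
proof -
  have 1: "shift (- a) \<circ> shift a = id" "shift a \<circ> shift (- a) = id"
    by (auto simp: shift_def fun_eq_iff)
  then show "bij (shift a)" by (rule o_bij)
  show "inv (shift a) = shift (- a)" by (rule inv_unique_comp[OF 1(2) 1(1)])
qed

lemma to_torus_surj: "\<exists>x. y = to_torus x"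
proof -
  have "\<forall>i. \<exists>t. y $ i = to_circle t" using to_circle_surj by blast
  then obtain t where "\<And>i. y $ i = to_circle (t i)" by metis
  then show ?thesis by (intro exI[of _ "\<chi> i. t i"]) (auto simp: vec_eq_iff)
qed

lemma shift_invariant:
  assumes "A \<in> sets borel"
  shows "emeasure torus_measure (shift a -` A) = emeasure torus_measure A"
proof -
  obtain c where c: "a = to_torus c" using to_torus_surj by blast
  show ?thesis
    by (rule torus_measure_invariant[where L = "\<lambda>x. x" and L' = "\<lambda>x. x" and c = c, OF linear_ident _ _ shift_continuous])
       (auto simp: assms linear_ident shift_def c vec_eq_iff to_circle_add)
qed

lemma skew_shift_nth: "skew_shift a \<omega> $ 1 = \<omega> $ 1 + (a + a)" "skew_shift a \<omega> $ 2 = \<omega> $ 1 + \<omega> $ 2"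
  by (simp_all add: skew_shift_def)

lemma skew_shift_continuous: "continuous_on UNIV (skew_shift a)"
proof -
  have "skew_shift a = (\<lambda>\<omega>. \<chi> i. if i = 1 then \<omega> $ 1 + (a + a) else \<omega> $ 1 + \<omega> $ 2)"
    by (simp add: fun_eq_iff vec_eq_iff forall_2 skew_shift_nth)
  moreover have "continuous_on UNIV (\<lambda>\<omega> :: circle ^ 2. if i = 1 then \<omega> $ 1 + (a + a) else \<omega> $ 1 + \<omega> $ 2)" for i :: 2
    by (cases "i = 1") (simp_all, (intro continuous_intros)+)
  ultimately show ?thesis by (simp add: continuous_on_vec_lambda)
qed

lemma skew_shift_bij: "bij (skew_shift a)" and inv_skew_shift_continuous: "continuous_on UNIV (inv (skew_shift a))"
proof -
  define S :: "circle ^ 2 \<Rightarrow> circle ^ 2" where "S \<omega> = (\<chi> i. if i = 1 then \<omega> $ 1 - (a + a) else \<omega> $ 2 - (\<omega> $ 1 - (a + a)))" for \<omega>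
  have 1: "S \<circ> skew_shift a = id" "skew_shift a \<circ> S = id"
    by (auto simp: S_def fun_eq_iff vec_eq_iff forall_2 skew_shift_nth)
  then show "bij (skew_shift a)" by (rule o_bij)
  have "inv (skew_shift a) = S" by (rule inv_unique_comp[OF 1(2) 1(1)])
  moreover have "continuous_on UNIV (\<lambda>\<omega> :: circle ^ 2. if i = 1 then \<omega> $ 1 - (a + a) else \<omega> $ 2 - (\<omega> $ 1 - (a + a)))" for i :: 2
    by (cases "i = 1") (simp_all, (intro continuous_intros)+)
  ultimately show "continuous_on UNIV (inv (skew_shift a))" unfolding S_def[abs_def] by (simp add: continuous_on_vec_lambda)
qed

lemma skew_shift_invariant:
  assumes "A \<in> sets borel"
  shows "emeasure torus_measure (skew_shift a -` A) = emeasure torus_measure A"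
proof -
  obtain t where t: "a = to_circle t" using to_circle_surj by blast
  \<comment> \<open>The lift of the skew-shift is a shear followed by a translation; the shear has
    determinant 1 and an integral inverse.\<close>
  define L :: "real ^ 2 \<Rightarrow> real ^ 2" where "L x = (\<chi> i. if i = 1 then x $ 1 else x $ 1 + x $ 2)" for x
  define L' :: "real ^ 2 \<Rightarrow> real ^ 2" where "L' x = (\<chi> i. if i = 1 then x $ 1 else x $ 2 - x $ 1)" for x
  define c :: "real ^ 2" where "c = (\<chi> i. if i = 1 then t + t else 0)"
  have lin: "linear L" "linear L'"
    by (auto intro!: linearI simp: L_def L'_def vec_eq_iff forall_2 algebra_simps)
  have "det (matrix L) = 1" by (simp add: det_2 matrix_def L_def axis_def)
  then have "measure lebesgue (L ` S) = measure lebesgue S" if "S \<in> lmeasurable" for S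
    using measure_linear_image[OF lin(1) that] by simp
  then show ?thesis
    by (intro torus_measure_invariant[where L = L and L' = L' and c = c])
       (auto simp: assms lin skew_shift_continuous L_def L'_def c_def t vec_eq_iff forall_2 skew_shift_nth to_circle_add integer_lattice_def)
qed

lemma int_iterate_multiple:
  assumes T: "bij T" and p: "int_iterate T p x = x"
  shows "int_iterate T (k * p) x = x"
proof (induction k rule: int_induct[where k = 0])
  case (step1 i)
  have "int_iterate T ((i + 1) * p) x = int_iterate T (i * p) (int_iterate T p x)"
    using int_iterate_add[OF T, of "i * p" p x] by (simp add: algebra_simps)
  then show ?case using step1 p by simp
next
  case (step2 i)
  have "int_iterate T (i * p) x = int_iterate T ((i - 1) * p) (int_iterate T p x)"
    using int_iterate_add[OF T, of "(i - 1) * p" p x] by (simp add: algebra_simps)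
  then show ?case using step2 p by simp
qed simp

lemma infinite_torus: "infinite (UNIV :: (circle ^ ('d::finite)) set)"
proof
  assume "finite (UNIV :: (circle ^ 'd) set)"
  then have "finite ((\<lambda>t. to_torus (\<chi> i. t)) ` {0<..<1::real} :: (circle ^ 'd) set)" by (rule finite_subset[rotated]) simp
  moreover have "inj_on (\<lambda>t. to_torus (\<chi> i. t) :: circle ^ 'd) {0<..<1}"
  proof (rule inj_onI)
    fix s t :: real assume st: "s \<in> {0<..<1}" "t \<in> {0<..<1}" "to_torus (\<chi> i. s) = (to_torus (\<chi> i. t) :: circle ^ 'd)"
    then have "s - t \<in> \<int>" by (simp add: vec_eq_iff to_circle_eq_iff)
    then obtain n where n: "s - t = of_int n" by (auto elim: Ints_cases)
    then have "\<bar>real_of_int n\<bar> < 1" using st(1,2) by auto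
    then have "n = 0" by linarith
    then show "s = t" using n by simp
  qed
  ultimately have "finite {0<..<1::real}" using finite_image_iff by blast
  then show False using infinite_Ioo[of 0 "1::real"] by simp
qed

text \<open>A periodic orbit is finite and hence closed, so it is not dense in the infinite
  torus.\<close>

lemma minimal_aperiodic:
  fixes T :: "circle ^ ('d::finite) \<Rightarrow> circle ^ 'd"
  assumes T: "bij T" and m: "minimal_dynamics T" and n: "n \<noteq> 0"
  shows "int_iterate T n \<omega> \<noteq> \<omega>"
proof
  assume e: "int_iterate T n \<omega> = \<omega>"
  define p where "p = \<bar>n\<bar>"
  have p: "p > 0" using n by (simp add: p_def)
  have pe: "int_iterate T p \<omega> = \<omega>" using int_iterate_multiple[OF T e, of "sgn n"] by (simp add: p_def mult.commute abs_sgn[symmetric] abs_mult_sgn)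
  have "range (\<lambda>k. int_iterate T k \<omega>) \<subseteq> (\<lambda>k. int_iterate T k \<omega>) ` {0..<p}"
  proof
    fix y assume "y \<in> range (\<lambda>k. int_iterate T k \<omega>)"
    then obtain k where k: "y = int_iterate T k \<omega>" by blast
    have "int_iterate T k \<omega> = int_iterate T (k mod p) (int_iterate T (k div p * p) \<omega>)"
      using int_iterate_add[OF T, of "k mod p" "k div p * p" \<omega>] by simp
    then have "y = int_iterate T (k mod p) \<omega>" using k int_iterate_multiple[OF T pe] by simp
    then show "y \<in> (\<lambda>k. int_iterate T k \<omega>) ` {0..<p}" using p by auto
  qed
  then have "finite (range (\<lambda>k. int_iterate T k \<omega>))" by (rule finite_subset) simp
  then have "closure (range (\<lambda>k. int_iterate T k \<omega>)) = range (\<lambda>k. int_iterate T k \<omega>)"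
    by (simp add: finite_imp_closed)
  then show False using m infinite_torus[where 'd = 'd] \<open>finite (range _)\<close> by (metis minimal_dynamics_def)
qed

text \<open>In exponential coordinates the second coordinate collects one factor
  \<open>circle_exp (\<omega> $ 1)\<close> per step; the constants \<open>c\<close> and
  \<open>d\<close> depend on \<open>a\<close> and \<open>q\<close> but not on the point.\<close>

lemma skew_shift_iterate:
  "\<exists>c d. c \<noteq> 0 \<and> (\<forall>\<omega>. circle_exp (((skew_shift a ^^ q) \<omega>) $ 1) = circle_exp (\<omega> $ 1) * d \<and>
     circle_exp (((skew_shift a ^^ q) \<omega>) $ 2) = circle_exp (\<omega> $ 2) * (circle_exp (\<omega> $ 1)) ^ q * c)"
proof (induction q)
  case 0
  show ?case by (intro exI[of _ 1]) simp
next
  case (Suc q)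
  then obtain c d where cd: "c \<noteq> 0" "\<And>\<omega>. circle_exp (((skew_shift a ^^ q) \<omega>) $ 1) = circle_exp (\<omega> $ 1) * d"
    "\<And>\<omega>. circle_exp (((skew_shift a ^^ q) \<omega>) $ 2) = circle_exp (\<omega> $ 2) * (circle_exp (\<omega> $ 1)) ^ q * c" by blast
  have "cmod (circle_exp (((skew_shift a ^^ q) 0) $ 1)) = 1" by simp
  then have "d \<noteq> 0" unfolding cd(2) by auto
  then show ?case using cd
    by (intro exI[of _ "d * c"] exI[of _ "d * (circle_exp a * circle_exp a)"]) (simp add: skew_shift_nth circle_exp_add mult_ac)
qed

lemma null_sets_torus_coordinate:
  fixes i :: "'d::finite"
  shows "{\<omega>. \<omega> $ i = x} \<in> null_sets torus_measure"
proof -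
  have "closed {\<omega> :: circle ^ 'd. \<omega> $ i = x}" by (intro closed_Collect_eq continuous_intros)
  then have m: "{\<omega> :: circle ^ 'd. \<omega> $ i = x} \<in> sets borel" by simp
  obtain t where t: "x = to_circle t" using to_circle_surj by blast
  have neg: "negligible {y :: real ^ 'd. y $ i = c}" for c
  proof -
    have "negligible ((+) (\<chi> j. c) ` {y :: real ^ 'd. y $ i = 0})"
      by (rule negligible_translation[OF negligible_standard_hyperplane_cart])
    moreover have "{y :: real ^ 'd. y $ i = c} \<subseteq> (+) (\<chi> j. c) ` {y :: real ^ 'd. y $ i = 0}"
    proof
      fix y :: "real ^ 'd" assume "y \<in> {y. y $ i = c}"
      then show "y \<in> (+) (\<chi> j. c) ` {y :: real ^ 'd. y $ i = 0}"
        by (intro image_eqI[of _ _ "y - (\<chi> j. c)"]) auto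
    qed
    ultimately show ?thesis by (rule negligible_subset)
  qed
  have "to_torus -` {\<omega>. \<omega> $ i = x} \<inter> unit_cube \<subseteq> (\<Union>n::int. {y :: real ^ 'd. y $ i = t + of_int n})"
  proof
    fix y :: "real ^ 'd" assume "y \<in> to_torus -` {\<omega>. \<omega> $ i = x} \<inter> unit_cube"
    then have "y $ i - t \<in> \<int>" by (simp add: t to_circle_eq_iff)
    then obtain n where "y $ i - t = of_int n" by (auto elim: Ints_cases)
    then show "y \<in> (\<Union>n::int. {y :: real ^ 'd. y $ i = t + of_int n})" by (intro UN_I[of n]) auto
  qed
  moreover have "negligible (\<Union>n::int. {y :: real ^ 'd. y $ i = t + of_int n})"
    by (rule negligible_countable_Union) (auto intro: neg)
  ultimately have "negligible (to_torus -` {\<omega>. \<omega> $ i = x} \<inter> (unit_cube :: (real ^ 'd) set))" by (rule negligible_subset[rotated])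
  moreover have "to_torus -` {\<omega>. \<omega> $ i = x} \<inter> (unit_cube :: (real ^ 'd) set) \<in> sets lborel"
    unfolding sets_lborel by (intro sets.Int measurable_sets_borel[OF borel_measurable_to_torus m] unit_cube_borel)
  ultimately have "to_torus -` {\<omega>. \<omega> $ i = x} \<inter> (unit_cube :: (real ^ 'd) set) \<in> null_sets lborel"
    by (simp add: negligible_iff_null_sets null_sets_completion_iff)
  then show ?thesis using m by (auto simp: null_sets_def emeasure_torus sets_torus_measure)
qed

text \<open>If the point has period \<open>Suc q\<close>, comparing second coordinates determines
  the power \<open>Suc q\<close> of \<open>circle_exp (\<omega> $ 1)\<close>. So the first
  coordinate lies in a finite set, and the periodic points lie on finitely many null circles for
  each period.\<close>

lemma skew_shift_aperiodic:
  "AE \<omega> in torus_measure. \<forall>n. n \<noteq> 0 \<longrightarrow> int_iterate (skew_shift a) n \<omega> \<noteq> \<omega>"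
proof -
  have "AE \<omega> in torus_measure. (skew_shift a ^^ Suc q) \<omega> \<noteq> \<omega>" for q
  proof -
    obtain c d where cd: "c \<noteq> 0" "\<And>\<omega>. circle_exp (((skew_shift a ^^ Suc q) \<omega>) $ 2) = circle_exp (\<omega> $ 2) * (circle_exp (\<omega> $ 1)) ^ Suc q * c"
      using skew_shift_iterate[where a = a and q = "Suc q"] by blast
    define Z where "Z = {z. z ^ Suc q = 1 / c}"
    have Z: "finite Z" unfolding Z_def by (rule finite_nth_roots) simp
    define F where "F = circle_exp -` Z"
    have "finite F" unfolding F_def by (rule finite_vimageI[OF Z]) (auto intro!: injI circle_exp_inj)
    then have "(\<Union>x\<in>F. {\<omega> :: circle ^ 2. \<omega> $ 1 = x}) \<in> null_sets torus_measure"
      by (intro null_sets_UN' countable_finite null_sets_torus_coordinate)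
    then show ?thesis
    proof (rule AE_I')
      show "{\<omega> \<in> space torus_measure. \<not> (skew_shift a ^^ Suc q) \<omega> \<noteq> \<omega>} \<subseteq> (\<Union>x\<in>F. {\<omega>. \<omega> $ 1 = x})"
      proof
        fix \<omega> assume "\<omega> \<in> {\<omega> \<in> space torus_measure. \<not> (skew_shift a ^^ Suc q) \<omega> \<noteq> \<omega>}"
        then have e: "circle_exp (\<omega> $ 2) * (circle_exp (\<omega> $ 1)) ^ Suc q * c = circle_exp (\<omega> $ 2)" using cd(2)[of \<omega>] by simp
        have "circle_exp (\<omega> $ 2) \<noteq> 0" using norm_circle_exp[of "\<omega> $ 2"] by (metis norm_zero zero_neq_one)
        then have "(circle_exp (\<omega> $ 1)) ^ Suc q * c = 1" using e by (simp add: mult.assoc)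
        then have "\<omega> $ 1 \<in> F" using cd(1) unfolding F_def Z_def by (simp add: field_simps)
        then show "\<omega> \<in> (\<Union>x\<in>F. {\<omega>. \<omega> $ 1 = x})" by blast
      qed
    qed
  qed
  then have "AE \<omega> in torus_measure. \<forall>q. (skew_shift a ^^ Suc q) \<omega> \<noteq> \<omega>" by (simp add: AE_all_countable)
  then show ?thesis
  proof (rule AE_mp, intro AE_I2 impI allI notI)
    fix \<omega> n assume h: "\<forall>q. (skew_shift a ^^ Suc q) \<omega> \<noteq> \<omega>" and n: "n \<noteq> 0" and e: "int_iterate (skew_shift a) n \<omega> = \<omega>"
    have "int_iterate (skew_shift a) \<bar>n\<bar> \<omega> = \<omega>"
      using int_iterate_multiple[OF skew_shift_bij e, of "sgn n"] by (simp add: mult.commute abs_mult_sgn abs_sgn[symmetric])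
    moreover have "\<bar>n\<bar> = int (Suc (nat \<bar>n\<bar> - 1))" using n by simp
    ultimately have "(skew_shift a ^^ Suc (nat \<bar>n\<bar> - 1)) \<omega> = \<omega>" by (simp add: int_iterate_def del: funpow.simps)
    then show False using h by blast
  qed
qed

lemma AE_generic_singular_continuous:
  fixes T :: "circle ^ ('d::finite) \<Rightarrow> circle ^ 'd"
  assumes T: "bij T" and cT: "continuous_on UNIV T" "continuous_on UNIV (inv T)"
    and pres: "\<And>A. A \<in> sets borel \<Longrightarrow> emeasure torus_measure (T -` A) = emeasure torus_measure A"
    and aper: "AE \<omega> in torus_measure. \<forall>n. n \<noteq> 0 \<longrightarrow> int_iterate T n \<omega> \<noteq> \<omega>"
  shows "AE \<omega> in torus_measure. generic_singular_continuous T \<omega>"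
proof -
  have "AE \<omega> in torus_measure. \<forall>f\<in>sampling_functions. \<forall>\<rho>>0. \<exists>g\<in>sampling_functions. dist f g < \<rho> \<and>
    (\<forall>s. \<not> localized_at (1 / real (Suc k)) (orbit_coeffs T g \<omega>) s)" for k :: nat
    by (rule AE_point_dense[OF compact_torus T cT finite_torus_measure sets_torus_measure pres aper]) auto
  then have "AE \<omega> in torus_measure. \<forall>k::nat. \<forall>f\<in>sampling_functions. \<forall>\<rho>>0. \<exists>g\<in>sampling_functions. dist f g < \<rho> \<and>
    (\<forall>s. \<not> localized_at (1 / real (Suc k)) (orbit_coeffs T g \<omega>) s)" by (rule AE_all_countable[THEN iffD2, OF allI])
  with aper show ?thesis
  proof eventually_elim
    case (elim \<omega>)
    show ?case
    proof (rule generic_singular_continuousI[OF compact_torus T])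
      show "int_iterate T n \<omega> \<noteq> \<omega>" if "n \<noteq> 0" for n using elim(1) that by simp
      show "\<exists>g\<in>sampling_functions. dist f g < \<rho> \<and> (\<forall>s. \<not> localized_at (1 / real (Suc k)) (orbit_coeffs T g \<omega>) s)"
        if "f \<in> sampling_functions" "\<rho> > 0" for k f \<rho>
        using elim(2)[rule_format, OF that] by simp
    qed
  qed
qed

theorem theorem2:
  shows "(\<forall>a :: circle ^ 'd. minimal_dynamics (shift a) \<longrightarrow>
            (AE \<omega> in torus_measure. generic_singular_continuous (shift a) \<omega>)) \<and>
         (\<forall>a :: circle.
            (AE \<omega> in torus_measure. generic_singular_continuous (skew_shift a) \<omega>))"
proof (intro conjI allI impI)
  fix a :: "circle ^ 'd"
  assume m: "minimal_dynamics (shift a)"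
  have c: "continuous_on UNIV (inv (shift a))" unfolding inv_shift by (rule shift_continuous)
  show "AE \<omega> in torus_measure. generic_singular_continuous (shift a) \<omega>"
  proof (rule AE_generic_singular_continuous[OF shift_bij shift_continuous c])
    show "AE \<omega> in torus_measure. \<forall>n. n \<noteq> 0 \<longrightarrow> int_iterate (shift a) n \<omega> \<noteq> \<omega>"
      by (rule AE_I2) (use minimal_aperiodic[OF shift_bij m] in blast)
  qed (rule shift_invariant)
next
  fix a :: circle
  show "AE \<omega> in torus_measure. generic_singular_continuous (skew_shift a) \<omega>"
    by (rule AE_generic_singular_continuous[OF skew_shift_bij skew_shift_continuous inv_skew_shift_continuous
      skew_shift_invariant skew_shift_aperiodic])
qed

end
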